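(* For any radial $f\in L^2(\mathbb{R}^2,\mathrm{d}\boldsymbol x)$ we have $$\|e^{it\Delta}f(\boldsymbol x)\|_{L^4(\mathbb{R}^3,\mathrm{d}\boldsymbol x\,\mathrm{d}t)}\le2^{-1/2}\|f\|_{L^2(\mathbb{R}^2,\mathrm{d}\boldsymbol x)},$$ and equality is attained if and only if $f(\boldsymbol x)=Ae^{-B\|\boldsymbol x\|^2}$, where $A,B\in\mathbb{C}$ and $\mathrm{Re}\,B>0$.
   Context: $e^{it\Delta}f(\boldsymbol x)$ is the solution of the Schr\"odinger equation $\partial_t u=i\Delta u$ on $\mathbb{R}^2\times\mathbb{R}$ with $u(\boldsymbol x,0)=f(\boldsymbol x)$. Functions are complex valued. *)

theory Defs
  imports "HOL-Analysis.Analysis"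
begin

definition in_Lp :: "real \<Rightarrow> 'a measure \<Rightarrow> ('a \<Rightarrow> complex) \<Rightarrow> bool" where
  "in_Lp p M f \<longleftrightarrow> f \<in> borel_measurable M \<and> integrable M (\<lambda>x. norm (f x) powr p)"

text \<open>The following is the norm only on functions satisfying \<open>in_Lp p M\<close>: for other functions the
  Bochner integral is 0 by convention, so \<open>in_Lp\<close> has to be stated separately.\<close>

definition Lp_norm :: "real \<Rightarrow> 'a measure \<Rightarrow> ('a \<Rightarrow> complex) \<Rightarrow> real" where
  "Lp_norm p M f = (\<integral>x. norm (f x) powr p \<partial>M) powr (1 / p)"

text \<open>Radiality of an almost-everywhere class: some representative is a function of the norm.\<close>

definition radial :: "(real^2 \<Rightarrow> complex) \<Rightarrow> bool" where
  "radial f \<longleftrightarrow> (\<exists>g. AE x in lborel. f x = g (norm x))"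

definition partial_deriv :: "2 \<Rightarrow> (real^2 \<Rightarrow> complex) \<Rightarrow> real^2 \<Rightarrow> complex" where
  "partial_deriv i \<psi> x = frechet_derivative \<psi> (at x) (axis i 1)"

definition laplacian :: "(real^2 \<Rightarrow> complex) \<Rightarrow> real^2 \<Rightarrow> complex" where
  "laplacian \<psi> x = (\<Sum>i\<in>UNIV. partial_deriv i (partial_deriv i \<psi>) x)"

primrec C_k :: "nat \<Rightarrow> (real^2 \<Rightarrow> complex) \<Rightarrow> bool" where
  "C_k 0 \<psi> \<longleftrightarrow> continuous_on UNIV \<psi>"
| "C_k (Suc k) \<psi> \<longleftrightarrow> \<psi> differentiable_on UNIV \<and> (\<forall>i. C_k k (partial_deriv i \<psi>))"

text \<open>Only two derivatives are moved onto a test function; testing against \<open>C\<^sup>\<infinity>\<close> functions of compact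
  support gives the same solutions by mollification.\<close>

definition test_function :: "(real^2 \<Rightarrow> complex) \<Rightarrow> bool" where
  "test_function \<psi> \<longleftrightarrow> C_k 2 \<psi> \<and> compact (closure {x. \<psi> x \<noteq> 0})"

text \<open>For initial data merely in \<open>L\<^sup>2\<close> the equation \<open>\<partial>\<^sub>t u = \<i> \<Delta> u\<close> is understood weakly:
  \<open>t \<mapsto> u t\<close> is a continuous curve in \<open>L\<^sup>2(\<real>\<^sup>2)\<close> which satisfies
  \<open>d/dt \<integral> u(t) \<psi> = \<i> \<integral> u(t) \<Delta>\<psi>\<close> for all test functions \<open>\<psi>\<close>. This determines \<open>u t\<close> almost everywhere,
  for every \<open>t\<close>. Joint measurability selects a representative that is a function on space-time.\<close>

definition schroedinger_solution ::
    "(real^2 \<Rightarrow> complex) \<Rightarrow> (real \<Rightarrow> real^2 \<Rightarrow> complex) \<Rightarrow> bool" where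
  "schroedinger_solution f u \<longleftrightarrow>
     (\<lambda>(x, t). u t x) \<in> borel_measurable (lborel :: ((real^2) \<times> real) measure) \<and>
     (\<forall>t. in_Lp 2 lborel (u t)) \<and>
     (\<forall>t\<^sub>0. ((\<lambda>t. Lp_norm 2 lborel (\<lambda>x. u t x - u t\<^sub>0 x)) \<longlongrightarrow> 0) (at t\<^sub>0)) \<and>
     (AE x in lborel. u 0 x = f x) \<and>
     (\<forall>\<psi> t. test_function \<psi> \<longrightarrow>
        ((\<lambda>s. \<integral>x. u s x * \<psi> x \<partial>lborel) has_vector_derivative
          \<i> * (\<integral>x. u t x * laplacian \<psi> x \<partial>lborel)) (at t))"

text \<open>\<open>exp_it_laplacian t f x\<close> is \<open>e\<^bsup>it\<Delta>\<^esup>f(x)\<close>. The choice is only among representatives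
  of the unique solution, so it does not affect norms over space-time.\<close>

definition exp_it_laplacian :: "real \<Rightarrow> (real^2 \<Rightarrow> complex) \<Rightarrow> real^2 \<Rightarrow> complex" where
  "exp_it_laplacian t f = (SOME u. schroedinger_solution f u) t"

end

theory Submission
  imports Defs "HOL-Analysis.Analysis" "HOL-Computational_Algebra.Polynomial"
begin

text \<open>
  Write a radial \<open>f\<close> as \<open>f x = g (|x|\<^sup>2)\<close>. In the variable \<open>r = |x|\<^sup>2\<close> Lebesgue measure of the plane is \<open>\<pi> dr\<close>
  on the half-line, and there the Laguerre functions \<open>L\<^sub>n(r) exp(-r/2)\<close> form an orthonormal basis. Each of
  them evolves explicitly: with \<open>\<rho> = r / (1 + 4 t\<^sup>2)\<close> and the unimodular
  \<open>phase t = (1 - 2 \<i> t) / (1 + 2 \<i> t)\<close>, the solution that starts from the \<open>n\<close>-th one is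
  \<open>wave n t r = cis (t \<rho>) / (1 + 2 \<i> t) * phase t ^ n * L\<^sub>n(\<rho>) exp(-\<rho>/2)\<close>. Hence the data
  \<open>\<Sum>n. c n * L\<^sub>n(r) exp(-r/2)\<close> evolve into \<open>\<Sum>n. c n * wave n t r\<close>.

  The fourth power of the \<open>L\<^sup>4\<close> norm of \<open>u\<close> is the squared \<open>L\<^sup>2\<close> norm of \<open>u\<^sup>2\<close>. A product of two Laguerre
  functions is a combination \<open>\<Sum>k. a(n,m,k) L\<^sub>k(2r) exp(-r)\<close> (lemma \<open>poly_laguerre_mult\<close>), and the product
  of two phases is \<open>phase t ^ (n + m)\<close>. The Laguerre functions are orthonormal in space and the powers of
  the phase are orthogonal for \<open>dt / (1 + 4 t\<^sup>2)\<close>, because the phase carries that measure to a multiple of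
  arc length on the circle. This gives the identity (lemma \<open>wave_sum_L4\<close>)
  \<open>\<parallel>u\<parallel>\<^sub>4^4 = \<pi>\<^sup>2/4 * (\<Sum>N. \<Sum>k\<le>N. |\<Sum>n\<le>N. a(n,N-n,k) c(n) c(N-n)|\<^sup>2)\<close>.

  For fixed \<open>N\<close> the matrix \<open>a(n,N-n,k)\<close> is doubly stochastic, its entries being the squares of the entries
  of an orthogonal matrix of Krawtchouk polynomials. Averaging with such a matrix does not increase the sum
  of squares (lemma \<open>linearization_contraction\<close>), so the right-hand side is at most
  \<open>\<pi>\<^sup>2/4 * (\<Sum>N. \<Sum>n\<le>N. |c(n)|\<^sup>2 |c(N-n)|\<^sup>2) = \<pi>\<^sup>2/4 * (\<Sum>n. |c(n)|\<^sup>2)\<^sup>2 = \<parallel>f\<parallel>\<^sub>2^4 / 4\<close>, which is the estimate.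
  The weights with \<open>k = 0\<close> are all positive, so equality forces \<open>c(n) c(N-n)\<close> to depend on \<open>N\<close> only. Then
  \<open>c\<close> is a geometric sequence and \<open>g\<close> is a Gaussian by the generating function of the Laguerre
  polynomials (lemma \<open>deficit_zero_gaussian\<close>). Conversely, every Gaussian is, up to a factor, the value at
  some time of a dilated \<open>wave 0\<close>, for which all sums have a single term and the estimate is an equality
  (lemma \<open>gaussian_solution\<close>).

  The identity is proved for finite sums only. The partial sums of the series converge almost everywhere
  along a subsequence, their limit is a weak solution with the given data, and by Fatou's lemma it inherits
  the estimate with the loss \<open>deficit c N\<close> of any single \<open>N\<close> (lemma \<open>radial_solution_exists\<close>). The solution
  selected in the definition of the propagator has to agree with this one. Weak solutions are unique
  (lemma \<open>schroedinger_solution_unique\<close>): pairing the difference of two solutions with a Gaussian solution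
  gives a constant of motion, so the difference is orthogonal to all Gaussians at all times, and the
  translated and dilated Gaussians span a dense subspace.
\<close>

section \<open>Laguerre polynomials\<close>

definition laguerre :: "nat \<Rightarrow> real poly" where
  "laguerre n = (\<Sum>k\<le>n. monom ((-1)^k * real (n choose k) / fact k) k)"

lemma coeff_laguerre: "coeff (laguerre n) k = (-1)^k * real (n choose k) / fact k"
  by (cases "k \<le> n") (simp_all add: laguerre_def coeff_sum not_le)

lemma degree_laguerre_le: "degree (laguerre n) \<le> n"
  by (rule degree_le) (simp add: coeff_laguerre)

lemma poly_laguerre: "poly (laguerre n) x = (\<Sum>k\<le>n. (-1)^k * real (n choose k) / fact k * x^k)"
  by (simp add: laguerre_def poly_sum poly_monom)

lemma laguerre_0 [simp]: "laguerre 0 = 1"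
  by (simp add: laguerre_def monom_0)

text \<open>The Laguerre equation \<open>x y'' + (1 - x) y' + n y = 0\<close>, kept as an identity of polynomials so that it can
be transferred to complex arguments.\<close>

lemma laguerre_ode_poly:
  "pCons 0 (pderiv (pderiv (laguerre n))) + pderiv (laguerre n) - pCons 0 (pderiv (laguerre n))
     + smult (real n) (laguerre n) = 0" (is "?p = 0")
proof (rule poly_eqI)
  fix k
  have rec: "real (Suc k) * real (n choose Suc k) = (real n - real k) * real (n choose k)"
  proof (cases "k \<le> n")
    case True
    have "Suc k * (n choose Suc k) = (n - k) * (n choose k)"
      using binomial_absorption[of k n] binomial_absorb_comp[of n k] by simp
    then have "real (Suc k * (n choose Suc k)) = real ((n - k) * (n choose k))" by simp
    then show ?thesis using True by (simp only: of_nat_mult of_nat_diff)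
  qed (simp add: not_le binomial_eq_0 del: of_nat_Suc)
  show "coeff ?p k = coeff 0 k"
  proof (cases k)
    case 0
    then show ?thesis by (simp add: coeff_pderiv coeff_laguerre)
  next
    case (Suc j)
    have "real (Suc k) * (real (Suc k) * coeff (laguerre n) (Suc k))
        = - ((real n - real k) * coeff (laguerre n) k)"
    proof -
      have "real (Suc k) * coeff (laguerre n) (Suc k)
          = - ((-1)^k * real (n choose Suc k) / fact k)"
        unfolding coeff_laguerre by (simp add: field_simps del: binomial_Suc_Suc of_nat_Suc)
      then have "real (Suc k) * (real (Suc k) * coeff (laguerre n) (Suc k))
          = - ((-1)^k * (real (Suc k) * real (n choose Suc k)) / fact k)"
        by (simp add: algebra_simps)
      then show ?thesis by (simp only: rec) (simp add: coeff_laguerre)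
    qed
    then show ?thesis using Suc
      by (simp add: coeff_pderiv algebra_simps)
  qed
qed

text \<open>An \<open>n\<close>-th finite difference of \<open>j \<mapsto> (j + m) choose k\<close>, and each difference lowers \<open>k\<close> by one.\<close>

lemma alternating_binomial_sum:
  "(\<Sum>j\<le>n. (-1)^j * real (n choose j) * real ((j + m) choose k))
     = (if k < n then 0 else (-1)^n * real (m choose (k - n)))"
proof (induction n arbitrary: m k)
  case 0 then show ?case by simp
next
  case (Suc n)
  have "(\<Sum>j\<le>Suc n. (-1)^j * real (Suc n choose j) * real ((j + m) choose k))
      = real (m choose k) + (\<Sum>j\<le>n. (-1)^Suc j * real (Suc n choose Suc j) * real ((Suc j + m) choose k))"
    by (subst sum.atMost_Suc_shift) simp
  also have "\<dots> = (real (m choose k) + (\<Sum>j\<le>n. (-1)^Suc j * real (n choose Suc j) * real ((Suc j + m) choose k)))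
      - (\<Sum>j\<le>n. (-1)^j * real (n choose j) * real ((j + Suc m) choose k))"
    by (simp add: algebra_simps sum.distrib sum_negf sum_subtractf)
  also have "real (m choose k) + (\<Sum>j\<le>n. (-1)^Suc j * real (n choose Suc j) * real ((Suc j + m) choose k))
      = (\<Sum>j\<le>Suc n. (-1)^j * real (n choose j) * real ((j + m) choose k))"
    by (subst sum.atMost_Suc_shift) simp
  also have "\<dots> = (\<Sum>j\<le>n. (-1)^j * real (n choose j) * real ((j + m) choose k))" by simp
  finally have *: "(\<Sum>j\<le>Suc n. (-1)^j * real (Suc n choose j) * real ((j + m) choose k))
     = (if k < n then 0 else (-1)^n * real (m choose (k - n)))
       - (if k < n then 0 else (-1)^n * real (Suc m choose (k - n)))"
    by (simp only: Suc.IH)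
  show ?case
  proof (cases "k < n")
    case True then show ?thesis using * by simp
  next
    case False
    then show ?thesis
    proof (cases "k = n")
      case True then show ?thesis using * by simp
    next
      case False
      then obtain i where "k - n = Suc i" "k - Suc n = i" using \<open>\<not> k < n\<close>
        by (metis Suc_diff_Suc linorder_neqE_nat)
      then show ?thesis using * \<open>\<not> k < n\<close> False by (simp add: algebra_simps)
    qed
  qed
qed

text \<open>Orthonormality for the weight \<open>exp(-x)\<close>, whose moment of order \<open>i + j\<close> is \<open>fact (i + j)\<close>. The sum over \<open>i\<close>
is a finite difference that vanishes for \<open>j < n\<close>; the sum over \<open>j\<close> is another one.\<close>

lemma laguerre_orthogonality_sum:
  "(\<Sum>i\<le>n. \<Sum>j\<le>m. coeff (laguerre n) i * coeff (laguerre m) j * fact (i + j))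
     = (if n = m then 1 else 0)"
proof -
  have inner: "(\<Sum>i\<le>n. coeff (laguerre n) i * fact (i + j)) = fact j * ((-1)^n * real (j choose n))" for j
  proof -
    have "(\<Sum>i\<le>n. coeff (laguerre n) i * fact (i + j))
        = fact j * (\<Sum>i\<le>n. (-1)^i * real (n choose i) * real ((i + j) choose j))"
      unfolding sum_distrib_left
    proof (intro sum.cong refl)
      fix i
      have "fact j * fact i * ((i + j) choose j) = (fact (i + j) :: nat)"
        using binomial_fact_lemma[of j "i + j"] by simp
      then have "fact (i + j) = fact j * fact i * real ((i + j) choose j)"
        by (metis of_nat_fact of_nat_mult)
      then show "coeff (laguerre n) i * fact (i + j)
          = fact j * ((-1)^i * real (n choose i) * real ((i + j) choose j))"
        by (simp add: coeff_laguerre)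
    qed
    also have "\<dots> = fact j * ((-1)^n * real (j choose n))"
      unfolding alternating_binomial_sum using binomial_symmetric[of n j] by (simp add: binomial_eq_0)
    finally show ?thesis .
  qed
  have "(\<Sum>i\<le>n. \<Sum>j\<le>m. coeff (laguerre n) i * coeff (laguerre m) j * fact (i + j))
      = (\<Sum>j\<le>m. coeff (laguerre m) j * (\<Sum>i\<le>n. coeff (laguerre n) i * fact (i + j)))"
    by (subst sum.swap) (simp add: sum_distrib_left mult_ac)
  also have "\<dots> = (-1)^n * (\<Sum>j\<le>m. (-1)^j * real (m choose j) * real ((j + 0) choose n))"
    unfolding inner sum_distrib_left
    by (intro sum.cong refl) (simp add: coeff_laguerre)
  also have "\<dots> = (if n = m then 1 else 0)"
    unfolding alternating_binomial_sum by (auto simp: power_mult_distrib[symmetric] binomial_eq_0)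
  finally show ?thesis .
qed

section \<open>Linearization of products of Laguerre polynomials\<close>

text \<open>Homogeneous polynomials of degree \<open>N = n + m\<close> in two variables, dehomogenized. The polynomials
\<open>(u + v)^n (u - v)^m\<close> are the monomials after an orthogonal change of variables, up to scaling, and are
called rotated monomials below. Their coefficients are the values of the Krawtchouk polynomials.\<close>

definition diag_poly :: "nat \<Rightarrow> nat \<Rightarrow> real poly" where
  "diag_poly n m = [:1, 1:] ^ n * [:1, -1:] ^ m"

text \<open>The Fischer inner product, for which multiplication by a variable is adjoint to differentiation and
which is invariant under orthogonal changes of variables. The parameter \<open>N\<close> is the degree of homogeneity.\<close>

definition fischer :: "nat \<Rightarrow> real poly \<Rightarrow> real poly \<Rightarrow> real" where
  "fischer N p q = (\<Sum>k\<le>N. fact k * fact (N - k) * coeff p k * coeff q k)"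

lemma degree_diag_poly_le: "degree (diag_poly n m) \<le> n + m"
proof -
  have "degree (diag_poly n m) \<le> degree ([:1, 1:] ^ n :: real poly) + degree ([:1, -1:] ^ m :: real poly)"
    unfolding diag_poly_def by (rule degree_mult_le)
  moreover have "degree ([:1, 1:] ^ n :: real poly) \<le> 1 * n" by (rule order.trans[OF degree_power_le]) simp
  moreover have "degree ([:1, -1:] ^ m :: real poly) \<le> 1 * m" by (rule order.trans[OF degree_power_le]) simp
  ultimately show ?thesis by simp
qed

lemma coeff_diag_poly_0: "coeff (diag_poly n m) 0 = 1"
  by (simp add: diag_poly_def coeff_mult_0 coeff_0_power)

lemma pderiv_diag_poly:
  "pderiv (diag_poly n m) = smult (real n) (diag_poly (n - 1) m) - smult (real m) (diag_poly n (m - 1))"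
proof -
  have 1: "pderiv ([:1, 1:] ^ n :: real poly) = smult (real n) ([:1,1:] ^ (n - 1))"
    by (simp add: pderiv_power pderiv_pCons)
  have 2: "pderiv ([:1, -1:] ^ m :: real poly) = - smult (real m) ([:1,-1:] ^ (m - 1))"
    by (simp add: pderiv_power pderiv_pCons)
  show ?thesis unfolding diag_poly_def pderiv_mult 1 2 by (simp add: algebra_simps)
qed

lemma fischer_mult_var:
  "fischer (Suc N) (pCons 0 q) p = fischer N q (pderiv p)"
  unfolding fischer_def
  by (subst sum.atMost_Suc_shift) (simp add: coeff_pderiv algebra_simps)

text \<open>Adjointness for the second variable: for a homogeneous polynomial of degree \<open>Suc N\<close>, Euler's relation
turns the derivative in that variable into \<open>(Suc N) p - x p'\<close>.\<close>

lemma fischer_Suc: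
  assumes "degree q \<le> N"
  shows "fischer (Suc N) q p = fischer N q (smult (real (Suc N)) p - pCons 0 (pderiv p))"
proof -
  have c: "coeff (smult (real (Suc N)) p - pCons 0 (pderiv p)) k = (real (Suc N) - real k) * coeff p k" for k
    by (cases k) (simp_all add: coeff_pderiv algebra_simps)
  have "coeff q (Suc N) = 0" using assms by (simp add: coeff_eq_0)
  then have "fischer (Suc N) q p = (\<Sum>k\<le>N. fact k * fact (Suc N - k) * coeff q k * coeff p k)"
    by (simp add: fischer_def)
  also have "\<dots> = fischer N q (smult (real (Suc N)) p - pCons 0 (pderiv p))"
    unfolding fischer_def c
    by (intro sum.cong refl) (simp add: Suc_diff_le of_nat_diff algebra_simps)
  finally show ?thesis .
qed

lemma fischer_add_left: "fischer N (p + p') q = fischer N p q + fischer N p' q"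
  and fischer_diff_left: "fischer N (p - p') q = fischer N p q - fischer N p' q"
  and fischer_add_right: "fischer N q (p + p') = fischer N q p + fischer N q p'"
  and fischer_diff_right: "fischer N q (p - p') = fischer N q p - fischer N q p'"
  and fischer_smult_right: "fischer N q (smult c p) = c * fischer N q p"
  and fischer_smult_left: "fischer N (smult c p) q = c * fischer N p q"
  by (simp_all add: fischer_def algebra_simps sum.distrib sum_subtractf sum_distrib_left)

lemma fischer_0_right [simp]: "fischer N q 0 = 0"
  by (simp add: fischer_def)

text \<open>The derivative along the diagonal, which kills the factor \<open>1 - x\<close>, in dehomogenized form.\<close>

lemma euler_plus:
  assumes "n + m = Suc N"
  shows "smult (real (Suc N)) (diag_poly n m) - pCons 0 (pderiv (diag_poly n m)) + pderiv (diag_poly n m)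
      = smult (2 * real n) (diag_poly (n - 1) m)" (is "?l = ?r")
proof (rule poly_eq_poly_eq_iff[THEN iffD1], rule ext)
  fix x :: real
  have N: "real (Suc N) = real n + real m" using assms by simp
  show "poly ?l x = poly ?r x"
    unfolding N pderiv_diag_poly
    by (cases n; cases m) (simp_all add: diag_poly_def algebra_simps)
qed

text \<open>The derivative along the antidiagonal, which kills the factor \<open>1 + x\<close>.\<close>

lemma euler_minus:
  assumes "n + m = Suc N"
  shows "smult (real (Suc N)) (diag_poly n m) - pCons 0 (pderiv (diag_poly n m)) - pderiv (diag_poly n m)
      = smult (2 * real m) (diag_poly n (m - 1))" (is "?l = ?r")
proof (rule poly_eq_poly_eq_iff[THEN iffD1], rule ext)
  fix x :: real
  have N: "real (Suc N) = real n + real m" using assms by simp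
  show "poly ?l x = poly ?r x"
    unfolding N pderiv_diag_poly
    by (cases n; cases m) (simp_all add: diag_poly_def algebra_simps)
qed

text \<open>Rotated monomials are orthogonal like the monomials themselves. The induction takes off one linear
factor on the left and moves it to the right as a derivative.\<close>

lemma fischer_diag_poly:
  assumes "n + m = N" "n' + m' = N"
  shows "fischer N (diag_poly n m) (diag_poly n' m') = (if n = n' then 2^N * fact n * fact m else 0)"
  using assms
proof (induction N arbitrary: n m n' m')
  case 0 then show ?case by (simp add: fischer_def diag_poly_def)
next
  case (Suc N)
  show ?case
  proof (cases n)
    case (Suc n0)
    have N: "n0 + m = N" using Suc Suc.prems by simp
    have e: "diag_poly n m = diag_poly n0 m + pCons 0 (diag_poly n0 m)"
      by (simp add: Suc diag_poly_def algebra_simps)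
    have "fischer (Suc N) (diag_poly n m) (diag_poly n' m')
        = fischer N (diag_poly n0 m) (smult (2 * real n') (diag_poly (n' - 1) m'))"
      unfolding e fischer_add_left fischer_mult_var
        fischer_Suc[OF degree_diag_poly_le[of n0 m, unfolded N]]
      using euler_plus[OF Suc.prems(2)] by (simp only: fischer_add_right[symmetric])
    also have "\<dots> = (if n = n' then 2^Suc N * fact n * fact m else 0)"
    proof (cases n')
      case 0 then show ?thesis using Suc by (simp add: fischer_smult_right)
    next
      case (Suc k)
      have "k + m' = N" using Suc.prems Suc by simp
      then show ?thesis using Suc.IH[OF N, of k m'] Suc \<open>n = Suc n0\<close>
        by (simp add: fischer_smult_right)
    qed
    finally show ?thesis .
  next
    case 0
    then have m: "m = Suc N" using Suc.prems by simp
    have e: "diag_poly n m = diag_poly 0 N - pCons 0 (diag_poly 0 N)"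
      by (simp add: 0 m diag_poly_def algebra_simps)
    have "fischer (Suc N) (diag_poly n m) (diag_poly n' m')
        = fischer N (diag_poly 0 N) (smult (2 * real m') (diag_poly n' (m' - 1)))"
      unfolding e fischer_diff_left fischer_mult_var
        fischer_Suc[OF degree_diag_poly_le[of 0 N, simplified]]
      using euler_minus[OF Suc.prems(2)] by (simp only: fischer_diff_right[symmetric])
    also have "\<dots> = (if n = n' then 2^Suc N * fact n * fact m else 0)"
    proof (cases m')
      case 0 then show ?thesis using \<open>n = 0\<close> Suc.prems by (simp add: fischer_smult_right)
    next
      case (Suc k)
      have "n' + k = N" using Suc.prems Suc by simp
      then show ?thesis using Suc.IH[of 0 N n' k] Suc \<open>n = 0\<close> m Suc.prems
        by (auto simp add: fischer_smult_right)
    qed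
    finally show ?thesis .
  qed
qed

text \<open>The Fischer norm of a \<open>j\<close>-th derivative is a factorial moment of the squared coefficients. This is how
the binomial moments of the linearization coefficients become computable.\<close>

lemma fischer_pderiv_iterate:
  assumes "j \<le> N" "degree p \<le> N"
  shows "fischer (N - j) ((pderiv ^^ j) p) ((pderiv ^^ j) p)
     = fact j * (\<Sum>k\<le>N. (coeff p k)\<^sup>2 * fact k * fact (N - k) * real (k choose j))"
proof -
  have c: "coeff ((pderiv ^^ j) p) k = fact (k + j) / fact k * coeff p (k + j)" for k
  proof (induction j arbitrary: k)
    case (Suc j)
    have "real (Suc k) * (X / fact (Suc k) * c) = X / fact k * c" for X c :: real
      by (simp del: of_nat_Suc)
    then show ?case by (simp add: coeff_pderiv Suc del: of_nat_Suc fact_Suc)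
  qed simp
  have "fischer (N - j) ((pderiv ^^ j) p) ((pderiv ^^ j) p)
      = (\<Sum>k\<le>N - j. fact j * ((coeff p (k + j))\<^sup>2 * fact (k + j) * fact (N - (k + j)) * real ((k + j) choose j)))"
    unfolding fischer_def c
    by (intro sum.cong refl) (simp add: binomial_fact field_simps power2_eq_square)
  also have "\<dots> = (\<Sum>k\<in>{j..N}. fact j * ((coeff p k)\<^sup>2 * fact k * fact (N - k) * real (k choose j)))"
    using assms(1)
    by (intro sum.reindex_bij_witness[of _ "\<lambda>k. k - j" "\<lambda>k. k + j"]) auto
  also have "\<dots> = (\<Sum>k\<le>N. fact j * ((coeff p k)\<^sup>2 * fact k * fact (N - k) * real (k choose j)))"
    by (intro sum.mono_neutral_left) (auto simp: not_le)
  finally show ?thesis by (simp add: sum_distrib_left)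
qed

lemma pderiv_sum_poly: "pderiv (\<Sum>i\<in>I. p i) = (\<Sum>i\<in>I. pderiv (p i :: real poly))"
  by (induction I rule: infinite_finite_induct) (simp_all add: pderiv_add)

text \<open>Leibniz' rule; each derivative of a rotated monomial is again a combination of rotated monomials.\<close>

lemma pderiv_iterate_diag_poly:
  "(pderiv ^^ j) (diag_poly n m) = (\<Sum>i\<le>j. smult (real (j choose i) * ((-1)^(j-i)
      * (real (n choose i) * fact i * (real (m choose (j-i)) * fact (j-i))))) (diag_poly (n - i) (m - (j - i))))"
proof (induction j)
  case (Suc j)
  define e where "e n i = real (n choose i) * fact i" for n i :: nat
  have e: "e n i * real (n - i) = e n (Suc i)" for n i
  proof -
    have "Suc i * (n choose Suc i) = (n - i) * (n choose i)"
      using binomial_absorption[of i n] binomial_absorb_comp[of n i] by simp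
    then have "real (Suc i) * real (n choose Suc i) = real (n - i) * real (n choose i)"
      by (metis of_nat_mult)
    then show ?thesis by (simp add: e_def algebra_simps del: of_nat_Suc)
  qed
  define T where "T i l = smult ((-1)^l * (e n i * e m l)) (diag_poly (n - i) (m - l))" for i l
  have pT: "pderiv (T i l) = T (Suc i) l + T i (Suc l)" for i l
    unfolding T_def pderiv_smult pderiv_diag_poly e[symmetric]
    by (simp add: algebra_simps smult_diff_right)
  have IH: "(pderiv ^^ j) (diag_poly n m) = (\<Sum>i\<le>j. smult (real (j choose i)) (T i (j - i)))"
    unfolding Suc T_def e_def by (simp add: mult_ac)
  have "(pderiv ^^ Suc j) (diag_poly n m)
     = (\<Sum>i\<le>j. smult (real (j choose i)) (T (Suc i) (j - i))) + (\<Sum>i\<le>j. smult (real (j choose i)) (T i (Suc j - i)))"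
    by (simp add: IH pderiv_sum_poly pderiv_smult pT smult_add_right sum.distrib Suc_diff_le)
  also have "(\<Sum>i\<le>j. smult (real (j choose i)) (T i (Suc j - i))) = (\<Sum>i\<le>Suc j. smult (real (j choose i)) (T i (Suc j - i)))"
    by simp
  also have "\<dots> = T 0 (Suc j) + (\<Sum>i\<le>j. smult (real (j choose Suc i)) (T (Suc i) (j - i)))"
    by (subst sum.atMost_Suc_shift) simp
  also have "(\<Sum>i\<le>j. smult (real (j choose i)) (T (Suc i) (j - i))) + (T 0 (Suc j) + (\<Sum>i\<le>j. smult (real (j choose Suc i)) (T (Suc i) (j - i))))
     = T 0 (Suc j) + (\<Sum>i\<le>j. smult (real (Suc j choose Suc i)) (T (Suc i) (j - i)))"
    by (simp add: sum.distrib smult_add_left algebra_simps)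
  also have "\<dots> = (\<Sum>i\<le>Suc j. smult (real (Suc j choose i)) (T i (Suc j - i)))"
    by (subst sum.atMost_Suc_shift) simp
  finally show ?case unfolding T_def e_def by (simp add: mult_ac)
qed simp

text \<open>The squared entries of the matrix of normalized rotated monomials, written in the normalized monomial
basis. The matrix is orthogonal, which makes its squared entries doubly stochastic.\<close>

definition linearization :: "nat \<Rightarrow> nat \<Rightarrow> nat \<Rightarrow> real" where
  "linearization n m k = (coeff (diag_poly n m) k)\<^sup>2 * fact k * fact (n + m - k) / (fact n * fact m * 2 ^ (n + m))"

lemma linearization_nonneg: "linearization n m k \<ge> 0"
  by (simp add: linearization_def)

lemma linearization_0_pos: "linearization n m 0 > 0"
  by (simp add: linearization_def coeff_diag_poly_0)

lemma fischer_sum_left: "fischer N (\<Sum>i\<in>I. f i) q = (\<Sum>i\<in>I. fischer N (f i) q)"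
  unfolding fischer_def coeff_sum
  by (subst sum.swap) (simp add: sum_distrib_left sum_distrib_right)

lemma fischer_sum_right: "fischer N q (\<Sum>i\<in>I. f i) = (\<Sum>i\<in>I. fischer N q (f i))"
  unfolding fischer_def coeff_sum
  by (subst sum.swap) (simp add: sum_distrib_left sum_distrib_right)

text \<open>Both sides are the Fischer norm of the \<open>j\<close>-th derivative of \<open>diag_poly n m\<close>: on the left computed by
coefficients, on the right through Leibniz' rule and orthogonality.\<close>

lemma linearization_moment:
  "(\<Sum>k\<le>n+m. linearization n m k * real (k choose j))
     = (\<Sum>i\<le>j. real (j choose i) * real (n choose i) * real (m choose (j - i))) / 2 ^ j"
proof (cases "j \<le> n + m")
  case False
  have "real (k choose j) = 0" if "k \<le> n + m" for k using that False by simp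
  moreover have "real (n choose i) * real (m choose (j - i)) = 0" for i
    using False by (cases "n < i") auto
  ultimately show ?thesis by (simp only: mult.assoc) (simp add: sum.neutral del: mult_eq_0_iff of_nat_eq_0_iff binomial_eq_0_iff)
next
  case True
  define N where "N = n + m"
  define w where "w i = real (j choose i) * ((-1)^(j-i)
      * (real (n choose i) * fact i * (real (m choose (j-i)) * fact (j-i))))" for i
  have wz: "w i = 0" if "\<not> (i \<le> n \<and> j - i \<le> m)" for i using that by (auto simp: w_def not_le)
  have cross: "w i * w l * fischer (N - j) (diag_poly (n - i) (m - (j - i))) (diag_poly (n - l) (m - (j - l)))
     = (if i = l then (w i)\<^sup>2 * (2^(N-j) * fact (n - i) * fact (m - (j - i))) else 0)"
    if "i \<le> j" "l \<le> j" for i l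
  proof (cases "(i \<le> n \<and> j - i \<le> m) \<and> (l \<le> n \<and> j - l \<le> m)")
    case t: True
    have "n - i + (m - (j - i)) = N - j" "n - l + (m - (j - l)) = N - j" using t that True by (auto simp: N_def)
    moreover have "(n - i = n - l) = (i = l)" using t by auto
    ultimately show ?thesis by (simp add: fischer_diag_poly power2_eq_square)
  next
    case False
    then have "w i * w l = 0" using wz by fastforce
    moreover have "i = l \<Longrightarrow> w i = 0" using False wz by auto
    ultimately show ?thesis by auto
  qed
  have "fischer (N - j) ((pderiv ^^ j) (diag_poly n m)) ((pderiv ^^ j) (diag_poly n m))
     = (\<Sum>i\<le>j. \<Sum>l\<le>j. w i * w l * fischer (N - j) (diag_poly (n - i) (m - (j - i))) (diag_poly (n - l) (m - (j - l))))"
    unfolding pderiv_iterate_diag_poly w_def[symmetric]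
    by (simp add: fischer_sum_left fischer_sum_right fischer_smult_left fischer_smult_right sum_distrib_left mult.assoc)
       (subst sum.swap, simp add: mult.left_commute)
  also have "\<dots> = (\<Sum>i\<le>j. (w i)\<^sup>2 * (2^(N-j) * fact (n - i) * fact (m - (j - i))))"
  proof (intro sum.cong refl)
    fix i assume i: "i \<in> {..j}"
    have "(\<Sum>l\<le>j. w i * w l * fischer (N - j) (diag_poly (n - i) (m - (j - i))) (diag_poly (n - l) (m - (j - l))))
      = (\<Sum>l\<le>j. if i = l then (w i)\<^sup>2 * (2^(N-j) * fact (n - i) * fact (m - (j - i))) else 0)"
      by (intro sum.cong refl cross) (use i in auto)
    also have "\<dots> = (w i)\<^sup>2 * (2^(N-j) * fact (n - i) * fact (m - (j - i)))"
      using i by (subst sum.delta') auto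
    finally show "(\<Sum>l\<le>j. w i * w l * fischer (N - j) (diag_poly (n - i) (m - (j - i))) (diag_poly (n - l) (m - (j - l))))
      = (w i)\<^sup>2 * (2^(N-j) * fact (n - i) * fact (m - (j - i)))" .
  qed
  also have "\<dots> = (\<Sum>i\<le>j. fact j * (2^(N-j) * fact n * fact m * (real (j choose i) * real (n choose i) * real (m choose (j - i)))))"
  proof (intro sum.cong refl)
    fix i assume "i \<in> {..j}"
    show "(w i)\<^sup>2 * (2^(N-j) * fact (n - i) * fact (m - (j - i)))
      = fact j * (2^(N-j) * fact n * fact m * (real (j choose i) * real (n choose i) * real (m choose (j - i))))"
    proof (cases "i \<le> n \<and> j - i \<le> m")
      case t: True
      have "fact i * fact (n - i) * real (n choose i) = fact n"
        using binomial_fact_lemma[of i n] t by (metis of_nat_fact of_nat_mult)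
      moreover have "fact (j-i) * fact (m - (j-i)) * real (m choose (j-i)) = fact m"
        using binomial_fact_lemma[of "j-i" m] t by (metis of_nat_fact of_nat_mult)
      moreover have "fact i * fact (j - i) * real (j choose i) = fact j"
        using binomial_fact_lemma[of i j] \<open>i \<in> {..j}\<close> by (metis atMost_iff of_nat_fact of_nat_mult)
      moreover have "(w i)\<^sup>2 * (2^(N-j) * fact (n - i) * fact (m - (j - i)))
         = 2^(N-j) * real (j choose i) * (real (n choose i) * real (m choose (j - i)))
            * (fact i * fact (j - i) * real (j choose i)) * (fact i * fact (n - i) * real (n choose i))
            * (fact (j-i) * fact (m - (j-i)) * real (m choose (j-i)))"
        unfolding w_def by (simp add: power_mult_distrib power2_eq_square mult_ac flip: power_add mult_2)
      ultimately show ?thesis by (simp add: mult_ac)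
    next
      case False
      then show ?thesis using wz[OF False] by (auto simp: not_le)
    qed
  qed
  finally have main: "(\<Sum>k\<le>N. (coeff (diag_poly n m) k)\<^sup>2 * fact k * fact (N - k) * real (k choose j))
      = 2^(N-j) * fact n * fact m * (\<Sum>i\<le>j. real (j choose i) * real (n choose i) * real (m choose (j - i)))"
    using fischer_pderiv_iterate[of j N "diag_poly n m"] True degree_diag_poly_le[of n m]
    by (simp add: N_def sum_distrib_left[symmetric])
  have "(\<Sum>k\<le>n+m. linearization n m k * real (k choose j))
     = (\<Sum>k\<le>N. (coeff (diag_poly n m) k)\<^sup>2 * fact k * fact (N - k) * real (k choose j)) / (fact n * fact m * 2^N)"
    unfolding linearization_def N_def[symmetric] sum_divide_distrib
    by (intro sum.cong refl) simp
  also have "\<dots> = (\<Sum>i\<le>j. real (j choose i) * real (n choose i) * real (m choose (j - i))) / 2 ^ j"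
    unfolding main using True by (simp add: N_def power_diff field_simps)
  finally show ?thesis .
qed

lemma linearization_row_sum: "(\<Sum>k\<le>n+m. linearization n m k) = 1"
  using linearization_moment[of n m 0] by simp

text \<open>Choosing \<open>i + l + 1\<close> of \<open>N + 1\<close> objects by the position of the \<open>(i + 1)\<close>-st chosen one.\<close>

lemma sum_binomial_product:
  "(\<Sum>n\<le>N. (n choose i) * ((N - n) choose l)) = Suc N choose Suc (i + l)"
proof (induction N arbitrary: l)
  case 0 then show ?case by (cases i; cases l) auto
next
  case (Suc N)
  show ?case
  proof (cases l)
    case 0
    then show ?thesis using sum_choose_upper[of i "Suc N"] by simp
  next
    case (Suc l')
    have "(\<Sum>n\<le>Suc N. (n choose i) * ((Suc N - n) choose l))
       = (\<Sum>n\<le>N. (n choose i) * (Suc (N - n) choose Suc l'))"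
      by (simp add: Suc Suc_diff_le)
    also have "\<dots> = (\<Sum>n\<le>N. (n choose i) * ((N - n) choose l')) + (\<Sum>n\<le>N. (n choose i) * ((N - n) choose l))"
      by (simp add: Suc algebra_simps sum.distrib)
    also have "\<dots> = Suc (Suc N) choose Suc (i + l)"
      unfolding Suc.IH by (simp add: Suc)
    finally show ?thesis .
  qed
qed

text \<open>The column sums and the constant 1 have the same binomial moments \<open>(Suc N) choose (Suc j)\<close>, and these
moments determine a sequence on \<open>{..N}\<close> because the matrix of binomial coefficients is triangular.\<close>

lemma linearization_column_sum:
  assumes "k \<le> N"
  shows "(\<Sum>n\<le>N. linearization n (N - n) k) = 1"
proof -
  define d where "d k = (\<Sum>n\<le>N. linearization n (N - n) k) - 1" for k
  have z: "(\<Sum>k\<le>N. d k * real (k choose j)) = 0" for j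
  proof -
    have "(\<Sum>k\<le>N. (\<Sum>n\<le>N. linearization n (N - n) k) * real (k choose j))
       = (\<Sum>n\<le>N. \<Sum>k\<le>n + (N - n). linearization n (N - n) k * real (k choose j))"
      by (simp add: sum_distrib_right) (subst sum.swap, simp)
    also have "\<dots> = (\<Sum>n\<le>N. (\<Sum>i\<le>j. real (j choose i) * real (n choose i) * real ((N - n) choose (j - i))) / 2 ^ j)"
      unfolding linearization_moment ..
    also have "\<dots> = (\<Sum>i\<le>j. real (j choose i) * real (\<Sum>n\<le>N. (n choose i) * ((N - n) choose (j - i)))) / 2^j"
      unfolding sum_divide_distrib[symmetric] of_nat_sum sum_distrib_left of_nat_mult
      by (subst sum.swap) (simp add: mult.assoc)
    also have "\<dots> = (\<Sum>i\<le>j. real (j choose i) * real (Suc N choose Suc j)) / 2^j"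
      unfolding sum_binomial_product by (intro arg_cong[where f="\<lambda>x. x / 2^j"] sum.cong refl) simp
    also have "\<dots> = real (\<Sum>i\<le>j. j choose i) * real (Suc N choose Suc j) / 2^j"
      by (simp add: sum_distrib_right del: binomial_Suc_Suc)
    also have "\<dots> = real (\<Sum>k\<le>N. k choose j)" unfolding choose_row_sum sum_choose_upper by simp
    finally show ?thesis by (simp add: d_def left_diff_distrib sum_subtractf)
  qed
  (* Downwards from N: the moment of order k involves only d i with i \<ge> k. *)
  have "d k = 0" if "k \<le> N" for k
    using that
  proof (induction "N - k" arbitrary: k rule: less_induct)
    case less
    have "0 = (\<Sum>i\<le>N. d i * real (i choose k))" using z by simp
    also have "\<dots> = (\<Sum>i\<in>{k}. d i * real (i choose k))"
    proof (intro sum.mono_neutral_right ballI)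
      fix i assume i: "i \<in> {..N} - {k}"
      show "d i * real (i choose k) = 0"
      proof (cases "i < k")
        case False
        then have "d i = 0" using i less.hyps[of i] less.prems by auto
        then show ?thesis by simp
      qed simp
    qed (use less.prems in auto)
    finally show ?case by simp
  qed
  then show ?thesis using assms by (simp add: d_def)
qed

text \<open>The coefficient of \<open>x^j\<close> on the right is a binomial moment of the linearization coefficients, and by
the moment formula it is the Cauchy product of the coefficients on the left.\<close>

lemma poly_laguerre_mult:
  "poly (laguerre n) x * poly (laguerre m) x = (\<Sum>k\<le>n+m. linearization n m k * poly (laguerre k) (2 * x))"
proof -
  have L: "poly (laguerre k) y = (\<Sum>j\<le>K. (-1)^j * real (k choose j) / fact j * y^j)" if "k \<le> K" for k K and y
    unfolding poly_laguerre using that by (intro sum.mono_neutral_left) auto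
  have "(\<Sum>k\<le>n+m. linearization n m k * poly (laguerre k) (2 * x))
     = (\<Sum>k\<le>n+m. \<Sum>j\<le>n+m. linearization n m k * ((-1)^j * real (k choose j) / fact j * (2*x)^j))"
    by (intro sum.cong refl) (simp add: L[of _ "n+m"] sum_distrib_left)
  also have "\<dots> = (\<Sum>j\<le>n+m. (-1)^j / fact j * (2*x)^j * (\<Sum>k\<le>n+m. linearization n m k * real (k choose j)))"
    by (subst sum.swap) (simp add: sum_distrib_left sum_divide_distrib mult_ac)
  also have "\<dots> = (\<Sum>j\<le>n+m. x^j * (\<Sum>i\<le>j. coeff (laguerre n) i * coeff (laguerre m) (j - i)))"
  proof (intro sum.cong refl)
    fix j
    have "(-1)^j / fact j * (real (j choose i) * real (n choose i) * real (m choose (j - i)))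
       = coeff (laguerre n) i * coeff (laguerre m) (j - i)" if "i \<le> j" for i
      using that by (simp add: coeff_laguerre binomial_fact[OF that] field_simps flip: power_add)
    then show "(-1)^j / fact j * (2*x)^j * (\<Sum>k\<le>n+m. linearization n m k * real (k choose j))
      = x^j * (\<Sum>i\<le>j. coeff (laguerre n) i * coeff (laguerre m) (j - i))"
      unfolding linearization_moment
      by (simp add: sum_distrib_left sum_divide_distrib power_mult_distrib sum_distrib_right) (auto intro!: sum.cong simp: field_simps)
  qed
  also have "\<dots> = (\<Sum>j\<le>n+m. coeff (laguerre n * laguerre m) j * x^j)"
    by (simp add: coeff_mult mult.commute[of "x ^ _"])
  also have "\<dots> = poly (laguerre n * laguerre m) x"
  proof -
    have "degree (laguerre n * laguerre m) \<le> n + m"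
      using degree_mult_le[of "laguerre n" "laguerre m"] degree_laguerre_le[of n] degree_laguerre_le[of m]
      by linarith
    then show ?thesis unfolding poly_altdef
      by (intro sum.mono_neutral_right) (auto simp: coeff_eq_0 not_le simp del: mult_eq_0_iff)
  qed
  finally show ?thesis by simp
qed

text \<open>Averaging with a doubly stochastic matrix: the loss in the sum of squares is the total weighted variance
of \<open>V\<close> around the averages \<open>m k\<close>. If there is no loss, the variance around \<open>m 0\<close> vanishes; as the
weights with \<open>k = 0\<close> are positive, \<open>V\<close> is then constant.\<close>

lemma linearization_contraction:
  fixes V :: "nat \<Rightarrow> complex" and N :: nat
  defines "m \<equiv> \<lambda>k. \<Sum>n\<le>N. of_real (linearization n (N - n) k) * V n"
  shows "(\<Sum>k\<le>N. (norm (m k))\<^sup>2) \<le> (\<Sum>n\<le>N. (norm (V n))\<^sup>2)"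
    and "(\<Sum>k\<le>N. (norm (m k))\<^sup>2) = (\<Sum>n\<le>N. (norm (V n))\<^sup>2) \<Longrightarrow> n \<le> N \<Longrightarrow> V n = V 0"
proof -
  define a where "a k n = linearization n (N - n) k" for k n
  have a0: "a k n \<ge> 0" for k n by (simp add: a_def linearization_nonneg)
  have col: "(\<Sum>n\<le>N. a k n) = 1" if "k \<le> N" for k
    using linearization_column_sum[OF that] by (simp add: a_def)
  have row: "(\<Sum>k\<le>N. a k n) = 1" if "n \<le> N" for n
    using linearization_row_sum[of n "N - n"] that by (simp add: a_def)
  have mk: "m k = (\<Sum>n\<le>N. of_real (a k n) * V n)" for k by (simp add: m_def a_def)
  have var: "(\<Sum>n\<le>N. a k n * (norm (V n - m k))\<^sup>2) = (\<Sum>n\<le>N. a k n * (norm (V n))\<^sup>2) - (norm (m k))\<^sup>2"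
    if k: "k \<le> N" for k
  proof -
    have "(\<Sum>n\<le>N. a k n * (norm (V n - m k))\<^sup>2)
      = (\<Sum>n\<le>N. a k n * (norm (V n))\<^sup>2 - 2 * (a k n * (V n \<bullet> m k)) + a k n * (norm (m k))\<^sup>2)"
      by (intro sum.cong refl) (simp add: power2_norm_eq_inner inner_diff inner_commute algebra_simps)
    also have "\<dots> = (\<Sum>n\<le>N. a k n * (norm (V n))\<^sup>2) - 2 * (\<Sum>n\<le>N. a k n * (V n \<bullet> m k)) + (\<Sum>n\<le>N. a k n) * (norm (m k))\<^sup>2"
      by (simp add: sum.distrib sum_subtractf sum_distrib_left sum_distrib_right)
    also have "(\<Sum>n\<le>N. a k n * (V n \<bullet> m k)) = m k \<bullet> m k"
    proof -
      have "(\<Sum>n\<le>N. a k n * (V n \<bullet> m k)) = (\<Sum>n\<le>N. (of_real (a k n) * V n) \<bullet> m k)"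
        by (intro sum.cong refl) (simp add: scaleR_conv_of_real[symmetric])
      also have "\<dots> = m k \<bullet> m k" unfolding mk[of k] by (simp only: inner_sum_left)
      finally show ?thesis .
    qed
    finally show ?thesis using col[OF k] by (simp add: power2_norm_eq_inner)
  qed
  have "(\<Sum>k\<le>N. \<Sum>n\<le>N. a k n * (norm (V n - m k))\<^sup>2) = (\<Sum>k\<le>N. (\<Sum>n\<le>N. a k n * (norm (V n))\<^sup>2) - (norm (m k))\<^sup>2)"
    by (intro sum.cong refl var) simp
  also have "\<dots> = (\<Sum>k\<le>N. \<Sum>n\<le>N. a k n * (norm (V n))\<^sup>2) - (\<Sum>k\<le>N. (norm (m k))\<^sup>2)"
    by (simp add: sum_subtractf)
  also have "(\<Sum>k\<le>N. \<Sum>n\<le>N. a k n * (norm (V n))\<^sup>2) = (\<Sum>n\<le>N. (\<Sum>k\<le>N. a k n) * (norm (V n))\<^sup>2)"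
    by (subst sum.swap) (simp add: sum_distrib_right)
  also have "\<dots> = (\<Sum>n\<le>N. (norm (V n))\<^sup>2)" using row by simp
  finally have main: "(\<Sum>k\<le>N. \<Sum>n\<le>N. a k n * (norm (V n - m k))\<^sup>2) = (\<Sum>n\<le>N. (norm (V n))\<^sup>2) - (\<Sum>k\<le>N. (norm (m k))\<^sup>2)" .
  have nn: "0 \<le> (\<Sum>n\<le>N. a k n * (norm (V n - m k))\<^sup>2)" for k using a0 by (intro sum_nonneg) auto
  show "(\<Sum>k\<le>N. (norm (m k))\<^sup>2) \<le> (\<Sum>n\<le>N. (norm (V n))\<^sup>2)"
    using sum_nonneg[of "{..N}" "\<lambda>k. \<Sum>n\<le>N. a k n * (norm (V n - m k))\<^sup>2"] nn main by simp
  assume eq: "(\<Sum>k\<le>N. (norm (m k))\<^sup>2) = (\<Sum>n\<le>N. (norm (V n))\<^sup>2)" and n: "n \<le> N"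
  have "(\<Sum>k\<le>N. \<Sum>n\<le>N. a k n * (norm (V n - m k))\<^sup>2) = 0" using main eq by simp
  then have "(\<Sum>n\<le>N. a 0 n * (norm (V n - m 0))\<^sup>2) = 0"
    using sum_nonneg_eq_0_iff[of "{..N}" "\<lambda>k. \<Sum>n\<le>N. a k n * (norm (V n - m k))\<^sup>2"] nn by simp
  then have "\<forall>n\<le>N. a 0 n * (norm (V n - m 0))\<^sup>2 = 0"
    using sum_nonneg_eq_0_iff[of "{..N}" "\<lambda>n. a 0 n * (norm (V n - m 0))\<^sup>2"] a0 by simp
  moreover have "a 0 n > 0" for n by (simp add: a_def linearization_0_pos)
  ultimately have "V n = m 0" if "n \<le> N" for n using that by (metis mult_eq_0_iff less_irrefl zero_eq_power2 norm_eq_zero right_minus_eq)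
  then show "V n = V 0" using n by simp
qed

section \<open>Square-integrable functions\<close>

lemma in_Lp_2_iff: "in_Lp 2 M f \<longleftrightarrow> f \<in> borel_measurable M \<and> integrable M (\<lambda>x. (norm (f x))\<^sup>2)"
  by (simp add: in_Lp_def)

lemma in_Lp_2_borel: "in_Lp 2 M f \<Longrightarrow> f \<in> borel_measurable M"
  and in_Lp_2_integrable: "in_Lp 2 M f \<Longrightarrow> integrable M (\<lambda>x. (norm (f x))\<^sup>2)"
  by (simp_all add: in_Lp_2_iff)

lemma Lp_norm_2: "Lp_norm 2 M f = sqrt (\<integral>x. (norm (f x))\<^sup>2 \<partial>M)"
  by (simp add: Lp_norm_def powr_half_sqrt)

lemma norm_add_sq_le: "(norm (a + b))\<^sup>2 \<le> 2 * (norm a)\<^sup>2 + 2 * (norm b)\<^sup>2"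
  for a b :: "'a::real_normed_vector"
proof -
  have "(norm (a + b))\<^sup>2 \<le> (norm a + norm b)\<^sup>2" by (simp add: norm_triangle_ineq power_mono)
  also have "\<dots> \<le> 2 * (norm a)\<^sup>2 + 2 * (norm b)\<^sup>2"
    using sum_squares_bound[of "norm a" "norm b"] by (simp add: power2_sum)
  finally show ?thesis .
qed

lemma in_Lp_2_add:
  assumes "in_Lp 2 M f" "in_Lp 2 M g" shows "in_Lp 2 M (\<lambda>x. f x + g x)"
  unfolding in_Lp_2_iff
proof
  show m: "(\<lambda>x. f x + g x) \<in> borel_measurable M"
    by (intro borel_measurable_add in_Lp_2_borel assms)
  show "integrable M (\<lambda>x. (norm (f x + g x))\<^sup>2)"
  proof (rule Bochner_Integration.integrable_bound)
    show "integrable M (\<lambda>x. 2 * (norm (f x))\<^sup>2 + 2 * (norm (g x))\<^sup>2)"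
      using assms by (simp add: in_Lp_2_iff)
    show "AE x in M. norm ((norm (f x + g x))\<^sup>2) \<le> norm (2 * (norm (f x))\<^sup>2 + 2 * (norm (g x))\<^sup>2)"
      using norm_add_sq_le by (intro AE_I2) (simp add: abs_of_nonneg)
  qed (use m in measurable)
qed

lemma in_Lp_2_cmult: "in_Lp 2 M f \<Longrightarrow> in_Lp 2 M (\<lambda>x. c * f x)"
  unfolding in_Lp_2_iff by (auto simp: norm_mult power_mult_distrib intro!: borel_measurable_times)

lemma in_Lp_2_diff: "in_Lp 2 M f \<Longrightarrow> in_Lp 2 M g \<Longrightarrow> in_Lp 2 M (\<lambda>x. f x - g x)"
  using in_Lp_2_add[of M f "\<lambda>x. - 1 * g x"] in_Lp_2_cmult[of M g "-1"] by simp

lemma in_Lp_2_integrable_mult: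
  assumes "in_Lp 2 M f" "in_Lp 2 M g" shows "integrable M (\<lambda>x. f x * g x)"
proof (rule Bochner_Integration.integrable_bound)
  show "integrable M (\<lambda>x. (norm (f x))\<^sup>2 + (norm (g x))\<^sup>2)" using assms by (simp add: in_Lp_2_iff)
  show "(\<lambda>x. f x * g x) \<in> borel_measurable M"
    by (intro borel_measurable_times in_Lp_2_borel assms)
  show "AE x in M. norm (f x * g x) \<le> norm ((norm (f x))\<^sup>2 + (norm (g x))\<^sup>2)"
  proof (intro AE_I2)
    fix x
    have "norm (f x) * norm (g x) \<le> (norm (f x))\<^sup>2 + (norm (g x))\<^sup>2"
      using sum_squares_bound[of "norm (f x)" "norm (g x)"] zero_le_power2[of "norm (f x)"] zero_le_power2[of "norm (g x)"]
        mult_nonneg_nonneg[OF norm_ge_zero[of "f x"] norm_ge_zero[of "g x"]] by linarith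
    then show "norm (f x * g x) \<le> norm ((norm (f x))\<^sup>2 + (norm (g x))\<^sup>2)" by (simp add: norm_mult)
  qed
qed

lemma Cauchy_Schwarz_integral:
  assumes "in_Lp 2 M f" "in_Lp 2 M g"
  shows "(\<integral>x. norm (f x) * norm (g x) \<partial>M)\<^sup>2 \<le> (\<integral>x. (norm (f x))\<^sup>2 \<partial>M) * (\<integral>x. (norm (g x))\<^sup>2 \<partial>M)"
    and "(norm (\<integral>x. f x * g x \<partial>M))\<^sup>2 \<le> (\<integral>x. (norm (f x))\<^sup>2 \<partial>M) * (\<integral>x. (norm (g x))\<^sup>2 \<partial>M)"
proof -
  define A where "A = (\<integral>x. (norm (f x))\<^sup>2 \<partial>M)"
  define B where "B = (\<integral>x. (norm (g x))\<^sup>2 \<partial>M)"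
  define I where "I = (\<integral>x. norm (f x) * norm (g x) \<partial>M)"
  have int: "integrable M (\<lambda>x. norm (f x) * norm (g x))"
    using integrable_norm[OF in_Lp_2_integrable_mult[OF assms]] by (simp add: norm_mult)
  have q: "0 \<le> A - 2 * l * I + l\<^sup>2 * B" for l
  proof -
    have "0 \<le> (\<integral>x. (norm (f x) - l * norm (g x))\<^sup>2 \<partial>M)" by simp
    also have "\<dots> = (\<integral>x. (norm (f x))\<^sup>2 - 2 * l * (norm (f x) * norm (g x)) + l\<^sup>2 * (norm (g x))\<^sup>2 \<partial>M)"
      by (simp add: power2_diff power_mult_distrib algebra_simps)
    also have "\<dots> = A - 2 * l * I + l\<^sup>2 * B"
      unfolding A_def B_def I_def using assms int by (simp add: in_Lp_2_iff)
    finally show ?thesis .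
  qed
  have "B \<ge> 0" "I \<ge> 0" unfolding B_def I_def by simp_all
  show *: "(\<integral>x. norm (f x) * norm (g x) \<partial>M)\<^sup>2 \<le> (\<integral>x. (norm (f x))\<^sup>2 \<partial>M) * (\<integral>x. (norm (g x))\<^sup>2 \<partial>M)"
    unfolding A_def[symmetric] B_def[symmetric] I_def[symmetric]
  proof (cases "B = 0")
    case True
    have "I = 0"
    proof (rule ccontr)
      assume "I \<noteq> 0"
      then show False using q[of "(A + 1) / (2 * I)"] True by simp
    qed
    then show "I\<^sup>2 \<le> A * B" using True by simp
  next
    case False
    then have "B > 0" using \<open>B \<ge> 0\<close> by simp
    have "A - 2 * (I / B) * I + (I / B)\<^sup>2 * B = A - I\<^sup>2 / B"
      using \<open>B > 0\<close> by (simp add: power2_eq_square field_simps)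
    then have "I\<^sup>2 / B \<le> A" using q[of "I / B"] by simp
    then show "I\<^sup>2 \<le> A * B" using \<open>B > 0\<close> by (simp add: pos_divide_le_eq)
  qed
  have "norm (\<integral>x. f x * g x \<partial>M) \<le> I"
    unfolding I_def using integral_norm_bound[of M "\<lambda>x. f x * g x"] by (simp add: norm_mult)
  then have "(norm (\<integral>x. f x * g x \<partial>M))\<^sup>2 \<le> I\<^sup>2" by (simp add: power_mono)
  then show "(norm (\<integral>x. f x * g x \<partial>M))\<^sup>2 \<le> (\<integral>x. (norm (f x))\<^sup>2 \<partial>M) * (\<integral>x. (norm (g x))\<^sup>2 \<partial>M)"
    using * unfolding I_def by linarith
qed

text \<open>The rate \<open>(1/4)^j\<close> leaves room for the weights \<open>2^j\<close>: the weighted sum of the squared increments is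
integrable, so almost everywhere the increments are bounded by a geometric sequence.\<close>

lemma L2_fast_Cauchy_convergent:
  fixes u :: "nat \<Rightarrow> 'a \<Rightarrow> complex"
  assumes [measurable]: "\<And>j. u j \<in> borel_measurable M"
    and bound: "\<And>j. (\<integral>\<^sup>+x. ennreal ((norm (u (Suc j) x - u j x))\<^sup>2) \<partial>M) \<le> ennreal (C * (1/4)^j)"
    and "C \<ge> 0"
  shows "AE x in M. convergent (\<lambda>j. u j x)"
proof -
  define d where "d j x = norm (u (Suc j) x - u j x)" for j x
  have "(\<integral>\<^sup>+x. (\<Sum>j. ennreal (2^j * (d j x)\<^sup>2)) \<partial>M) = (\<Sum>j. \<integral>\<^sup>+x. ennreal (2^j * (d j x)\<^sup>2) \<partial>M)"
    unfolding d_def by (rule nn_integral_suminf) measurable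
  also have "\<dots> \<le> (\<Sum>j. ennreal (C * (1/2)^j))"
  proof (intro suminf_le allI)
    fix j
    have "(\<integral>\<^sup>+x. ennreal (2^j * (d j x)\<^sup>2) \<partial>M) = (\<integral>\<^sup>+x. ennreal (2^j) * ennreal ((d j x)\<^sup>2) \<partial>M)"
      by (simp add: ennreal_mult)
    also have "\<dots> = ennreal (2^j) * (\<integral>\<^sup>+x. ennreal ((d j x)\<^sup>2) \<partial>M)"
      unfolding d_def by (rule nn_integral_cmult) measurable
    also have "\<dots> \<le> ennreal (2^j) * ennreal (C * (1/4)^j)"
      using bound[of j] unfolding d_def by (rule mult_left_mono) simp
    also have "\<dots> = ennreal (2^j * (C * (1/4)^j))" using \<open>C \<ge> 0\<close> by (simp add: ennreal_mult)
    also have "2^j * (C * (1/4)^j) = C * (1/2)^j"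
      using power_mult_distrib[of "2::real" "1/4" j] by simp
    finally show "(\<integral>\<^sup>+x. ennreal (2^j * (d j x)\<^sup>2) \<partial>M) \<le> ennreal (C * (1/2)^j)" .
  qed auto
  also have "\<dots> < \<infinity>"
    using \<open>C \<ge> 0\<close> by (subst suminf_ennreal2) (auto intro!: summable_mult summable_geometric)
  finally have "(\<integral>\<^sup>+x. (\<Sum>j. ennreal (2^j * (d j x)\<^sup>2)) \<partial>M) \<noteq> \<infinity>" by simp
  then have "AE x in M. (\<Sum>j. ennreal (2^j * (d j x)\<^sup>2)) \<noteq> \<infinity>"
    by (rule nn_integral_PInf_AE[rotated]) (simp add: d_def)
  then show ?thesis
  proof (rule AE_mp[OF _ AE_I2[OF impI]])
    fix x assume fin: "(\<Sum>j. ennreal (2^j * (d j x)\<^sup>2)) \<noteq> \<infinity>"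
    define s where "s j = 2^j * (d j x)\<^sup>2" for j :: nat
    have "s j \<ge> 0" for j by (simp add: s_def)
    then have summ: "summable s" using fin unfolding s_def[symmetric]
      by (intro summable_suminf_not_top) (auto simp: infinity_ennreal_def)
    have "Bseq s" by (rule convergent_imp_Bseq[OF convergentI[OF summable_LIMSEQ_zero[OF summ]]])
    then obtain K where K: "K > 0" "\<And>j. norm (s j) \<le> K" by (auto elim: BseqE)
    have dj: "d j x \<le> sqrt K * (1 / sqrt 2)^j" for j
    proof -
      have "(d j x)\<^sup>2 \<le> K * (1/2)^j" using K(2)[of j] by (simp add: s_def field_simps)
      then have "sqrt ((d j x)\<^sup>2) \<le> sqrt (K * (1/2)^j)" by (rule real_sqrt_le_mono)
      then show ?thesis by (simp add: d_def real_sqrt_mult real_sqrt_power real_sqrt_divide)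
    qed
    have "summable (\<lambda>j. norm (u (Suc j) x - u j x))"
    proof (rule summable_comparison_test')
      show "summable (\<lambda>j. sqrt K * (1 / sqrt 2)^j)"
        by (intro summable_mult summable_geometric) (simp add: field_simps)
      show "norm (norm (u (Suc j) x - u j x)) \<le> sqrt K * (1 / sqrt 2) ^ j" if "j \<ge> 0" for j
        using dj[of j] by (simp add: d_def)
    qed
    then have "summable (\<lambda>j. u (Suc j) x - u j x)" by (rule summable_norm_cancel)
    then obtain l where "(\<lambda>n. \<Sum>j<n. u (Suc j) x - u j x) \<longlonglongrightarrow> l"
      by (auto simp: summable_def sums_def)
    then have "(\<lambda>n. u n x - u 0 x) \<longlonglongrightarrow> l" using sum_lessThan_telescope[of "\<lambda>j. u j x"] by (simp only:)
    then have "(\<lambda>n. u n x - u 0 x + u 0 x) \<longlonglongrightarrow> l + u 0 x" by (intro tendsto_add tendsto_const)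
    then show "convergent (\<lambda>j. u j x)" by (auto simp: convergent_def)
  qed
qed

lemma has_vector_derivative_iff_quotient:
  "(f has_vector_derivative D) (at t) \<longleftrightarrow> ((\<lambda>s. (f s - f t) /\<^sub>R (s - t)) \<longlongrightarrow> D) (at t)"
proof -
  have "((\<lambda>s. (f s - f t) /\<^sub>R (s - t)) \<longlongrightarrow> D) (at t)
      \<longleftrightarrow> ((\<lambda>s. norm ((f s - f t) /\<^sub>R (s - t) - D)) \<longlongrightarrow> 0) (at t)"
    by (subst Lim_null) (rule tendsto_norm_zero_iff[symmetric])
  also have "\<dots> \<longleftrightarrow> ((\<lambda>s. norm ((f s - f t - (s - t) *\<^sub>R D) /\<^sub>R norm (s - t))) \<longlongrightarrow> 0) (at t)"
  proof (rule filterlim_cong[OF refl refl], rule eventually_at_filter[THEN iffD2], rule always_eventually, safe)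
    fix s assume "s \<noteq> t"
    then have "(f s - f t) /\<^sub>R (s - t) - D = (f s - f t - (s - t) *\<^sub>R D) /\<^sub>R (s - t)"
      by (simp add: scaleR_diff_right)
    then show "norm ((f s - f t) /\<^sub>R (s - t) - D) = norm ((f s - f t - (s - t) *\<^sub>R D) /\<^sub>R norm (s - t))"
      by simp
  qed
  also have "\<dots> \<longleftrightarrow> (f has_vector_derivative D) (at t)"
    unfolding has_vector_derivative_def has_derivative_at_within
    by (simp add: tendsto_norm_zero_iff bounded_linear_scaleR_left del: norm_scaleR)
  finally show ?thesis by simp
qed

lemma vector_derivative_bound_difference:
  assumes "\<And>s. \<bar>s - t\<bar> < e \<Longrightarrow> (f has_vector_derivative f' s) (at s)"
    and "\<And>s. \<bar>s - t\<bar> < e \<Longrightarrow> norm (f' s) \<le> B" and "\<bar>s - t\<bar> < e"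
  shows "norm (f s - f t) \<le> B * \<bar>s - t\<bar>"
proof -
  have "norm (f s - f t) \<le> B * norm (s - t)"
  proof (rule differentiable_bound[of "ball t e" f "\<lambda>s h. h *\<^sub>R f' s"])
    fix x assume "x \<in> ball t e"
    then have x: "\<bar>x - t\<bar> < e" by (simp add: dist_real_def)
    show "(f has_derivative (\<lambda>h. h *\<^sub>R f' x)) (at x within ball t e)"
      using assms(1)[OF x] unfolding has_vector_derivative_def by (rule has_derivative_at_withinI)
    show "onorm (\<lambda>h. h *\<^sub>R f' x) \<le> B"
      using assms(2)[OF x] by (intro onorm_le) (simp add: mult.commute[of B] mult_left_mono)
  qed (use assms(3) in \<open>auto simp: dist_real_def\<close>)
  then show ?thesis by simp
qed

text \<open>Differentiation under the integral sign with a majorant of the derivative; the mean value inequality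
makes it a majorant of the difference quotients.\<close>

lemma integral_has_vector_derivative_dominated:
  fixes f :: "real \<Rightarrow> 'a \<Rightarrow> complex"
  assumes e: "e > 0"
    and int: "\<And>s. \<bar>s - t\<bar> < e \<Longrightarrow> integrable M (f s)"
    and deriv: "\<And>s x. \<bar>s - t\<bar> < e \<Longrightarrow> ((\<lambda>s. f s x) has_vector_derivative f' s x) (at s)"
    and bound: "\<And>s x. \<bar>s - t\<bar> < e \<Longrightarrow> norm (f' s x) \<le> G x"
    and G: "integrable M G"
  shows "((\<lambda>s. \<integral>x. f s x \<partial>M) has_vector_derivative (\<integral>x. f' t x \<partial>M)) (at t)"
  unfolding has_vector_derivative_iff_quotient tendsto_at_iff_sequentially
proof (intro allI impI)
  fix X :: "nat \<Rightarrow> real" assume X: "\<forall>i. X i \<in> UNIV - {t}" "X \<longlonglongrightarrow> t"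
  have "\<forall>\<^sub>F i in sequentially. dist (X i) t < e" using tendstoD[OF X(2) e] .
  then obtain n0 where n0: "\<And>i. \<bar>X (i + n0) - t\<bar> < e"
    unfolding eventually_sequentially dist_real_def by (meson le_add2)
  define Y where "Y i = X (i + n0)" for i
  have Y: "Y \<longlonglongrightarrow> t" unfolding Y_def using X(2) by (rule LIMSEQ_ignore_initial_segment)
  have Yt: "Y i \<noteq> t" "\<bar>Y i - t\<bar> < e" for i using X(1) n0 by (auto simp: Y_def)
  have 1: "(\<lambda>i. \<integral>x. (f (Y i) x - f t x) /\<^sub>R (Y i - t) \<partial>M) \<longlonglongrightarrow> (\<integral>x. f' t x \<partial>M)"
  proof (rule integral_dominated_convergence)
    show "AE x in M. (\<lambda>i. (f (Y i) x - f t x) /\<^sub>R (Y i - t)) \<longlonglongrightarrow> f' t x"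
    proof (rule AE_I2)
      fix x
      have "((\<lambda>s. (f s x - f t x) /\<^sub>R (s - t)) \<longlongrightarrow> f' t x) (at t)"
        using deriv[of t x] e by (simp add: has_vector_derivative_iff_quotient)
      then show "(\<lambda>i. (f (Y i) x - f t x) /\<^sub>R (Y i - t)) \<longlonglongrightarrow> f' t x"
        unfolding tendsto_at_iff_sequentially using Y Yt by (auto simp: o_def)
    qed
    show "(\<lambda>x. (f (Y i) x - f t x) /\<^sub>R (Y i - t)) \<in> borel_measurable M" for i
      using int[OF Yt(2)] int[of t] e by auto
    then show "f' t \<in> borel_measurable M"
    proof (rule borel_measurable_LIMSEQ_metric)
      fix x
      have "((\<lambda>s. (f s x - f t x) /\<^sub>R (s - t)) \<longlongrightarrow> f' t x) (at t)"
        using deriv[of t x] e by (simp add: has_vector_derivative_iff_quotient)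
      then show "(\<lambda>i. (f (Y i) x - f t x) /\<^sub>R (Y i - t)) \<longlonglongrightarrow> f' t x"
        unfolding tendsto_at_iff_sequentially using Y Yt by (auto simp: o_def)
    qed
    show "AE x in M. norm ((f (Y i) x - f t x) /\<^sub>R (Y i - t)) \<le> G x" for i
    proof (rule AE_I2)
      fix x
      have "norm (f (Y i) x - f t x) \<le> G x * \<bar>Y i - t\<bar>"
        by (rule vector_derivative_bound_difference[of t e "\<lambda>s. f s x" "\<lambda>s. f' s x"])
           (use deriv bound Yt in auto)
      then show "norm ((f (Y i) x - f t x) /\<^sub>R (Y i - t)) \<le> G x"
        using Yt(1)[of i] by (simp add: divide_inverse[symmetric] mult.commute[of "inverse _"] pos_divide_le_eq
            del: scaleR_right_diff_distrib)
    qed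
  qed (rule G)
  have "(\<integral>x. (f (Y i) x - f t x) /\<^sub>R (Y i - t) \<partial>M) = ((\<integral>x. f (Y i) x \<partial>M) - (\<integral>x. f t x \<partial>M)) /\<^sub>R (Y i - t)" for i
    using int[OF Yt(2)] int[of t] e by simp
  with 1 have "(\<lambda>i. ((\<integral>x. f (X (i + n0)) x \<partial>M) - (\<integral>x. f t x \<partial>M)) /\<^sub>R (X (i + n0) - t)) \<longlonglongrightarrow> (\<integral>x. f' t x \<partial>M)"
    by (simp only: Y_def)
  then show "((\<lambda>s. ((\<integral>x. f s x \<partial>M) - (\<integral>x. f t x \<partial>M)) /\<^sub>R (s - t)) \<circ> X) \<longlonglongrightarrow> (\<integral>x. f' t x \<partial>M)"
    unfolding o_def by (rule LIMSEQ_offset)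
qed

section \<open>Radial integration in the plane\<close>

text \<open>The radial measure in the variable \<open>r = |x|\<^sup>2\<close>: up to the factor \<open>\<pi>\<close> it is the image of Lebesgue measure
of the plane. As a measure on all of \<open>\<real>\<close> it can be used with functions that are given on the line.\<close>

definition halfline :: "real measure" where
  "halfline = density lborel (indicator {0..})"

lemma sets_halfline [measurable_cong, simp]: "sets halfline = sets borel"
  and space_halfline [simp]: "space halfline = UNIV"
  by (simp_all add: halfline_def)

lemma AE_halfline: "(AE r in halfline. P r) \<longleftrightarrow> (AE r in lborel. r \<ge> 0 \<longrightarrow> P r)"
  unfolding halfline_def by (subst AE_density) (auto simp: indicator_def)

lemma integral_halfline:
  fixes g :: "real \<Rightarrow> 'b::{banach, second_countable_topology}"
  assumes [measurable]: "g \<in> borel_measurable borel"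
  shows "(\<integral>r. g r \<partial>halfline) = (\<integral>r. indicator {0..} r *\<^sub>R g r \<partial>lborel)"
    and "integrable halfline g \<longleftrightarrow> integrable lborel (\<lambda>r. indicator {0..} r *\<^sub>R g r)"
proof -
  have *: "halfline = density lborel (\<lambda>r. ennreal (indicator {0..} r))"
    by (simp add: halfline_def ennreal_indicator)
  show "(\<integral>r. g r \<partial>halfline) = (\<integral>r. indicator {0..} r *\<^sub>R g r \<partial>lborel)"
    unfolding * by (rule integral_density) auto
  show "integrable halfline g \<longleftrightarrow> integrable lborel (\<lambda>r. indicator {0..} r *\<^sub>R g r)"
    unfolding * by (rule integrable_density) auto
qed

text \<open>The disc \<open>|x|\<^sup>2 \<le> a\<close> has area \<open>\<pi> a\<close>.\<close>

lemma distr_norm_sq: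
  "distr (lborel :: (real^2) measure) borel (\<lambda>x. (norm x)\<^sup>2) = density halfline (\<lambda>_. ennreal pi)"
proof (rule measure_eqI_generator_eq[where E = "range atMost" and \<Omega> = UNIV and A = "\<lambda>n. {..real n}"])
  show "Int_stable (range (atMost :: real \<Rightarrow> _))"
    by (auto simp: Int_stable_def)
  have m: "(\<lambda>x::real^2. (norm x)\<^sup>2) \<in> borel_measurable lborel" by measurable
  have e: "emeasure (distr (lborel :: (real^2) measure) borel (\<lambda>x. (norm x)\<^sup>2)) {..a}
      = (if a < 0 then 0 else ennreal (pi * a))" for a
  proof (cases "a < 0")
    case True
    then have "(\<lambda>x::real^2. (norm x)\<^sup>2) -` {..a} = {}"
      by (auto simp: not_le) (meson less_le_trans zero_le_power2 not_le)
    then show ?thesis using True by (simp add: emeasure_distr)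
  next
    case False
    have "(\<lambda>x::real^2. (norm x)\<^sup>2) -` {..a} = cball 0 (sqrt a)"
      using False by (auto simp: real_le_rsqrt) (metis norm_ge_zero not_less power_mono real_sqrt_pow2)
    then show ?thesis using False
      by (simp add: emeasure_distr emeasure_cball unit_ball_vol_2)
  qed
  have h: "emeasure (density halfline (\<lambda>_. ennreal pi)) {..a} = (if a < 0 then 0 else ennreal (pi * a))" for a
  proof -
    have "emeasure (density halfline (\<lambda>_. ennreal pi)) {..a} = ennreal pi * emeasure halfline {..a}"
      by (subst emeasure_density_const) auto
    also have "emeasure halfline {..a} = emeasure lborel ({0..} \<inter> {..a})"
      unfolding halfline_def by (subst emeasure_restricted) auto
    also have "{0..} \<inter> {..a} = {0..a}" by auto
    finally show ?thesis by (auto simp: ennreal_mult)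
  qed
  show "emeasure (distr (lborel :: (real^2) measure) borel (\<lambda>x. (norm x)\<^sup>2)) X
      = emeasure (density halfline (\<lambda>_. ennreal pi)) X" if "X \<in> range atMost" for X
    using that e h by auto
  show "emeasure (distr (lborel :: (real^2) measure) borel (\<lambda>x. (norm x)\<^sup>2)) {..real i} \<noteq> \<infinity>" for i
    using e by simp
  show "(\<Union>i. {..real i}) = UNIV" by (auto simp: real_arch_simple)
qed (auto simp: borel_eq_atMost)

lemma nn_integral_radial:
  assumes [measurable]: "g \<in> borel_measurable borel"
  shows "(\<integral>\<^sup>+x. g ((norm (x::real^2))\<^sup>2) \<partial>lborel) = ennreal pi * (\<integral>\<^sup>+r. g r \<partial>halfline)"
proof -
  have "(\<integral>\<^sup>+x. g ((norm (x::real^2))\<^sup>2) \<partial>lborel) = (\<integral>\<^sup>+r. g r \<partial>distr (lborel :: (real^2) measure) borel (\<lambda>x. (norm x)\<^sup>2))"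
    by (subst nn_integral_distr) auto
  also have "\<dots> = (\<integral>\<^sup>+r. ennreal pi * g r \<partial>halfline)"
    unfolding distr_norm_sq by (subst nn_integral_density) auto
  finally show ?thesis by (simp add: nn_integral_cmult)
qed

lemma integral_radial:
  fixes g :: "real \<Rightarrow> 'b::{banach, second_countable_topology}"
  assumes [measurable]: "g \<in> borel_measurable borel"
  shows "(\<integral>x. g ((norm (x::real^2))\<^sup>2) \<partial>lborel) = pi *\<^sub>R (\<integral>r. g r \<partial>halfline)"
    and "integrable lborel (\<lambda>x::real^2. g ((norm x)\<^sup>2)) \<longleftrightarrow> integrable halfline g"
proof -
  let ?d = "distr (lborel :: (real^2) measure) borel (\<lambda>x. (norm x)\<^sup>2)"
  have "(\<integral>x. g ((norm (x::real^2))\<^sup>2) \<partial>lborel) = (\<integral>r. g r \<partial>?d)"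
    by (subst integral_distr) auto
  also have "\<dots> = (\<integral>r. pi *\<^sub>R g r \<partial>halfline)"
    unfolding distr_norm_sq by (subst integral_density) auto
  finally show "(\<integral>x. g ((norm (x::real^2))\<^sup>2) \<partial>lborel) = pi *\<^sub>R (\<integral>r. g r \<partial>halfline)" by simp
  have "integrable lborel (\<lambda>x::real^2. g ((norm x)\<^sup>2)) \<longleftrightarrow> integrable ?d g"
    by (subst integrable_distr_eq) auto
  also have "\<dots> \<longleftrightarrow> integrable halfline g"
    unfolding distr_norm_sq
    using integrable_scaleR_right[of "1 / pi" halfline "\<lambda>r. pi *\<^sub>R g r"]
    by (subst integrable_density) auto
  finally show "integrable lborel (\<lambda>x::real^2. g ((norm x)\<^sup>2)) \<longleftrightarrow> integrable halfline g" .
qed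

lemma AE_radial:
  assumes [measurable]: "Measurable.pred borel P"
  shows "(AE x in lborel. P ((norm (x::real^2))\<^sup>2)) \<longleftrightarrow> (AE r in halfline. P r)"
proof -
  have "(AE x in lborel. P ((norm (x::real^2))\<^sup>2)) \<longleftrightarrow> (AE r in distr (lborel :: (real^2) measure) borel (\<lambda>x. (norm x)\<^sup>2). P r)"
    by (subst AE_distr_iff) auto
  also have "\<dots> \<longleftrightarrow> (AE r in halfline. P r)"
    unfolding distr_norm_sq by (subst AE_density) (auto simp: ennreal_eq_0_iff pi_gt_zero)
  finally show ?thesis .
qed

section \<open>Laguerre functions and their Laplace transforms\<close>

lemma integral_halfline_derivative:
  fixes F :: "real \<Rightarrow> complex"
  assumes F: "\<And>r. (F has_vector_derivative F' r) (at r)" and c: "continuous_on UNIV F'"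
    and int: "integrable halfline F'" and lim: "(F \<longlongrightarrow> L) at_top"
  shows "(\<integral>r. F' r \<partial>halfline) = L - F 0"
proof -
  have [measurable]: "F' \<in> borel_measurable borel" using c by (rule borel_measurable_continuous_onI)
  have i: "integrable lborel (\<lambda>r. indicator {0..} r *\<^sub>R F' r)" using int by (simp add: integral_halfline)
  have 1: "(\<lambda>n. \<integral>r. indicator {0..real n} r *\<^sub>R F' r \<partial>lborel) \<longlonglongrightarrow> (\<integral>r. indicator {0..} r *\<^sub>R F' r \<partial>lborel)"
  proof (rule integral_dominated_convergence[where w = "\<lambda>r. norm (indicator {0..} r *\<^sub>R F' r)"])
    show "AE r in lborel. (\<lambda>n. indicator {0..real n} r *\<^sub>R F' r) \<longlonglongrightarrow> indicator {0..} r *\<^sub>R F' r"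
    proof (intro AE_I2 tendsto_eventually)
      fix r :: real
      obtain n0 :: nat where "r \<le> real n0" using real_arch_simple by blast
      then show "\<forall>\<^sub>F n in sequentially. indicator {0..real n} r *\<^sub>R F' r = indicator {0..} r *\<^sub>R F' r"
        by (intro eventually_sequentiallyI[of n0]) (auto simp: indicator_def)
    qed
    show "integrable lborel (\<lambda>r. norm (indicator {0..} r *\<^sub>R F' r))" using i by (rule integrable_norm)
  qed (auto simp: indicator_def)
  have "(\<integral>r. indicator {0..real n} r *\<^sub>R F' r \<partial>lborel) = F (real n) - F 0" for n
    by (rule integral_FTC_atLeastAtMost)
       (use F c in \<open>auto intro: has_vector_derivative_at_within continuous_on_subset\<close>)
  with 1 have "(\<lambda>n. F (real n) - F 0) \<longlonglongrightarrow> (\<integral>r. indicator {0..} r *\<^sub>R F' r \<partial>lborel)" by simp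
  moreover have "(\<lambda>n. F (real n) - F 0) \<longlonglongrightarrow> L - F 0"
    using lim by (intro tendsto_diff tendsto_const filterlim_compose[OF lim] filterlim_real_sequentially)
  ultimately show ?thesis using LIMSEQ_unique by (simp add: integral_halfline)
qed

lemma integral_real_line_derivative:
  fixes F :: "real \<Rightarrow> complex"
  assumes F: "\<And>r. (F has_vector_derivative F' r) (at r)" and c: "continuous_on UNIV F'"
    and int: "integrable lborel F'" and lim: "(F \<longlongrightarrow> L) at_top" "(F \<longlongrightarrow> L') at_bot"
  shows "(\<integral>r. F' r \<partial>lborel) = L - L'"
proof -
  have [measurable]: "F' \<in> borel_measurable borel" using c by (rule borel_measurable_continuous_onI)
  have 1: "(\<lambda>n. \<integral>r. indicator {-real n..real n} r *\<^sub>R F' r \<partial>lborel) \<longlonglongrightarrow> (\<integral>r. F' r \<partial>lborel)"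
  proof (rule integral_dominated_convergence[where w = "\<lambda>r. norm (F' r)"])
    show "AE r in lborel. (\<lambda>n. indicator {-real n..real n} r *\<^sub>R F' r) \<longlonglongrightarrow> F' r"
    proof (intro AE_I2 tendsto_eventually)
      fix r :: real
      obtain n0 :: nat where "\<bar>r\<bar> \<le> real n0" using real_arch_simple by blast
      then show "\<forall>\<^sub>F n in sequentially. indicator {-real n..real n} r *\<^sub>R F' r = F' r"
        by (intro eventually_sequentiallyI[of n0]) (auto simp: indicator_def)
    qed
    show "integrable lborel (\<lambda>r. norm (F' r))" using int by (rule integrable_norm)
  qed (auto simp: indicator_def)
  have "(\<integral>r. indicator {-real n..real n} r *\<^sub>R F' r \<partial>lborel) = F (real n) - F (- real n)" for n
    by (rule integral_FTC_atLeastAtMost)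
       (use F c in \<open>auto intro: has_vector_derivative_at_within continuous_on_subset\<close>)
  with 1 have "(\<lambda>n. F (real n) - F (- real n)) \<longlonglongrightarrow> (\<integral>r. F' r \<partial>lborel)" by simp
  moreover have "filterlim (\<lambda>n. - real n) at_bot sequentially"
    by (simp add: filterlim_uminus_at_top[symmetric] filterlim_real_sequentially)
  then have "(\<lambda>n. F (real n) - F (- real n)) \<longlonglongrightarrow> L - L'"
    using lim by (intro tendsto_diff filterlim_compose[OF lim(1)] filterlim_compose[OF lim(2)] filterlim_real_sequentially)
  ultimately show ?thesis using LIMSEQ_unique by blast
qed

lemma power_le_fact_exp: "r ^ k \<le> fact k * exp r" if "r \<ge> 0" for r :: real
proof -
  have s: "(\<lambda>n. r^n /\<^sub>R fact n) sums exp r" by (rule exp_converges)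
  have "(\<Sum>n\<in>{k}. r^n /\<^sub>R fact n) \<le> exp r"
    unfolding sums_unique[OF s] using s that by (intro sum_le_suminf) (auto simp: sums_iff)
  then show ?thesis by (simp add: field_simps)
qed

lemma power_exp_bound:
  fixes a r :: real
  assumes "a > 0" "r \<ge> 0"
  shows "r ^ k * exp (- a * r) \<le> fact k * (2 / a) ^ k * exp (- (a/2) * r)"
proof -
  have "(a/2 * r)^k \<le> fact k * exp (a/2 * r)" using assms by (intro power_le_fact_exp) simp
  then have "(a/2)^k * r^k * exp (- a * r) \<le> fact k * exp (a/2 * r) * exp (- a * r)"
    by (intro mult_right_mono) (simp only: power_mult_distrib, simp)
  also have "\<dots> = fact k * exp (- (a/2) * r)" by (simp add: mult.assoc flip: exp_add)
  finally show ?thesis using assms by (simp add: power_divide field_simps)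
qed

lemma tendsto_exp_neg_at_top:
  assumes "a > (0::real)" shows "((\<lambda>r. exp (- (a * r))) \<longlongrightarrow> 0) at_top"
proof (rule filterlim_compose[OF exp_at_bot])
  have "filterlim (\<lambda>r. a * r) at_top at_top"
    by (rule filterlim_tendsto_pos_mult_at_top[OF tendsto_const assms filterlim_ident])
  then show "filterlim (\<lambda>r. - (a * r)) at_bot at_top" by (simp add: filterlim_uminus_at_top)
qed

lemma integrable_exp_halfline: "a > 0 \<Longrightarrow> integrable halfline (\<lambda>r. exp (- a * r))"
proof -
  assume a: "a > 0"
  have "(\<integral>\<^sup>+r. ennreal (exp (- a * r)) * indicator {0..} r \<partial>lborel) = ennreal (0 - (- exp (- a * 0) / a))"
  proof (rule nn_integral_FTC_atLeast[where F = "\<lambda>r. - exp (- a * r) / a"])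
    show "DERIV (\<lambda>r. - exp (- a * r) / a) x :> exp (- a * x)" for x
      using a by (auto intro!: derivative_eq_intros)
    have "((\<lambda>r. exp (- (a * r))) \<longlongrightarrow> 0) at_top" using a by (rule tendsto_exp_neg_at_top)
    then have "((\<lambda>r. - exp (- (a * r)) / a) \<longlongrightarrow> - 0 / a) at_top" using a by (intro tendsto_intros) auto
    then show "((\<lambda>r. - exp (- a * r) / a) \<longlongrightarrow> 0) at_top" by simp
  qed auto
  moreover have "(\<integral>\<^sup>+r. ennreal (norm (indicator {0..} r *\<^sub>R exp (- a * r))) \<partial>lborel)
      = (\<integral>\<^sup>+r. ennreal (exp (- a * r)) * indicator {0..} r \<partial>lborel)"
    by (intro nn_integral_cong) (simp add: indicator_def)
  ultimately have "(\<integral>\<^sup>+r. ennreal (norm (indicator {0..} r *\<^sub>R exp (- a * r))) \<partial>lborel) < \<infinity>"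
    by simp
  then show ?thesis by (subst integral_halfline) (auto intro: integrableI_bounded)
qed

lemma integrable_power_exp_halfline:
  assumes "a > 0" shows "integrable halfline (\<lambda>r. r ^ k * exp (- a * r))"
proof (rule Bochner_Integration.integrable_bound)
  show "integrable halfline (\<lambda>r. fact k * (2 / a) ^ k * exp (- (a/2) * r))"
    using integrable_exp_halfline[of "a/2"] assms by simp
  show "AE r in halfline. norm (r ^ k * exp (- a * r)) \<le> norm (fact k * (2 / a) ^ k * exp (- (a/2) * r))"
    unfolding AE_halfline using power_exp_bound[OF assms, of _ k] assms by (intro AE_I2) (auto simp: abs_mult power_abs)
qed auto

lemma laplace_power:
  assumes s: "Re s > 0"
  shows "integrable halfline (\<lambda>r. of_real r ^ k * exp (- s * of_real r))"
    and "(\<integral>r. of_real r ^ k * exp (- s * of_real r) \<partial>halfline) = fact k / s ^ Suc k"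
proof -
  have int: "integrable halfline (\<lambda>r. of_real r ^ k * exp (- s * of_real r))" for k
  proof (rule Bochner_Integration.integrable_bound[OF integrable_power_exp_halfline[OF s, of k]])
    show "AE r in halfline. norm (of_real r ^ k * exp (- s * of_real r)) \<le> norm (r ^ k * exp (- Re s * r))"
      by (intro AE_I2) (simp add: norm_mult norm_power abs_mult power_abs)
  qed measurable
  have lim: "((\<lambda>r. of_real r ^ k * exp (- s * of_real r)) \<longlongrightarrow> 0) at_top" for k
  proof (rule Lim_null_comparison)
    show "\<forall>\<^sub>F r in at_top. norm (of_real r ^ k * exp (- s * of_real r)) \<le> fact k * (2 / Re s) ^ k * exp (- (Re s/2) * r)"
      using eventually_ge_at_top[of "0::real"]
      by eventually_elim (use power_exp_bound[OF s, of _ k] in \<open>simp add: norm_mult norm_power\<close>)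
    have "((\<lambda>r. exp (- (Re s/2 * r))) \<longlongrightarrow> 0) at_top"
      using s by (intro tendsto_exp_neg_at_top) simp
    then have "((\<lambda>r. fact k * (2 / Re s) ^ k * exp (- (Re s/2 * r))) \<longlongrightarrow> fact k * (2 / Re s) ^ k * 0) at_top"
      by (intro tendsto_mult tendsto_const)
    then show "((\<lambda>r. fact k * (2 / Re s) ^ k * exp (- (Re s/2) * r)) \<longlongrightarrow> 0) at_top" by simp
  qed
  have s0: "s \<noteq> 0" using s by auto
  show "integrable halfline (\<lambda>r. of_real r ^ k * exp (- s * of_real r))" by (rule int)
  show "(\<integral>r. of_real r ^ k * exp (- s * of_real r) \<partial>halfline) = fact k / s ^ Suc k"
  proof (induction k)
    case 0
    have "(\<integral>r. - s * exp (- s * of_real r) \<partial>halfline) = 0 - exp (- s * of_real 0)"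
    proof (rule integral_halfline_derivative)
      show "((\<lambda>r. exp (- s * of_real r)) has_vector_derivative - s * exp (- s * of_real r)) (at r)" for r
        by (rule has_vector_derivative_real_field[where f = "\<lambda>z. exp (- s * z)"]) (auto intro!: derivative_eq_intros)
      show "((\<lambda>r. exp (- s * of_real r)) \<longlongrightarrow> 0) at_top" using lim[of 0] by simp
      show "integrable halfline (\<lambda>r. - s * exp (- s * of_real r))" using int[of 0] by simp
    qed (intro continuous_intros)
    then show ?case using s0 by (simp add: field_simps)
  next
    case (Suc k)
    have "(\<integral>r. of_nat (Suc k) * (of_real r ^ k * exp (- s * of_real r)) - s * (of_real r ^ Suc k * exp (- s * of_real r)) \<partial>halfline)
       = 0 - of_real 0 ^ Suc k * exp (- s * of_real 0)"
    proof (rule integral_halfline_derivative)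
      show "((\<lambda>r. of_real r ^ Suc k * exp (- s * of_real r)) has_vector_derivative
          of_nat (Suc k) * (of_real r ^ k * exp (- s * of_real r)) - s * (of_real r ^ Suc k * exp (- s * of_real r))) (at r)" for r
        by (rule has_vector_derivative_real_field[where f = "\<lambda>z. z ^ Suc k * exp (- s * z)"])
           (auto intro!: derivative_eq_intros simp: algebra_simps simp del: power_Suc)
      show "integrable halfline (\<lambda>r. of_nat (Suc k) * (of_real r ^ k * exp (- s * of_real r)) - s * (of_real r ^ Suc k * exp (- s * of_real r)))"
        by (intro Bochner_Integration.integrable_diff integrable_mult_right int)
    qed (intro continuous_intros lim)+
    then have "of_nat (Suc k) * (\<integral>r. of_real r ^ k * exp (- s * of_real r) \<partial>halfline)
        = s * (\<integral>r. of_real r ^ Suc k * exp (- s * of_real r) \<partial>halfline)"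
      using int[of k] int[of "Suc k"]
      by (subst (asm) Bochner_Integration.integral_diff) (auto simp del: power_Suc of_nat_Suc)
    then have "(\<integral>r. of_real r ^ Suc k * exp (- s * of_real r) \<partial>halfline)
        = of_nat (Suc k) * (fact k / s ^ Suc k) / s"
      unfolding Suc.IH by (simp only: s0 nonzero_mult_div_cancel_left not_False_eq_True)
    then show ?case by simp
  qed
qed

definition laguerre_fun :: "nat \<Rightarrow> real \<Rightarrow> real" where
  "laguerre_fun n r = poly (laguerre n) r * exp (- r / 2)"

lemma continuous_laguerre_fun: "continuous_on A (laguerre_fun n)"
  unfolding laguerre_fun_def by (intro continuous_intros) auto

lemma borel_laguerre_fun [measurable]: "laguerre_fun n \<in> borel_measurable borel"
  by (rule borel_measurable_continuous_onI[OF continuous_laguerre_fun])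

lemma laplace_poly:
  assumes s: "Re s > 0"
  shows "integrable halfline (\<lambda>r. of_real (poly p r) * exp (- s * of_real r))"
    and "(\<integral>r. of_real (poly p r) * exp (- s * of_real r) \<partial>halfline) = (\<Sum>k\<le>degree p. of_real (coeff p k) * fact k / s ^ Suc k)"
proof -
  have e: "(\<lambda>r. of_real (poly p r) * exp (- s * of_real r))
    = (\<lambda>r. \<Sum>k\<le>degree p. of_real (coeff p k) * (of_real r ^ k * exp (- s * of_real r)))"
    by (simp add: poly_altdef sum_distrib_right mult.assoc)
  show "integrable halfline (\<lambda>r. of_real (poly p r) * exp (- s * of_real r))"
    unfolding e by (intro Bochner_Integration.integrable_sum integrable_mult_right laplace_power s)
  show "(\<integral>r. of_real (poly p r) * exp (- s * of_real r) \<partial>halfline) = (\<Sum>k\<le>degree p. of_real (coeff p k) * fact k / s ^ Suc k)"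
    unfolding e using laplace_power[OF s] by (subst Bochner_Integration.integral_sum) (auto simp del: power_Suc)
qed

text \<open>The Laplace transform of \<open>L\<^sub>n\<close> is \<open>(s - 1)^n / s^(n + 1)\<close> by the binomial theorem. It is the
coefficient of a Gaussian \<open>exp(-b |x|\<^sup>2)\<close> with respect to the \<open>n\<close>-th Laguerre function.\<close>

lemma laplace_laguerre_fun:
  assumes "Re b > -1/2"
  shows "(\<integral>r. of_real (laguerre_fun n r) * exp (- b * of_real r) \<partial>halfline) = (b - 1/2) ^ n / (b + 1/2) ^ Suc n"
proof -
  define s where "s = b + 1/2"
  have s: "Re s > 0" "s \<noteq> 0" using assms by (auto simp: s_def complex_eq_iff)
  have "(\<integral>r. of_real (laguerre_fun n r) * exp (- b * of_real r) \<partial>halfline)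
     = (\<integral>r. of_real (poly (laguerre n) r) * exp (- s * of_real r) \<partial>halfline)"
    by (intro Bochner_Integration.integral_cong refl)
       (simp add: laguerre_fun_def s_def algebra_simps flip: exp_of_real exp_add)
  also have "\<dots> = (\<Sum>k\<le>degree (laguerre n). of_real (coeff (laguerre n) k) * fact k / s ^ Suc k)"
    by (rule laplace_poly(2)[OF s(1)])
  also have "\<dots> = (\<Sum>k\<le>n. of_real (coeff (laguerre n) k) * fact k / s ^ Suc k)"
    using degree_laguerre_le[of n] by (intro sum.mono_neutral_left) (auto simp: coeff_eq_0)
  also have "\<dots> = (\<Sum>k\<le>n. of_nat (n choose k) * (- 1 / s) ^ k * 1 ^ (n - k)) / s"
    unfolding sum_divide_distrib
    by (intro sum.cong refl) (simp add: coeff_laguerre power_divide power_minus' field_simps)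
  also have "\<dots> = (- 1 / s + 1) ^ n / s"
    by (simp only: binomial_ring)
  also have "- 1 / s + 1 = (s - 1) / s" using s(2) by (simp add: field_simps)
  also have "s - 1 = b - 1/2" by (simp add: s_def)
  finally show ?thesis using s by (simp add: power_divide s_def)
qed

lemma integrable_laguerre_fun_mult: "integrable halfline (\<lambda>r. laguerre_fun n r * laguerre_fun m r)"
  and laguerre_fun_orthonormal:
    "(\<integral>r. laguerre_fun n r * laguerre_fun m r \<partial>halfline) = (if n = m then 1 else 0)"
proof -
  define p where "p = laguerre n * laguerre m"
  have e: "of_real (laguerre_fun n r * laguerre_fun m r) = (of_real (poly p r) * exp (- 1 * of_real r) :: complex)" for r
  proof -
    have "exp (- r / 2) * exp (- r / 2) = exp (- r)" by (simp flip: exp_add)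
    then have "laguerre_fun n r * laguerre_fun m r = poly p r * exp (- r)"
      by (simp add: laguerre_fun_def p_def mult_ac)
    then show ?thesis by (simp flip: exp_of_real)
  qed
  have "integrable halfline (\<lambda>r. of_real (laguerre_fun n r * laguerre_fun m r) :: complex)"
    unfolding e by (rule laplace_poly) simp
  then show "integrable halfline (\<lambda>r. laguerre_fun n r * laguerre_fun m r)"
    by (simp only: complex_of_real_integrable_eq)
  have "of_real (\<integral>r. laguerre_fun n r * laguerre_fun m r \<partial>halfline)
      = (\<integral>r. of_real (laguerre_fun n r * laguerre_fun m r) \<partial>halfline :: complex)"
    by (simp only: integral_complex_of_real)
  also have "\<dots> = (\<Sum>k\<le>degree p. of_real (coeff p k) * fact k / 1 ^ Suc k)"
    unfolding e by (rule laplace_poly) simp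
  also have "\<dots> = of_real (\<Sum>k\<le>degree p. coeff p k * fact k)" by simp
  finally have "(\<integral>r. laguerre_fun n r * laguerre_fun m r \<partial>halfline) = (\<Sum>k\<le>degree p. coeff p k * fact k)"
    by (simp only: of_real_eq_iff)
  also have "\<dots> = (\<Sum>k\<le>n+m. coeff p k * fact k)"
    using degree_mult_le[of "laguerre n" "laguerre m"] degree_laguerre_le[of n] degree_laguerre_le[of m]
    by (intro sum.mono_neutral_left) (auto simp: p_def coeff_eq_0)
  also have "\<dots> = (\<Sum>k\<le>n+m. \<Sum>i\<le>k. coeff (laguerre n) i * coeff (laguerre m) (k - i) * fact (i + (k - i)))"
    by (simp add: p_def coeff_mult sum_distrib_right)
  also have "\<dots> = (\<Sum>(i,j)\<in>{(i,j). i + j \<le> n + m}. coeff (laguerre n) i * coeff (laguerre m) j * fact (i + j))"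
    by (subst sum.triangle_reindex_eq[symmetric]) simp
  also have "\<dots> = (\<Sum>(i,j)\<in>{..n}\<times>{..m}. coeff (laguerre n) i * coeff (laguerre m) j * fact (i + j))"
  proof (rule sum.mono_neutral_right)
    show "finite {(i, j). i + j \<le> n + m}"
      by (rule finite_subset[of _ "{..n+m} \<times> {..n+m}"]) auto
  qed (auto simp: coeff_laguerre)
  also have "\<dots> = (if n = m then 1 else 0)"
    using laguerre_orthogonality_sum[of n m] by (simp add: sum.cartesian_product)
  finally show "(\<integral>r. laguerre_fun n r * laguerre_fun m r \<partial>halfline) = (if n = m then 1 else 0)" .
qed

lemma laguerre_fun_L2: "in_Lp 2 halfline (\<lambda>r. of_real (laguerre_fun n r))"
  unfolding in_Lp_2_iff using integrable_laguerre_fun_mult[of n n] by (simp add: power2_eq_square)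

section \<open>Test functions and Green's identity\<close>

lemma partial_deriv_eq: "(\<psi> has_derivative D) (at x) \<Longrightarrow> partial_deriv i \<psi> x = D (axis i 1)"
  unfolding partial_deriv_def using frechet_derivative_at by metis

lemma differentiable_has_frechet:
  "\<psi> differentiable_on UNIV \<Longrightarrow> (\<psi> has_derivative frechet_derivative \<psi> (at x)) (at x)"
  by (simp add: differentiable_on_def frechet_derivative_works[symmetric])

lemma C_k_2_iff:
  "C_k 2 \<psi> \<longleftrightarrow> \<psi> differentiable_on UNIV \<and> (\<forall>i. partial_deriv i \<psi> differentiable_on UNIV)
    \<and> (\<forall>i j. continuous_on UNIV (partial_deriv j (partial_deriv i \<psi>)))"
  by (auto simp: numeral_2_eq_2)

lemma partial_deriv_mult:
  assumes "a differentiable_on UNIV" "b differentiable_on UNIV"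
  shows "partial_deriv i (\<lambda>x. a x * b x) x = a x * partial_deriv i b x + partial_deriv i a x * b x"
  unfolding partial_deriv_def[of i a] partial_deriv_def[of i b]
  by (rule partial_deriv_eq[OF has_derivative_mult]) (intro differentiable_has_frechet assms)+

lemma partial_deriv_diff:
  assumes "a differentiable_on UNIV" "b differentiable_on UNIV"
  shows "partial_deriv i (\<lambda>x. a x - b x) x = partial_deriv i a x - partial_deriv i b x"
  unfolding partial_deriv_def[of i a] partial_deriv_def[of i b]
  by (rule partial_deriv_eq[OF has_derivative_diff]) (intro differentiable_has_frechet assms)+

lemma has_vector_derivative_along_axis:
  assumes "\<psi> differentiable_on UNIV"
  shows "((\<lambda>h. \<psi> (x + h *\<^sub>R axis i 1)) has_vector_derivative partial_deriv i \<psi> (x + s *\<^sub>R axis i 1)) (at s)"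
proof -
  have l: "((\<lambda>h::real. x + h *\<^sub>R axis i (1::real)) has_derivative (\<lambda>h. h *\<^sub>R axis i 1)) (at s)"
    by (auto intro!: derivative_eq_intros)
  have d: "(\<psi> has_derivative frechet_derivative \<psi> (at (x + s *\<^sub>R axis i 1))) (at (x + s *\<^sub>R axis i 1))"
    using assms by (rule differentiable_has_frechet)
  show ?thesis
    unfolding has_vector_derivative_def partial_deriv_def
    using has_derivative_compose[OF l d] linear_scale[OF has_derivative_linear[OF d]] by simp
qed

lemma partial_deriv_zero_outside:
  assumes "\<And>x. norm x > R \<Longrightarrow> \<psi> x = 0" "norm x > R"
  shows "partial_deriv i \<psi> x = 0"
proof -
  have "(\<psi> has_derivative (\<lambda>_. 0)) (at x)"
  proof (rule has_derivative_transform_within_open[where f = "\<lambda>_. 0" and s = "- cball 0 R"])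
    show "0 = \<psi> y" if "y \<in> - cball 0 R" for y using that assms(1)[of y] by simp
  qed (use assms(2) in auto)
  then show ?thesis by (rule partial_deriv_eq)
qed

lemma continuous_compact_support_bounded:
  fixes f :: "'a::euclidean_space \<Rightarrow> complex"
  assumes "continuous_on UNIV f" "\<And>x. norm x > R \<Longrightarrow> f x = 0"
  obtains B where "B \<ge> 0" "\<And>x. norm (f x) \<le> B * indicator (cball 0 R) x"
proof -
  have "bounded (f ` cball 0 R)"
    by (intro compact_imp_bounded compact_continuous_image continuous_on_subset[OF assms(1)]) auto
  then obtain B where B: "\<And>x. x \<in> cball 0 R \<Longrightarrow> norm (f x) \<le> B" unfolding bounded_iff by blast
  have "norm (f x) \<le> max 0 B * indicator (cball 0 R) x" for x
    using B[of x] assms(2)[of x] by (auto simp: indicator_def)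
  then show ?thesis using that[of "max 0 B"] by auto
qed

lemma integrable_indicator_cball:
  "integrable lborel (\<lambda>x. B * indicator (cball c R) x :: real)" for c :: "'a::euclidean_space"
  by (intro integrable_mult_right integrable_real_indicator) (use emeasure_bounded_finite[OF bounded_cball, of c R] in auto)

lemma continuous_compact_support_L:
  fixes f :: "'a::euclidean_space \<Rightarrow> complex"
  assumes "continuous_on UNIV f" "\<And>x. norm x > R \<Longrightarrow> f x = 0"
  shows "integrable lborel f" "in_Lp 2 lborel f"
proof -
  obtain B where B: "B \<ge> 0" "\<And>x. norm (f x) \<le> B * indicator (cball 0 R) x"
    using continuous_compact_support_bounded[OF assms] by blast
  have [measurable]: "f \<in> borel_measurable borel" using assms(1) by (rule borel_measurable_continuous_onI)
  show "integrable lborel f"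
    by (rule Bochner_Integration.integrable_bound[OF integrable_indicator_cball[of B 0 R]]) (use B in auto)
  show "in_Lp 2 lborel f" unfolding in_Lp_2_iff
  proof
    show "integrable lborel (\<lambda>x. (norm (f x))\<^sup>2)"
    proof (rule Bochner_Integration.integrable_bound[OF integrable_indicator_cball[of "B\<^sup>2" 0 R]])
      have "(norm (f x))\<^sup>2 \<le> B\<^sup>2 * indicator (cball 0 R) x" for x
        using power_mono[OF B(2)[of x], of 2] by (auto simp: indicator_def power_mult_distrib split: if_splits)
      then show "AE x in lborel. norm ((norm (f x))\<^sup>2) \<le> norm (B\<^sup>2 * indicator (cball 0 R) x :: real)"
        by (intro AE_I2) simp
    qed measurable
  qed measurable
qed

text \<open>By translation invariance \<open>\<integral> F(x + s e) dx\<close> is independent of \<open>s\<close>; its derivative at \<open>s = 0\<close> is the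
integral in question.\<close>

lemma integral_partial_deriv_zero:
  assumes d: "F differentiable_on UNIV" and c: "continuous_on UNIV (partial_deriv i F)"
    and z: "\<And>x. norm x > R \<Longrightarrow> F x = 0"
  shows "(\<integral>x. partial_deriv i F x \<partial>lborel) = 0"
proof -
  have z': "partial_deriv i F x = 0" if "norm x > R" for x
    using partial_deriv_zero_outside[of R F x i] z that by blast
  obtain B where B: "B \<ge> 0" "\<And>x. norm (partial_deriv i F x) \<le> B * indicator (cball 0 R) x"
    using continuous_compact_support_bounded[OF c z'] by blast
  let ?e = "axis i (1::real) :: real^2"
  have ne: "norm ?e = 1" by (simp add: norm_axis_1)
  have Fc: "continuous_on UNIV F" using d by (rule differentiable_imp_continuous_on)
  have [measurable]: "F \<in> borel_measurable borel" using Fc by (rule borel_measurable_continuous_onI)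
  have Fi: "integrable lborel F" by (rule continuous_compact_support_L(1)[OF Fc z])
  have sh: "(\<integral>x. F (x + s *\<^sub>R ?e) \<partial>lborel) = (\<integral>x. F x \<partial>lborel)" "integrable lborel (\<lambda>x. F (x + s *\<^sub>R ?e))" for s
  proof -
    have "(\<integral>x. F x \<partial>lborel) = (\<integral>x. F x \<partial>distr lborel borel (\<lambda>x. s *\<^sub>R ?e + x))" by (simp add: lborel_distr_plus)
    also have "\<dots> = (\<integral>x. F (x + s *\<^sub>R ?e) \<partial>lborel)" by (subst integral_distr) (auto simp: add.commute)
    finally show "(\<integral>x. F (x + s *\<^sub>R ?e) \<partial>lborel) = (\<integral>x. F x \<partial>lborel)" by simp
    have "integrable (distr lborel borel (\<lambda>x. s *\<^sub>R ?e + x)) F" using Fi by (simp add: lborel_distr_plus)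
    then show "integrable lborel (\<lambda>x. F (x + s *\<^sub>R ?e))"
      by (subst (asm) integrable_distr_eq) (auto simp: add.commute)
  qed
  have "((\<lambda>s. \<integral>x. F (x + s *\<^sub>R ?e) \<partial>lborel) has_vector_derivative (\<integral>x. partial_deriv i F (x + 0 *\<^sub>R ?e) \<partial>lborel)) (at 0)"
  proof (rule integral_has_vector_derivative_dominated[where e = 1 and G = "\<lambda>x. B * indicator (cball 0 (R + 1)) x"])
    show "((\<lambda>s. F (x + s *\<^sub>R ?e)) has_vector_derivative partial_deriv i F (x + s *\<^sub>R ?e)) (at s)" for s x
      by (rule has_vector_derivative_along_axis[OF d])
    show "norm (partial_deriv i F (x + s *\<^sub>R ?e)) \<le> B * indicator (cball 0 (R + 1)) x" if "\<bar>s - 0\<bar> < 1" for s x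
    proof -
      have "norm x \<le> norm (x + s *\<^sub>R ?e) + norm (s *\<^sub>R ?e)" using norm_triangle_ineq4[of "x + s *\<^sub>R ?e" "s *\<^sub>R ?e"] by simp
      then have "norm x \<le> norm (x + s *\<^sub>R ?e) + 1" using that ne by simp
      then have "indicator (cball 0 R) (x + s *\<^sub>R ?e) \<le> (indicator (cball 0 (R + 1)) x :: real)"
        by (auto simp: indicator_def)
      then show ?thesis using B(2)[of "x + s *\<^sub>R ?e"] mult_left_mono[OF _ B(1)] by (meson order.trans)
    qed
  qed (use sh(2) integrable_indicator_cball in auto)
  then have "((\<lambda>s. \<integral>x. F x \<partial>lborel) has_vector_derivative (\<integral>x. partial_deriv i F x \<partial>lborel)) (at (0::real))"
    by (simp add: sh(1))
  then show ?thesis using vector_derivative_unique_at has_vector_derivative_const by metis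
qed

lemma test_function_support:
  assumes "test_function \<psi>"
  obtains R where "\<And>x. norm x > R \<Longrightarrow> \<psi> x = 0"
proof -
  have "bounded (closure {x. \<psi> x \<noteq> 0})" using assms by (simp add: test_function_def compact_imp_bounded)
  then have "bounded {x. \<psi> x \<noteq> 0}" using closure_subset by (rule bounded_subset)
  then obtain R where "\<And>x. \<psi> x \<noteq> 0 \<Longrightarrow> norm x \<le> R" unfolding bounded_iff by auto
  then show ?thesis using that[of R] by (meson not_le)
qed

lemma test_functionI:
  assumes "C_k 2 \<psi>" "\<And>x. norm x > R \<Longrightarrow> \<psi> x = 0"
  shows "test_function \<psi>"
proof -
  have "bounded {x. \<psi> x \<noteq> 0}" unfolding bounded_iff using assms(2) by (meson mem_Collect_eq not_le)
  then show ?thesis using assms(1) by (simp add: test_function_def compact_closure)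
qed

lemma C_k_2_continuous:
  assumes "C_k 2 \<psi>"
  shows "continuous_on UNIV \<psi>" "continuous_on UNIV (partial_deriv i \<psi>)" "continuous_on UNIV (laplacian \<psi>)"
  using assms unfolding C_k_2_iff laplacian_def
  by (blast intro: differentiable_imp_continuous_on, blast intro: differentiable_imp_continuous_on, intro continuous_on_sum, blast)

lemma laplacian_zero_outside:
  assumes "\<And>x. norm x > R \<Longrightarrow> \<psi> x = 0" "norm x > R"
  shows "laplacian \<psi> x = 0"
proof -
  have "partial_deriv i \<psi> x = 0" if "norm x > R" for i x
    using partial_deriv_zero_outside[of R \<psi> x i] assms(1) that by blast
  then have "partial_deriv i (partial_deriv i \<psi>) x = 0" for i
    using partial_deriv_zero_outside[of R "partial_deriv i \<psi>" x i] assms(2) by blast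
  then show ?thesis by (simp add: laplacian_def)
qed

lemma test_function_L2:
  assumes "test_function \<psi>"
  shows "in_Lp 2 lborel \<psi>" "in_Lp 2 lborel (laplacian \<psi>)"
proof -
  obtain R where R: "\<And>x. norm x > R \<Longrightarrow> \<psi> x = 0" using test_function_support[OF assms] by blast
  have "C_k 2 \<psi>" using assms by (simp add: test_function_def)
  then have c: "continuous_on UNIV \<psi>" "continuous_on UNIV (laplacian \<psi>)"
    by (rule C_k_2_continuous)+
  have z: "laplacian \<psi> x = 0" if "norm x > R" for x
    using laplacian_zero_outside[of R \<psi> x] R that by blast
  show "in_Lp 2 lborel \<psi>" by (rule continuous_compact_support_L(2)[OF c(1) R])
  show "in_Lp 2 lborel (laplacian \<psi>)" by (rule continuous_compact_support_L(2)[OF c(2) z])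
qed

text \<open>The field \<open>\<psi> \<nabla>\<phi> - \<phi> \<nabla>\<psi>\<close> has compact support and divergence \<open>\<psi> \<Delta>\<phi> - \<phi> \<Delta>\<psi>\<close>.\<close>

lemma green_identity:
  assumes p: "C_k 2 \<phi>" and t: "test_function \<psi>"
  shows "(\<integral>x. laplacian \<phi> x * \<psi> x \<partial>lborel) = (\<integral>x. \<phi> x * laplacian \<psi> x \<partial>lborel)"
proof -
  obtain R where R: "\<And>x. norm x > R \<Longrightarrow> \<psi> x = 0" using test_function_support[OF t] by blast
  have q: "C_k 2 \<psi>" using t by (simp add: test_function_def)
  define F where "F i x = \<psi> x * partial_deriv i \<phi> x - \<phi> x * partial_deriv i \<psi> x" for i x
  have d: "\<phi> differentiable_on UNIV" "\<psi> differentiable_on UNIV"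
    "partial_deriv i \<phi> differentiable_on UNIV" "partial_deriv i \<psi> differentiable_on UNIV" for i
    using p q by (auto simp: C_k_2_iff)
  have dd: "(\<lambda>x. \<psi> x * partial_deriv i \<phi> x) differentiable_on UNIV" "(\<lambda>x. \<phi> x * partial_deriv i \<psi> x) differentiable_on UNIV" for i
    using d by (auto intro!: differentiable_on_mult)
  have Fd: "F i differentiable_on UNIV" for i
    unfolding F_def using dd by (intro differentiable_on_diff)
  have pF: "partial_deriv i (F i) x
      = \<psi> x * partial_deriv i (partial_deriv i \<phi>) x - \<phi> x * partial_deriv i (partial_deriv i \<psi>) x" for i x
    unfolding F_def partial_deriv_diff[OF dd] partial_deriv_mult[OF d(2) d(3)] partial_deriv_mult[OF d(1) d(4)]
    by (simp add: algebra_simps)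
  have cont: "continuous_on UNIV (partial_deriv i (F i))" for i
    unfolding pF[abs_def] using p q
    by (intro continuous_intros) (auto simp: C_k_2_iff intro: differentiable_imp_continuous_on)
  have F0: "F i x = 0" if "norm x > R" for i x
    using R[OF that] partial_deriv_zero_outside[of R \<psi> x i] R that by (simp add: F_def)
  have F1: "partial_deriv i (F i) x = 0" if "norm x > R" for i x
    using partial_deriv_zero_outside[of R "F i" x i] F0 that by blast
  have L0: "laplacian \<psi> x = 0" if "norm x > R" for x
    using laplacian_zero_outside[of R \<psi> x] R that by blast
  have "(\<integral>x. (\<Sum>i\<in>UNIV. partial_deriv i (F i) x) \<partial>lborel) = (\<Sum>i\<in>UNIV. (\<integral>x. partial_deriv i (F i) x \<partial>lborel))"
    by (intro Bochner_Integration.integral_sum continuous_compact_support_L(1)[OF cont F1])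
  also have "\<dots> = 0" using integral_partial_deriv_zero[OF Fd cont F0] by simp
  finally have 0: "(\<integral>x. \<psi> x * laplacian \<phi> x - \<phi> x * laplacian \<psi> x \<partial>lborel) = 0"
    by (simp add: pF sum_subtractf laplacian_def sum_distrib_left)
  have "integrable lborel (\<lambda>x. \<psi> x * laplacian \<phi> x)" "integrable lborel (\<lambda>x. \<phi> x * laplacian \<psi> x)"
    by (rule continuous_compact_support_L(1)[of _ R];
        use R L0 in \<open>auto intro!: continuous_on_mult C_k_2_continuous(1)[OF p] C_k_2_continuous(1)[OF q]
          C_k_2_continuous(3)[OF p] C_k_2_continuous(3)[OF q]\<close>)+
  with 0 show ?thesis by (simp add: mult.commute)
qed

lemma norm_sq_has_derivative:
  "((\<lambda>x. (norm (x - y))\<^sup>2) has_derivative (\<lambda>v. 2 * ((x - y) \<bullet> v))) (at x)"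
  for x y :: "'a::real_inner"
  unfolding power2_norm_eq_inner
  by (auto intro!: derivative_eq_intros simp: inner_commute)

text \<open>In the variable \<open>r = |x - y|\<^sup>2\<close> the Laplacian of the plane is \<open>4 (r d\<^sup>2/dr\<^sup>2 + d/dr)\<close>.\<close>

lemma radial_C2:
  fixes k :: "real \<Rightarrow> complex" and y :: "real^2"
  assumes k: "\<And>r. (k has_vector_derivative k1 r) (at r)" and k1: "\<And>r. (k1 has_vector_derivative k2 r) (at r)"
    and k2: "continuous_on UNIV k2"
  shows "C_k 2 (\<lambda>x. k ((norm (x - y))\<^sup>2))"
    and "laplacian (\<lambda>x. k ((norm (x - y))\<^sup>2)) x
      = 4 * (of_real ((norm (x - y))\<^sup>2) * k2 ((norm (x - y))\<^sup>2) + k1 ((norm (x - y))\<^sup>2))"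
proof -
  define Q where "Q x = (norm (x - y))\<^sup>2" for x
  have dQ: "(Q has_derivative (\<lambda>v. 2 * ((x - y) \<bullet> v))) (at x)" for x
    unfolding Q_def by (rule norm_sq_has_derivative)
  have comp: "((\<lambda>x. j (Q x)) has_derivative (\<lambda>v. of_real (2 * ((x - y) \<bullet> v)) * j1 (Q x))) (at x)"
    if "\<And>r. (j has_vector_derivative j1 r) (at r)" for j j1 :: "real \<Rightarrow> complex" and x
    using has_derivative_compose[OF dQ[of x] that[of "Q x", unfolded has_vector_derivative_def]]
    by (simp add: scaleR_conv_of_real)
  have ax: "(x - y) \<bullet> axis i 1 = (x - y) $ i" for i x by (simp add: inner_axis)
  have p1: "partial_deriv i (\<lambda>x. k (Q x)) = (\<lambda>x. of_real (2 * (x - y) $ i) * k1 (Q x))" for i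
    using partial_deriv_eq[OF comp[OF k]] by (simp add: fun_eq_iff ax)
  have lin: "((\<lambda>x. complex_of_real (2 * (x - y) $ i)) has_derivative (\<lambda>v. of_real (2 * v $ i))) (at x)" for i x
    by (auto intro!: derivative_eq_intros bounded_linear.has_derivative[OF bounded_linear_vec_nth])
  have d2: "((\<lambda>x. of_real (2 * (x - y) $ i) * k1 (Q x)) has_derivative
      (\<lambda>v. of_real (2 * (x - y) $ i) * (of_real (2 * ((x - y) \<bullet> v)) * k2 (Q x)) + of_real (2 * v $ i) * k1 (Q x))) (at x)" for i x
    by (rule has_derivative_mult[OF lin comp[OF k1]])
  have p2: "partial_deriv j (partial_deriv i (\<lambda>x. k (Q x))) = (\<lambda>x. of_real (2 * (x - y) $ i) * (of_real (2 * (x - y) $ j) * k2 (Q x))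
      + of_real (if i = j then 2 else 0) * k1 (Q x))" for i j
  proof (rule ext)
    fix x
    have "axis j (1::real) $ i = (if i = j then 1 else 0)" by (simp add: axis_def)
    then show "partial_deriv j (partial_deriv i (\<lambda>x. k (Q x))) x = of_real (2 * (x - y) $ i) * (of_real (2 * (x - y) $ j) * k2 (Q x))
      + of_real (if i = j then 2 else 0) * k1 (Q x)"
      unfolding p1 partial_deriv_eq[OF d2] by (simp add: ax)
  qed
  have Qc: "continuous_on UNIV Q" unfolding Q_def by (intro continuous_intros)
  have k1c: "continuous_on UNIV k1"
    using k1 by (meson continuous_at_imp_continuous_on has_vector_derivative_continuous)
  have cc: "continuous_on UNIV (\<lambda>x. k1 (Q x))" "continuous_on UNIV (\<lambda>x. k2 (Q x))"
    by (auto intro!: continuous_on_compose2[OF k1c Qc] continuous_on_compose2[OF k2 Qc])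
  show "C_k 2 (\<lambda>x. k ((norm (x - y))\<^sup>2))"
    unfolding C_k_2_iff Q_def[symmetric]
  proof (intro conjI allI)
    show "(\<lambda>x. k (Q x)) differentiable_on UNIV"
      using comp[OF k] by (auto simp: differentiable_on_def differentiable_def)
    show "partial_deriv i (\<lambda>x. k (Q x)) differentiable_on UNIV" for i
      unfolding p1 using d2 by (auto simp: differentiable_on_def differentiable_def)
    show "continuous_on UNIV (partial_deriv j (partial_deriv i (\<lambda>x. k (Q x))))" for i j
      unfolding p2 by (intro continuous_intros cc)
  qed
  have n2: "(norm (x - y))\<^sup>2 = ((x - y) $ 1)\<^sup>2 + ((x - y) $ 2)\<^sup>2"
    unfolding power2_norm_eq_inner inner_vec_def sum_2 by (simp add: power2_eq_square)
  have s2: "(\<Sum>i\<in>UNIV. h i) = h 1 + h (2::2)" for h :: "2 \<Rightarrow> complex" by (rule sum_2)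
  show "laplacian (\<lambda>x. k ((norm (x - y))\<^sup>2)) x
      = 4 * (of_real ((norm (x - y))\<^sup>2) * k2 ((norm (x - y))\<^sup>2) + k1 ((norm (x - y))\<^sup>2))"
  proof -
    have "Q x = (x $ 1 - y $ 1) * (x $ 1 - y $ 1) + (x $ 2 - y $ 2) * (x $ 2 - y $ 2)"
      using n2 by (simp add: Q_def power2_eq_square)
    then have nQ: "complex_of_real (Q x) = of_real (x $ 1 - y $ 1) * of_real (x $ 1 - y $ 1)
        + of_real (x $ 2 - y $ 2) * of_real (x $ 2 - y $ 2)" by (simp only: of_real_add of_real_mult)
    show ?thesis
      unfolding laplacian_def Q_def[symmetric] p2 s2 nQ by (simp add: algebra_simps)
  qed
qed

text \<open>Differentiate under the integral and integrate by parts: a classical radial solution of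
\<open>g\<^sub>t = 4 \<i> (r g\<^sub>r\<^sub>r + g\<^sub>r)\<close> solves the Schroedinger equation weakly.\<close>

lemma radial_classical_weak_solution:
  fixes g :: "real \<Rightarrow> real \<Rightarrow> complex" and y :: "real^2"
  assumes g1: "\<And>t r. ((\<lambda>r. g t r) has_vector_derivative g1 t r) (at r)"
    and g2: "\<And>t r. ((\<lambda>r. g1 t r) has_vector_derivative g2 t r) (at r)"
    and c2: "\<And>t. continuous_on UNIV (g2 t)"
    and gt: "\<And>t r. ((\<lambda>t. g t r) has_vector_derivative \<i> * (4 * (of_real r * g2 t r + g1 t r))) (at t)"
    and c: "continuous_on UNIV (\<lambda>(t, r). of_real r * g2 t r + g1 t r)"
    and t: "test_function \<psi>"
  shows "((\<lambda>s. \<integral>x. g s ((norm (x - y))\<^sup>2) * \<psi> x \<partial>lborel) has_vector_derivative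
      \<i> * (\<integral>x. g t ((norm (x - y))\<^sup>2) * laplacian \<psi> x \<partial>lborel)) (at t)"
proof -
  obtain R where R: "\<And>x. norm x > R \<Longrightarrow> \<psi> x = 0" using test_function_support[OF t] by blast
  have q: "C_k 2 \<psi>" using t by (simp add: test_function_def)
  obtain B where B: "B \<ge> 0" "\<And>x. norm (\<psi> x) \<le> B * indicator (cball 0 R) x"
    using continuous_compact_support_bounded[OF C_k_2_continuous(1)[OF q] R] by blast
  define h where "h t r = of_real r * g2 t r + g1 t r" for t r
  define P where "P = (R + norm y)\<^sup>2"
  have "bounded ((\<lambda>(t, r). h t r) ` ({t-1..t+1} \<times> {0..P}))"
    unfolding h_def
    by (intro compact_imp_bounded compact_continuous_image continuous_on_subset[OF c] compact_Times) auto
  then obtain C where C: "\<And>s r. s \<in> {t-1..t+1} \<Longrightarrow> r \<in> {0..P} \<Longrightarrow> norm (h s r) \<le> C"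
    unfolding bounded_iff by fastforce
  have gC: "C_k 2 (\<lambda>x. g s ((norm (x - y))\<^sup>2))" for s by (rule radial_C2(1)[OF g1 g2 c2])
  have "((\<lambda>s. \<integral>x. g s ((norm (x - y))\<^sup>2) * \<psi> x \<partial>lborel) has_vector_derivative
      (\<integral>x. \<i> * (4 * h t ((norm (x - y))\<^sup>2)) * \<psi> x \<partial>lborel)) (at t)"
  proof (rule integral_has_vector_derivative_dominated[where e = 1 and G = "\<lambda>x. 4 * \<bar>C\<bar> * B * indicator (cball 0 R) x"])
    show "integrable lborel (\<lambda>x. g s ((norm (x - y))\<^sup>2) * \<psi> x)" for s
      by (rule continuous_compact_support_L(1)[of _ R])
         (use R in \<open>auto intro!: continuous_on_mult C_k_2_continuous(1)[OF gC] C_k_2_continuous(1)[OF q]\<close>)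
    show "((\<lambda>s. g s ((norm (x - y))\<^sup>2) * \<psi> x) has_vector_derivative \<i> * (4 * h s ((norm (x - y))\<^sup>2)) * \<psi> x) (at s)" for s x
      using has_vector_derivative_mult_left[OF gt[of "(norm (x - y))\<^sup>2" s]] by (simp add: h_def)
    show "norm (\<i> * (4 * h s ((norm (x - y))\<^sup>2)) * \<psi> x) \<le> 4 * \<bar>C\<bar> * B * indicator (cball 0 R) x" if s: "\<bar>s - t\<bar> < 1" for s x
    proof (cases "norm x \<le> R")
      case True
      have "norm (x - y) \<le> R + norm y" using True norm_triangle_ineq4[of x y] by linarith
      then have "(norm (x - y))\<^sup>2 \<in> {0..P}" unfolding P_def by (auto intro: power_mono)
      then have "norm (h s ((norm (x - y))\<^sup>2)) \<le> \<bar>C\<bar>" using C[of s "(norm (x - y))\<^sup>2"] s by (fastforce simp: abs_if)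
      then have "norm (h s ((norm (x - y))\<^sup>2)) * norm (\<psi> x) \<le> \<bar>C\<bar> * (B * indicator (cball 0 R) x)"
        using B(2)[of x] by (intro mult_mono) auto
      then show ?thesis by (simp add: norm_mult)
    next
      case False
      then show ?thesis using R[of x] by simp
    qed
  qed (use integrable_indicator_cball in auto)
  also have "(\<integral>x. \<i> * (4 * h t ((norm (x - y))\<^sup>2)) * \<psi> x \<partial>lborel)
     = \<i> * (\<integral>x. laplacian (\<lambda>x. g t ((norm (x - y))\<^sup>2)) x * \<psi> x \<partial>lborel)"
    unfolding radial_C2(2)[OF g1 g2 c2] h_def by (simp add: mult.assoc)
  also have "\<dots> = \<i> * (\<integral>x. g t ((norm (x - y))\<^sup>2) * laplacian \<psi> x \<partial>lborel)"
    by (subst green_identity[OF gC t]) simp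
  finally show ?thesis .
qed

section \<open>Completeness of the Laguerre functions\<close>

text \<open>Test with continuous approximations of the bounded function \<open>cnj h / (1 + |h|)\<close> times a
continuous bump: in the limit a nonnegative function that vanishes only where \<open>h\<close> does has integral 0.\<close>

lemma AE_zero_of_continuous_tests:
  fixes h :: "'a::euclidean_space \<Rightarrow> complex"
  assumes [measurable]: "h \<in> borel_measurable borel"
    and loc: "\<And>R. integrable lborel (\<lambda>x. indicator (cball 0 R) x *\<^sub>R h x)"
    and test: "\<And>\<phi> R. continuous_on UNIV \<phi> \<Longrightarrow> (\<And>x. norm x \<ge> R \<Longrightarrow> \<phi> x = 0) \<Longrightarrow>
        (\<integral>x. h x * \<phi> x \<partial>lborel) = 0"
  shows "AE x in lborel. h x = 0"
proof -
  define u where "u x = cnj (h x) / of_real (1 + norm (h x))" for x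
  have [measurable]: "u \<in> borel_measurable borel"
    unfolding u_def by (intro borel_measurable_divide) (auto intro!: borel_measurable_continuous_on[of cnj] continuous_intros)
  have nu: "norm (u x) < 1" for x
    by (simp add: u_def norm_divide abs_of_nonneg add_nonneg_nonneg divide_less_eq)
       (smt (verit) norm_ge_zero norm_of_real of_real_1 of_real_add)
  have "u \<in> borel_measurable lebesgue" by (simp add: measurable_completion)
  then have "u measurable_on UNIV"
    by (rule lebesgue_measurable_imp_measurable_on) simp
  then obtain N g where N: "negligible N" and g: "\<And>n. continuous_on UNIV (g n)"
    and lim: "\<And>x. x \<notin> N \<Longrightarrow> (\<lambda>n. g n x) \<longlonglongrightarrow> u x"
    unfolding measurable_on_def by auto
  have aeN: "AE x in lborel. x \<notin> N"
  proof -
    have "AE x in lebesgue. x \<notin> N" using N by (simp add: negligible_iff_null_sets AE_not_in)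
    then show ?thesis by (simp add: AE_completion_iff)
  qed
  (* Radial projection to the unit disc gives a bounded sequence without changing the limit u. *)
  define c where "c n x = g n x / of_real (max 1 (norm (g n x)))" for n x
  have cc: "continuous_on UNIV (c n)" for n
    unfolding c_def by (intro continuous_intros g) auto
  have cn: "norm (c n x) \<le> 1" for n x by (simp add: c_def norm_divide divide_le_eq max_def)
  have clim: "(\<lambda>n. c n x) \<longlonglongrightarrow> u x" if "x \<notin> N" for x
  proof -
    have "(\<lambda>n. c n x) \<longlonglongrightarrow> u x / of_real (max 1 (norm (u x)))"
      unfolding c_def by (intro tendsto_intros lim that) auto
    then show ?thesis using nu[of x] by (simp add: max_def)
  qed
  have main: "AE x in lborel. norm x < R \<longrightarrow> h x = 0" if R: "R > 0" for R :: real
  proof -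
    define k where "k x = max 0 (1 - norm x / R)" for x :: 'a
    have kc: "continuous_on UNIV k" unfolding k_def by (intro continuous_intros) (use R in auto)
    have [measurable]: "k \<in> borel_measurable borel" using kc by (rule borel_measurable_continuous_onI)
    have k01: "0 \<le> k x" "k x \<le> 1" for x unfolding k_def using R by auto
    have kz: "k x = 0" if "norm x \<ge> R" for x unfolding k_def using R that by simp
    have zero: "(\<integral>x. h x * (c n x * of_real (k x)) \<partial>lborel) = 0" for n
      by (rule test[where R = R]) (auto intro!: continuous_intros cc kc simp: kz)
    have dom: "norm (h x * (z * of_real (k x))) \<le> norm (indicator (cball 0 R) x *\<^sub>R h x)" if "norm z \<le> 1" for x z
    proof (cases "norm x \<le> R")
      case True
      have "norm (h x * (z * of_real (k x))) = norm (h x) * (norm z * k x)"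
        using k01[of x] by (simp add: norm_mult)
      also have "\<dots> \<le> norm (h x) * (1 * 1)" using that k01[of x] by (intro mult_left_mono mult_mono) auto
      finally show ?thesis using True by simp
    next
      case False then show ?thesis using kz[of x] by simp
    qed
    have conv: "(\<lambda>n. \<integral>x. h x * (c n x * of_real (k x)) \<partial>lborel) \<longlonglongrightarrow> (\<integral>x. h x * (u x * of_real (k x)) \<partial>lborel)"
    proof (rule integral_dominated_convergence[OF _ _ integrable_norm[OF loc[of R]]])
      show "AE x in lborel. (\<lambda>n. h x * (c n x * of_real (k x))) \<longlonglongrightarrow> h x * (u x * of_real (k x))"
        using aeN by eventually_elim (intro tendsto_intros clim)
      show "AE x in lborel. norm (h x * (c n x * of_real (k x))) \<le> norm (indicator (cball 0 R) x *\<^sub>R h x)" for n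
        by (intro AE_I2 dom cn)
      have [measurable]: "c n \<in> borel_measurable borel" for n using cc by (rule borel_measurable_continuous_onI)
      show "(\<lambda>x. h x * (c n x * of_real (k x))) \<in> borel_measurable lborel" for n by measurable
    qed measurable
    then have "(\<lambda>n::nat. 0) \<longlonglongrightarrow> (\<integral>x. h x * (u x * of_real (k x)) \<partial>lborel)"
      unfolding zero .
    then have i0: "(\<integral>x. h x * (u x * of_real (k x)) \<partial>lborel) = 0"
      by (rule LIMSEQ_unique) (rule tendsto_const)
    define q where "q x = (norm (h x))\<^sup>2 / (1 + norm (h x)) * k x" for x
    have q: "h x * (u x * of_real (k x)) = of_real (q x)" for x
    proof -
      have "h x * cnj (h x) = of_real ((norm (h x))\<^sup>2)" by (rule complex_norm_square[symmetric])
      then show ?thesis by (simp add: u_def q_def)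
    qed
    have "integrable lborel (\<lambda>x. h x * (u x * of_real (k x)))"
      by (rule Bochner_Integration.integrable_bound[OF loc[of R]]) (use dom nu in \<open>auto intro!: AE_I2 simp: less_imp_le\<close>)
    then have "integrable lborel (\<lambda>x. of_real (q x) :: complex)" by (simp only: q)
    then have qi: "integrable lborel q" by (simp only: complex_of_real_integrable_eq)
    have "(\<integral>x. of_real (q x) \<partial>lborel :: complex) = 0" using i0 by (simp only: q)
    then have "(\<integral>x. q x \<partial>lborel) = 0" by (simp only: integral_complex_of_real of_real_eq_0_iff)
    moreover have "AE x in lborel. 0 \<le> q x" using k01 by (intro AE_I2) (auto simp: q_def)
    ultimately have "AE x in lborel. q x = 0" using integral_nonneg_eq_0_iff_AE[OF qi] by simp
    then show ?thesis
    proof eventually_elim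
      case (elim x)
      show ?case
      proof
        assume "norm x < R"
        then have "k x > 0" using R by (simp add: k_def)
        moreover have "1 + norm (h x) \<noteq> 0" using norm_ge_zero[of "h x"] by linarith
        ultimately show "h x = 0" using elim by (simp add: q_def)
      qed
    qed
  qed
  have "AE x in lborel. \<forall>n::nat. norm x < real (Suc n) \<longrightarrow> h x = 0"
    unfolding AE_all_countable using main by simp
  then show ?thesis
  proof eventually_elim
    case (elim x)
    obtain n :: nat where "norm x < real n" using reals_Archimedean2 by blast
    then show ?case using elim by (metis less_SucI of_nat_less_iff order_less_trans lessI)
  qed
qed

lemma laguerre_monomial_span: "\<exists>c. \<forall>r. r ^ k = (\<Sum>n\<le>k. c n * poly (laguerre n) r)"
proof (induction k rule: less_induct)
  case (less k)
  define c0 where "c0 = (-1)^k * fact k * (1::real)"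
  obtain c where c: "\<And>j r. j < k \<Longrightarrow> r ^ j = (\<Sum>n\<le>j. c j n * poly (laguerre n) r)"
    using less by metis
  have top: "poly (laguerre k) r = (\<Sum>j<k. coeff (laguerre k) j * r ^ j) + (-1)^k / fact k * r ^ k" for r
    by (simp add: poly_laguerre coeff_laguerre lessThan_Suc_atMost[symmetric])
  have pad: "(\<Sum>n\<le>j. c j n * poly (laguerre n) r) = (\<Sum>n<k. (if n \<le> j then c j n else 0) * poly (laguerre n) r)"
    if "j < k" for j r
    using that by (intro sum.mono_neutral_cong_left) auto
  define e where "e n = (\<Sum>j<k. coeff (laguerre k) j * (if n \<le> j then c j n else 0))" for n
  define d where "d n = (if n = k then c0 else - c0 * e n)" for n
  have "r ^ k = (\<Sum>n\<le>k. d n * poly (laguerre n) r)" for r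
  proof -
    have "(\<Sum>j<k. coeff (laguerre k) j * r ^ j) = (\<Sum>j<k. coeff (laguerre k) j * (\<Sum>n<k. (if n \<le> j then c j n else 0) * poly (laguerre n) r))"
      by (intro sum.cong refl) (simp add: c pad)
    also have "\<dots> = (\<Sum>n<k. e n * poly (laguerre n) r)"
      unfolding e_def sum_distrib_left sum_distrib_right by (subst sum.swap) (simp only: mult.assoc)
    finally have s: "(\<Sum>j<k. coeff (laguerre k) j * r ^ j) = \<dots>" .
    have "r ^ k = c0 * ((-1)^k / fact k * r ^ k)" by (simp add: c0_def flip: power_mult_distrib)
    also have "\<dots> = c0 * (poly (laguerre k) r - (\<Sum>j<k. coeff (laguerre k) j * r ^ j))" using top[of r] by simp
    also have "\<dots> = (\<Sum>n\<le>k. d n * poly (laguerre n) r)"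
      unfolding s lessThan_Suc_atMost[symmetric]
      by (simp add: d_def right_diff_distrib sum_distrib_left  mult.assoc sum_negf)
    finally show ?thesis .
  qed
  then show ?case by blast
qed

text \<open>Expand \<open>exp(-(b - a) r)\<close> into its power series. The partial sums are at most \<open>exp((b - a) r)\<close>, so
\<open>b < 2 a\<close> leaves the square-integrable majorant \<open>r^n exp(-(2 a - b) r)\<close>.\<close>

lemma exponential_moments_shift:
  fixes h :: "real \<Rightarrow> complex"
  assumes h: "in_Lp 2 halfline h" and ab: "0 < a" "a \<le> b" "b < 2 * a"
    and z: "\<And>n. (\<integral>r. h r * of_real (r ^ n * exp (- a * r)) \<partial>halfline) = 0"
  shows "(\<integral>r. h r * of_real (r ^ n * exp (- b * r)) \<partial>halfline) = 0"
proof -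
  have [measurable]: "h \<in> borel_measurable borel" using in_Lp_2_borel[OF h] by (simp cong: measurable_cong_sets)
  have w: "in_Lp 2 halfline (\<lambda>r. of_real (r ^ n * exp (- c * r)))" if "c > 0" for c n
    unfolding in_Lp_2_iff
  proof
    have "(norm (of_real (r ^ n * exp (- c * r)) :: complex))\<^sup>2 = r ^ (2*n) * exp (- (2 * c) * r)" for r
      by (simp only: norm_of_real power2_abs power_mult_distrib)
         (simp add: power_mult[symmetric] mult.commute[of n] exp_double[symmetric] mult.assoc)
    then show "integrable halfline (\<lambda>r. (norm (of_real (r ^ n * exp (- c * r)) :: complex))\<^sup>2)"
      using integrable_power_exp_halfline[of "2 * c" "2 * n"] that by simp
  qed measurable
  define S where "S j r = (\<Sum>i<j. (-(b - a) * r) ^ i /\<^sub>R fact i)" for j :: nat and r :: real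
  have S: "(\<lambda>j. S j r) \<longlonglongrightarrow> exp (-(b - a) * r)" for r
    using exp_converges[of "-(b - a) * r"] by (simp add: sums_def S_def)
  have Sb: "\<bar>S j r\<bar> \<le> exp ((b - a) * r)" if "r \<ge> 0" for j r
  proof -
    have "\<bar>S j r\<bar> \<le> (\<Sum>i<j. \<bar>(-(b - a) * r) ^ i /\<^sub>R fact i\<bar>)" unfolding S_def by (rule sum_abs)
    also have "\<dots> = (\<Sum>i<j. ((b - a) * r) ^ i /\<^sub>R fact i)"
      using that ab by (simp add: abs_mult power_abs)
    also have "\<dots> \<le> exp ((b - a) * r)"
      unfolding sums_unique[OF exp_converges]
      using exp_converges[of "(b - a) * r"] that ab by (intro sum_le_suminf) (auto simp: sums_iff)
    finally show ?thesis .
  qed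
  have zero: "(\<integral>r. h r * of_real (r ^ n * exp (- a * r) * S j r) \<partial>halfline) = 0" for j
  proof -
    have "(\<integral>r. h r * of_real (r ^ n * exp (- a * r) * S j r) \<partial>halfline)
      = (\<integral>r. (\<Sum>i<j. of_real ((-(b - a)) ^ i / fact i) * (h r * of_real (r ^ (n + i) * exp (- a * r)))) \<partial>halfline)"
      by (intro Bochner_Integration.integral_cong refl)
         (simp only: S_def sum_distrib_left of_real_sum, intro sum.cong refl,
          simp only: power_mult_distrib power_add of_real_mult of_real_divide scaleR_conv_of_real divide_inverse of_real_inverse mult_ac of_real_eq_id id_apply)
    also have "\<dots> = 0"
      using in_Lp_2_integrable_mult[OF h w[OF ab(1)]] z
      by (subst Bochner_Integration.integral_sum) auto
    finally show ?thesis .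
  qed
  have "(\<lambda>j. \<integral>r. h r * of_real (r ^ n * exp (- a * r) * S j r) \<partial>halfline)
     \<longlonglongrightarrow> (\<integral>r. h r * of_real (r ^ n * exp (- b * r)) \<partial>halfline)"
  proof (rule integral_dominated_convergence)
    show "integrable halfline (\<lambda>r. norm (h r * of_real (r ^ n * exp (- (2*a - b) * r))))"
      using ab by (intro integrable_norm in_Lp_2_integrable_mult h w) simp
    show "AE r in halfline. (\<lambda>j. h r * of_real (r ^ n * exp (- a * r) * S j r)) \<longlonglongrightarrow> h r * of_real (r ^ n * exp (- b * r))"
    proof (intro AE_I2)
      fix r
      have "(\<lambda>j. h r * of_real (r ^ n * exp (- a * r) * S j r)) \<longlonglongrightarrow> h r * of_real (r ^ n * exp (- a * r) * exp (-(b - a) * r))"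
        by (intro tendsto_intros S)
      also have "r ^ n * exp (- a * r) * exp (-(b - a) * r) = r ^ n * exp (- b * r)"
        by (simp add: mult.assoc flip: exp_add) (simp add: algebra_simps)
      finally show "(\<lambda>j. h r * of_real (r ^ n * exp (- a * r) * S j r)) \<longlonglongrightarrow> h r * of_real (r ^ n * exp (- b * r))" .
    qed
    show "AE r in halfline. norm (h r * of_real (r ^ n * exp (- a * r) * S j r)) \<le> norm (h r * of_real (r ^ n * exp (- (2*a - b) * r)))" for j
      unfolding AE_halfline
    proof (intro AE_I2 impI)
      fix r :: real assume r: "r \<ge> 0"
      have "\<bar>r ^ n * exp (- a * r) * S j r\<bar> \<le> r ^ n * exp (- a * r) * exp ((b - a) * r)"
        using r Sb[OF r, of j] by (simp add: abs_mult mult_left_mono)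
      also have "\<dots> = r ^ n * exp (- (2*a - b) * r)"
        by (simp add: mult.assoc flip: exp_add) (simp add: algebra_simps)
      finally have "\<bar>r ^ n * exp (- a * r) * S j r\<bar> \<le> \<bar>r ^ n * exp (- (2*a - b) * r)\<bar>" by linarith
      then show "norm (h r * of_real (r ^ n * exp (- a * r) * S j r)) \<le> norm (h r * of_real (r ^ n * exp (- (2*a - b) * r)))"
        unfolding norm_mult norm_of_real by (intro mult_left_mono) auto
    qed
    show "(\<lambda>r. h r * of_real (r ^ n * exp (- a * r) * S j r)) \<in> borel_measurable halfline" for j
      unfolding S_def by measurable
  qed measurable
  then have "(\<lambda>j::nat. 0) \<longlonglongrightarrow> (\<integral>r. h r * of_real (r ^ n * exp (- b * r)) \<partial>halfline)"
    unfolding zero .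
  then show ?thesis by (rule LIMSEQ_unique) (rule tendsto_const)
qed

text \<open>Orthogonality to all Laguerre functions is orthogonality to all \<open>r^k exp(-r/2)\<close>. Shifting the exponent
in steps of 1/4 gives orthogonality to \<open>exp(-r/4)^i exp(-r/2)\<close> for all \<open>i\<close>. On the half-line \<open>exp(-r/4)\<close>
takes values in the unit interval, where the Weierstrass theorem approximates continuous functions by
polynomials.\<close>

lemma laguerre_complete:
  assumes h: "in_Lp 2 halfline h"
    and orth: "\<And>n. (\<integral>r. h r * of_real (laguerre_fun n r) \<partial>halfline) = 0"
  shows "AE r in halfline. h r = 0"
proof -
  have [measurable]: "h \<in> borel_measurable borel" using in_Lp_2_borel[OF h] by (simp cong: measurable_cong_sets)
  note w = laguerre_fun_L2
  have base: "(\<integral>r. h r * of_real (r ^ k * exp (- (1/2) * r)) \<partial>halfline) = 0" for k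
  proof -
    obtain c where c: "\<And>r. r ^ k = (\<Sum>n\<le>k. c n * poly (laguerre n) r)" using laguerre_monomial_span[of k] by blast
    have "(\<integral>r. h r * of_real (r ^ k * exp (- (1/2) * r)) \<partial>halfline)
       = (\<integral>r. (\<Sum>n\<le>k. of_real (c n) * (h r * of_real (laguerre_fun n r))) \<partial>halfline)"
      unfolding c laguerre_fun_def
      by (intro Bochner_Integration.integral_cong refl)
         (simp add: sum_distrib_left sum_distrib_right mult_ac)
    also have "\<dots> = 0"
      using in_Lp_2_integrable_mult[OF h w] orth by (subst Bochner_Integration.integral_sum) auto
    finally show ?thesis .
  qed
  have all: "(\<integral>r. h r * of_real (r ^ k * exp (- (real (m + 2) / 4) * r)) \<partial>halfline) = 0" for k m
  proof (induction m arbitrary: k)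
    case 0 show ?case using base[of k] by simp
  next
    case (Suc m)
    show ?case by (rule exponential_moments_shift[OF h _ _ _ Suc]) (simp_all add: field_simps)
  qed
  have exps: "(\<integral>r. h r * of_real (exp (- r / 4) ^ i * exp (- r / 2)) \<partial>halfline) = 0" for i
  proof -
    have "exp (- r / 4) ^ i * exp (- r / 2) = r ^ 0 * exp (- (real (i + 2) / 4) * r)" for r :: real
      by (simp add: exp_of_nat_mult[symmetric] exp_add[symmetric]) (simp add: algebra_simps add_divide_distrib)
    then show ?thesis using all[of 0 i] by (simp only:)
  qed
  have expL2: "in_Lp 2 halfline (\<lambda>r. of_real (exp (- r / 2)))"
    using w[of 0] by (simp add: laguerre_fun_def)
  have expL2': "in_Lp 2 halfline (\<lambda>r. of_real (exp (- r / 4) ^ i * exp (- r / 2)))" for i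
    unfolding in_Lp_2_iff
  proof
    have "(norm (of_real (exp (- r / 4) ^ i * exp (- r / 2)) :: complex))\<^sup>2 = exp (- (real i / 2 + 1) * r)" for r :: real
      by (simp add: norm_mult norm_power power_mult_distrib exp_of_nat_mult[symmetric] power2_eq_square
           exp_add[symmetric] del: of_real_mult of_real_power of_real_exp exp_of_real)
         (simp add: algebra_simps add_divide_distrib)
    then show "integrable halfline (\<lambda>r. (norm (of_real (exp (- r / 4) ^ i * exp (- r / 2)) :: complex))\<^sup>2)"
      using integrable_exp_halfline[of "real i / 2 + 1"] by (simp add: add_nonneg_pos)
  qed measurable
  have real_test: "(\<integral>r. h r * of_real (\<phi> r) \<partial>halfline) = 0"
    if \<phi>: "continuous_on UNIV \<phi>" and \<phi>0: "\<And>r. norm r \<ge> R \<Longrightarrow> \<phi> r = 0" for \<phi> :: "real \<Rightarrow> real" and R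
  proof -
    (* \<eta> is \<phi> r * exp (r / 2) as a function of y = exp (- r / 4), continued to y \<le> \<delta>, that is r \<ge> \<bar>R\<bar>, by a constant; the constant is 0 as \<phi> vanishes there. *)
    define \<delta> where "\<delta> = exp (- \<bar>R\<bar> / 4)"
    have \<delta>: "\<delta> > 0" by (simp add: \<delta>_def)
    define \<eta> where "\<eta> y = \<phi> (- 4 * ln (max y \<delta>)) / (max y \<delta>)\<^sup>2" for y
    have c: "continuous_on UNIV \<eta>"
      unfolding \<eta>_def using \<delta>
      by (intro continuous_intros continuous_on_compose2[OF \<phi>]) (auto simp: max_def)
    have eq: "\<phi> r = \<eta> (exp (- r / 4)) * exp (- r / 2)" if "r \<ge> 0" for r
    proof (cases "r \<le> \<bar>R\<bar>")
      case True
      then have "max (exp (- r / 4)) \<delta> = exp (- r / 4)" by (simp add: \<delta>_def max_def)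
      then show ?thesis by (simp add: \<eta>_def flip: exp_double exp_minus)
    next
      case False
      then have "max (exp (- r / 4)) \<delta> = \<delta>" by (simp add: \<delta>_def max_def)
      then show ?thesis using \<phi>0[of r] \<phi>0[of "\<bar>R\<bar>"] False that by (simp add: \<eta>_def \<delta>_def)
    qed
    define I where "I = (\<integral>r. norm (h r) * norm (of_real (exp (- r / 2)) :: complex) \<partial>halfline)"
    have Iint: "integrable halfline (\<lambda>r. norm (h r) * norm (of_real (exp (- r / 2)) :: complex))"
      using integrable_norm[OF in_Lp_2_integrable_mult[OF h expL2]] by (simp only: norm_mult)
    have "norm (\<integral>r. h r * of_real (\<phi> r) \<partial>halfline) \<le> e * I" if e: "e > 0" for e
    proof -
      obtain g where g: "real_polynomial_function g" "\<And>y. y \<in> {0..1} \<Longrightarrow> \<bar>\<eta> y - g y\<bar> < e"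
        by (rule Stone_Weierstrass_real_polynomial_function[OF compact_Icc continuous_on_subset[OF c subset_UNIV] e, of 0 1]) blast
      obtain a n where gs: "g = (\<lambda>y. \<Sum>i\<le>n. a i * y ^ i)"
        using g(1) unfolding real_polynomial_function_iff_sum by blast
      have gi: "integrable halfline (\<lambda>r. h r * of_real (g (exp (- r / 4)) * exp (- r / 2)))"
        and g0: "(\<integral>r. h r * of_real (g (exp (- r / 4)) * exp (- r / 2)) \<partial>halfline) = 0"
      proof -
        have ge: "(\<lambda>r. h r * of_real (g (exp (- r / 4)) * exp (- r / 2)))
           = (\<lambda>r. \<Sum>i\<le>n. of_real (a i) * (h r * of_real (exp (- r / 4) ^ i * exp (- r / 2))))"
          by (rule ext) (simp only: gs sum_distrib_left sum_distrib_right of_real_sum, intro sum.cong refl,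
              simp only: of_real_mult mult_ac)
        show "integrable halfline (\<lambda>r. h r * of_real (g (exp (- r / 4)) * exp (- r / 2)))"
          unfolding ge by (intro Bochner_Integration.integrable_sum integrable_mult_right in_Lp_2_integrable_mult h expL2')
        show "(\<integral>r. h r * of_real (g (exp (- r / 4)) * exp (- r / 2)) \<partial>halfline) = 0"
          unfolding ge using in_Lp_2_integrable_mult[OF h expL2'] exps
          by (subst Bochner_Integration.integral_sum) (auto simp del: of_real_mult of_real_power)
      qed
      have pw: "norm (h r * of_real (\<phi> r) - h r * of_real (g (exp (- r / 4)) * exp (- r / 2)))
          \<le> e * (norm (h r) * norm (of_real (exp (- r / 2)) :: complex))" if "r \<ge> 0" for r
      proof -
        have "h r * of_real (\<phi> r) - h r * of_real (g (exp (- r / 4)) * exp (- r / 2))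
           = h r * of_real ((\<eta> (exp (- r / 4)) - g (exp (- r / 4))) * exp (- r / 2))"
          unfolding eq[OF that] by (simp add: algebra_simps)
        then have "norm (h r * of_real (\<phi> r) - h r * of_real (g (exp (- r / 4)) * exp (- r / 2)))
           = \<bar>\<eta> (exp (- r / 4)) - g (exp (- r / 4))\<bar> * (norm (h r) * exp (- r / 2))"
          by (simp only: norm_mult norm_of_real abs_mult) (simp add: mult_ac)
        also have "\<dots> \<le> e * (norm (h r) * exp (- r / 2))"
          using g(2)[of "exp (- r / 4)"] that by (intro mult_right_mono) auto
        finally show ?thesis by simp
      qed
      have \<phi>i: "integrable halfline (\<lambda>r. h r * of_real (\<phi> r))"
      proof -
        have [measurable]: "\<phi> \<in> borel_measurable borel" using \<phi> by (rule borel_measurable_continuous_onI)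
        have "integrable halfline (\<lambda>r. h r * of_real (\<phi> r) - h r * of_real (g (exp (- r / 4)) * exp (- r / 2)))"
        proof (rule Bochner_Integration.integrable_bound[OF integrable_mult_right[OF Iint, of e]])
          show "(\<lambda>r. h r * of_real (\<phi> r) - h r * of_real (g (exp (- r / 4)) * exp (- r / 2))) \<in> borel_measurable halfline"
            unfolding gs by measurable
          show "AE r in halfline. norm (h r * of_real (\<phi> r) - h r * of_real (g (exp (- r / 4)) * exp (- r / 2)))
              \<le> norm (e * (norm (h r) * norm (of_real (exp (- r / 2)) :: complex)))"
            unfolding AE_halfline using pw e by (intro AE_I2 impI) (fastforce simp: abs_mult)
        qed
        from Bochner_Integration.integrable_add[OF this gi] show ?thesis by simp
      qed
      have "(\<integral>r. h r * of_real (\<phi> r) \<partial>halfline)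
         = (\<integral>r. h r * of_real (\<phi> r) - h r * of_real (g (exp (- r / 4)) * exp (- r / 2)) \<partial>halfline)"
        using \<phi>i gi g0 by (subst Bochner_Integration.integral_diff) auto
      also have "norm \<dots> \<le> (\<integral>r. e * (norm (h r) * norm (of_real (exp (- r / 2)) :: complex)) \<partial>halfline)"
      proof (rule order.trans[OF integral_norm_bound integral_mono_AE])
        show "AE r in halfline. norm (h r * of_real (\<phi> r) - h r * of_real (g (exp (- r / 4)) * exp (- r / 2)))
              \<le> e * (norm (h r) * norm (of_real (exp (- r / 2)) :: complex))"
          unfolding AE_halfline using pw by (intro AE_I2 impI)
      qed (use \<phi>i gi Iint in auto)
      finally show ?thesis by (simp add: I_def)
    qed
    then have "norm (\<integral>r. h r * of_real (\<phi> r) \<partial>halfline) \<le> 0 + e" if "e > 0" for e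
    proof -
      have "I \<ge> 0" by (simp add: I_def)
      have "norm (\<integral>r. h r * of_real (\<phi> r) \<partial>halfline) \<le> e / (I + 1) * I"
        using \<open>I \<ge> 0\<close> that \<open>\<And>e. e > 0 \<Longrightarrow> _ \<le> e * I\<close>[of "e / (I + 1)"] by simp
      also have "\<dots> \<le> e" using \<open>I \<ge> 0\<close> that by (simp add: field_simps)
      finally show ?thesis by simp
    qed
    then have "norm (\<integral>r. h r * of_real (\<phi> r) \<partial>halfline) \<le> 0" by (rule field_le_epsilon)
    then show ?thesis by simp
  qed
  define h' where "h' r = indicator {0..} r *\<^sub>R h r" for r
  have [measurable]: "h' \<in> borel_measurable borel" unfolding h'_def by measurable
  have cint: "integrable halfline (\<lambda>r. h r * \<phi> r)"
    if \<phi>: "continuous_on UNIV \<phi>" and \<phi>0: "\<And>r. norm r \<ge> R \<Longrightarrow> \<phi> r = 0" for \<phi> :: "real \<Rightarrow> complex" and R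
  proof (rule in_Lp_2_integrable_mult[OF h])
    have [measurable]: "\<phi> \<in> borel_measurable borel" using \<phi> by (rule borel_measurable_continuous_onI)
    have "bounded (\<phi> ` cball 0 R)"
      by (intro compact_imp_bounded compact_continuous_image continuous_on_subset[OF \<phi>]) auto
    then obtain B where B: "\<And>r. r \<in> cball 0 R \<Longrightarrow> norm (\<phi> r) \<le> B" unfolding bounded_iff by blast
    show "in_Lp 2 halfline \<phi>" unfolding in_Lp_2_iff
    proof
      show "integrable halfline (\<lambda>r. (norm (\<phi> r))\<^sup>2)"
      proof (subst integral_halfline)
        show "integrable lborel (\<lambda>r. indicator {0..} r *\<^sub>R (norm (\<phi> r))\<^sup>2)"
        proof (rule Bochner_Integration.integrable_bound)
          show "integrable lborel (\<lambda>r::real. B\<^sup>2 * indicator (cball 0 R) r)"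
            by (rule integrable_indicator_cball)
          show "AE r in lborel. norm (indicator {0..} r *\<^sub>R (norm (\<phi> r))\<^sup>2) \<le> norm (B\<^sup>2 * indicator (cball 0 R) r)"
            using B \<phi>0 by (intro AE_I2) (auto simp: indicator_def not_le intro!: power_mono)
        qed measurable
      qed measurable
    qed measurable
  qed
  have "AE r in lborel. h' r = 0"
  proof (rule AE_zero_of_continuous_tests)
    show "integrable lborel (\<lambda>x. indicator (cball 0 R) x *\<^sub>R h' x)" for R
    proof -
      have [measurable]: "(indicator (cball 0 R) :: real \<Rightarrow> complex) \<in> borel_measurable borel"
        by (rule borel_measurable_indicator) simp
      have i: "in_Lp 2 halfline (indicator (cball 0 R))" unfolding in_Lp_2_iff
      proof
        have "integrable lborel (\<lambda>r::real. indicator {0..} r *\<^sub>R (norm (indicator (cball 0 R) r :: complex))\<^sup>2)"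
        proof (rule Bochner_Integration.integrable_bound)
          show "integrable lborel (\<lambda>r::real. indicator (cball 0 R) r :: real)"
            using integrable_indicator_cball[of 1 "0::real" R] by simp
        qed (auto simp: indicator_def)
        then show "integrable halfline (\<lambda>r. (norm (indicator (cball 0 R) r :: complex))\<^sup>2)"
          by (subst integral_halfline) auto
      qed measurable
      have "integrable halfline (\<lambda>r. h r * indicator (cball 0 R) r)"
        by (rule in_Lp_2_integrable_mult[OF h i])
      then have "integrable lborel (\<lambda>r. indicator {0..} r *\<^sub>R (h r * indicator (cball 0 R) r))"
        by (subst (asm) integral_halfline) auto
      then show ?thesis
        by (rule Bochner_Integration.integrable_cong[THEN iffD1, rotated -1]) (auto simp: h'_def indicator_def)
    qed
    fix \<phi> :: "real \<Rightarrow> complex" and R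
    assume \<phi>: "continuous_on UNIV \<phi>" and \<phi>0: "\<And>r. norm r \<ge> R \<Longrightarrow> \<phi> r = 0"
    have [measurable]: "\<phi> \<in> borel_measurable borel" using \<phi> by (rule borel_measurable_continuous_onI)
    have cr: "continuous_on UNIV (\<lambda>r. Re (\<phi> r))" "continuous_on UNIV (\<lambda>r. Im (\<phi> r))"
      by (intro continuous_intros \<phi>)+
    have "(\<integral>r. h' r * \<phi> r \<partial>lborel) = (\<integral>r. indicator {0..} r *\<^sub>R (h r * \<phi> r) \<partial>lborel)"
      by (intro Bochner_Integration.integral_cong refl) (simp add: h'_def)
    also have "\<dots> = (\<integral>r. h r * \<phi> r \<partial>halfline)" by (subst integral_halfline) auto
    also have "\<dots> = (\<integral>r. h r * of_real (Re (\<phi> r)) + \<i> * (h r * of_real (Im (\<phi> r))) \<partial>halfline)"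
      by (intro Bochner_Integration.integral_cong refl) (subst complex_eq[of "\<phi> _"], simp add: algebra_simps)
    also have "\<dots> = (\<integral>r. h r * of_real (Re (\<phi> r)) \<partial>halfline) + \<i> * (\<integral>r. h r * of_real (Im (\<phi> r)) \<partial>halfline)"
    proof -
      have "integrable halfline (\<lambda>r. h r * of_real (Re (\<phi> r)))" "integrable halfline (\<lambda>r. h r * of_real (Im (\<phi> r)))"
        using \<phi>0 by (auto intro!: cint[where R = R] continuous_intros \<phi>)
      then show ?thesis by simp
    qed
    also have "\<dots> = 0"
      using real_test[OF cr(1), of R] real_test[OF cr(2), of R] \<phi>0 by simp
    finally show "(\<integral>r. h' r * \<phi> r \<partial>lborel) = 0" .
  qed measurable
  then show ?thesis unfolding AE_halfline h'_def by eventually_elim (auto simp: indicator_def)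
qed

section \<open>Explicit radial solutions\<close>

definition claguerre :: "nat \<Rightarrow> complex poly" where
  "claguerre n = map_poly of_real (laguerre n)"

lemma poly_claguerre: "poly (claguerre n) (of_real x) = of_real (poly (laguerre n) x)"
  by (simp add: claguerre_def poly_altdef degree_map_poly coeff_map_poly)

lemma claguerre_ode:
  "z * poly (pderiv (pderiv (claguerre n))) z
    = (z - 1) * poly (pderiv (claguerre n)) z - of_nat n * poly (claguerre n) z"
proof -
  have m: "map_poly of_real (pderiv p) = pderiv (map_poly complex_of_real p)" for p
    by (rule poly_eqI) (simp add: coeff_map_poly coeff_pderiv)
  have e: "pCons 0 (pderiv (pderiv (claguerre n))) + pderiv (claguerre n) - pCons 0 (pderiv (claguerre n))
     + smult (of_nat n) (claguerre n) = map_poly of_real (pCons 0 (pderiv (pderiv (laguerre n))) + pderiv (laguerre n) - pCons 0 (pderiv (laguerre n))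
     + smult (real n) (laguerre n))"
    unfolding claguerre_def
    by (rule poly_eqI) (simp add: coeff_map_poly coeff_pderiv coeff_pCons split: nat.split)
  show ?thesis
    using arg_cong[OF e[unfolded laguerre_ode_poly], of "\<lambda>p. poly p z"] by (simp add: algebra_simps)
qed

text \<open>The amplitude as a function of complex time \<open>w\<close>: the derivatives below are then derivatives of
holomorphic functions and follow from the field rules.\<close>

definition wave_amp :: "nat \<Rightarrow> complex \<Rightarrow> complex" where
  "wave_amp n w = ((1 - 2 * \<i> * w) / (1 + 2 * \<i> * w)) ^ n / (1 + 2 * \<i> * w)"

text \<open>A wave with an arbitrary polynomial in place of the Laguerre polynomial, because the derivatives in \<open>z\<close>
are combinations of waves of this kind for the derivatives of the polynomial. At real \<open>w\<close> the product
\<open>(1 + 2 \<i> w) (1 - 2 \<i> w)\<close> is \<open>1 + 4 w\<^sup>2\<close>; the factorized form is holomorphic.\<close>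

definition wave_gen :: "complex poly \<Rightarrow> nat \<Rightarrow> complex \<Rightarrow> complex \<Rightarrow> complex" where
  "wave_gen p n w z = wave_amp n w * poly p (z / ((1 + 2 * \<i> * w) * (1 - 2 * \<i> * w))) * exp (- z / (2 * (1 + 2 * \<i> * w)))"

text \<open>The solution that starts from the \<open>n\<close>-th Laguerre function at \<open>t = 0\<close>, in the variable \<open>r = |x|\<^sup>2\<close>;
\<open>wave_r\<close> and \<open>wave_rr\<close> are its derivatives in \<open>r\<close>.\<close>

definition wave :: "nat \<Rightarrow> real \<Rightarrow> real \<Rightarrow> complex" where
  "wave n t r = wave_gen (claguerre n) n (of_real t) (of_real r)"

definition wave_r :: "nat \<Rightarrow> real \<Rightarrow> real \<Rightarrow> complex" where
  "wave_r n t r = wave_gen (pderiv (claguerre n)) n (of_real t) (of_real r) / ((1 + 2 * \<i> * of_real t) * (1 - 2 * \<i> * of_real t))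
     - wave_gen (claguerre n) n (of_real t) (of_real r) / (2 * (1 + 2 * \<i> * of_real t))"

definition wave_rr :: "nat \<Rightarrow> real \<Rightarrow> real \<Rightarrow> complex" where
  "wave_rr n t r = wave_gen (pderiv (pderiv (claguerre n))) n (of_real t) (of_real r) / ((1 + 2 * \<i> * of_real t) * (1 - 2 * \<i> * of_real t))\<^sup>2
     - wave_gen (pderiv (claguerre n)) n (of_real t) (of_real r) / ((1 + 2 * \<i> * of_real t)\<^sup>2 * (1 - 2 * \<i> * of_real t))
     + wave_gen (claguerre n) n (of_real t) (of_real r) / (2 * (1 + 2 * \<i> * of_real t))\<^sup>2"

lemma one_plus_i_nonzero: "1 + 2 * \<i> * complex_of_real t \<noteq> 0" "1 - 2 * \<i> * complex_of_real t \<noteq> 0"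
  by (simp_all add: complex_eq_iff)

lemma wave_gen_deriv_z:
  "((\<lambda>z. wave_gen p n w z) has_field_derivative
      wave_gen (pderiv p) n w z / ((1 + 2 * \<i> * w) * (1 - 2 * \<i> * w)) - wave_gen p n w z / (2 * (1 + 2 * \<i> * w))) (at z)"
proof -
  have p: "((\<lambda>z. poly p (z / c)) has_field_derivative poly (pderiv p) (z / c) * (1 / c)) (at z)" for c
    by (rule DERIV_chain2[OF poly_DERIV]) (rule DERIV_cdivide[OF DERIV_ident])
  have e: "((\<lambda>z. exp (- z / c)) has_field_derivative exp (- z / c) * (- 1 / c)) (at z)" for c
    by (rule DERIV_chain2[OF DERIV_exp]) (rule DERIV_cdivide[OF DERIV_minus[OF DERIV_ident]])
  have "((\<lambda>z. wave_amp n w * (poly p (z / c) * exp (- z / d))) has_field_derivative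
      wave_amp n w * (poly p (z / c) * (exp (- z / d) * (- 1 / d)) + poly (pderiv p) (z / c) * (1 / c) * exp (- z / d))) (at z)" for c d
    by (rule DERIV_cmult[OF DERIV_mult'[OF p e]])
  from this[of "(1 + 2 * \<i> * w) * (1 - 2 * \<i> * w)" "2 * (1 + 2 * \<i> * w)"]
  show ?thesis unfolding wave_gen_def
    by (simp add: algebra_simps)
qed

lemma wave_deriv_r: "((\<lambda>r. wave n t r) has_vector_derivative wave_r n t r) (at r)"
  unfolding wave_def wave_r_def by (rule has_vector_derivative_real_field[OF wave_gen_deriv_z])

lemma wave_deriv_rr: "((\<lambda>r. wave_r n t r) has_vector_derivative wave_rr n t r) (at r)"
proof -
  define D where "D = 1 + 2 * \<i> * complex_of_real t"
  define E where "E = 1 - 2 * \<i> * complex_of_real t"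
  have nz: "D \<noteq> 0" "E \<noteq> 0" using one_plus_i_nonzero by (auto simp: D_def E_def)
  let ?w = "\<lambda>p. wave_gen p n (of_real t)"
  let ?L = "claguerre n"
  have "((\<lambda>z. ?w (pderiv ?L) z / (D * E) - ?w ?L z / (2 * D)) has_field_derivative
     (?w (pderiv (pderiv ?L)) z / (D * E) - ?w (pderiv ?L) z / (2 * D)) / (D * E) - (?w (pderiv ?L) z / (D * E) - ?w ?L z / (2 * D)) / (2 * D)) (at z)" for z
    unfolding D_def E_def by (intro DERIV_diff DERIV_cdivide wave_gen_deriv_z)
  from has_vector_derivative_real_field[OF this[of "of_real r"]]
  have 1: "((\<lambda>r. wave_r n t r) has_vector_derivative
     (?w (pderiv (pderiv ?L)) (of_real r) / (D * E) - ?w (pderiv ?L) (of_real r) / (2 * D)) / (D * E) - (?w (pderiv ?L) (of_real r) / (D * E) - ?w ?L (of_real r) / (2 * D)) / (2 * D)) (at r)"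
    unfolding wave_r_def D_def[symmetric] E_def[symmetric] .
  have "(a / (D * E) - b / (2 * D)) / (D * E) - (b / (D * E) - c / (2 * D)) / (2 * D)
     = a / (D * E)\<^sup>2 - b / (D\<^sup>2 * E) + c / (2 * D)\<^sup>2" for a b c
    using nz by (simp add: field_simps power2_eq_square)
  with 1 show ?thesis unfolding wave_rr_def D_def[symmetric] E_def[symmetric] by simp
qed

lemma wave_amp_deriv:
  fixes w :: complex
  defines "D \<equiv> 1 + 2 * \<i> * w" and "E \<equiv> 1 - 2 * \<i> * w"
  assumes nz: "D \<noteq> 0" "E \<noteq> 0"
  shows "(wave_amp n has_field_derivative wave_amp n w * (- 2 * \<i> * of_nat n / E - 2 * \<i> * of_nat (Suc n) / D)) (at w)"
proof (induction n)
  case 0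
  have "((\<lambda>w. 1 / (1 + 2 * \<i> * w)) has_field_derivative 1 / D * (- 2 * \<i> / D)) (at w)"
    using nz unfolding D_def by (auto intro!: derivative_eq_intros simp: field_simps)
  then show ?case by (simp add: wave_amp_def[abs_def] D_def)
next
  case (Suc n)
  have q: "((\<lambda>w. (1 - 2 * \<i> * w) / (1 + 2 * \<i> * w)) has_field_derivative (E / D) * (- 2 * \<i> / E - 2 * \<i> / D)) (at w)"
  proof -
    have n: "((\<lambda>w. 1 - 2 * \<i> * w) has_field_derivative - 2 * \<i>) (at w)" "((\<lambda>w. 1 + 2 * \<i> * w) has_field_derivative 2 * \<i>) (at w)"
      by (auto intro!: derivative_eq_intros)
    have "((\<lambda>w. (1 - 2 * \<i> * w) / (1 + 2 * \<i> * w)) has_field_derivative (- 2 * \<i> * D - E * (2 * \<i>)) / (D * D)) (at w)"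
      using DERIV_divide[OF n] nz unfolding D_def E_def by simp
    moreover have "(- 2 * \<i> * D - E * (2 * \<i>)) / (D * D) = (E / D) * (- 2 * \<i> / E - 2 * \<i> / D)"
      using nz by (simp add: field_simps)
    ultimately show ?thesis by simp
  qed
  have e: "wave_amp (Suc n) = (\<lambda>w. ((1 - 2 * \<i> * w) / (1 + 2 * \<i> * w)) * wave_amp n w)"
    by (simp add: wave_amp_def[abs_def])
  have "(wave_amp (Suc n) has_field_derivative (E / D) * (wave_amp n w * (- 2 * \<i> * of_nat n / E - 2 * \<i> * of_nat (Suc n) / D))
     + (E / D) * (- 2 * \<i> / E - 2 * \<i> / D) * wave_amp n w) (at w)"
    unfolding e D_def E_def by (rule DERIV_mult'[OF q[unfolded D_def E_def] Suc[unfolded D_def E_def]])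
  also have "(E / D) * (wave_amp n w * (- 2 * \<i> * of_nat n / E - 2 * \<i> * of_nat (Suc n) / D)) + (E / D) * (- 2 * \<i> / E - 2 * \<i> / D) * wave_amp n w
     = ((E / D) * wave_amp n w) * (- 2 * \<i> * of_nat (Suc n) / E - 2 * \<i> * of_nat (Suc (Suc n)) / D)"
  proof -
    have gen: "q * (W * a) + q * b * W = (q * W) * (a + b)" for q W a b :: complex by (simp add: algebra_simps)
    have ab: "(- 2 * \<i> * of_nat n / E - 2 * \<i> * of_nat (Suc n) / D) + (- 2 * \<i> / E - 2 * \<i> / D)
       = - 2 * \<i> * of_nat (Suc n) / E - 2 * \<i> * of_nat (Suc (Suc n)) / D"
      by (simp add: add_divide_distrib diff_divide_distrib algebra_simps)
    show ?thesis unfolding gen ab ..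
  qed
  finally show ?case unfolding e D_def E_def .
qed

text \<open>The radial Schroedinger equation. After division by the common exponential it is the Laguerre
equation at the complex point \<open>z / (D E)\<close>.\<close>

lemma wave_deriv_t:
  "((\<lambda>t. wave n t r) has_vector_derivative \<i> * (4 * (of_real r * wave_rr n t r + wave_r n t r))) (at t)"
proof -
  define w where "w = complex_of_real t"
  define D where "D = 1 + 2 * \<i> * w"
  define E where "E = 1 - 2 * \<i> * w"
  define z where "z = complex_of_real r"
  have nz: "D \<noteq> 0" "E \<noteq> 0" using one_plus_i_nonzero by (auto simp: D_def E_def w_def)
  have DE: "E = 2 - D" by (simp add: D_def E_def)
  define A where "A = wave_amp n w"
  define \<rho> where "\<rho> = z / (D * E)"
  define P where "P = poly (claguerre n) \<rho>"
  define P1 where "P1 = poly (pderiv (claguerre n)) \<rho>"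
  define P2 where "P2 = poly (pderiv (pderiv (claguerre n))) \<rho>"
  define e where "e = exp (- z / (2 * D))"
  have dA: "(wave_amp n has_field_derivative A * (- 2 * \<i> * of_nat n / E - 2 * \<i> * of_nat (Suc n) / D)) (at w)"
    unfolding A_def D_def E_def by (rule wave_amp_deriv) (use nz in \<open>auto simp: D_def E_def\<close>)
  have d\<rho>: "((\<lambda>w. z / ((1 + 2 * \<i> * w) * (1 - 2 * \<i> * w))) has_field_derivative \<rho> * (2 * \<i> / E - 2 * \<i> / D)) (at w)"
  proof -
    have n: "((\<lambda>w. 1 - 2 * \<i> * w) has_field_derivative - 2 * \<i>) (at w)" "((\<lambda>w. 1 + 2 * \<i> * w) has_field_derivative 2 * \<i>) (at w)"
      by (auto intro!: derivative_eq_intros)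
    have "((\<lambda>w. z / ((1 + 2 * \<i> * w) * (1 - 2 * \<i> * w))) has_field_derivative
        (0 * (D * E) - z * (D * (- 2 * \<i>) + 2 * \<i> * E)) / ((D * E) * (D * E))) (at w)"
      using DERIV_divide[OF DERIV_const DERIV_mult'[OF n(2,1)]] nz unfolding D_def E_def by simp
    moreover have "(0 * (D * E) - z * (D * (- 2 * \<i>) + 2 * \<i> * E)) / ((D * E) * (D * E)) = \<rho> * (2 * \<i> / E - 2 * \<i> / D)"
      unfolding \<rho>_def using nz by (simp add: field_simps)
    ultimately show ?thesis by simp
  qed
  have de: "((\<lambda>w. exp (- z / (2 * (1 + 2 * \<i> * w)))) has_field_derivative e * (\<i> * z / D\<^sup>2)) (at w)"
  proof -
    have n: "((\<lambda>w. 2 * (1 + 2 * \<i> * w)) has_field_derivative 2 * (2 * \<i>)) (at w)"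
      by (auto intro!: derivative_eq_intros)
    have "((\<lambda>w. - z / (2 * (1 + 2 * \<i> * w))) has_field_derivative (0 * (2 * D) - (- z) * (2 * (2 * \<i>))) / ((2 * D) * (2 * D))) (at w)"
    proof -
      have "2 * D \<noteq> 0" using nz(1) by simp
      from DERIV_divide[OF DERIV_const n this[unfolded D_def], of "- z"] show ?thesis unfolding D_def .
    qed
    moreover have "(0 * (2 * D) - (- z) * (2 * (2 * \<i>))) / ((2 * D) * (2 * D)) = \<i> * z / D\<^sup>2"
      using nz by (simp add: field_simps power2_eq_square)
    ultimately have "((\<lambda>w. - z / (2 * (1 + 2 * \<i> * w))) has_field_derivative \<i> * z / D\<^sup>2) (at w)" by simp
    from DERIV_chain2[OF DERIV_exp this] show ?thesis by (simp add: e_def D_def)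
  qed
  have dP: "((\<lambda>w. poly (claguerre n) (z / ((1 + 2 * \<i> * w) * (1 - 2 * \<i> * w)))) has_field_derivative P1 * (\<rho> * (2 * \<i> / E - 2 * \<i> / D))) (at w)"
    unfolding P1_def \<rho>_def D_def E_def
    by (rule DERIV_chain2[OF poly_DERIV d\<rho>[unfolded \<rho>_def D_def E_def]])
  have dall: "((\<lambda>w. wave_gen (claguerre n) n w z) has_field_derivative
      (A * P) * (e * (\<i> * z / D\<^sup>2)) + (A * (P1 * (\<rho> * (2 * \<i> / E - 2 * \<i> / D))) + A * (- 2 * \<i> * of_nat n / E - 2 * \<i> * of_nat (Suc n) / D) * P) * e) (at w)"
    unfolding wave_gen_def
    using DERIV_mult'[OF DERIV_mult'[OF dA dP] de]
    by (simp add: A_def P_def e_def D_def E_def \<rho>_def)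
  have ode: "\<rho> * P2 = (\<rho> - 1) * P1 - of_nat n * P" unfolding P_def P1_def P2_def by (rule claguerre_ode)
  have zr: "z = \<rho> * D * E" using nz by (simp add: \<rho>_def)
  have wr: "wave_r n t r = A * e * (P1 / (D * E) - P / (2 * D))"
    unfolding wave_r_def wave_gen_def P_def P1_def A_def e_def \<rho>_def z_def w_def D_def E_def by (simp add: algebra_simps)
  have wrr: "wave_rr n t r = A * e * (P2 / (D * E)\<^sup>2 - P1 / (D\<^sup>2 * E) + P / (2 * D)\<^sup>2)"
    unfolding wave_rr_def wave_gen_def P_def P1_def P2_def A_def e_def \<rho>_def z_def w_def D_def E_def by (simp add: algebra_simps)
  have "(A * P) * (e * (\<i> * z / D\<^sup>2)) + (A * (P1 * (\<rho> * (2 * \<i> / E - 2 * \<i> / D))) + A * (- 2 * \<i> * of_nat n / E - 2 * \<i> * of_nat (Suc n) / D) * P) * e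
     = \<i> * (4 * (z * wave_rr n t r + wave_r n t r))"
  proof -
    have c1: "z * (P2 / (D * E)\<^sup>2) = (\<rho> * P2) / (D * E)"
      using nz by (simp add: zr power2_eq_square)
    have c2: "z * (P1 / (D\<^sup>2 * E)) = \<rho> * P1 / D" using nz by (simp add: zr power2_eq_square)
    have "z * wave_rr n t r + wave_r n t r
       = A * e * (((\<rho> - 1) * P1 - of_nat n * P) / (D * E) - \<rho> * P1 / D + z * P / (2 * D)\<^sup>2 + P1 / (D * E) - P / (2 * D))"
    proof -
      have gen: "z * (A * e * (a - b + c)) + A * e * (d - f) = A * e * (z * a - z * b + z * c + d - f)" for a b c d f
        by (simp add: algebra_simps)
      have c1': "z * P2 / (D * E)\<^sup>2 = ((\<rho> - 1) * P1 - of_nat n * P) / (D * E)" using c1 by (simp add: ode)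
      have c2': "z * P1 / (D\<^sup>2 * E) = \<rho> * P1 / D" using c2 by simp
      show ?thesis unfolding wr wrr gen times_divide_eq_right c1' c2' ..
    qed
    also have "\<dots> = A * e * ((\<rho> * P1 - of_nat n * P) / (D * E) - \<rho> * P1 / D + z * P / (2 * D)\<^sup>2 - P / (2 * D))"
      by (simp add: diff_divide_distrib add_divide_distrib algebra_simps)
    finally have R: "z * wave_rr n t r + wave_r n t r = \<dots>" .
    have inv: "1 / (D * E) = (1 / D + 1 / E) / 2" using nz by (simp add: field_simps) (simp add: DE)
    have "(\<rho> * P1 - of_nat n * P) / (D * E) = (\<rho> * P1 - of_nat n * P) * ((1 / D + 1 / E) / 2)"
      by (simp add: inv[symmetric])
    then have "z * wave_rr n t r + wave_r n t r
      = A * e * ((\<rho> * P1 - of_nat n * P) * ((1 / D + 1 / E) / 2) - \<rho> * P1 / D + z * P / (2 * D)\<^sup>2 - P / (2 * D))"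
      using R by simp
    then have R': "\<i> * (4 * (z * wave_rr n t r + wave_r n t r))
      = \<i> * A * e * (2 * (\<rho> * P1 - of_nat n * P) * (1 / D + 1 / E) - 4 * \<rho> * P1 * (1 / D) + z * P * (1 / D)\<^sup>2 - 2 * P * (1 / D))"
    proof -
      have gen: "\<i> * (4 * (A * e * (X * (S / 2) - a + b - c))) = \<i> * A * e * (2 * X * S - 4 * a + 4 * b - 4 * c)" for X S a b c
        by (simp add: algebra_simps)
      have s: "4 * (\<rho> * P1 / D) = 4 * \<rho> * P1 * (1 / D)" "4 * (z * P / (2 * D)\<^sup>2) = z * P * (1 / D)\<^sup>2"
        "4 * (P / (2 * D)) = 2 * P * (1 / D)"
        by (simp_all add: power_divide power_mult_distrib)
      assume R: "z * wave_rr n t r + wave_r n t r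
        = A * e * ((\<rho> * P1 - of_nat n * P) * ((1 / D + 1 / E) / 2) - \<rho> * P1 / D + z * P / (2 * D)\<^sup>2 - P / (2 * D))"
      show ?thesis unfolding R gen s ..
    qed
    have id: "(A * P) * (e * (\<i> * z * u\<^sup>2)) + (A * (P1 * (\<rho> * (2 * \<i> * v - 2 * \<i> * u))) + A * (- 2 * \<i> * m * v - 2 * \<i> * (m + 1) * u) * P) * e
      = \<i> * A * e * (2 * (\<rho> * P1 - m * P) * (u + v) - 4 * \<rho> * P1 * u + z * P * u\<^sup>2 - 2 * P * u)" for u v m
      by (simp add: algebra_simps)
    show ?thesis unfolding R' using id[of "inverse D" "inverse E" "of_nat n"]
      by (simp only: divide_inverse power_inverse of_nat_Suc mult_1_left add.commute[of 1])
  qed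
  with dall have "((\<lambda>w. wave_gen (claguerre n) n w z) has_field_derivative \<i> * (4 * (z * wave_rr n t r + wave_r n t r))) (at w)"
    by simp
  then show ?thesis unfolding wave_def z_def w_def by (rule has_vector_derivative_real_field)
qed

lemma wave_gen_continuous:
  "continuous_on UNIV (\<lambda>(t, r). wave_gen p n (complex_of_real t) (complex_of_real r))"
  unfolding wave_gen_def wave_amp_def split_beta
  by (intro continuous_intros ballI)
    (simp_all only: mult_eq_0_iff power_eq_0_iff one_plus_i_nonzero zero_neq_numeral zero_neq_numeral[symmetric] simp_thms)

lemma wave_continuous: "continuous_on UNIV (\<lambda>(t, r). wave n t r)"
  unfolding wave_def by (rule wave_gen_continuous)

lemma wave_r_continuous: "continuous_on UNIV (\<lambda>(t, r). wave_r n t r)"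
  unfolding wave_r_def split_beta
  by (intro continuous_intros ballI wave_gen_continuous[unfolded split_beta])
    (simp_all only: mult_eq_0_iff power_eq_0_iff one_plus_i_nonzero zero_neq_numeral zero_neq_numeral[symmetric] simp_thms)

lemma wave_rr_continuous: "continuous_on UNIV (\<lambda>(t, r). wave_rr n t r)"
  unfolding wave_rr_def split_beta
  by (intro continuous_intros ballI wave_gen_continuous[unfolded split_beta])
    (simp_all only: mult_eq_0_iff power_eq_0_iff one_plus_i_nonzero zero_neq_numeral zero_neq_numeral[symmetric] simp_thms)

text \<open>Parabolic scaling \<open>(t, r) \<mapsto> (\<alpha> t + \<beta>, \<alpha> r)\<close> preserves the equation since \<open>r\<close> is quadratic in \<open>x\<close>.\<close>

lemma scaled_wave_deriv:
  fixes \<alpha> \<beta> :: real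
  shows "((\<lambda>r. wave n s (\<alpha> * r)) has_vector_derivative of_real \<alpha> * wave_r n s (\<alpha> * r)) (at r)"
    and "((\<lambda>r. of_real \<alpha> * wave_r n s (\<alpha> * r)) has_vector_derivative of_real (\<alpha>\<^sup>2) * wave_rr n s (\<alpha> * r)) (at r)"
    and "((\<lambda>t. wave n (\<alpha> * t + \<beta>) (\<alpha> * r)) has_vector_derivative
      \<i> * (4 * (of_real r * (of_real (\<alpha>\<^sup>2) * wave_rr n (\<alpha> * t + \<beta>) (\<alpha> * r)) + of_real \<alpha> * wave_r n (\<alpha> * t + \<beta>) (\<alpha> * r)))) (at t)"
proof -
  have s: "((\<lambda>r. \<alpha> * r) has_vector_derivative \<alpha>) (at r)" for r
    by (auto intro!: derivative_eq_intros simp flip: has_real_derivative_iff_has_vector_derivative)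
  have l: "((\<lambda>t. \<alpha> * t + \<beta>) has_vector_derivative \<alpha>) (at t)" for t
    by (auto intro!: derivative_eq_intros simp flip: has_real_derivative_iff_has_vector_derivative)
  show "((\<lambda>r. wave n s (\<alpha> * r)) has_vector_derivative of_real \<alpha> * wave_r n s (\<alpha> * r)) (at r)"
    using vector_diff_chain_at[OF s wave_deriv_r] by (simp add: o_def scaleR_conv_of_real)
  have "((\<lambda>r. wave_r n s (\<alpha> * r)) has_vector_derivative of_real \<alpha> * wave_rr n s (\<alpha> * r)) (at r)"
    using vector_diff_chain_at[OF s wave_deriv_rr] by (simp add: o_def scaleR_conv_of_real)
  from has_vector_derivative_mult_right[OF this, of "of_real \<alpha>"]
  show "((\<lambda>r. of_real \<alpha> * wave_r n s (\<alpha> * r)) has_vector_derivative of_real (\<alpha>\<^sup>2) * wave_rr n s (\<alpha> * r)) (at r)"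
    by (simp add: power2_eq_square mult.assoc)
  show "((\<lambda>t. wave n (\<alpha> * t + \<beta>) (\<alpha> * r)) has_vector_derivative
      \<i> * (4 * (of_real r * (of_real (\<alpha>\<^sup>2) * wave_rr n (\<alpha> * t + \<beta>) (\<alpha> * r)) + of_real \<alpha> * wave_r n (\<alpha> * t + \<beta>) (\<alpha> * r)))) (at t)"
    using vector_diff_chain_at[OF l[of t] wave_deriv_t[of n "\<alpha> * r"]] by (simp add: o_def scaleR_conv_of_real algebra_simps power2_eq_square)
qed

lemma wave_weak_solution:
  fixes y :: "real^2"
  assumes "test_function \<psi>"
  shows "((\<lambda>s. \<integral>x. wave n (\<alpha> * s + \<beta>) (\<alpha> * (norm (x - y))\<^sup>2) * \<psi> x \<partial>lborel) has_vector_derivative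
      \<i> * (\<integral>x. wave n (\<alpha> * t + \<beta>) (\<alpha> * (norm (x - y))\<^sup>2) * laplacian \<psi> x \<partial>lborel)) (at t)"
proof (rule radial_classical_weak_solution[where g = "\<lambda>t r. wave n (\<alpha> * t + \<beta>) (\<alpha> * r)", OF _ _ _ _ _ assms])
  show "continuous_on UNIV (\<lambda>r. of_real (\<alpha>\<^sup>2) * wave_rr n (\<alpha> * t + \<beta>) (\<alpha> * r))" for t
  proof -
    have "continuous_on UNIV (\<lambda>r. (\<alpha> * t + \<beta>, \<alpha> * r))" by (intro continuous_intros)
    from continuous_on_compose2[OF wave_rr_continuous[of n] this]
    have "continuous_on UNIV (\<lambda>r. wave_rr n (\<alpha> * t + \<beta>) (\<alpha> * r))" by simp
    then show ?thesis by (intro continuous_intros)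
  qed
  have p: "continuous_on UNIV (\<lambda>(t, r). (\<alpha> * t + \<beta>, \<alpha> * r))"
    unfolding split_beta by (intro continuous_intros)
  have c: "continuous_on UNIV (\<lambda>(t, r). wave_rr n (\<alpha> * t + \<beta>) (\<alpha> * r))" "continuous_on UNIV (\<lambda>(t, r). wave_r n (\<alpha> * t + \<beta>) (\<alpha> * r))"
    using continuous_on_compose2[OF wave_rr_continuous[of n] p] continuous_on_compose2[OF wave_r_continuous[of n] p]
    by (simp_all add: split_beta)
  then show "continuous_on UNIV (\<lambda>(t, r). of_real r * (of_real (\<alpha>\<^sup>2) * wave_rr n (\<alpha> * t + \<beta>) (\<alpha> * r)) + of_real \<alpha> * wave_r n (\<alpha> * t + \<beta>) (\<alpha> * r))"
    unfolding split_beta by (intro continuous_intros)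
qed (rule scaled_wave_deriv)+

section \<open>Superpositions of waves\<close>

lemma laguerre_parseval_finite:
  fixes b :: "nat \<Rightarrow> complex"
  assumes "finite I"
  shows "integrable halfline (\<lambda>r. (norm (\<Sum>n\<in>I. b n * of_real (laguerre_fun n r)))\<^sup>2)"
    and "(\<integral>r. (norm (\<Sum>n\<in>I. b n * of_real (laguerre_fun n r)))\<^sup>2 \<partial>halfline) = (\<Sum>n\<in>I. (norm (b n))\<^sup>2)"
proof -
  let ?z = "\<lambda>r. \<Sum>n\<in>I. b n * of_real (laguerre_fun n r)"
  have e: "of_real ((norm (?z r))\<^sup>2) = (\<Sum>n\<in>I. \<Sum>m\<in>I. (b n * cnj (b m)) * of_real (laguerre_fun n r * laguerre_fun m r))" for r
    unfolding complex_norm_square cnj_sum sum_product by (intro sum.cong refl) simp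
  have i: "integrable halfline (\<lambda>r. (b n * cnj (b m)) * of_real (laguerre_fun n r * laguerre_fun m r))" for n m
    using integrable_laguerre_fun_mult[of n m] by (intro integrable_mult_right) (simp only: complex_of_real_integrable_eq)
  have "integrable halfline (\<lambda>r. of_real ((norm (?z r))\<^sup>2) :: complex)"
    unfolding e by (intro Bochner_Integration.integrable_sum i)
  then show "integrable halfline (\<lambda>r. (norm (?z r))\<^sup>2)" by (simp only: complex_of_real_integrable_eq)
  have "of_real (\<integral>r. (norm (?z r))\<^sup>2 \<partial>halfline) = (\<integral>r. of_real ((norm (?z r))\<^sup>2) \<partial>halfline :: complex)"
    by (simp only: integral_complex_of_real)
  also have "\<dots> = (\<Sum>n\<in>I. \<Sum>m\<in>I. (\<integral>r. (b n * cnj (b m)) * of_real (laguerre_fun n r * laguerre_fun m r) \<partial>halfline))"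
    unfolding e by (subst Bochner_Integration.integral_sum, intro Bochner_Integration.integrable_sum i,
      subst Bochner_Integration.integral_sum, rule i, rule refl)
  also have "\<dots> = (\<Sum>n\<in>I. \<Sum>m\<in>I. if n = m then of_real ((norm (b n))\<^sup>2) else 0)"
    by (intro sum.cong refl) (simp only: integral_mult_right_zero integral_complex_of_real laguerre_fun_orthonormal,
       simp add: complex_norm_square del: of_real_power)
  also have "\<dots> = of_real (\<Sum>n\<in>I. (norm (b n))\<^sup>2)" using assms by simp
  finally show "(\<integral>r. (norm (?z r))\<^sup>2 \<partial>halfline) = (\<Sum>n\<in>I. (norm (b n))\<^sup>2)" by (simp only: of_real_eq_iff)
qed

lemma nn_integral_halfline_scale:
  assumes [measurable]: "g \<in> borel_measurable borel" and l: "l > 0"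
  shows "(\<integral>\<^sup>+r. g (r / l) \<partial>halfline) = ennreal l * (\<integral>\<^sup>+r. g r \<partial>halfline)"
proof -
  have "(\<integral>\<^sup>+r. g (r / l) \<partial>halfline) = (\<integral>\<^sup>+r. indicator {0..} r * g (r / l) \<partial>lborel)"
    unfolding halfline_def by (subst nn_integral_density) auto
  also have "\<dots> = ennreal l * (\<integral>\<^sup>+r. indicator {0..} (l * r) * g (l * r / l) \<partial>lborel)"
    using l by (subst nn_integral_real_affine[of _ l 0]) auto
  also have "(\<integral>\<^sup>+r. indicator {0..} (l * r) * g (l * r / l) \<partial>lborel) = (\<integral>\<^sup>+r. indicator {0..} r * g r \<partial>lborel)"
    using l by (intro nn_integral_cong) (auto simp: indicator_def zero_le_mult_iff)
  also have "\<dots> = (\<integral>\<^sup>+r. g r \<partial>halfline)" unfolding halfline_def by (subst nn_integral_density) auto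
  finally show ?thesis .
qed

text \<open>The Cayley transform of the time line onto the unit circle.\<close>

definition phase :: "real \<Rightarrow> complex" where
  "phase t = (1 - 2 * \<i> * of_real t) / (1 + 2 * \<i> * of_real t)"

lemma norm_one_plus: "norm (1 + 2 * \<i> * complex_of_real t) = sqrt (1 + 4 * t\<^sup>2)" "norm (1 - 2 * \<i> * complex_of_real t) = sqrt (1 + 4 * t\<^sup>2)"
  by (simp_all add: cmod_def power2_eq_square)

lemma one_plus_pos: "1 + 4 * t\<^sup>2 > (0::real)"
  by (simp add: add_pos_nonneg)

lemma norm_phase: "norm (phase t) = 1"
  using one_plus_pos[of t] by (simp add: phase_def norm_divide norm_one_plus)

text \<open>At real time the exponential splits into modulus and argument: apart from the unimodular factors the
wave is the Laguerre function dilated by \<open>1 + 4 t\<^sup>2\<close>.\<close>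

lemma wave_eq:
  fixes t r :: real
  defines "\<rho> \<equiv> r / (1 + 4 * t\<^sup>2)"
  shows "wave n t r = cis (t * \<rho>) / (1 + 2 * \<i> * of_real t) * (phase t ^ n * of_real (laguerre_fun n \<rho>))"
proof -
  define D where "D = 1 + 2 * \<i> * complex_of_real t"
  define E where "E = 1 - 2 * \<i> * complex_of_real t"
  have nz: "D \<noteq> 0" "E \<noteq> 0" using one_plus_i_nonzero by (auto simp: D_def E_def)
  have DE: "D * E = of_real (1 + 4 * t\<^sup>2)" by (simp add: D_def E_def algebra_simps power2_eq_square)
  have \<rho>: "complex_of_real r / (D * E) = of_real \<rho>" unfolding DE \<rho>_def by simp
  have "- complex_of_real r / (2 * D) = - (of_real r / (D * E)) * E / 2" using nz by (simp add: field_simps)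
  also have "\<dots> = of_real (- \<rho> / 2) + \<i> * of_real (t * \<rho>)" unfolding \<rho> unfolding E_def by (simp add: algebra_simps diff_divide_distrib)
  finally have "exp (- complex_of_real r / (2 * D)) = of_real (exp (- \<rho> / 2)) * cis (t * \<rho>)"
    by (simp only: exp_add exp_of_real cis_conv_exp)
  then show ?thesis
    unfolding wave_def wave_gen_def wave_amp_def D_def[symmetric] E_def[symmetric] phase_def \<rho> poly_claguerre laguerre_fun_def
    by (simp add: mult_ac)
qed

definition wave_sum :: "(nat \<Rightarrow> complex) \<Rightarrow> nat \<Rightarrow> real \<Rightarrow> real \<Rightarrow> complex" where
  "wave_sum c K t r = (\<Sum>n<K. c n * wave n t r)"

lemma norm_wave_sum:
  "norm (wave_sum c K t r) = norm (\<Sum>n<K. (c n * phase t ^ n) * of_real (laguerre_fun n (r / (1 + 4 * t\<^sup>2)))) / sqrt (1 + 4 * t\<^sup>2)"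
proof -
  have "wave_sum c K t r = cis (t * (r / (1 + 4 * t\<^sup>2))) / (1 + 2 * \<i> * of_real t)
     * (\<Sum>n<K. (c n * phase t ^ n) * of_real (laguerre_fun n (r / (1 + 4 * t\<^sup>2))))"
    unfolding wave_sum_def wave_eq sum_distrib_left by (intro sum.cong refl) (simp only: mult_ac)
  then show ?thesis by (simp only: norm_mult norm_divide norm_cis norm_one_plus) simp
qed

lemma continuous_wave_sum: "continuous_on UNIV (\<lambda>(t, r). wave_sum c K t r)"
  unfolding wave_sum_def split_beta
  by (intro continuous_intros wave_continuous[unfolded split_beta])

lemma continuous_wave_sum_r: "continuous_on A (wave_sum c K t)"
proof -
  have "continuous_on UNIV (\<lambda>r. (t, r))" by (intro continuous_intros)
  from continuous_on_compose2[OF continuous_wave_sum this]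
  show ?thesis by (auto intro: continuous_on_subset)
qed

lemma borel_wave_sum_r [measurable]: "wave_sum c K t \<in> borel_measurable borel"
  by (rule borel_measurable_continuous_onI[OF continuous_wave_sum_r])

text \<open>The unimodular factors and the dilation drop out, so the norm is that of the coefficients at all times.\<close>

lemma wave_sum_L2:
  "(\<integral>\<^sup>+x. ennreal ((norm (wave_sum c K t ((norm (x::real^2))\<^sup>2)))\<^sup>2) \<partial>lborel) = ennreal (pi * (\<Sum>n<K. (norm (c n))\<^sup>2))"
proof -
  let ?z = "\<lambda>r. \<Sum>n<K. (c n * phase t ^ n) * of_real (laguerre_fun n r)"
  define l where "l = 1 + 4 * t\<^sup>2"
  have l: "l > 0" unfolding l_def by (rule one_plus_pos)
  have "(\<integral>\<^sup>+x. ennreal ((norm (wave_sum c K t ((norm (x::real^2))\<^sup>2)))\<^sup>2) \<partial>lborel)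
     = ennreal pi * (\<integral>\<^sup>+r. ennreal ((norm (wave_sum c K t r))\<^sup>2) \<partial>halfline)"
    by (rule nn_integral_radial) measurable
  also have "(\<integral>\<^sup>+r. ennreal ((norm (wave_sum c K t r))\<^sup>2) \<partial>halfline) = (\<integral>\<^sup>+r. ennreal ((norm (?z (r / l)))\<^sup>2 / l) \<partial>halfline)"
    using l by (intro nn_integral_cong) (simp add: norm_wave_sum power_divide less_imp_le flip: l_def)
  also have "\<dots> = ennreal l * (\<integral>\<^sup>+r. ennreal ((norm (?z r))\<^sup>2 / l) \<partial>halfline)"
    by (rule nn_integral_halfline_scale[OF _ l]) measurable
  also have "(\<integral>\<^sup>+r. ennreal ((norm (?z r))\<^sup>2 / l) \<partial>halfline) = ennreal (\<integral>r. (norm (?z r))\<^sup>2 / l \<partial>halfline)"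
    using laguerre_parseval_finite(1)[of "{..<K}"] l by (intro nn_integral_eq_integral) (auto simp: less_imp_le)
  also have "(\<integral>r. (norm (?z r))\<^sup>2 / l \<partial>halfline) = (\<Sum>n<K. (norm (c n))\<^sup>2) / l"
    by (simp add: laguerre_parseval_finite(2) norm_mult norm_power norm_phase)
  also have "ennreal pi * (ennreal l * ennreal ((\<Sum>n<K. (norm (c n))\<^sup>2) / l)) = ennreal (pi * (l * ((\<Sum>n<K. (norm (c n))\<^sup>2) / l)))"
  proof -
    have "ennreal pi * (ennreal l * ennreal x) = ennreal (pi * (l * x))" if "x \<ge> 0" for x
      using l that by (simp add: ennreal_mult)
    then show ?thesis using l by (simp only: sum_nonneg zero_le_power2 divide_nonneg_pos)
  qed
  also have "l * ((\<Sum>n<K. (norm (c n))\<^sup>2) / l) = (\<Sum>n<K. (norm (c n))\<^sup>2)" using l by simp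
  finally show ?thesis .
qed

section \<open>Orthogonality of the powers of the phase\<close>

lemma nn_integral_Cauchy_density: "(\<integral>\<^sup>+t. ennreal (1 / (1 + 4 * t\<^sup>2)) \<partial>lborel) = ennreal (pi / 2)"
proof -
  have half: "(\<integral>\<^sup>+t. ennreal (1 / (1 + 4 * t\<^sup>2)) * indicator {0..} t \<partial>lborel) = ennreal (pi / 4 - arctan (2 * 0) / 2)"
  proof (rule nn_integral_FTC_atLeast)
    show "DERIV (\<lambda>t. arctan (2 * t) / 2) t :> 1 / (1 + 4 * t\<^sup>2)" for t
    proof -
      have "DERIV (\<lambda>t. arctan (2 * t)) t :> inverse (1 + (2 * t)\<^sup>2) * (2 * 1)"
        by (rule DERIV_chain2[OF DERIV_arctan DERIV_cmult[OF DERIV_ident]])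
      from DERIV_cdivide[OF this, of 2] have "DERIV (\<lambda>t. arctan (2 * t) / 2) t :> inverse (1 + (2 * t)\<^sup>2)" by simp
      moreover have "inverse (1 + (2 * t)\<^sup>2) = 1 / (1 + 4 * t\<^sup>2)" by (simp add: power_mult_distrib inverse_eq_divide)
      ultimately show ?thesis by (simp only:)
    qed
    have f1: "filterlim (\<lambda>t::real. 2 * t) at_top at_top"
      by (rule filterlim_tendsto_pos_mult_at_top[OF tendsto_const zero_less_numeral filterlim_ident])
    have f2: "((\<lambda>t. arctan (2 * t)) \<longlongrightarrow> pi / 2) at_top"
      by (rule filterlim_compose[OF tendsto_arctan_at_top f1])
    have "((\<lambda>t. arctan (2 * t) * (1/2)) \<longlongrightarrow> pi / 2 * (1/2)) at_top"
      by (rule tendsto_mult_right[OF f2])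
    then show "((\<lambda>t. arctan (2 * t) / 2) \<longlongrightarrow> pi / 4) at_top" by simp
    show "0 \<le> 1 / (1 + 4 * t\<^sup>2)" for t :: real using one_plus_pos[of t] by simp
  qed measurable
  have "(\<integral>\<^sup>+t. ennreal (1 / (1 + 4 * t\<^sup>2)) * indicator {..0} t \<partial>lborel)
      = (\<integral>\<^sup>+t. ennreal (1 / (1 + 4 * t\<^sup>2)) * indicator {0..} t \<partial>lborel)"
    by (subst nn_integral_real_affine[of _ "-1" 0]) (auto intro!: nn_integral_cong simp: indicator_def)
  note this[unfolded half]
  moreover have "(\<integral>\<^sup>+t. ennreal (1 / (1 + 4 * t\<^sup>2)) \<partial>lborel)
     = (\<integral>\<^sup>+t. ennreal (1 / (1 + 4 * t\<^sup>2)) * indicator {0..} t + ennreal (1 / (1 + 4 * t\<^sup>2)) * indicator {..0} t \<partial>lborel)"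
    by (rule nn_integral_cong_AE, rule AE_mp[OF AE_lborel_singleton[of 0]], rule AE_I2) (auto simp: indicator_def)
  ultimately show ?thesis using half
    by (simp add: nn_integral_add ennreal_plus[symmetric] del: ennreal_plus)
qed

lemma integrable_Cauchy_density: "integrable lborel (\<lambda>t::real. 1 / (1 + 4 * t\<^sup>2))"
  and integral_Cauchy_density: "(\<integral>t. 1 / (1 + 4 * t\<^sup>2) \<partial>lborel) = pi / 2"
proof -
  have nn: "1 / (1 + 4 * t\<^sup>2) \<ge> 0" for t :: real using one_plus_pos[of t] by simp
  show "integrable lborel (\<lambda>t::real. 1 / (1 + 4 * t\<^sup>2))"
    by (rule integrableI_nonneg) (use nn nn_integral_Cauchy_density in auto)
  show "(\<integral>t. 1 / (1 + 4 * t\<^sup>2) \<partial>lborel) = pi / 2"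
    by (subst integral_eq_nn_integral) (use nn nn_integral_Cauchy_density in auto)
qed

text \<open>The density \<open>1 / (1 + 4 t\<^sup>2)\<close> is the speed of the phase up to a constant, so that it measures arc length.\<close>

lemma phase_deriv: "(phase has_vector_derivative - 4 * \<i> * phase t / of_real (1 + 4 * t\<^sup>2)) (at t)"
proof -
  define w where "w = complex_of_real t"
  define D where "D = 1 + 2 * \<i> * w"
  define E where "E = 1 - 2 * \<i> * w"
  have nz: "D \<noteq> 0" "E \<noteq> 0" using one_plus_i_nonzero by (auto simp: D_def E_def w_def)
  have DE: "of_real (1 + 4 * t\<^sup>2) = D * E" by (simp add: D_def E_def w_def algebra_simps power2_eq_square)
  have n: "((\<lambda>w. 1 - 2 * \<i> * w) has_field_derivative - 2 * \<i>) (at w)" "((\<lambda>w. 1 + 2 * \<i> * w) has_field_derivative 2 * \<i>) (at w)"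
    by (auto intro!: derivative_eq_intros)
  have "((\<lambda>w. (1 - 2 * \<i> * w) / (1 + 2 * \<i> * w)) has_field_derivative (- 2 * \<i> * D - E * (2 * \<i>)) / (D * D)) (at w)"
    using DERIV_divide[OF n] nz unfolding D_def E_def by simp
  moreover have "(- 2 * \<i> * D - E * (2 * \<i>)) / (D * D) = - 4 * \<i> * (E / D) / (D * E)"
  proof -
    have "D + E = 2" by (simp add: D_def E_def)
    have "- 2 * \<i> * D - E * (2 * \<i>) = - 2 * \<i> * (D + E)" by (simp add: algebra_simps)
    also have "\<dots> = - 4 * \<i>" unfolding \<open>D + E = 2\<close> by simp
    finally show ?thesis using nz by simp
  qed
  ultimately have "((\<lambda>w. (1 - 2 * \<i> * w) / (1 + 2 * \<i> * w)) has_field_derivative - 4 * \<i> * (E / D) / (D * E)) (at w)" by simp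
  from has_vector_derivative_real_field[OF this[unfolded w_def]]
  show ?thesis unfolding DE phase_def[abs_def] by (simp add: D_def E_def w_def)
qed

lemma continuous_phase: "continuous_on A phase"
  using phase_deriv by (meson continuous_at_imp_continuous_on has_vector_derivative_continuous)

lemma phase_limit: "(phase \<longlongrightarrow> -1) at_top" "(phase \<longlongrightarrow> -1) at_bot"
proof -
  have e: "norm (phase t + 1) \<le> inverse \<bar>t\<bar>" if "t \<noteq> 0" for t
  proof -
    have "phase t + 1 = 2 / (1 + 2 * \<i> * of_real t)"
    proof -
      define D where "D = 1 + 2 * \<i> * complex_of_real t"
      have "D \<noteq> 0" using one_plus_i_nonzero by (simp add: D_def)
      have e2: "1 - 2 * \<i> * complex_of_real t = 2 - D" by (simp add: D_def)
      show ?thesis unfolding phase_def D_def[symmetric] e2 using \<open>D \<noteq> 0\<close>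
        by (simp add: diff_divide_distrib)
    qed
    then have "norm (phase t + 1) = 2 / sqrt (1 + 4 * t\<^sup>2)" by (simp add: norm_divide norm_one_plus)
    also have "\<dots> \<le> 2 / (2 * \<bar>t\<bar>)"
    proof (rule divide_left_mono)
      show "2 * \<bar>t\<bar> \<le> sqrt (1 + 4 * t\<^sup>2)" by (rule real_le_rsqrt) (simp add: power_mult_distrib)
      show "0 < sqrt (1 + 4 * t\<^sup>2) * (2 * \<bar>t\<bar>)" using that one_plus_pos[of t] by simp
    qed simp
    finally show ?thesis by (simp add: inverse_eq_divide)
  qed
  have "((\<lambda>t. phase t + 1) \<longlongrightarrow> 0) at_top"
  proof (rule Lim_null_comparison)
    show "\<forall>\<^sub>F t in at_top. norm (phase t + 1) \<le> inverse \<bar>t\<bar>"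
      using eventually_gt_at_top[of 0] by eventually_elim (rule e, simp)
    show "((\<lambda>t::real. inverse \<bar>t\<bar>) \<longlongrightarrow> 0) at_top"
      using tendsto_inverse_0_at_top[OF filterlim_abs_real] by simp
  qed
  from tendsto_diff[OF this tendsto_const[of 1]] show "(phase \<longlongrightarrow> -1) at_top" by simp
  have "((\<lambda>t. phase t + 1) \<longlongrightarrow> 0) at_bot"
  proof (rule Lim_null_comparison)
    show "\<forall>\<^sub>F t in at_bot. norm (phase t + 1) \<le> inverse \<bar>t\<bar>"
      using eventually_gt_at_bot[of 0] by eventually_elim (rule e, simp)
    show "((\<lambda>t::real. inverse \<bar>t\<bar>) \<longlongrightarrow> 0) at_bot"
      unfolding filterlim_at_bot_mirror
      using tendsto_inverse_0_at_top[OF filterlim_abs_real] by simp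
  qed
  from tendsto_diff[OF this tendsto_const[of 1]] show "(phase \<longlongrightarrow> -1) at_bot" by simp
qed

text \<open>The primitive \<open>phase t ^ k / (-4 \<i> k)\<close> has the same limit at both ends of the line.\<close>

lemma integral_phase_power:
  assumes "k > 0"
  shows "integrable lborel (\<lambda>t. phase t ^ k / of_real (1 + 4 * t\<^sup>2))" "(\<integral>t. phase t ^ k / of_real (1 + 4 * t\<^sup>2) \<partial>lborel) = 0"
proof -
  have c: "continuous_on UNIV (\<lambda>t. phase t ^ k / of_real (1 + 4 * t\<^sup>2))"
    using one_plus_pos by (intro continuous_intros continuous_phase) (auto simp flip: of_real_add of_real_power simp: less_imp_neq[symmetric])
  show i: "integrable lborel (\<lambda>t. phase t ^ k / of_real (1 + 4 * t\<^sup>2))"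
  proof (rule Bochner_Integration.integrable_bound[OF integrable_Cauchy_density])
    show "(\<lambda>t. phase t ^ k / of_real (1 + 4 * t\<^sup>2)) \<in> borel_measurable lborel"
      using borel_measurable_continuous_onI[OF c] by simp
    show "AE t in lborel. norm (phase t ^ k / of_real (1 + 4 * t\<^sup>2)) \<le> norm (1 / (1 + 4 * t\<^sup>2))"
      by (intro AE_I2) (simp only: norm_divide norm_power norm_phase norm_of_real power_one norm_one real_norm_def abs_one abs_divide order_refl)
  qed
  have "(\<integral>t. phase t ^ k / of_real (1 + 4 * t\<^sup>2) \<partial>lborel) = (- 1) ^ k / (- 4 * \<i> * of_nat k) - (- 1) ^ k / (- 4 * \<i> * of_nat k)"
  proof (rule integral_real_line_derivative[where F = "\<lambda>t. phase t ^ k / (- 4 * \<i> * of_nat k)", OF _ c i])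
    fix t
    have dz: "((\<lambda>z::complex. z ^ k) has_field_derivative of_nat k * z ^ (k - 1)) (at z)" for z
      by (auto intro!: derivative_eq_intros)
    have "((\<lambda>t. phase t ^ k) has_vector_derivative of_nat k * phase t ^ (k - 1) * (- 4 * \<i> * phase t / of_real (1 + 4 * t\<^sup>2))) (at t)"
      using field_vector_diff_chain_at[OF phase_deriv[of t] dz] by (simp add: o_def mult_ac)
    from has_vector_derivative_divide[OF this, of "- 4 * \<i> * of_nat k"]
    have dd: "((\<lambda>t. phase t ^ k / (- 4 * \<i> * of_nat k)) has_vector_derivative
      of_nat k * phase t ^ (k - 1) * (- 4 * \<i> * phase t / of_real (1 + 4 * t\<^sup>2)) / (- 4 * \<i> * of_nat k)) (at t)" .
    show "((\<lambda>t. phase t ^ k / (- 4 * \<i> * of_nat k)) has_vector_derivative phase t ^ k / of_real (1 + 4 * t\<^sup>2)) (at t)"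
    proof -
      have c: "- 4 * \<i> * of_nat k \<noteq> (0::complex)" using assms by simp
      have "of_nat k * p * (- 4 * \<i> * q / X) = (- 4 * \<i> * of_nat k) * (p * q / X)" for p q X :: complex by simp
      then have "of_nat k * p * (- 4 * \<i> * q / X) / (- 4 * \<i> * of_nat k) = p * q / X" for p q X :: complex
        by (simp only: nonzero_mult_div_cancel_left[OF c])
      with dd show ?thesis by (simp only: power_minus_mult[OF assms])
    qed
  qed (intro tendsto_intros phase_limit; use assms in simp)+
  then show "(\<integral>t. phase t ^ k / of_real (1 + 4 * t\<^sup>2) \<partial>lborel) = 0" by simp
qed

section \<open>The space-time norm of a superposition\<close>

lemma laguerre_fun_mult:
  "laguerre_fun n r * laguerre_fun m r = (\<Sum>k\<le>n+m. linearization n m k * laguerre_fun k (2 * r))"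
proof -
  have "exp (- r / 2) * exp (- r / 2) = exp (- (2 * r) / 2)" by (simp flip: exp_add)
  then have "laguerre_fun n r * laguerre_fun m r = (poly (laguerre n) r * poly (laguerre m) r) * exp (- (2 * r) / 2)"
    by (simp add: laguerre_fun_def mult_ac)
  then show ?thesis unfolding poly_laguerre_mult laguerre_fun_def by (simp add: sum_distrib_right mult.assoc)
qed

lemma phase_parseval_finite:
  fixes b :: "nat \<Rightarrow> complex"
  assumes "finite I"
  shows "(\<integral>\<^sup>+t. ennreal ((norm (\<Sum>n\<in>I. b n * phase t ^ n))\<^sup>2 / (1 + 4 * t\<^sup>2)) \<partial>lborel)
    = ennreal (pi / 2 * (\<Sum>n\<in>I. (norm (b n))\<^sup>2))"
proof -
  define W where "W n m t = phase t ^ n * cnj (phase t ^ m) / complex_of_real (1 + 4 * t\<^sup>2)" for n m t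
  have unit: "phase t * cnj (phase t) = 1" for t
    using norm_phase[of t] by (metis complex_norm_square of_real_1 power_one)
  have unit_pow: "phase t ^ k * cnj (phase t ^ k) = 1" for t k
    by (simp add: unit flip: power_mult_distrib)
  have diag: "W n n t = of_real (1 / (1 + 4 * t\<^sup>2))" for n t unfolding W_def unit_pow by simp
  have upper: "W (m + k) m t = phase t ^ k / of_real (1 + 4 * t\<^sup>2)" for m k t
  proof -
    have "phase t ^ (m + k) * cnj (phase t ^ m) = phase t ^ k * (phase t ^ m * cnj (phase t ^ m))"
      by (simp add: power_add mult_ac)
    then show ?thesis unfolding W_def unit_pow by simp
  qed
  have lower: "W n m t = cnj (W m n t)" for n m t unfolding W_def by simp
  have up: "integrable lborel (W n m)" "(\<integral>t. W n m t \<partial>lborel) = 0" if "m < n" for n m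
  proof -
    obtain k where k: "n = m + k" "k > 0" using \<open>m < n\<close> by (metis less_imp_add_positive)
    have e: "W n m = (\<lambda>t. phase t ^ k / of_real (1 + 4 * t\<^sup>2))" unfolding k(1) by (rule ext, rule upper)
    show "integrable lborel (W n m)" "(\<integral>t. W n m t \<partial>lborel) = 0"
      unfolding e using integral_phase_power[OF k(2)] by auto
  qed
  have W: "integrable lborel (W n m)" "(\<integral>t. W n m t \<partial>lborel) = (if n = m then of_real (pi / 2) else 0)" for n m
  proof -
    consider "n = m" | "m < n" | "n < m" by linarith
    then have "integrable lborel (W n m) \<and> (\<integral>t. W n m t \<partial>lborel) = (if n = m then of_real (pi / 2) else 0)"
    proof cases
      case 1
      have e: "W n n = (\<lambda>t. of_real (1 / (1 + 4 * t\<^sup>2)))" by (rule ext, rule diag)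
      have "integrable lborel (W n n)" unfolding e complex_of_real_integrable_eq by (rule integrable_Cauchy_density)
      moreover have "(\<integral>t. W n n t \<partial>lborel) = of_real (pi / 2)"
        unfolding e integral_complex_of_real integral_Cauchy_density ..
      ultimately show ?thesis using 1 by simp
    next
      case 2 then show ?thesis using up by simp
    next
      case 3
      have e: "W n m = (\<lambda>t. cnj (W m n t))" by (rule ext, rule lower)
      have "integrable lborel (\<lambda>t. cnj (W m n t))" by (rule integrable_cnj[OF up(1)[OF 3]])
      moreover have "(\<integral>t. cnj (W m n t) \<partial>lborel) = 0" using up(2)[OF 3] by (simp only: Bochner_Integration.integral_cnj complex_cnj_zero)
      ultimately show ?thesis using 3 by (simp flip: e)
    qed
    then show "integrable lborel (W n m)" "(\<integral>t. W n m t \<partial>lborel) = (if n = m then of_real (pi / 2) else 0)" by auto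
  qed
  let ?q = "\<lambda>t. (norm (\<Sum>n\<in>I. b n * phase t ^ n))\<^sup>2 / (1 + 4 * t\<^sup>2)"
  have e: "of_real (?q t) = (\<Sum>n\<in>I. \<Sum>m\<in>I. (b n * cnj (b m)) * W n m t)" for t
    unfolding of_real_divide complex_norm_square cnj_sum sum_product sum_divide_distrib W_def
    by (intro sum.cong refl) simp
  have "integrable lborel (\<lambda>t. of_real (?q t) :: complex)"
    unfolding e by (intro Bochner_Integration.integrable_sum integrable_mult_right W)
  then have i: "integrable lborel ?q" by (simp only: complex_of_real_integrable_eq)
  have "of_real (\<integral>t. ?q t \<partial>lborel) = (\<integral>t. of_real (?q t) \<partial>lborel :: complex)"
    by (simp only: integral_complex_of_real)
  also have "\<dots> = (\<Sum>n\<in>I. \<Sum>m\<in>I. (\<integral>t. (b n * cnj (b m)) * W n m t \<partial>lborel))"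
    unfolding e by (subst Bochner_Integration.integral_sum, intro Bochner_Integration.integrable_sum integrable_mult_right W,
      subst Bochner_Integration.integral_sum, rule integrable_mult_right, rule W, rule refl)
  also have "\<dots> = (\<Sum>n\<in>I. \<Sum>m\<in>I. if n = m then of_real (pi / 2 * (norm (b n))\<^sup>2) else 0)"
    by (intro sum.cong refl) (simp only: integral_mult_right_zero W,
       simp add: complex_norm_square[symmetric] del: of_real_power)
  also have "\<dots> = of_real (pi / 2 * (\<Sum>n\<in>I. (norm (b n))\<^sup>2))" using assms by (simp add: sum_distrib_left)
  finally have v: "(\<integral>t. ?q t \<partial>lborel) = pi / 2 * (\<Sum>n\<in>I. (norm (b n))\<^sup>2)" by (simp only: of_real_eq_iff)
  have "AE t in lborel. 0 \<le> ?q t" by (intro AE_I2 divide_nonneg_pos zero_le_power2 one_plus_pos)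
  from nn_integral_eq_integral[OF i this] show ?thesis by (simp only: v)
qed

text \<open>The coefficient of \<open>phase t ^ N\<close> and of the \<open>k\<close>-th dilated Laguerre function in the square of a wave sum.\<close>

definition antidiagonal :: "(nat \<Rightarrow> complex) \<Rightarrow> nat \<Rightarrow> nat \<Rightarrow> complex" where
  "antidiagonal c N k = (\<Sum>n\<le>N. of_real (linearization n (N - n) k) * (c n * c (N - n)))"

lemma sum_triangle_swap:
  fixes g :: "nat \<Rightarrow> nat \<Rightarrow> 'a::comm_monoid_add"
  shows "(\<Sum>N<M. \<Sum>k\<le>N. g N k) = (\<Sum>k<M. \<Sum>N\<in>{k..<M}. g N k)"
  by (simp add: sum.Sigma)
     (rule sum.reindex_bij_witness[of _ "\<lambda>(k, N). (N, k)" "\<lambda>(N, k). (k, N)"], auto)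

text \<open>The square of a finite sum by antidiagonals. As \<open>a\<close> vanishes from \<open>K\<close> on, the antidiagonals below
\<open>2 * K\<close> contain all nonzero products.\<close>

lemma sum_product_triangle:
  fixes a :: "nat \<Rightarrow> 'a::idom"
  assumes "\<And>n. n \<ge> K \<Longrightarrow> a n = 0"
  shows "(\<Sum>n<K. a n) * (\<Sum>n<K. a n) = (\<Sum>N<2*K. \<Sum>n\<le>N. a n * a (N - n))"
proof -
  have lt: "n < K" if "a n \<noteq> 0" for n using assms[of n] that not_less by blast
  have "(\<Sum>n<K. a n) * (\<Sum>n<K. a n) = (\<Sum>(i,j)\<in>{..<K}\<times>{..<K}. a i * a j)"
    by (simp add: sum_product sum.cartesian_product)
  also have "\<dots> = (\<Sum>(i,j)\<in>{(i,j). i + j < 2*K}. a i * a j)"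
  proof (rule sum.mono_neutral_left)
    show "finite {(i, j). i + j < 2*K}" by (rule finite_subset[of _ "{..2*K} \<times> {..2*K}"]) auto
  qed (auto intro: lt)
  also have "\<dots> = (\<Sum>N<2*K. \<Sum>n\<le>N. a n * a (N - n))" by (rule sum.triangle_reindex)
  finally show ?thesis .
qed

lemma laguerre_sum_square:
  fixes c :: "nat \<Rightarrow> complex"
  assumes c: "\<And>n. n \<ge> K \<Longrightarrow> c n = 0"
  shows "(\<Sum>n<K. (c n * w ^ n) * of_real (laguerre_fun n r))\<^sup>2
    = (\<Sum>k<2*K. (\<Sum>N\<in>{k..<2*K}. antidiagonal c N k * w ^ N) * of_real (laguerre_fun k (2 * r)))"
proof -
  let ?l = "\<lambda>k. complex_of_real (laguerre_fun k (2 * r))"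
  have "(\<Sum>n<K. (c n * w ^ n) * of_real (laguerre_fun n r))\<^sup>2
     = (\<Sum>N<2*K. \<Sum>n\<le>N. ((c n * w ^ n) * of_real (laguerre_fun n r)) * ((c (N - n) * w ^ (N - n)) * of_real (laguerre_fun (N - n) r)))"
    unfolding power2_eq_square by (rule sum_product_triangle) (simp add: c)
  also have "\<dots> = (\<Sum>N<2*K. \<Sum>k\<le>N. antidiagonal c N k * w ^ N * ?l k)"
  proof (rule sum.cong[OF refl])
    fix N
    have "(\<Sum>n\<le>N. ((c n * w ^ n) * of_real (laguerre_fun n r)) * ((c (N - n) * w ^ (N - n)) * of_real (laguerre_fun (N - n) r)))
       = (\<Sum>n\<le>N. \<Sum>k\<le>N. of_real (linearization n (N - n) k) * (c n * c (N - n)) * (w ^ N * ?l k))"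
    proof (intro sum.cong refl)
      fix n assume n: "n \<in> {..N}"
      have "w ^ N = w ^ n * w ^ (N - n)" using n by (simp flip: power_add)
      then have "((c n * w ^ n) * of_real (laguerre_fun n r)) * ((c (N - n) * w ^ (N - n)) * of_real (laguerre_fun (N - n) r))
         = (c n * c (N - n)) * w ^ N * of_real (laguerre_fun n r * laguerre_fun (N - n) r)"
        by (simp add: mult_ac)
      also have "\<dots> = (\<Sum>k\<le>N. of_real (linearization n (N - n) k) * (c n * c (N - n)) * (w ^ N * ?l k))"
        using n by (simp add: laguerre_fun_mult sum_distrib_left mult_ac)
      finally show "((c n * w ^ n) * of_real (laguerre_fun n r)) * ((c (N - n) * w ^ (N - n)) * of_real (laguerre_fun (N - n) r))
         = (\<Sum>k\<le>N. of_real (linearization n (N - n) k) * (c n * c (N - n)) * (w ^ N * ?l k))" .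
    qed
    also have "\<dots> = (\<Sum>k\<le>N. antidiagonal c N k * w ^ N * ?l k)"
      unfolding antidiagonal_def by (subst sum.swap) (simp add: sum_distrib_right mult.assoc)
    finally show "(\<Sum>n\<le>N. ((c n * w ^ n) * of_real (laguerre_fun n r)) * ((c (N - n) * w ^ (N - n)) * of_real (laguerre_fun (N - n) r)))
       = (\<Sum>k\<le>N. antidiagonal c N k * w ^ N * ?l k)" .
  qed
  also have "\<dots> = (\<Sum>k<2*K. \<Sum>N\<in>{k..<2*K}. antidiagonal c N k * w ^ N * ?l k)"
    by (rule sum_triangle_swap)
  finally show ?thesis by (simp add: sum_distrib_right)
qed

text \<open>The square of the wave sum is expanded in the dilated Laguerre functions. Parseval's identity in space, and then
in the phase, turns the fourth power into a sum of squares.\<close>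

lemma wave_sum_L4:
  fixes c :: "nat \<Rightarrow> complex"
  assumes c: "\<And>n. n \<ge> K \<Longrightarrow> c n = 0"
  shows "(\<integral>\<^sup>+t. \<integral>\<^sup>+x. ennreal ((norm (wave_sum c K t ((norm (x::real^2))\<^sup>2)))^4) \<partial>lborel \<partial>lborel)
     = ennreal (pi\<^sup>2 / 4 * (\<Sum>N<2*K. \<Sum>k\<le>N. (norm (antidiagonal c N k))\<^sup>2))"
proof -
  define e where "e t k = (\<Sum>N\<in>{k..<2*K}. antidiagonal c N k * phase t ^ N)" for t k
  have inner: "(\<integral>\<^sup>+x. ennreal ((norm (wave_sum c K t ((norm (x::real^2))\<^sup>2)))^4) \<partial>lborel)
     = (\<Sum>k<2*K. ennreal (pi / 2) * ennreal ((norm (e t k))\<^sup>2 / (1 + 4 * t\<^sup>2)))" for t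
  proof -
    let ?z = "\<lambda>r. \<Sum>n<K. (c n * phase t ^ n) * of_real (laguerre_fun n r)"
    let ?y = "\<lambda>r. \<Sum>k\<in>{..<2*K}. e t k * of_real (laguerre_fun k r)"
    define l where "l = 1 + 4 * t\<^sup>2"
    have l: "l > 0" unfolding l_def by (rule one_plus_pos)
    (* The Laguerre functions in the square have the argument 2 r; integrating them costs a factor 1/2. *)
    have zy: "(norm (?z r))^4 = (norm (?y (r / (1/2))))\<^sup>2" for r
    proof -
      have s: "(norm (?z r))^4 = (norm ((?z r)\<^sup>2))\<^sup>2" by (simp add: norm_power)
      have h: "r / (1/2) = 2 * r" by simp
      have "(?z r)\<^sup>2 = ?y (r / (1/2))" using laguerre_sum_square[where c = c and K = K and w = "phase t" and r = r, OF c] by (simp only: e_def h)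
      with s show ?thesis by (simp only:)
    qed
    have "(\<integral>\<^sup>+x. ennreal ((norm (wave_sum c K t ((norm (x::real^2))\<^sup>2)))^4) \<partial>lborel)
       = ennreal pi * (\<integral>\<^sup>+r. ennreal ((norm (wave_sum c K t r))^4) \<partial>halfline)"
      by (rule nn_integral_radial) measurable
    also have "(\<integral>\<^sup>+r. ennreal ((norm (wave_sum c K t r))^4) \<partial>halfline) = (\<integral>\<^sup>+r. ennreal ((norm (?z (r / l)))^4 / l\<^sup>2) \<partial>halfline)"
    proof (intro nn_integral_cong arg_cong[where f = ennreal])
      fix r
      have "sqrt l ^ 4 = l\<^sup>2" using l by (metis less_imp_le numeral_Bit0 power_add power2_eq_square power4_eq_xxxx real_sqrt_pow2 mult.assoc)
      then show "(norm (wave_sum c K t r))^4 = (norm (?z (r / l)))^4 / l\<^sup>2"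
        unfolding norm_wave_sum l_def[symmetric] power_divide by simp
    qed
    also have "\<dots> = ennreal l * (\<integral>\<^sup>+r. ennreal ((norm (?z r))^4 / l\<^sup>2) \<partial>halfline)"
      by (rule nn_integral_halfline_scale[OF _ l]) measurable
    also have "(\<integral>\<^sup>+r. ennreal ((norm (?z r))^4 / l\<^sup>2) \<partial>halfline) = (\<integral>\<^sup>+r. ennreal ((norm (?y (r / (1/2))))\<^sup>2 / l\<^sup>2) \<partial>halfline)"
      unfolding zy ..
    also have "\<dots> = ennreal (1/2) * (\<integral>\<^sup>+r. ennreal ((norm (?y r))\<^sup>2 / l\<^sup>2) \<partial>halfline)"
      by (rule nn_integral_halfline_scale) auto
    also have "(\<integral>\<^sup>+r. ennreal ((norm (?y r))\<^sup>2 / l\<^sup>2) \<partial>halfline) = ennreal (\<integral>r. (norm (?y r))\<^sup>2 / l\<^sup>2 \<partial>halfline)"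
      using laguerre_parseval_finite(1)[of "{..<2*K}" "e t"] by (intro nn_integral_eq_integral) auto
    also have "(\<integral>r. (norm (?y r))\<^sup>2 / l\<^sup>2 \<partial>halfline) = (\<Sum>k<2*K. (norm (e t k))\<^sup>2) / l\<^sup>2"
      by (simp add: laguerre_parseval_finite(2))
    also have "ennreal pi * (ennreal l * (ennreal (1/2) * ennreal ((\<Sum>k<2*K. (norm (e t k))\<^sup>2) / l\<^sup>2)))
       = ennreal (pi / 2 * ((\<Sum>k<2*K. (norm (e t k))\<^sup>2) / l))"
    proof -
      have "ennreal pi * (ennreal l * (ennreal (1/2) * ennreal (x / l\<^sup>2))) = ennreal (pi / 2 * (x / l))" if "x \<ge> 0" for x
      proof -
        have "ennreal pi * (ennreal l * (ennreal (1/2) * ennreal (x / l\<^sup>2))) = ennreal (pi * (l * (1/2 * (x / l\<^sup>2))))"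
          using l that by (simp only: ennreal_mult mult_nonneg_nonneg divide_nonneg_nonneg zero_le_power2 pi_ge_zero less_imp_le zero_le_one zero_le_numeral)
        also have "pi * (l * (1/2 * (x / l\<^sup>2))) = pi / 2 * (x / l)" using l by (simp add: power2_eq_square)
        finally show ?thesis .
      qed
      then show ?thesis by (simp only: sum_nonneg zero_le_power2)
    qed
    also have "\<dots> = (\<Sum>k<2*K. ennreal (pi / 2 * ((norm (e t k))\<^sup>2 / l)))"
      using l by (subst sum_ennreal) (auto simp: sum_distrib_left sum_divide_distrib less_imp_le)
    also have "\<dots> = (\<Sum>k<2*K. ennreal (pi / 2) * ennreal ((norm (e t k))\<^sup>2 / l))"
      using l by (intro sum.cong refl ennreal_mult) (auto simp: less_imp_le)
    finally show ?thesis unfolding l_def .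
  qed
  have [measurable]: "phase \<in> borel_measurable borel" by (rule borel_measurable_continuous_onI[OF continuous_phase])
  have "(\<integral>\<^sup>+t. \<integral>\<^sup>+x. ennreal ((norm (wave_sum c K t ((norm (x::real^2))\<^sup>2)))^4) \<partial>lborel \<partial>lborel)
     = (\<Sum>k<2*K. \<integral>\<^sup>+t. ennreal (pi / 2) * ennreal ((norm (e t k))\<^sup>2 / (1 + 4 * t\<^sup>2)) \<partial>lborel)"
    unfolding inner e_def by (rule nn_integral_sum) measurable
  also have "\<dots> = (\<Sum>k<2*K. ennreal (pi / 2) * ennreal (pi / 2 * (\<Sum>N\<in>{k..<2*K}. (norm (antidiagonal c N k))\<^sup>2)))"
  proof (intro sum.cong refl)
    fix k
    have "(\<integral>\<^sup>+t. ennreal (pi / 2) * ennreal ((norm (e t k))\<^sup>2 / (1 + 4 * t\<^sup>2)) \<partial>lborel)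
       = ennreal (pi / 2) * (\<integral>\<^sup>+t. ennreal ((norm (e t k))\<^sup>2 / (1 + 4 * t\<^sup>2)) \<partial>lborel)"
      unfolding e_def by (rule nn_integral_cmult) measurable
    also have "(\<integral>\<^sup>+t. ennreal ((norm (e t k))\<^sup>2 / (1 + 4 * t\<^sup>2)) \<partial>lborel) = ennreal (pi / 2 * (\<Sum>N\<in>{k..<2*K}. (norm (antidiagonal c N k))\<^sup>2))"
      unfolding e_def by (rule phase_parseval_finite) simp
    finally show "(\<integral>\<^sup>+t. ennreal (pi / 2) * ennreal ((norm (e t k))\<^sup>2 / (1 + 4 * t\<^sup>2)) \<partial>lborel)
       = ennreal (pi / 2) * ennreal (pi / 2 * (\<Sum>N\<in>{k..<2*K}. (norm (antidiagonal c N k))\<^sup>2))" .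
  qed
  also have "\<dots> = (\<Sum>k<2*K. ennreal (pi\<^sup>2 / 4 * (\<Sum>N\<in>{k..<2*K}. (norm (antidiagonal c N k))\<^sup>2)))"
    by (intro sum.cong refl) (subst ennreal_mult[symmetric], simp, simp add: sum_nonneg, simp add: power2_eq_square mult.assoc)
  also have "\<dots> = ennreal (pi\<^sup>2 / 4 * (\<Sum>k<2*K. \<Sum>N\<in>{k..<2*K}. (norm (antidiagonal c N k))\<^sup>2))"
    by (subst sum_ennreal) (auto simp: sum_distrib_left intro!: sum_nonneg)
  also have "(\<Sum>k<2*K. \<Sum>N\<in>{k..<2*K}. (norm (antidiagonal c N k))\<^sup>2) = (\<Sum>N<2*K. \<Sum>k\<le>N. (norm (antidiagonal c N k))\<^sup>2)"
    by (rule sum_triangle_swap[symmetric])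
  finally show ?thesis .
qed

text \<open>The loss of the averaging on the \<open>N\<close>-th antidiagonal. It is recorded because it must vanish in the case of
equality.\<close>

definition deficit :: "(nat \<Rightarrow> complex) \<Rightarrow> nat \<Rightarrow> real" where
  "deficit c N = (\<Sum>n\<le>N. (norm (c n * c (N - n)))\<^sup>2) - (\<Sum>k\<le>N. (norm (antidiagonal c N k))\<^sup>2)"

lemma deficit_nonneg: "deficit c N \<ge> 0"
  unfolding deficit_def antidiagonal_def using linearization_contraction(1)[where V = "\<lambda>n. c n * c (N - n)"] by simp

lemma deficit_0_imp:
  assumes "deficit c N = 0" "n \<le> N" shows "c n * c (N - n) = c 0 * c N"
  using linearization_contraction(2)[where V = "\<lambda>n. c n * c (N - n)" and N = N and n = n] assms
  unfolding deficit_def antidiagonal_def by simp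

text \<open>All antidiagonals are estimated by the contraction, and the loss is kept for one of them. A single
\<open>N\<close> suffices for the case of equality and survives the limit of many terms.\<close>

lemma wave_sum_L4_bound:
  assumes N: "N < K"
  shows "(\<integral>\<^sup>+t. \<integral>\<^sup>+x. ennreal ((norm (wave_sum c K t ((norm (x::real^2))\<^sup>2)))^4) \<partial>lborel \<partial>lborel)
     \<le> ennreal (pi\<^sup>2 / 4 * ((\<Sum>n<K. (norm (c n))\<^sup>2)\<^sup>2 - deficit c N))"
proof -
  define b where "b n = (if n < K then c n else 0)" for n
  have eq: "wave_sum c K = wave_sum b K" by (auto simp: wave_sum_def b_def fun_eq_iff)
  have def_eq: "deficit b N = deficit c N"
  proof -
    have "(\<Sum>n\<le>N. of_real (linearization n (N - n) k) * (b n * b (N - n))) = (\<Sum>n\<le>N. of_real (linearization n (N - n) k) * (c n * c (N - n)))" for k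
      by (intro sum.cong refl) (use N in \<open>auto simp: b_def\<close>)
    moreover have "(\<Sum>n\<le>N. (norm (b n * b (N - n)))\<^sup>2) = (\<Sum>n\<le>N. (norm (c n * c (N - n)))\<^sup>2)"
      by (intro sum.cong refl) (use N in \<open>auto simp: b_def\<close>)
    ultimately show ?thesis unfolding deficit_def antidiagonal_def by (simp only:)
  qed
  have "(\<Sum>N<2*K. \<Sum>k\<le>N. (norm (antidiagonal b N k))\<^sup>2) = (\<Sum>N<2*K. (\<Sum>n\<le>N. (norm (b n * b (N - n)))\<^sup>2) - deficit b N)"
    by (simp add: deficit_def)
  also have "\<dots> = (\<Sum>N<2*K. \<Sum>n\<le>N. (norm (b n))\<^sup>2 * (norm (b (N - n)))\<^sup>2) - (\<Sum>N<2*K. deficit b N)"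
    by (simp add: sum_subtractf norm_mult power_mult_distrib)
  also have "(\<Sum>N<2*K. \<Sum>n\<le>N. (norm (b n))\<^sup>2 * (norm (b (N - n)))\<^sup>2) = (\<Sum>n<K. (norm (b n))\<^sup>2)\<^sup>2"
    unfolding power2_eq_square[of "sum _ _"] by (rule sum_product_triangle[symmetric]) (simp add: b_def)
  also have "(\<Sum>n<K. (norm (b n))\<^sup>2) = (\<Sum>n<K. (norm (c n))\<^sup>2)" by (simp add: b_def)
  finally have s: "(\<Sum>N<2*K. \<Sum>k\<le>N. (norm (antidiagonal b N k))\<^sup>2) = (\<Sum>n<K. (norm (c n))\<^sup>2)\<^sup>2 - (\<Sum>N<2*K. deficit b N)" .
  have "deficit c N \<le> (\<Sum>N<2*K. deficit b N)"
    unfolding def_eq[symmetric] using N by (intro member_le_sum) (auto simp: deficit_nonneg)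
  then show ?thesis
    unfolding eq using wave_sum_L4[of K b] s by (simp add: b_def ennreal_leI)
qed

section \<open>Weak solutions\<close>

text \<open>The conditions on a weak solution that refer to single times, with the norm of \<open>L\<^sup>2\<close> replaced by its
square.\<close>

definition weak_curve :: "(real \<Rightarrow> real^2 \<Rightarrow> complex) \<Rightarrow> bool" where
  "weak_curve w \<longleftrightarrow> (\<forall>t. in_Lp 2 lborel (w t)) \<and>
     (\<forall>t0. ((\<lambda>t. \<integral>x. (norm (w t x - w t0 x))\<^sup>2 \<partial>lborel) \<longlongrightarrow> 0) (at t0)) \<and>
     (\<forall>\<psi> t. test_function \<psi> \<longrightarrow>
        ((\<lambda>s. \<integral>x. w s x * \<psi> x \<partial>lborel) has_vector_derivative
          \<i> * (\<integral>x. w t x * laplacian \<psi> x \<partial>lborel)) (at t))"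

lemma schroedinger_solution_iff_weak_curve:
  "schroedinger_solution f u \<longleftrightarrow>
     (\<lambda>(x, t). u t x) \<in> borel_measurable (lborel :: ((real^2) \<times> real) measure) \<and> weak_curve u \<and>
     (AE x in lborel. u 0 x = f x)"
proof -
  have "((\<lambda>t. Lp_norm 2 lborel (\<lambda>x. u t x - u t0 x)) \<longlongrightarrow> 0) (at t0)
      \<longleftrightarrow> ((\<lambda>t. \<integral>x. (norm (u t x - u t0 x))\<^sup>2 \<partial>lborel) \<longlongrightarrow> 0) (at t0)" for t0
  proof
    assume "((\<lambda>t. Lp_norm 2 lborel (\<lambda>x. u t x - u t0 x)) \<longlongrightarrow> 0) (at t0)"
    from tendsto_power[OF this, of 2]
    show "((\<lambda>t. \<integral>x. (norm (u t x - u t0 x))\<^sup>2 \<partial>lborel) \<longlongrightarrow> 0) (at t0)" by (simp add: Lp_norm_2)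
  next
    assume "((\<lambda>t. \<integral>x. (norm (u t x - u t0 x))\<^sup>2 \<partial>lborel) \<longlongrightarrow> 0) (at t0)"
    from tendsto_real_sqrt[OF this]
    show "((\<lambda>t. Lp_norm 2 lborel (\<lambda>x. u t x - u t0 x)) \<longlongrightarrow> 0) (at t0)" by (simp add: Lp_norm_2)
  qed
  then show ?thesis unfolding schroedinger_solution_def weak_curve_def by blast
qed

lemma weak_curve_L2: "weak_curve w \<Longrightarrow> in_Lp 2 lborel (w t)"
  and weak_curve_continuous: "weak_curve w \<Longrightarrow> ((\<lambda>t. \<integral>x. (norm (w t x - w t0 x))\<^sup>2 \<partial>lborel) \<longlongrightarrow> 0) (at t0)"
  and weak_curve_deriv: "weak_curve w \<Longrightarrow> test_function \<psi> \<Longrightarrow>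
     ((\<lambda>s. \<integral>x. w s x * \<psi> x \<partial>lborel) has_vector_derivative \<i> * (\<integral>x. w t x * laplacian \<psi> x \<partial>lborel)) (at t)"
  by (auto simp: weak_curve_def)

lemma weak_curve_diff:
  assumes u: "weak_curve u" and v: "weak_curve v"
  shows "weak_curve (\<lambda>t x. u t x - v t x)"
  unfolding weak_curve_def
proof (intro conjI allI impI)
  show "in_Lp 2 lborel (\<lambda>x. u t x - v t x)" for t
    by (intro in_Lp_2_diff weak_curve_L2 u v)
  show "((\<lambda>t. \<integral>x. (norm ((u t x - v t x) - (u t0 x - v t0 x)))\<^sup>2 \<partial>lborel) \<longlongrightarrow> 0) (at t0)" for t0
  proof (rule Lim_null_comparison)
    show "\<forall>\<^sub>F t in at t0. norm (\<integral>x. (norm ((u t x - v t x) - (u t0 x - v t0 x)))\<^sup>2 \<partial>lborel)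
       \<le> 2 * (\<integral>x. (norm (u t x - u t0 x))\<^sup>2 \<partial>lborel) + 2 * (\<integral>x. (norm (v t x - v t0 x))\<^sup>2 \<partial>lborel)"
    proof (rule always_eventually, rule allI)
      fix t
      have i: "integrable lborel (\<lambda>x. (norm (u t x - u t0 x))\<^sup>2)" "integrable lborel (\<lambda>x. (norm (v t x - v t0 x))\<^sup>2)"
        "integrable lborel (\<lambda>x. (norm ((u t x - v t x) - (u t0 x - v t0 x)))\<^sup>2)"
        by (intro in_Lp_2_integrable in_Lp_2_diff weak_curve_L2 u v)+
      have "(\<integral>x. (norm ((u t x - v t x) - (u t0 x - v t0 x)))\<^sup>2 \<partial>lborel)
         \<le> (\<integral>x. 2 * (norm (u t x - u t0 x))\<^sup>2 + 2 * (norm (v t x - v t0 x))\<^sup>2 \<partial>lborel)"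
      proof (rule integral_mono)
        fix x
        have e: "(u t x - v t x) - (u t0 x - v t0 x) = (u t x - u t0 x) + (v t0 x - v t x)" by simp
        show "(norm ((u t x - v t x) - (u t0 x - v t0 x)))\<^sup>2 \<le> 2 * (norm (u t x - u t0 x))\<^sup>2 + 2 * (norm (v t x - v t0 x))\<^sup>2"
          unfolding e using norm_add_sq_le[of "u t x - u t0 x" "v t0 x - v t x"] by (simp add: norm_minus_commute)
      qed (use i in auto)
      then show "norm (\<integral>x. (norm ((u t x - v t x) - (u t0 x - v t0 x)))\<^sup>2 \<partial>lborel)
       \<le> 2 * (\<integral>x. (norm (u t x - u t0 x))\<^sup>2 \<partial>lborel) + 2 * (\<integral>x. (norm (v t x - v t0 x))\<^sup>2 \<partial>lborel)"
        using i by simp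
    qed
    have "((\<lambda>t. 2 * (\<integral>x. (norm (u t x - u t0 x))\<^sup>2 \<partial>lborel) + 2 * (\<integral>x. (norm (v t x - v t0 x))\<^sup>2 \<partial>lborel)) \<longlongrightarrow> 2 * 0 + 2 * 0) (at t0)"
      by (intro tendsto_intros weak_curve_continuous u v)
    then show "((\<lambda>t. 2 * (\<integral>x. (norm (u t x - u t0 x))\<^sup>2 \<partial>lborel) + 2 * (\<integral>x. (norm (v t x - v t0 x))\<^sup>2 \<partial>lborel)) \<longlongrightarrow> 0) (at t0)"
      by simp
  qed
  fix \<psi> t assume t: "test_function \<psi>"
  have i: "integrable lborel (\<lambda>x. u s x * \<psi> x)" "integrable lborel (\<lambda>x. v s x * \<psi> x)"
      "integrable lborel (\<lambda>x. u s x * laplacian \<psi> x)" "integrable lborel (\<lambda>x. v s x * laplacian \<psi> x)" for s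
    by (intro in_Lp_2_integrable_mult weak_curve_L2 u v test_function_L2 t)+
  show "((\<lambda>s. \<integral>x. (u s x - v s x) * \<psi> x \<partial>lborel) has_vector_derivative
          \<i> * (\<integral>x. (u t x - v t x) * laplacian \<psi> x \<partial>lborel)) (at t)"
    using has_vector_derivative_diff[OF weak_curve_deriv[OF u t, of t] weak_curve_deriv[OF v t, of t]] i
    by (simp add: left_diff_distrib right_diff_distrib)
qed

lemma weak_curve_locally_bounded:
  assumes w: "weak_curve w" and "a \<le> b"
  shows "\<exists>B\<ge>0. \<forall>s\<in>{a..b}. (\<integral>x. (norm (w s x))\<^sup>2 \<partial>lborel) \<le> B"
proof -
  define n where "n s = (\<integral>x. (norm (w s x))\<^sup>2 \<partial>lborel)" for s
  have near: "\<exists>d>0. \<forall>s. \<bar>s - t\<bar> < d \<longrightarrow> n s \<le> 2 + 2 * n t" for t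
  proof -
    have "\<forall>\<^sub>F s in at t. (\<integral>x. (norm (w s x - w t x))\<^sup>2 \<partial>lborel) < 1"
      by (rule order_tendstoD(2)[OF weak_curve_continuous[OF w]]) simp
    then obtain d where d: "d > 0" "\<And>s. s \<noteq> t \<Longrightarrow> dist s t < d \<Longrightarrow> (\<integral>x. (norm (w s x - w t x))\<^sup>2 \<partial>lborel) < 1"
      unfolding eventually_at by auto
    have "n s \<le> 2 + 2 * n t" if s: "\<bar>s - t\<bar> < d" for s
    proof -
      have D: "(\<integral>x. (norm (w s x - w t x))\<^sup>2 \<partial>lborel) \<le> 1"
        using d(2)[of s] s by (cases "s = t") (auto simp: dist_real_def less_imp_le)
      have i: "integrable lborel (\<lambda>x. (norm (w s x - w t x))\<^sup>2)" "integrable lborel (\<lambda>x. (norm (w t x))\<^sup>2)" "integrable lborel (\<lambda>x. (norm (w s x))\<^sup>2)"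
        by (intro in_Lp_2_integrable in_Lp_2_diff weak_curve_L2 w)+
      have "n s \<le> (\<integral>x. 2 * (norm (w s x - w t x))\<^sup>2 + 2 * (norm (w t x))\<^sup>2 \<partial>lborel)"
        unfolding n_def
      proof (rule integral_mono)
        fix x show "(norm (w s x))\<^sup>2 \<le> 2 * (norm (w s x - w t x))\<^sup>2 + 2 * (norm (w t x))\<^sup>2"
          using norm_add_sq_le[of "w s x - w t x" "w t x"] by simp
      qed (use i in auto)
      then show ?thesis using i D by (simp add: n_def)
    qed
    then show ?thesis using d(1) by blast
  qed
  have "\<exists>B\<ge>0. \<forall>s\<in>{a..b}. n s \<le> B"
  proof (rule Bolzano[OF \<open>a \<le> b\<close>])
    fix a b c
    assume "\<exists>B\<ge>0. \<forall>s\<in>{a..b}. n s \<le> B" "\<exists>B\<ge>0. \<forall>s\<in>{b..c}. n s \<le> B"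
    then obtain B B' where B0: "B \<ge> 0" "\<forall>s\<in>{a..b}. n s \<le> B" "\<forall>s\<in>{b..c}. n s \<le> B'" by blast
    then have B: "B \<ge> 0" "\<And>s. s\<in>{a..b} \<Longrightarrow> n s \<le> B" "\<And>s. s\<in>{b..c} \<Longrightarrow> n s \<le> B'" by blast+
    have "n s \<le> max B B'" if "s \<in> {a..c}" for s
      using B(2)[of s] B(3)[of s] that by (cases "s \<le> b") auto
    then show "\<exists>B\<ge>0. \<forall>s\<in>{a..c}. n s \<le> B" using B(1) by (intro exI[of _ "max B B'"]) auto
  next
    fix t
    obtain d where d: "d > 0" "\<And>s. \<bar>s - t\<bar> < d \<Longrightarrow> n s \<le> 2 + 2 * n t" using near[of t] by blast
    have "n t \<ge> 0" by (simp add: n_def)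
    show "\<exists>d>0. \<forall>a b. a \<le> t \<and> t \<le> b \<and> b - a < d \<longrightarrow> (\<exists>B\<ge>0. \<forall>s\<in>{a..b}. n s \<le> B)"
    proof (rule exI[of _ d], intro conjI allI impI)
      fix a b assume "a \<le> t \<and> t \<le> b \<and> b - a < d"
      then have "\<forall>s\<in>{a..b}. n s \<le> 2 + 2 * n t" by (intro ballI d(2)) auto
      then show "\<exists>B\<ge>0. \<forall>s\<in>{a..b}. n s \<le> B" using \<open>n t \<ge> 0\<close> by (intro exI[of _ "2 + 2 * n t"]) auto
    qed (rule d(1))
  qed
  then show ?thesis by (simp add: n_def)
qed

lemma indicator_cball_L2: "in_Lp 2 lborel (\<lambda>x::'a::euclidean_space. of_real (B * indicator (cball c R) x))"
  unfolding in_Lp_2_iff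
proof
  have "(norm (of_real (B * indicator (cball c R) x) :: complex))\<^sup>2 = B\<^sup>2 * indicator (cball c R) x" for x :: 'a
    by (auto simp: indicator_def)
  then show "integrable lborel (\<lambda>x::'a. (norm (of_real (B * indicator (cball c R) x) :: complex))\<^sup>2)"
    using integrable_indicator_cball[of "B\<^sup>2" c R] by simp
  have [measurable]: "cball c R \<in> sets borel" by simp
  show "(\<lambda>x::'a. complex_of_real (B * indicator (cball c R) x)) \<in> borel_measurable lborel" by measurable
qed

text \<open>The product rule for a test function that moves: the mixed term is of first order in the increment of
\<open>\<Phi>\<close> times the continuity modulus of \<open>w\<close> in \<open>L\<^sup>2\<close>, and so has derivative 0.\<close>

lemma weak_curve_time_dependent_test:
  assumes w: "weak_curve w" and test: "\<And>s. test_function (\<Phi> s)"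
    and supp: "\<And>s x. norm x > R \<Longrightarrow> \<Phi> s x = 0"
    and deriv: "\<And>s x. ((\<lambda>s. \<Phi> s x) has_vector_derivative \<Phi>' s x) (at s)"
    and cont: "continuous_on UNIV (\<lambda>(s, x). \<Phi>' s x)"
  shows "((\<lambda>s. \<integral>x. w s x * \<Phi> s x \<partial>lborel) has_vector_derivative
    (\<integral>x. w t x * (\<i> * laplacian (\<Phi> t) x + \<Phi>' t x) \<partial>lborel)) (at t)"
proof -
  have supp': "\<Phi>' s x = 0" if "norm x > R" for s x
    using deriv[of x s] supp[OF that] vector_derivative_unique_at has_vector_derivative_const by (metis (no_types, lifting) ext)
  have "bounded ((\<lambda>(s, x). \<Phi>' s x) ` ({t-1..t+1} \<times> cball 0 R))"
    by (intro compact_imp_bounded compact_continuous_image continuous_on_subset[OF cont] compact_Times) auto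
  then obtain B0 where B0: "\<And>s x. s \<in> {t-1..t+1} \<Longrightarrow> x \<in> cball 0 R \<Longrightarrow> norm (\<Phi>' s x) \<le> B0"
    unfolding bounded_iff by fastforce
  define B where "B = max 0 B0"
  have B: "norm (\<Phi>' s x) \<le> B * indicator (cball 0 R) x" if "\<bar>s - t\<bar> < 1" for s x
    using B0[of s x] supp'[of x s] that by (auto simp: B_def indicator_def abs_less_iff)
  have diffB: "norm (\<Phi> s x - \<Phi> t x) \<le> B * indicator (cball 0 R) x * \<bar>s - t\<bar>" if "\<bar>s - t\<bar> < 1" for s x
    by (rule vector_derivative_bound_difference[of t 1 "\<lambda>s. \<Phi> s x" "\<lambda>s. \<Phi>' s x"]) (use deriv B that in auto)
  have contx: "continuous_on UNIV (\<Phi>' t)"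
  proof -
    have "continuous_on UNIV (\<lambda>x. (t, x))" by (intro continuous_intros)
    from continuous_on_compose2[OF cont this] show ?thesis by simp
  qed
  have \<Phi>'L: "in_Lp 2 lborel (\<Phi>' t)" by (rule continuous_compact_support_L(2)[OF contx supp'])
  note wL = weak_curve_L2[OF w]
  note \<Phi>L = test_function_L2[OF test]
  have 1: "((\<lambda>s. \<integral>x. w s x * \<Phi> t x \<partial>lborel) has_vector_derivative \<i> * (\<integral>x. w t x * laplacian (\<Phi> t) x \<partial>lborel)) (at t)"
    by (rule weak_curve_deriv[OF w test])
  have 2: "((\<lambda>s. \<integral>x. w t x * (\<Phi> s x - \<Phi> t x) \<partial>lborel) has_vector_derivative (\<integral>x. w t x * \<Phi>' t x \<partial>lborel)) (at t)"
  proof (rule integral_has_vector_derivative_dominated[where e = 1 and f' = "\<lambda>s x. w t x * \<Phi>' s x"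
        and G = "\<lambda>x. norm (w t x * of_real (B * indicator (cball 0 R) x))"])
    show "integrable lborel (\<lambda>x. w t x * (\<Phi> s x - \<Phi> t x))" for s
      by (intro in_Lp_2_integrable_mult in_Lp_2_diff wL \<Phi>L)
    show "((\<lambda>s. w t x * (\<Phi> s x - \<Phi> t x)) has_vector_derivative w t x * \<Phi>' s x) (at s)" for s x
      using has_vector_derivative_mult_right[OF has_vector_derivative_diff[OF deriv[of x s] has_vector_derivative_const]] by simp
    show "norm (w t x * \<Phi>' s x) \<le> norm (w t x * of_real (B * indicator (cball 0 R) x))" if "\<bar>s - t\<bar> < 1" for s x
      using B[OF that, of x] B_def by (simp add: norm_mult mult_left_mono)
    show "integrable lborel (\<lambda>x. norm (w t x * of_real (B * indicator (cball 0 R) x)))"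
      by (intro integrable_norm in_Lp_2_integrable_mult wL indicator_cball_L2)
  qed simp
  define V where "V = (\<integral>x. (B * indicator (cball (0::real^2) R) x)\<^sup>2 \<partial>lborel)"
  have 3: "((\<lambda>s. \<integral>x. (w s x - w t x) * (\<Phi> s x - \<Phi> t x) \<partial>lborel) has_vector_derivative 0) (at t)"
    unfolding has_vector_derivative_iff_quotient
  proof (rule Lim_null_comparison)
    let ?D = "\<lambda>s. (\<integral>x. (norm (w s x - w t x))\<^sup>2 \<partial>lborel)"
    show "\<forall>\<^sub>F s in at t. norm (((\<integral>x. (w s x - w t x) * (\<Phi> s x - \<Phi> t x) \<partial>lborel)
        - (\<integral>x. (w t x - w t x) * (\<Phi> t x - \<Phi> t x) \<partial>lborel)) /\<^sub>R (s - t)) \<le> sqrt (?D s * V)"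
      unfolding eventually_at
    proof (intro exI[of _ 1] conjI ballI impI)
      fix s assume s: "s \<noteq> t \<and> dist s t < 1"
      let ?d = "\<lambda>x. \<Phi> s x - \<Phi> t x"
      have dL: "in_Lp 2 lborel ?d" by (intro in_Lp_2_diff \<Phi>L)
      have "(\<integral>x. (norm (?d x))\<^sup>2 \<partial>lborel) \<le> (\<integral>x. \<bar>s - t\<bar>\<^sup>2 * (B * indicator (cball (0::real^2) R) x)\<^sup>2 \<partial>lborel)"
      proof (rule integral_mono)
        show "integrable lborel (\<lambda>x. (norm (?d x))\<^sup>2)" by (rule in_Lp_2_integrable[OF dL])
        show "integrable lborel (\<lambda>x::real^2. \<bar>s - t\<bar>\<^sup>2 * (B * indicator (cball 0 R) x)\<^sup>2)"
          using in_Lp_2_integrable[OF indicator_cball_L2[of B "0::real^2" R]]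
          by (intro integrable_mult_right) (simp only: norm_of_real power2_abs)
        fix x
        have "(norm (?d x))\<^sup>2 \<le> (B * indicator (cball 0 R) x * \<bar>s - t\<bar>)\<^sup>2"
          using diffB[of s x] s by (intro power_mono) (auto simp: dist_real_def)
        then show "(norm (?d x))\<^sup>2 \<le> \<bar>s - t\<bar>\<^sup>2 * (B * indicator (cball 0 R) x)\<^sup>2" by (simp add: power_mult_distrib mult_ac)
      qed
      then have d2: "(\<integral>x. (norm (?d x))\<^sup>2 \<partial>lborel) \<le> \<bar>s - t\<bar>\<^sup>2 * V" by (simp add: V_def)
      have "(norm (\<integral>x. (w s x - w t x) * ?d x \<partial>lborel))\<^sup>2 \<le> ?D s * (\<integral>x. (norm (?d x))\<^sup>2 \<partial>lborel)"
        by (rule Cauchy_Schwarz_integral(2)[OF in_Lp_2_diff[OF wL wL] dL])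
      also have "\<dots> \<le> ?D s * (\<bar>s - t\<bar>\<^sup>2 * V)" using d2 by (intro mult_left_mono) auto
      finally have "norm (\<integral>x. (w s x - w t x) * ?d x \<partial>lborel) \<le> sqrt (\<bar>s - t\<bar>\<^sup>2 * (?D s * V))"
        by (intro real_le_rsqrt) (simp add: mult_ac)
      also have "\<dots> = \<bar>s - t\<bar> * sqrt (?D s * V)" unfolding real_sqrt_mult[of "\<bar>s - t\<bar>\<^sup>2"] by simp
      finally show "norm (((\<integral>x. (w s x - w t x) * (\<Phi> s x - \<Phi> t x) \<partial>lborel)
          - (\<integral>x. (w t x - w t x) * (\<Phi> t x - \<Phi> t x) \<partial>lborel)) /\<^sub>R (s - t)) \<le> sqrt (?D s * V)"
        using s by (simp add: divide_inverse[symmetric] mult.commute[of "inverse _"] pos_divide_le_eq mult.commute[of _ "\<bar>s - t\<bar>"])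
    qed simp
    have "((\<lambda>s. sqrt (?D s * V)) \<longlongrightarrow> sqrt (0 * V)) (at t)"
      by (intro tendsto_intros weak_curve_continuous w)
    then show "((\<lambda>s. sqrt (?D s * V)) \<longlongrightarrow> 0) (at t)" by simp
  qed
  have split: "(\<integral>x. w s x * \<Phi> s x \<partial>lborel) = (\<integral>x. w s x * \<Phi> t x \<partial>lborel) + (\<integral>x. w t x * (\<Phi> s x - \<Phi> t x) \<partial>lborel)
     + (\<integral>x. (w s x - w t x) * (\<Phi> s x - \<Phi> t x) \<partial>lborel)" for s
  proof -
    have "integrable lborel (\<lambda>x. w s x * \<Phi> t x)" "integrable lborel (\<lambda>x. w t x * (\<Phi> s x - \<Phi> t x))"
      "integrable lborel (\<lambda>x. (w s x - w t x) * (\<Phi> s x - \<Phi> t x))"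
      by (intro in_Lp_2_integrable_mult in_Lp_2_diff wL \<Phi>L)+
    then show ?thesis
      by (subst Bochner_Integration.integral_add[symmetric], simp, simp,
          subst Bochner_Integration.integral_add[symmetric], simp, simp) (simp add: algebra_simps)
  qed
  have "(\<integral>x. w t x * (\<i> * laplacian (\<Phi> t) x + \<Phi>' t x) \<partial>lborel)
     = \<i> * (\<integral>x. w t x * laplacian (\<Phi> t) x \<partial>lborel) + (\<integral>x. w t x * \<Phi>' t x \<partial>lborel)"
  proof -
    have "integrable lborel (\<lambda>x. w t x * laplacian (\<Phi> t) x)" "integrable lborel (\<lambda>x. w t x * \<Phi>' t x)"
      by (intro in_Lp_2_integrable_mult wL \<Phi>L \<Phi>'L)+
    then have "(\<integral>x. \<i> * (w t x * laplacian (\<Phi> t) x) + w t x * \<Phi>' t x \<partial>lborel) = \<i> * (\<integral>x. w t x * laplacian (\<Phi> t) x \<partial>lborel) + (\<integral>x. w t x * \<Phi>' t x \<partial>lborel)"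
      by simp
    then show ?thesis by (simp add: algebra_simps)
  qed
  then show ?thesis
    unfolding split using has_vector_derivative_add[OF has_vector_derivative_add[OF 1 2] 3] by simp
qed

section \<open>Uniqueness of weak solutions\<close>

lemma integral_translate:
  fixes f :: "'a::euclidean_space \<Rightarrow> 'b::{banach, second_countable_topology}"
  assumes [measurable]: "f \<in> borel_measurable borel"
  shows "(\<integral>x. f (x - y) \<partial>lborel) = (\<integral>x. f x \<partial>lborel)"
    and "integrable lborel (\<lambda>x. f (x - y)) \<longleftrightarrow> integrable lborel f"
proof -
  have d: "distr lborel borel (\<lambda>x. - y + x) = (lborel :: 'a measure)" by (rule lborel_distr_plus)
  have "(\<integral>x. f x \<partial>lborel) = (\<integral>x. f x \<partial>distr lborel borel (\<lambda>x. - y + x))" by (simp only: d)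
  also have "\<dots> = (\<integral>x. f (x - y) \<partial>lborel)" by (subst integral_distr) auto
  finally show "(\<integral>x. f (x - y) \<partial>lborel) = (\<integral>x. f x \<partial>lborel)" by simp
  have "integrable lborel f \<longleftrightarrow> integrable (distr lborel borel (\<lambda>x. - y + x)) f" by (simp only: d)
  also have "\<dots> \<longleftrightarrow> integrable lborel (\<lambda>x. f (x - y))" by (subst integrable_distr_eq) auto
  finally show "integrable lborel (\<lambda>x. f (x - y)) \<longleftrightarrow> integrable lborel f" by simp
qed

lemma integrable_gaussian_shifted:
  assumes "c > 0"
  shows "integrable lborel (\<lambda>x::real^2. ((norm (x - y))\<^sup>2) ^ k * exp (- c * (norm (x - y))\<^sup>2))"
proof -
  have "integrable lborel (\<lambda>x::real^2. ((norm x)\<^sup>2) ^ k * exp (- c * (norm x)\<^sup>2))"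
    using integral_radial(2)[of "\<lambda>r. r ^ k * exp (- c * r)"] integrable_power_exp_halfline[OF assms] by simp
  then show ?thesis using integral_translate(2)[of "\<lambda>x::real^2. ((norm x)\<^sup>2) ^ k * exp (- c * (norm x)\<^sup>2)" y] by simp
qed

lemma gaussian_shifted_L2:
  assumes "c > 0"
  shows "in_Lp 2 lborel (\<lambda>x::real^2. of_real ((1 + (norm (x - y))\<^sup>2) * exp (- c * (norm (x - y))\<^sup>2)))"
  unfolding in_Lp_2_iff
proof
  have "(norm (of_real ((1 + q) * exp (- c * q)) :: complex))\<^sup>2 = q ^ 0 * exp (- (2 * c) * q) + 2 * (q ^ 1 * exp (- (2 * c) * q)) + q ^ 2 * exp (- (2 * c) * q)" for q
  proof -
    have "(exp (- c * q))\<^sup>2 = exp (- (2 * c) * q)" by (simp add: power2_eq_square flip: exp_add)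
    then show ?thesis by (simp only: norm_of_real power2_abs power_mult_distrib) (simp add: power2_eq_square algebra_simps)
  qed
  then show "integrable lborel (\<lambda>x::real^2. (norm (of_real ((1 + (norm (x - y))\<^sup>2) * exp (- c * (norm (x - y))\<^sup>2)) :: complex))\<^sup>2)"
    using assms by (simp only: integrable_gaussian_shifted Bochner_Integration.integrable_add integrable_mult_right zero_less_mult_iff zero_less_numeral simp_thms)
qed measurable

lemma max_0_power_deriv:
  assumes "m \<ge> 2"
  shows "((\<lambda>u::real. (max 0 u) ^ m) has_real_derivative of_nat m * (max 0 u) ^ (m - 1)) (at u)"
proof -
  consider "u > 0" | "u < 0" | "u = 0" by linarith
  then show ?thesis
  proof cases
    case 1
    have "((\<lambda>u::real. u ^ m) has_real_derivative of_nat m * u ^ (m - 1)) (at u)"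
      by (auto intro!: derivative_eq_intros)
    then have "((\<lambda>u::real. (max 0 u) ^ m) has_real_derivative of_nat m * u ^ (m - 1)) (at u)"
      by (rule has_field_derivative_transform_within_open[where S = "{0<..}"]) (use 1 in \<open>auto simp: max_def\<close>)
    then show ?thesis using 1 by (simp add: max_def)
  next
    case 2
    have "((\<lambda>u::real. 0) has_real_derivative 0) (at u)" by simp
    then have "((\<lambda>u::real. (max 0 u) ^ m) has_real_derivative 0) (at u)"
      by (rule has_field_derivative_transform_within_open[where S = "{..<0}"]) (use 2 assms in \<open>auto simp: max_def\<close>)
    moreover have "max 0 u = 0" using 2 by simp
    ultimately show ?thesis using assms by (simp add: zero_power)
  next
    case 3
    have "((\<lambda>h::real. ((max 0 (0 + h)) ^ m - (max 0 0) ^ m) / h) \<longlongrightarrow> 0) (at 0)"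
    proof (rule Lim_null_comparison)
      show "\<forall>\<^sub>F h in at 0. norm (((max 0 (0 + h)) ^ m - (max 0 0) ^ m) / h) \<le> \<bar>h\<bar> ^ (m - 1)"
      proof (rule always_eventually, rule allI)
        fix h :: real
        have m: "m = Suc (m - 1)" using assms by simp
        have "(max 0 h) ^ m \<le> \<bar>h\<bar> ^ m" by (intro power_mono) auto
        also have "\<bar>h\<bar> ^ m = \<bar>h\<bar> ^ (m - 1) * \<bar>h\<bar>" using power_Suc2[of "\<bar>h\<bar>" "m - 1"] m by simp
        finally have "(max 0 h) ^ m / \<bar>h\<bar> \<le> \<bar>h\<bar> ^ (m - 1)" by (cases "h = 0") (auto simp: divide_le_eq)
        then show "norm (((max 0 (0 + h)) ^ m - (max 0 0) ^ m) / h) \<le> \<bar>h\<bar> ^ (m - 1)"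
          using assms by (simp add: abs_divide zero_power)
      qed
      have "((\<lambda>h::real. \<bar>h\<bar> ^ (m - 1)) \<longlongrightarrow> \<bar>0\<bar> ^ (m - 1)) (at 0)" by (intro tendsto_intros)
      then show "((\<lambda>h::real. \<bar>h\<bar> ^ (m - 1)) \<longlongrightarrow> 0) (at 0)" using assms by (simp add: zero_power)
    qed
    then show ?thesis using 3 assms by (simp add: DERIV_def zero_power)
  qed
qed

text \<open>A \<open>C\<^sup>2\<close> cutoff at scale \<open>P\<close> in the variable \<open>r = |x|\<^sup>2\<close>, with its two derivatives. The cube is the
smallest power of the positive part that is twice continuously differentiable.\<close>

definition cutoff :: "real \<Rightarrow> real \<Rightarrow> real" where "cutoff P r = (max 0 (1 - r / P)) ^ 3"
definition cutoff1 :: "real \<Rightarrow> real \<Rightarrow> real" where "cutoff1 P r = - 3 / P * (max 0 (1 - r / P)) ^ 2"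
definition cutoff2 :: "real \<Rightarrow> real \<Rightarrow> real" where "cutoff2 P r = 6 / P\<^sup>2 * max 0 (1 - r / P)"

lemma cutoff_deriv:
  assumes "P > 0"
  shows "(cutoff P has_real_derivative cutoff1 P r) (at r)" "(cutoff1 P has_real_derivative cutoff2 P r) (at r)"
proof -
  have l: "((\<lambda>r. 1 - r / P) has_real_derivative - 1 / P) (at r)" using assms by (auto intro!: derivative_eq_intros)
  show "(cutoff P has_real_derivative cutoff1 P r) (at r)"
    unfolding cutoff_def[abs_def] cutoff1_def
    using DERIV_chain2[OF max_0_power_deriv[of 3 "1 - r / P"] l] by (simp add: mult_ac)
  have "((\<lambda>r. (max 0 (1 - r / P)) ^ 2) has_real_derivative (of_nat 2 * (max 0 (1 - r / P)) ^ (2 - 1)) * (- 1 / P)) (at r)"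
    by (rule DERIV_chain2[OF max_0_power_deriv l]) simp
  from DERIV_cmult[OF this, of "- 3 / P"]
  show "(cutoff1 P has_real_derivative cutoff2 P r) (at r)"
    unfolding cutoff1_def[abs_def] cutoff2_def by (simp add: power2_eq_square)
qed

lemma cutoff_bounds:
  assumes "P \<ge> 1" "r \<ge> 0"
  shows "0 \<le> cutoff P r" "cutoff P r \<le> 1" "\<bar>cutoff1 P r\<bar> \<le> 3 / P" "\<bar>cutoff2 P r\<bar> \<le> 6 / P"
proof -
  define m where "m = max 0 (1 - r / P)"
  have m: "0 \<le> m" "m \<le> 1" using assms by (auto simp: m_def)
  show "0 \<le> cutoff P r" "cutoff P r \<le> 1" using m by (auto simp: cutoff_def m_def[symmetric] power_le_one)
  have "\<bar>cutoff1 P r\<bar> = 3 / P * m ^ 2" using assms m by (simp add: cutoff1_def m_def[symmetric] abs_mult)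
  also have "\<dots> \<le> 3 / P * 1" using assms m by (intro mult_left_mono) (auto simp: power_le_one)
  finally show "\<bar>cutoff1 P r\<bar> \<le> 3 / P" by simp
  have "\<bar>cutoff2 P r\<bar> = 6 / P\<^sup>2 * m" using assms m by (simp add: cutoff2_def m_def[symmetric] abs_mult)
  also have "\<dots> \<le> 6 / P\<^sup>2 * 1" using assms m by (intro mult_left_mono) auto
  also have "\<dots> \<le> 6 / P" using assms by (simp add: power2_eq_square field_simps)
  finally show "\<bar>cutoff2 P r\<bar> \<le> 6 / P" .
qed

lemma cutoff_zero: "P > 0 \<Longrightarrow> r \<ge> P \<Longrightarrow> cutoff P r = 0"
  by (simp add: cutoff_def)

lemma continuous_cutoffs: "P > 0 \<Longrightarrow> continuous_on A (cutoff P)" "P > 0 \<Longrightarrow> continuous_on A (cutoff1 P)" "P > 0 \<Longrightarrow> continuous_on A (cutoff2 P)"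
  unfolding cutoff_def cutoff1_def cutoff2_def by (intro continuous_intros; simp)+

lemma cutoff_tendsto: "(\<lambda>n. cutoff (real (Suc n)) r) \<longlonglongrightarrow> 1"
proof -
  have "(\<lambda>n. (max 0 (1 - r * inverse (real (Suc n)))) ^ 3) \<longlonglongrightarrow> (max 0 (1 - r * 0)) ^ 3"
    by (intro tendsto_intros LIMSEQ_inverse_real_of_nat)
  then show ?thesis by (simp add: cutoff_def divide_inverse)
qed

lemma cnj_vector_derivative:
  "(f has_vector_derivative d) F \<Longrightarrow> ((\<lambda>x. cnj (f x)) has_vector_derivative cnj d) F"
  by (rule bounded_linear.has_vector_derivative[OF bounded_linear_cnj])

text \<open>Pair \<open>w\<close> with the conjugate of a Gaussian solution around \<open>y\<close>. The pairing is constant in time, up to the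
cutoff that makes the Gaussian a test function; its error \<open>E\<close> contains derivatives of the cutoff and is
\<open>O(1/P)\<close>. The pairing vanishes at time 0, hence at time \<open>T\<close>.\<close>

lemma weak_curve_orthogonal_gaussian:
  fixes y :: "real^2"
  assumes w: "weak_curve w" and w0: "AE x in lborel. w 0 x = 0" and \<alpha>: "\<alpha> > 0"
  shows "(\<integral>x. w T x * of_real (exp (- (\<alpha> / 2) * (norm (x - y))\<^sup>2)) \<partial>lborel) = 0"
proof -
  (* The time shift makes the Gaussian solution real at time T. *)
  define \<beta> where "\<beta> = - \<alpha> * T"
  define g where "g s r = cnj (wave 0 (\<alpha> * s + \<beta>) (\<alpha> * r))" for s r
  define g1 where "g1 s r = cnj (of_real \<alpha> * wave_r 0 (\<alpha> * s + \<beta>) (\<alpha> * r))" for s r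
  define g2 where "g2 s r = cnj (of_real (\<alpha>\<^sup>2) * wave_rr 0 (\<alpha> * s + \<beta>) (\<alpha> * r))" for s r
  have dg: "((\<lambda>r. g s r) has_vector_derivative g1 s r) (at r)" for s r
    unfolding g_def g1_def by (intro cnj_vector_derivative scaled_wave_deriv(1))
  have dg1: "((\<lambda>r. g1 s r) has_vector_derivative g2 s r) (at r)" for s r
    unfolding g1_def g2_def by (intro cnj_vector_derivative scaled_wave_deriv(2))
  have dgt: "((\<lambda>s. g s r) has_vector_derivative - \<i> * (4 * (of_real r * g2 s r + g1 s r))) (at s)" for s r
    using cnj_vector_derivative[OF scaled_wave_deriv(3)[of 0 \<alpha> \<beta> r s]] by (simp add: g_def g1_def g2_def)
  have p: "continuous_on UNIV (\<lambda>(t, r). (\<alpha> * t + \<beta>, \<alpha> * r))"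
    unfolding split_beta by (intro continuous_intros)
  have cw: "continuous_on UNIV (\<lambda>(s, r). wave 0 (\<alpha> * s + \<beta>) (\<alpha> * r))" "continuous_on UNIV (\<lambda>(s, r). wave_r 0 (\<alpha> * s + \<beta>) (\<alpha> * r))"
     "continuous_on UNIV (\<lambda>(s, r). wave_rr 0 (\<alpha> * s + \<beta>) (\<alpha> * r))"
    using continuous_on_compose2[OF wave_continuous[of 0] p] continuous_on_compose2[OF wave_rr_continuous[of 0] p] continuous_on_compose2[OF wave_r_continuous[of 0] p]
    by (simp_all add: split_beta)
  have cg: "continuous_on UNIV (\<lambda>(s, r). g s r)" "continuous_on UNIV (\<lambda>(s, r). g1 s r)" "continuous_on UNIV (\<lambda>(s, r). g2 s r)"
    unfolding g_def g1_def g2_def split_beta by (intro continuous_intros cw[unfolded split_beta])+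
  have cgr: "continuous_on UNIV (g s)" "continuous_on UNIV (g1 s)" "continuous_on UNIV (g2 s)" for s
  proof -
    have q: "continuous_on UNIV (\<lambda>r::real. (s, r))" by (intro continuous_intros)
    show "continuous_on UNIV (g s)" "continuous_on UNIV (g1 s)" "continuous_on UNIV (g2 s)"
      using continuous_on_compose2[OF cg(1) q] continuous_on_compose2[OF cg(2) q] continuous_on_compose2[OF cg(3) q] by simp_all
  qed
  have gT: "g T r = of_real (exp (- (\<alpha> / 2) * r))" for r
    unfolding g_def \<beta>_def wave_eq by (simp add: laguerre_fun_def phase_def)
  (* The slowest Gaussian decay rate between the times 0 and T. *)
  define c where "c = \<alpha> / (2 * (1 + 4 * (\<alpha> * T)\<^sup>2))"
  have c: "c > 0" unfolding c_def using \<alpha> by (intro divide_pos_pos mult_pos_pos one_plus_pos) auto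
  have gb: "norm (g s r) \<le> exp (- c * r)" and g1b: "norm (g1 s r) \<le> \<alpha> * exp (- c * r)"
    if s: "\<bar>s - T\<bar> \<le> \<bar>T\<bar>" and r: "r \<ge> 0" for s r
  proof -
    define \<tau> where "\<tau> = \<alpha> * s + \<beta>"
    have \<tau>: "\<tau>\<^sup>2 \<le> (\<alpha> * T)\<^sup>2"
    proof -
      have "\<tau> = \<alpha> * (s - T)" by (simp add: \<tau>_def \<beta>_def algebra_simps)
      then have "\<bar>\<tau>\<bar> \<le> \<bar>\<alpha> * T\<bar>" using s \<alpha> by (simp add: abs_mult)
      then show ?thesis by (rule abs_le_square_iff[THEN iffD1])
    qed
    have n: "norm (wave 0 \<tau> (\<alpha> * r)) = exp (- (\<alpha> * r / (1 + 4 * \<tau>\<^sup>2)) / 2) / sqrt (1 + 4 * \<tau>\<^sup>2)"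
      unfolding wave_eq by (simp add: laguerre_fun_def norm_mult norm_divide norm_one_plus)
    have sq: "1 \<le> sqrt (1 + 4 * \<tau>\<^sup>2)" by (simp add: real_le_rsqrt)
    then have sq0: "0 < sqrt (1 + 4 * \<tau>\<^sup>2)" by linarith
    have "exp (- (\<alpha> * r / (1 + 4 * \<tau>\<^sup>2)) / 2) / sqrt (1 + 4 * \<tau>\<^sup>2) \<le> exp (- (\<alpha> * r / (1 + 4 * \<tau>\<^sup>2)) / 2) / 1"
      using sq sq0 by (intro divide_left_mono) simp_all
    also have "\<dots> \<le> exp (- c * r)"
    proof -
      have "\<alpha> * r / (1 + 4 * (\<alpha> * T)\<^sup>2) \<le> \<alpha> * r / (1 + 4 * \<tau>\<^sup>2)"
        using \<tau> \<alpha> r by (intro divide_left_mono mult_pos_pos one_plus_pos) auto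
      moreover have "- c * r = - (\<alpha> * r / (1 + 4 * (\<alpha> * T)\<^sup>2)) / 2" unfolding c_def by simp
      moreover have "a \<le> b \<Longrightarrow> - b / 2 \<le> - a / 2" for a b :: real by simp
      ultimately have "- (\<alpha> * r / (1 + 4 * \<tau>\<^sup>2)) / 2 \<le> - c * r" by (simp only:)
      then show ?thesis by (simp only: div_by_1 exp_le_cancel_iff)
    qed
    finally have nb: "norm (wave 0 \<tau> (\<alpha> * r)) \<le> exp (- c * r)" unfolding n .
    then show "norm (g s r) \<le> exp (- c * r)" by (simp add: g_def \<tau>_def)
    have "wave_r 0 \<tau> (\<alpha> * r) = - wave 0 \<tau> (\<alpha> * r) / (2 * (1 + 2 * \<i> * of_real \<tau>))"
      by (simp add: wave_r_def wave_def wave_gen_def claguerre_def)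
    then have "norm (wave_r 0 \<tau> (\<alpha> * r)) = norm (wave 0 \<tau> (\<alpha> * r)) / (2 * sqrt (1 + 4 * \<tau>\<^sup>2))"
      by (simp only: norm_divide norm_minus_cancel norm_mult norm_one_plus norm_numeral)
    also have "\<dots> \<le> norm (wave 0 \<tau> (\<alpha> * r)) / 1"
    proof (rule divide_left_mono)
      show "1 \<le> 2 * sqrt (1 + 4 * \<tau>\<^sup>2)" using sq by linarith
      show "0 < 2 * sqrt (1 + 4 * \<tau>\<^sup>2) * 1" using sq0 by linarith
    qed simp
    finally have "norm (wave_r 0 \<tau> (\<alpha> * r)) \<le> exp (- c * r)" using nb by simp
    then show "norm (g1 s r) \<le> \<alpha> * exp (- c * r)" using \<alpha> by (simp add: g1_def \<tau>_def norm_mult)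
  qed
  define Q where "Q x = (norm (x - y))\<^sup>2" for x
  have Q0: "Q x \<ge> 0" for x by (simp add: Q_def)
  have Qc: "continuous_on UNIV Q" unfolding Q_def by (intro continuous_intros)
  define F where "F P s = (\<integral>x. w s x * (of_real (cutoff P (Q x)) * g s (Q x)) \<partial>lborel)" for P s
  define E where "E P s r = of_real (cutoff2 P r) * (of_real r * g s r) + 2 * of_real (cutoff1 P r) * (of_real r * g1 s r) + of_real (cutoff1 P r) * g s r" for P s r
  have dF: "(F P has_vector_derivative (\<integral>x. w s x * (4 * \<i> * E P s (Q x)) \<partial>lborel)) (at s)" if P: "P \<ge> 1" for P s
  proof -
    have P0: "P > 0" using P by simp
    define k where "k s r = of_real (cutoff P r) * g s r" for s r
    define k1 where "k1 s r = of_real (cutoff P r) * g1 s r + of_real (cutoff1 P r) * g s r" for s r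
    define k2 where "k2 s r = (of_real (cutoff P r) * g2 s r + of_real (cutoff1 P r) * g1 s r) + (of_real (cutoff1 P r) * g1 s r + of_real (cutoff2 P r) * g s r)" for s r
    have dc: "((\<lambda>r. complex_of_real (cutoff P r)) has_vector_derivative of_real (cutoff1 P r)) (at r)"
      "((\<lambda>r. complex_of_real (cutoff1 P r)) has_vector_derivative of_real (cutoff2 P r)) (at r)" for r
      using cutoff_deriv[OF P0, of r] by (simp_all add: has_vector_derivative_of_real has_real_derivative_iff_has_vector_derivative)
    have dk: "((\<lambda>r. k s r) has_vector_derivative k1 s r) (at r)" for s r
      unfolding k_def k1_def by (rule has_vector_derivative_mult[OF dc(1) dg])
    have dk1: "((\<lambda>r. k1 s r) has_vector_derivative k2 s r) (at r)" for s r
      unfolding k1_def k2_def by (intro has_vector_derivative_add has_vector_derivative_mult dc dg dg1)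
    have ck2: "continuous_on UNIV (k2 s)" for s
      unfolding k2_def by (intro continuous_intros continuous_cutoffs P0 cgr)
    define R where "R = norm y + sqrt P"
    have supp: "k s (Q x) = 0" if "norm x > R" for s x
    proof -
      have "sqrt P < norm (x - y)" using that norm_triangle_ineq2[of x y] by (simp add: R_def)
      then have "(sqrt P)\<^sup>2 \<le> Q x" unfolding Q_def using P0 by (intro power_mono) auto
      then show ?thesis using cutoff_zero[OF P0, of "Q x"] P0 by (simp add: k_def)
    qed
    have C2: "C_k 2 (\<lambda>x. k s (Q x))" for s unfolding Q_def by (rule radial_C2(1)[OF dk dk1 ck2])
    have lap: "laplacian (\<lambda>x. k s (Q x)) x = 4 * (of_real (Q x) * k2 s (Q x) + k1 s (Q x))" for s x
      unfolding Q_def by (rule radial_C2(2)[OF dk dk1 ck2])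
    have test: "test_function (\<lambda>x. k s (Q x))" for s by (rule test_functionI[OF C2 supp])
    have "((\<lambda>s. \<integral>x. w s x * k s (Q x) \<partial>lborel) has_vector_derivative
       (\<integral>x. w s x * (\<i> * laplacian (\<lambda>x. k s (Q x)) x + of_real (cutoff P (Q x)) * (- \<i> * (4 * (of_real (Q x) * g2 s (Q x) + g1 s (Q x))))) \<partial>lborel)) (at s)"
    proof (rule weak_curve_time_dependent_test[OF w test supp, where \<Phi>' = "\<lambda>s x. of_real (cutoff P (Q x)) * (- \<i> * (4 * (of_real (Q x) * g2 s (Q x) + g1 s (Q x))))"])
      show "((\<lambda>s. k s (Q x)) has_vector_derivative of_real (cutoff P (Q x)) * (- \<i> * (4 * (of_real (Q x) * g2 s (Q x) + g1 s (Q x))))) (at s)" for s x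
        unfolding k_def by (rule has_vector_derivative_mult_right[OF dgt])
      have pQ: "continuous_on UNIV (\<lambda>(s, x). (s, Q x))"
        unfolding split_beta by (intro continuous_intros continuous_on_compose2[OF Qc]) auto
      have "continuous_on UNIV (\<lambda>(s, x). g2 s (Q x))" "continuous_on UNIV (\<lambda>(s, x). g1 s (Q x))"
        using continuous_on_compose2[OF cg(2) pQ] continuous_on_compose2[OF cg(3) pQ] by (simp_all add: split_beta)
      moreover have "continuous_on UNIV (\<lambda>p::real \<times> (real^2). Q (snd p))"
        by (rule continuous_on_compose2[OF Qc]) (auto intro: continuous_intros)
      moreover have "continuous_on UNIV (\<lambda>p::real \<times> (real^2). cutoff P (Q (snd p)))"
        by (rule continuous_on_compose2[OF continuous_cutoffs(1)[OF P0, of UNIV]]) (use calculation in auto)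
      ultimately show "continuous_on UNIV (\<lambda>(s, x). of_real (cutoff P (Q x)) * (- \<i> * (4 * (of_real (Q x) * g2 s (Q x) + g1 s (Q x)))))"
        unfolding split_beta by (intro continuous_intros)
    qed
    moreover have "\<i> * laplacian (\<lambda>x. k s (Q x)) x + of_real (cutoff P (Q x)) * (- \<i> * (4 * (of_real (Q x) * g2 s (Q x) + g1 s (Q x)))) = 4 * \<i> * E P s (Q x)" for x
      unfolding lap E_def k2_def k1_def by (simp add: algebra_simps)
    ultimately show ?thesis unfolding F_def k_def by (simp only:)
  qed
  obtain B where B: "B \<ge> 0" "\<And>s. s \<in> {min 0 T..max 0 T} \<Longrightarrow> (\<integral>x. (norm (w s x))\<^sup>2 \<partial>lborel) \<le> B"
  proof -
    have "min 0 T \<le> max 0 T" by linarith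
    from weak_curve_locally_bounded[OF w this] show ?thesis using that by blast
  qed
  define h where "h x = complex_of_real ((1 + Q x) * exp (- c * Q x))" for x
  have hL: "in_Lp 2 lborel h" unfolding h_def Q_def by (rule gaussian_shifted_L2[OF c])
  define C where "C = 4 * (6 + 6 * \<alpha>)"
  have EB: "norm (4 * \<i> * E P s (Q x)) \<le> C / P * norm (h x)" if P: "P \<ge> 1" and s: "\<bar>s - T\<bar> \<le> \<bar>T\<bar>" for P s x
  proof -
    let ?e = "exp (- c * Q x)"
    note b = cutoff_bounds[OF P Q0[of x]]
    have "norm (E P s (Q x)) \<le> norm (of_real (cutoff2 P (Q x)) * (of_real (Q x) * g s (Q x))) + norm (2 * of_real (cutoff1 P (Q x)) * (of_real (Q x) * g1 s (Q x))) + norm (of_real (cutoff1 P (Q x)) * g s (Q x))"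
      unfolding E_def by (intro order.trans[OF norm_triangle_ineq] add_right_mono norm_triangle_ineq)
    also have "\<dots> = \<bar>cutoff2 P (Q x)\<bar> * (Q x * norm (g s (Q x))) + 2 * \<bar>cutoff1 P (Q x)\<bar> * (Q x * norm (g1 s (Q x))) + \<bar>cutoff1 P (Q x)\<bar> * norm (g s (Q x))"
      using Q0[of x] by (simp add: norm_mult)
    also have "\<dots> \<le> 6 / P * (Q x * ?e) + 2 * (3 / P) * (Q x * (\<alpha> * ?e)) + 3 / P * ?e"
      using b gb[OF s Q0[of x]] g1b[OF s Q0[of x]] Q0[of x] P
      by (intro add_mono mult_mono mult_nonneg_nonneg) auto
    also have "\<dots> \<le> (6 + 6 * \<alpha>) / P * ((1 + Q x) * ?e)"
    proof -
      have "(6 + 6 * \<alpha>) / P * ((1 + Q x) * ?e) - (6 / P * (Q x * ?e) + 2 * (3 / P) * (Q x * (\<alpha> * ?e)) + 3 / P * ?e) = (3 + 6 * \<alpha>) / P * ?e"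
        by (simp add: algebra_simps add_divide_distrib)
      moreover have "(3 + 6 * \<alpha>) / P * ?e \<ge> 0" using P \<alpha> by simp
      moreover have "a - b = d \<Longrightarrow> 0 \<le> d \<Longrightarrow> b \<le> a" for a b d :: real by linarith
      ultimately show ?thesis by blast
    qed
    also have "(1 + Q x) * ?e = norm (h x)" unfolding h_def norm_of_real using Q0[of x] by (simp add: abs_mult)
    finally have "4 * norm (E P s (Q x)) \<le> 4 * ((6 + 6 * \<alpha>) / P * norm (h x))" by (rule mult_left_mono) simp
    then have "4 * norm (E P s (Q x)) \<le> C / P * norm (h x)"
      by (simp only: C_def times_divide_eq_left times_divide_eq_right mult.assoc)
    then show ?thesis by (simp add: norm_mult)
  qed
  define M where "M = (\<integral>x. (norm (h x))\<^sup>2 \<partial>lborel)"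
  have C0: "C > 0" using \<alpha> by (simp add: C_def)
  have dFb: "norm (\<integral>x. w s x * (4 * \<i> * E P s (Q x)) \<partial>lborel) \<le> C / P * sqrt (B * M)"
    if P: "P \<ge> 1" and s: "s \<in> {min 0 T..max 0 T}" for P s
  proof -
    have sT: "\<bar>s - T\<bar> \<le> \<bar>T\<bar>" using s by auto
    have i: "integrable lborel (\<lambda>x. norm (w s x) * norm (h x))"
      using integrable_norm[OF in_Lp_2_integrable_mult[OF weak_curve_L2[OF w, of s] hL]] by (simp only: norm_mult)
    have "norm (\<integral>x. w s x * (4 * \<i> * E P s (Q x)) \<partial>lborel) \<le> (\<integral>x. C / P * (norm (w s x) * norm (h x)) \<partial>lborel)"
    proof (rule order.trans[OF integral_norm_bound integral_mono'])
      show "integrable lborel (\<lambda>x. C / P * (norm (w s x) * norm (h x)))" using i by (rule integrable_mult_right)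
      show "norm (w s x * (4 * \<i> * E P s (Q x))) \<le> C / P * (norm (w s x) * norm (h x))" for x
        using mult_left_mono[OF EB[OF P sT, of x] norm_ge_zero[of "w s x"]] by (simp add: norm_mult mult_ac)
      show "0 \<le> C / P * (norm (w s x) * norm (h x))" for x using C0 P by simp
    qed
    also have "\<dots> = C / P * (\<integral>x. norm (w s x) * norm (h x) \<partial>lborel)" by simp
    also have "\<dots> \<le> C / P * sqrt (B * M)"
    proof (rule mult_left_mono)
      have "(\<integral>x. norm (w s x) * norm (h x) \<partial>lborel)\<^sup>2 \<le> (\<integral>x. (norm (w s x))\<^sup>2 \<partial>lborel) * M"
        unfolding M_def by (rule Cauchy_Schwarz_integral(1)[OF weak_curve_L2[OF w] hL])
      also have "\<dots> \<le> B * M" using B(2)[OF s] by (intro mult_right_mono) (auto simp: M_def)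
      finally show "(\<integral>x. norm (w s x) * norm (h x) \<partial>lborel) \<le> sqrt (B * M)" by (rule real_le_rsqrt)
      show "0 \<le> C / P" using C0 P by simp
    qed
    finally show ?thesis .
  qed
  have F0: "F P 0 = 0" for P
  proof -
    have "F P 0 = (\<integral>x. 0 \<partial>(lborel :: (real^2) measure))"
      unfolding F_def
    proof (rule integral_cong_AE)
      show "AE x in lborel. w 0 x * (of_real (cutoff P (Q x)) * g 0 (Q x)) = 0" using w0 by eventually_elim simp
      have [measurable]: "w 0 \<in> borel_measurable lborel" by (rule in_Lp_2_borel[OF weak_curve_L2[OF w]])
      have [measurable]: "g 0 \<in> borel_measurable borel" "cutoff P \<in> borel_measurable borel" "Q \<in> borel_measurable borel"
        using cgr by (auto intro!: borel_measurable_continuous_onI Qc simp: cutoff_def[abs_def])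
      show "(\<lambda>x. w 0 x * (of_real (cutoff P (Q x)) * g 0 (Q x))) \<in> borel_measurable lborel" by measurable
    qed simp
    then show ?thesis by simp
  qed
  have FT: "norm (F P T) \<le> C / P * sqrt (B * M) * \<bar>T\<bar>" if P: "P \<ge> 1" for P
  proof -
    have "norm (F P T - F P 0) \<le> C / P * sqrt (B * M) * norm (T - 0)"
    proof (rule differentiable_bound[of "{min 0 T..max 0 T}" "F P" "\<lambda>s h. h *\<^sub>R (\<integral>x. w s x * (4 * \<i> * E P s (Q x)) \<partial>lborel)"])
      fix s assume s: "s \<in> {min 0 T..max 0 T}"
      show "(F P has_derivative (\<lambda>h. h *\<^sub>R (\<integral>x. w s x * (4 * \<i> * E P s (Q x)) \<partial>lborel))) (at s within {min 0 T..max 0 T})"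
        using dF[OF P, of s] unfolding has_vector_derivative_def by (rule has_derivative_at_withinI)
      show "onorm (\<lambda>h. h *\<^sub>R (\<integral>x. w s x * (4 * \<i> * E P s (Q x)) \<partial>lborel)) \<le> C / P * sqrt (B * M)"
        using mult_right_mono[OF dFb[OF P s]] by (intro onorm_le) (simp only: norm_scaleR mult.commute[of "\<bar>_\<bar>"] real_norm_def abs_ge_zero)
    qed auto
    then show ?thesis by (simp add: F0)
  qed
  (* Now the cutoff is removed: P = n + 1 tends to infinity. *)
  have lim0: "(\<lambda>n. F (real (Suc n)) T) \<longlonglongrightarrow> 0"
  proof (rule Lim_null_comparison)
    show "\<forall>\<^sub>F n in sequentially. norm (F (real (Suc n)) T) \<le> C * sqrt (B * M) * \<bar>T\<bar> * inverse (real (Suc n))"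
      by (rule always_eventually, rule allI) (use FT[of "real (Suc _)"] in \<open>simp add: divide_inverse mult_ac\<close>)
    have "(\<lambda>n. C * sqrt (B * M) * \<bar>T\<bar> * inverse (real (Suc n))) \<longlonglongrightarrow> C * sqrt (B * M) * \<bar>T\<bar> * 0"
      by (intro tendsto_intros LIMSEQ_inverse_real_of_nat)
    then show "(\<lambda>n. C * sqrt (B * M) * \<bar>T\<bar> * inverse (real (Suc n))) \<longlonglongrightarrow> 0" by simp
  qed
  have wTm [measurable]: "w T \<in> borel_measurable lborel" by (rule in_Lp_2_borel[OF weak_curve_L2[OF w]])
  have gm [measurable]: "g T \<in> borel_measurable borel" "cutoff P \<in> borel_measurable borel" "Q \<in> borel_measurable borel" for P
    using cgr by (auto intro!: borel_measurable_continuous_onI Qc simp: cutoff_def[abs_def])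
  have gL: "in_Lp 2 lborel (\<lambda>x. g T (Q x))"
    unfolding in_Lp_2_iff
  proof
    have "(norm (g T (Q x)))\<^sup>2 = ((norm (x - y))\<^sup>2) ^ 0 * exp (- \<alpha> * (norm (x - y))\<^sup>2)" for x
      unfolding gT Q_def by (simp add: power2_eq_square flip: exp_add)
    then show "integrable lborel (\<lambda>x. (norm (g T (Q x)))\<^sup>2)"
      using integrable_gaussian_shifted[OF \<alpha>, of y 0] by simp
  qed measurable
  have "(\<lambda>n. F (real (Suc n)) T) \<longlonglongrightarrow> (\<integral>x. w T x * g T (Q x) \<partial>lborel)"
    unfolding F_def
  proof (rule integral_dominated_convergence[where w = "\<lambda>x. norm (w T x * g T (Q x))"])
    show "integrable lborel (\<lambda>x. norm (w T x * g T (Q x)))"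
      by (intro integrable_norm in_Lp_2_integrable_mult weak_curve_L2 w gL)
    show "AE x in lborel. (\<lambda>n. w T x * (of_real (cutoff (real (Suc n)) (Q x)) * g T (Q x))) \<longlonglongrightarrow> w T x * g T (Q x)"
    proof (rule AE_I2)
      fix x
      have "(\<lambda>n. w T x * (of_real (cutoff (real (Suc n)) (Q x)) * g T (Q x))) \<longlonglongrightarrow> w T x * (of_real 1 * g T (Q x))"
        by (intro tendsto_intros cutoff_tendsto)
      then show "(\<lambda>n. w T x * (of_real (cutoff (real (Suc n)) (Q x)) * g T (Q x))) \<longlonglongrightarrow> w T x * g T (Q x)" by simp
    qed
    show "AE x in lborel. norm (w T x * (of_real (cutoff (real (Suc n)) (Q x)) * g T (Q x))) \<le> norm (w T x * g T (Q x))" for n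
    proof (rule AE_I2)
      fix x
      have "\<bar>cutoff (real (Suc n)) (Q x)\<bar> * norm (g T (Q x)) \<le> 1 * norm (g T (Q x))"
        using cutoff_bounds(1,2)[of "real (Suc n)" "Q x"] Q0[of x] by (intro mult_right_mono) auto
      then show "norm (w T x * (of_real (cutoff (real (Suc n)) (Q x)) * g T (Q x))) \<le> norm (w T x * g T (Q x))"
        unfolding norm_mult norm_of_real by (intro mult_left_mono) auto
    qed
  qed measurable
  from LIMSEQ_unique[OF lim0 this] show ?thesis by (simp add: gT Q_def)
qed

lemma integral_scale_shift:
  fixes f :: "real^2 \<Rightarrow> complex"
  assumes [measurable]: "f \<in> borel_measurable borel" and c: "c > 0"
  shows "(\<integral>y. f y \<partial>lborel) = of_real (c\<^sup>2) * (\<integral>z. f (x + c *\<^sub>R z) \<partial>lborel)"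
proof -
  have "(\<integral>y. f y \<partial>lborel) = (\<integral>y. f y \<partial>density (distr lborel borel (\<lambda>z. x + c *\<^sub>R z)) (\<lambda>_. ennreal (\<bar>c\<bar>^DIM(real^2))))"
    using c by (subst lborel_affine[of c x]) auto
  also have "\<dots> = (\<integral>y. (\<bar>c\<bar>^DIM(real^2)) *\<^sub>R f y \<partial>distr lborel borel (\<lambda>z. x + c *\<^sub>R z))"
    by (rule integral_density) auto
  also have "\<dots> = (\<integral>z. (\<bar>c\<bar>^DIM(real^2)) *\<^sub>R f (x + c *\<^sub>R z) \<partial>lborel)"
    by (rule integral_distr) auto
  finally show ?thesis using c by (simp add: scaleR_conv_of_real)
qed

lemma integrable_gaussian: "c > 0 \<Longrightarrow> integrable lborel (\<lambda>x::real^2. exp (- c * (norm x)\<^sup>2))"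
  using integrable_gaussian_shifted[of c 0 0] by simp

lemma integral_gaussian: "(\<integral>x. exp (- (norm (x::real^2))\<^sup>2) \<partial>lborel) = pi"
proof -
  have e: "laguerre_fun 0 r * laguerre_fun 0 r = exp (- r)" for r
    by (simp add: laguerre_fun_def flip: exp_add)
  have "(\<integral>r. exp (- r) \<partial>halfline) = 1" using laguerre_fun_orthonormal[of 0 0] unfolding e by simp
  then show ?thesis using integral_radial(1)[of "\<lambda>r. exp (- r)"] by simp
qed

lemma gaussian_L2: "c > 0 \<Longrightarrow> in_Lp 2 lborel (\<lambda>x::real^2. of_real (exp (- c * (norm (x - y))\<^sup>2)))"
  unfolding in_Lp_2_iff
proof
  assume c: "c > 0"
  have "(norm (of_real (exp (- c * q)) :: complex))\<^sup>2 = q ^ 0 * exp (- (2 * c) * q)" for q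
    by (simp add: power2_eq_square flip: exp_add)
  then show "integrable lborel (\<lambda>x::real^2. (norm (of_real (exp (- c * (norm (x - y))\<^sup>2)) :: complex))\<^sup>2)"
    using integrable_gaussian_shifted[of "2 * c" y 0] c by (simp only: zero_less_mult_iff zero_less_numeral simp_thms)
qed measurable

text \<open>Convolution with a Gaussian of width \<open>c\<close>, up to normalization. The substitution keeps the kernel fixed,
which suits dominated convergence as \<open>c\<close> tends to 0.\<close>

definition blur :: "(real^2 \<Rightarrow> complex) \<Rightarrow> real \<Rightarrow> real^2 \<Rightarrow> complex" where
  "blur \<phi> c x = (\<integral>z. of_real (exp (- (norm z)\<^sup>2)) * \<phi> (x + c *\<^sub>R z) \<partial>lborel)"

text \<open>A Gaussian bound in \<open>x\<close> that is uniform in the width, so that it majorizes both the integral over \<open>z\<close> and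
the pairing with a function in \<open>L\<^sup>2\<close>.\<close>

lemma blur_integrand_bound:
  fixes \<phi> :: "real^2 \<Rightarrow> complex"
  assumes \<phi>: "\<And>u. norm (\<phi> u) \<le> C * exp (- (1/4) * (norm u)\<^sup>2)" and C: "C \<ge> 0" and c: "0 < c" "c \<le> 1"
  shows "norm (of_real (exp (- (norm z)\<^sup>2)) * \<phi> (x + c *\<^sub>R z)) \<le> C * exp (- (1/8) * (norm x)\<^sup>2) * exp (- (3/4) * (norm z)\<^sup>2)"
proof -
  define u where "u = x + c *\<^sub>R z"
  have "(norm x)\<^sup>2 \<le> 2 * (norm u)\<^sup>2 + 2 * (norm (- (c *\<^sub>R z)))\<^sup>2"
    using norm_add_sq_le[of u "- (c *\<^sub>R z)"] by (simp add: u_def)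
  moreover have "(norm (- (c *\<^sub>R z)))\<^sup>2 \<le> (norm z)\<^sup>2"
    using c mult_right_mono[of c 1 "norm z"] by (intro power_mono) auto
  ultimately have q: "(1/8) * (norm x)\<^sup>2 \<le> (1/4) * (norm u)\<^sup>2 + (1/4) * (norm z)\<^sup>2" by linarith
  have "norm (of_real (exp (- (norm z)\<^sup>2)) * \<phi> u) \<le> exp (- (norm z)\<^sup>2) * (C * exp (- (1/4) * (norm u)\<^sup>2))"
    unfolding norm_mult using \<phi>[of u] by (intro mult_mono) auto
  also have "\<dots> = C * exp (- (norm z)\<^sup>2 + - (1/4) * (norm u)\<^sup>2)" by (simp only: exp_add mult_ac)
  also have "\<dots> \<le> C * exp (- (1/8) * (norm x)\<^sup>2 + - (3/4) * (norm z)\<^sup>2)"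
    using q C by (intro mult_left_mono) auto
  also have "\<dots> = C * exp (- (1/8) * (norm x)\<^sup>2) * exp (- (3/4) * (norm z)\<^sup>2)" by (simp only: exp_add mult.assoc)
  finally show ?thesis by (simp add: u_def)
qed

text \<open>By Fubini \<open>v\<close> is orthogonal to every blurred test function, and blurring tends to a multiple of the
identity.\<close>

lemma L2_zero_of_gaussians:
  fixes v :: "real^2 \<Rightarrow> complex"
  assumes v: "in_Lp 2 lborel v"
    and orth: "\<And>a y. a > 0 \<Longrightarrow> (\<integral>x. v x * of_real (exp (- a * (norm (x - y))\<^sup>2)) \<partial>lborel) = 0"
  shows "AE x in lborel. v x = 0"
proof (rule AE_zero_of_continuous_tests)
  show [measurable]: "v \<in> borel_measurable borel" using in_Lp_2_borel[OF v] by simp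
  show "integrable lborel (\<lambda>x. indicator (cball 0 R) x *\<^sub>R v x)" for R
    using in_Lp_2_integrable_mult[OF v indicator_cball_L2[of 1 0 R]] by (simp add: scaleR_conv_of_real mult.commute)
  fix \<phi> :: "real^2 \<Rightarrow> complex" and R
  assume \<phi>c: "continuous_on UNIV \<phi>" and \<phi>0: "\<And>x. norm x \<ge> R \<Longrightarrow> \<phi> x = 0"
  have [measurable]: "\<phi> \<in> borel_measurable borel" using \<phi>c by (rule borel_measurable_continuous_onI)
  obtain B where B: "B \<ge> 0" "\<And>x. norm (\<phi> x) \<le> B * indicator (cball 0 R) x"
    using continuous_compact_support_bounded[OF \<phi>c, of R] \<phi>0 by (metis less_imp_le)
  define C where "C = B * exp (R\<^sup>2 / 4)"
  have C0: "C \<ge> 0" using B(1) by (simp add: C_def)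
  have \<phi>b: "norm (\<phi> u) \<le> C * exp (- (1/4) * (norm u)\<^sup>2)" for u
  proof (cases "norm u \<le> R")
    case True
    then have "(norm u)\<^sup>2 \<le> R\<^sup>2" by (intro power_mono) auto
    then have "1 \<le> exp (R\<^sup>2 / 4 + - (1/4) * (norm u)\<^sup>2)" by simp
    then have "B * 1 \<le> B * exp (R\<^sup>2 / 4 + - (1/4) * (norm u)\<^sup>2)" using B(1) by (rule mult_left_mono)
    also have "\<dots> = C * exp (- (1/4) * (norm u)\<^sup>2)" by (simp only: C_def exp_add mult.assoc)
    finally show ?thesis using B(2)[of u] True by simp
  next
    case False
    then show ?thesis using \<phi>0[of u] C0 by simp
  qed
  have \<phi>nb: "norm (of_real (norm (\<phi> u)) :: complex) \<le> C * exp (- (1/4) * (norm u)\<^sup>2)" for u using \<phi>b[of u] by simp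
  define W where "W = (\<integral>z. exp (- (3/4) * (norm (z::real^2))\<^sup>2) \<partial>lborel)"
  define e where "e n = 1 / real (Suc n)" for n
  have e: "0 < e n" "e n \<le> 1" for n by (auto simp: e_def)
  have W0: "W \<ge> 0" by (simp add: W_def)
  have gint: "integrable lborel (\<lambda>z::real^2. c * exp (- (3/4) * (norm z)\<^sup>2))" for c :: real
    by (intro integrable_mult_right integrable_gaussian) simp
  have blur_bound: "norm (blur \<psi> (e n) x) \<le> C * W * exp (- (1/8) * (norm x)\<^sup>2)"
    if "\<And>u. norm (\<psi> u) \<le> C * exp (- (1/4) * (norm u)\<^sup>2)" for \<psi> n x
  proof -
    have "norm (blur \<psi> (e n) x) \<le> (\<integral>z. C * exp (- (1/8) * (norm x)\<^sup>2) * exp (- (3/4) * (norm (z::real^2))\<^sup>2) \<partial>lborel)"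
      unfolding blur_def
    proof (rule order.trans[OF integral_norm_bound integral_mono'])
      show "integrable lborel (\<lambda>z::real^2. C * exp (- (1/8) * (norm x)\<^sup>2) * exp (- (3/4) * (norm z)\<^sup>2))" by (rule gint)
    qed (use blur_integrand_bound[OF that C0 e] C0 in auto)
    also have "\<dots> = C * W * exp (- (1/8) * (norm x)\<^sup>2)" by (simp add: W_def)
    finally show ?thesis .
  qed
  have blur_meas [measurable]: "blur \<psi> c \<in> borel_measurable borel" if [measurable]: "\<psi> \<in> borel_measurable borel" for \<psi> c
  proof -
    have "(\<lambda>x. \<integral>z. of_real (exp (- (norm z)\<^sup>2)) * \<psi> (x + c *\<^sub>R z) \<partial>(lborel :: (real^2) measure)) \<in> borel_measurable borel"
      by measurable
    then show ?thesis unfolding blur_def[abs_def] .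
  qed
  have wL: "in_Lp 2 lborel (\<lambda>x::real^2. of_real (exp (- (1/8) * (norm x)\<^sup>2)))" using gaussian_L2[of "1/8" 0] by simp
  have domint: "integrable lborel (\<lambda>x. C * W * norm (v x * of_real (exp (- (1/8) * (norm x)\<^sup>2))))"
    by (intro integrable_mult_right integrable_norm in_Lp_2_integrable_mult v wL)
  have lim: "(\<lambda>n. \<integral>x. v x * blur \<phi> (e n) x \<partial>lborel) \<longlonglongrightarrow> (\<integral>x. v x * (of_real pi * \<phi> x) \<partial>lborel)"
  proof (rule integral_dominated_convergence[OF _ _ domint])
    show "AE x in lborel. (\<lambda>n. v x * blur \<phi> (e n) x) \<longlonglongrightarrow> v x * (of_real pi * \<phi> x)"
    proof (rule AE_I2, rule tendsto_mult[OF tendsto_const])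
      fix x
      have "(\<lambda>n. blur \<phi> (e n) x) \<longlonglongrightarrow> (\<integral>z. of_real (exp (- (norm (z::real^2))\<^sup>2)) * \<phi> x \<partial>lborel)"
        unfolding blur_def
      proof (rule integral_dominated_convergence[where w = "\<lambda>z. C * exp (- (1/8) * (norm x)\<^sup>2) * exp (- (3/4) * (norm z)\<^sup>2)"])
        show "AE z in lborel. (\<lambda>n. of_real (exp (- (norm z)\<^sup>2)) * \<phi> (x + e n *\<^sub>R z)) \<longlonglongrightarrow> of_real (exp (- (norm z)\<^sup>2)) * \<phi> x"
        proof (rule AE_I2, rule tendsto_mult[OF tendsto_const])
          fix z :: "real^2"
          have "(\<lambda>n. x + inverse (real (Suc n)) *\<^sub>R z) \<longlonglongrightarrow> x + 0 *\<^sub>R z"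
            by (intro tendsto_intros LIMSEQ_inverse_real_of_nat)
          then have l: "(\<lambda>n. x + e n *\<^sub>R z) \<longlonglongrightarrow> x" by (simp add: e_def inverse_eq_divide)
          have "isCont \<phi> x" using \<phi>c by (simp add: continuous_on_eq_continuous_at)
          from isCont_tendsto_compose[OF this l] show "(\<lambda>n. \<phi> (x + e n *\<^sub>R z)) \<longlonglongrightarrow> \<phi> x" .
        qed
      qed (use blur_integrand_bound[OF \<phi>b C0 e] gint in auto)
      also have "(\<integral>z. of_real (exp (- (norm (z::real^2))\<^sup>2)) * \<phi> x \<partial>lborel) = of_real pi * \<phi> x"
        using integral_gaussian by (simp only: integral_mult_left_zero integral_complex_of_real)
      finally show "(\<lambda>n. blur \<phi> (e n) x) \<longlonglongrightarrow> of_real pi * \<phi> x" .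
    qed
    show "AE x in lborel. norm (v x * blur \<phi> (e n) x) \<le> C * W * norm (v x * of_real (exp (- (1/8) * (norm x)\<^sup>2)))" for n
      using mult_left_mono[OF blur_bound[OF \<phi>b] norm_ge_zero] by (intro AE_I2) (simp add: norm_mult mult_ac)
  qed measurable
  have zero: "(\<integral>x. v x * blur \<phi> (e n) x \<partial>lborel) = 0" for n
  proof -
    define a where "a = 1 / (e n)\<^sup>2"
    have a: "a > 0" using e[of n] by (simp add: a_def)
    have kern: "(\<integral>y. of_real (exp (- a * (norm (y - x))\<^sup>2)) * \<psi> y \<partial>lborel) = of_real ((e n)\<^sup>2) * blur \<psi> (e n) x"
      if [measurable]: "\<psi> \<in> borel_measurable borel" for \<psi> x
    proof -
      have "(\<integral>y. of_real (exp (- a * (norm (y - x))\<^sup>2)) * \<psi> y \<partial>lborel)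
        = of_real ((e n)\<^sup>2) * (\<integral>z. of_real (exp (- a * (norm ((x + e n *\<^sub>R z) - x))\<^sup>2)) * \<psi> (x + e n *\<^sub>R z) \<partial>lborel)"
        by (rule integral_scale_shift[OF _ e(1)]) measurable
      also have "(\<lambda>z::real^2. complex_of_real (exp (- a * (norm ((x + e n *\<^sub>R z) - x))\<^sup>2))) = (\<lambda>z. of_real (exp (- (norm z)\<^sup>2)))"
        using e[of n] by (auto simp: a_def power_mult_distrib)
      finally show ?thesis unfolding blur_def by (simp only: fun_cong[OF \<open>_ = (\<lambda>z. of_real (exp (- (norm z)\<^sup>2)))\<close>])
    qed
    define f where "f x y = v x * (of_real (exp (- a * (norm (y - x))\<^sup>2)) * \<phi> y)" for x y
    have fint: "integrable (lborel \<Otimes>\<^sub>M lborel) (case_prod f)"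
    proof (rule lborel_pair.Fubini_integrable)
      show "case_prod f \<in> borel_measurable (lborel \<Otimes>\<^sub>M lborel)" unfolding f_def by measurable
      have n1: "(\<integral>y. norm (f x y) \<partial>lborel) = (e n)\<^sup>2 * norm (v x) * norm (blur (\<lambda>u. of_real (norm (\<phi> u))) (e n) x)" for x
      proof -
        have "complex_of_real (\<integral>y. norm (f x y) \<partial>lborel) = (\<integral>y. of_real (norm (f x y)) \<partial>lborel)" by (simp only: integral_complex_of_real)
        also have "\<dots> = of_real (norm (v x)) * (\<integral>y. of_real (exp (- a * (norm (y - x))\<^sup>2)) * of_real (norm (\<phi> y)) \<partial>lborel)"
          unfolding f_def by (simp add: norm_mult)
        also have "\<dots> = of_real (norm (v x)) * (of_real ((e n)\<^sup>2) * blur (\<lambda>u. of_real (norm (\<phi> u))) (e n) x)"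
          by (subst kern) auto
        finally have "norm (complex_of_real (\<integral>y. norm (f x y) \<partial>lborel)) = norm (of_real (norm (v x)) * (of_real ((e n)\<^sup>2) * blur (\<lambda>u. of_real (norm (\<phi> u))) (e n) x))"
          by (simp only:)
        then show ?thesis by (simp add: norm_mult norm_power mult_ac)
      qed
      show "integrable lborel (\<lambda>x. \<integral>y. norm (case_prod f (x, y)) \<partial>lborel)"
      proof (rule Bochner_Integration.integrable_bound[OF integrable_mult_right[OF domint, of "(e n)\<^sup>2"]])
        show "(\<lambda>x. \<integral>y. norm (case_prod f (x, y)) \<partial>lborel) \<in> borel_measurable lborel" unfolding f_def by measurable
        show "AE x in lborel. norm (\<integral>y. norm (case_prod f (x, y)) \<partial>lborel) \<le> norm ((e n)\<^sup>2 * (C * W * norm (v x * of_real (exp (- (1/8) * (norm x)\<^sup>2)))))"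
        proof (rule AE_I2)
          fix x
          have "(e n)\<^sup>2 * norm (v x) * norm (blur (\<lambda>u. of_real (norm (\<phi> u))) (e n) x) \<le> (e n)\<^sup>2 * norm (v x) * (C * W * exp (- (1/8) * (norm x)\<^sup>2))"
            by (intro mult_left_mono blur_bound \<phi>nb) auto
          then show "norm (\<integral>y. norm (case_prod f (x, y)) \<partial>lborel) \<le> norm ((e n)\<^sup>2 * (C * W * norm (v x * of_real (exp (- (1/8) * (norm x)\<^sup>2)))))"
            using C0 W0 by (simp add: n1 norm_mult abs_mult mult_ac)
        qed
      qed
      show "AE x in lborel. integrable lborel (\<lambda>y. case_prod f (x, y))"
      proof (rule AE_I2)
        fix x
        have "integrable lborel (\<lambda>y. of_real (exp (- a * (norm (y - x))\<^sup>2)) * \<phi> y)"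
          by (rule continuous_compact_support_L(1)[of _ R]) (use \<phi>0 in \<open>auto intro!: continuous_intros \<phi>c\<close>)
        then show "integrable lborel (\<lambda>y. case_prod f (x, y))" by (simp add: f_def)
      qed
    qed
    have "of_real ((e n)\<^sup>2) * (\<integral>x. v x * blur \<phi> (e n) x \<partial>lborel) = (\<integral>x. v x * (of_real ((e n)\<^sup>2) * blur \<phi> (e n) x) \<partial>lborel)"
      by (simp flip: integral_mult_right_zero add: mult_ac)
    also have "\<dots> = (\<integral>x. \<integral>y. f x y \<partial>lborel \<partial>lborel)"
    proof -
      have m: "\<phi> \<in> borel_measurable borel" by measurable
      have "(\<integral>y. f x y \<partial>lborel) = v x * (of_real ((e n)\<^sup>2) * blur \<phi> (e n) x)" for x
        unfolding f_def kern[OF m, symmetric] by (rule integral_mult_right_zero)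
      then show ?thesis by (simp only:)
    qed
    also have "\<dots> = (\<integral>y. \<integral>x. f x y \<partial>lborel \<partial>lborel)" by (rule lborel_pair.Fubini_integral[OF fint, symmetric])
    also have "\<dots> = (\<integral>y. 0 \<partial>(lborel :: (real^2) measure))"
    proof (intro Bochner_Integration.integral_cong refl)
      fix y
      have "(\<integral>x. f x y \<partial>lborel) = (\<integral>x. \<phi> y * (v x * of_real (exp (- a * (norm (x - y))\<^sup>2))) \<partial>lborel)"
        unfolding f_def by (intro Bochner_Integration.integral_cong refl) (simp add: norm_minus_commute mult_ac)
      also have "\<dots> = \<phi> y * (\<integral>x. v x * of_real (exp (- a * (norm (x - y))\<^sup>2)) \<partial>lborel)" by (rule integral_mult_right_zero)
      finally show "(\<integral>x. f x y \<partial>lborel) = 0" using orth[OF a, of y] by (simp only: mult_zero_right)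
    qed
    finally show ?thesis using e(1)[of n] by simp
  qed
  have "(\<lambda>n::nat. 0) \<longlonglongrightarrow> (\<integral>x. v x * (of_real pi * \<phi> x) \<partial>lborel)" using lim unfolding zero .
  then have "(\<integral>x. v x * (of_real pi * \<phi> x) \<partial>lborel) = 0" by (rule LIMSEQ_unique) (rule tendsto_const)
  moreover have "(\<integral>x. v x * (of_real pi * \<phi> x) \<partial>lborel) = of_real pi * (\<integral>x. v x * \<phi> x \<partial>lborel)"
    by (simp flip: integral_mult_right_zero add: mult_ac)
  ultimately show "(\<integral>x. v x * \<phi> x \<partial>lborel) = 0" by simp
qed

text \<open>The difference of two solutions is orthogonal to every Gaussian at every time.\<close>

lemma schroedinger_solution_unique:
  assumes u: "schroedinger_solution f u" and v: "schroedinger_solution f v"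
  shows "AE x in lborel. u t x = v t x"
proof -
  have w: "weak_curve (\<lambda>t x. u t x - v t x)"
    using u v by (intro weak_curve_diff) (auto simp: schroedinger_solution_iff_weak_curve)
  have "AE x in lborel. u 0 x = f x" "AE x in lborel. v 0 x = f x"
    using u v by (auto simp: schroedinger_solution_iff_weak_curve)
  then have w0: "AE x in lborel. u 0 x - v 0 x = 0" by eventually_elim simp
  have "AE x in lborel. u t x - v t x = 0"
  proof (rule L2_zero_of_gaussians[OF weak_curve_L2[OF w]])
    fix a :: real and y :: "real^2" assume "a > 0"
    then show "(\<integral>x. (u t x - v t x) * of_real (exp (- a * (norm (x - y))\<^sup>2)) \<partial>lborel) = 0"
      using weak_curve_orthogonal_gaussian[OF w w0, of "2 * a" t y] by simp
  qed
  then show ?thesis by eventually_elim simp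
qed

section \<open>Profiles of radial functions\<close>

definition rotation :: "real \<Rightarrow> real^2 \<Rightarrow> real^2" where
  "rotation \<theta> x = (\<chi> i. if i = 1 then cos \<theta> * x $ 1 - sin \<theta> * x $ 2 else sin \<theta> * x $ 1 + cos \<theta> * x $ 2)"

lemma rotation_nth: "rotation \<theta> x $ 1 = cos \<theta> * x $ 1 - sin \<theta> * x $ 2" "rotation \<theta> x $ 2 = sin \<theta> * x $ 1 + cos \<theta> * x $ 2"
  by (simp_all add: rotation_def)

lemma rotation_add: "rotation a (rotation b x) = rotation (a + b) x"
  by (simp add: vec_eq_iff forall_2 rotation_nth sin_add cos_add algebra_simps)

lemma rotation_0: "rotation 0 x = x"
  by (simp add: vec_eq_iff forall_2 rotation_nth)

lemma linear_rotation: "linear (rotation a)"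
  by (rule linearI) (simp_all add: vec_eq_iff forall_2 rotation_nth algebra_simps)

lemma norm_sq_2: "(norm x)\<^sup>2 = (x $ 1)\<^sup>2 + (x $ 2)\<^sup>2" for x :: "real^2"
  unfolding power2_norm_eq_inner inner_vec_def sum_2 by (simp add: power2_eq_square)

lemma norm_rotation: "norm (rotation a x) = norm x"
proof -
  have "(norm (rotation a x))\<^sup>2 = ((sin a)\<^sup>2 + (cos a)\<^sup>2) * ((x $ 1)\<^sup>2 + (x $ 2)\<^sup>2)"
    unfolding norm_sq_2 rotation_nth by (simp only: power2_eq_square algebra_simps)
  then have "(norm (rotation a x))\<^sup>2 = (norm x)\<^sup>2" by (simp add: norm_sq_2)
  then show ?thesis by simp
qed

text \<open>Rotations act transitively on circles.\<close>

lemma polar_rotation: "\<exists>b. x = rotation b (norm x *\<^sub>R axis 1 1)"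
proof (cases "x = 0")
  case True
  then show ?thesis by (intro exI[of _ 0]) (simp add: rotation_0)
next
  case False
  define \<rho> where "\<rho> = norm x"
  have \<rho>: "\<rho> > 0" using False by (simp add: \<rho>_def)
  have "(x $ 1 / \<rho>)\<^sup>2 + (x $ 2 / \<rho>)\<^sup>2 = 1"
    unfolding power_divide add_divide_distrib[symmetric] norm_sq_2[symmetric] \<rho>_def[symmetric] using \<rho> by simp
  then obtain b where "x $ 1 / \<rho> = cos b" "x $ 2 / \<rho> = sin b" using sincos_total_2pi by metis
  then have "x $ 1 = \<rho> * cos b" "x $ 2 = \<rho> * sin b" using \<rho> by (simp_all add: field_simps)
  then show ?thesis
    by (intro exI[of _ b]) (simp add: vec_eq_iff forall_2 rotation_nth axis_def \<rho>_def[symmetric] mult.commute)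
qed

lemma continuous_rotation: "continuous_on UNIV (\<lambda>(a, x). rotation a x)"
  unfolding rotation_def split_beta
proof (rule continuous_on_vec_lambda)
  fix i :: 2
  show "continuous_on UNIV (\<lambda>p::real \<times> (real^2). if i = 1 then cos (fst p) * snd p $ 1 - sin (fst p) * snd p $ 2 else sin (fst p) * snd p $ 1 + cos (fst p) * snd p $ 2)"
    by (cases "i = 1") (auto intro!: continuous_intros)
qed

lemma borel_rotation [measurable]: "(\<lambda>p. rotation (fst p) (snd p)) \<in> borel \<Otimes>\<^sub>M borel \<rightarrow>\<^sub>M borel"
proof -
  have "(\<lambda>p. rotation (fst p) (snd p)) = (\<lambda>(a, x). rotation a x)" by auto
  then show ?thesis unfolding borel_prod using borel_measurable_continuous_onI[OF continuous_rotation] by (simp only:)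
qed

lemma borel_rotation_fixed [measurable]:
  "rotation a \<in> borel \<rightarrow>\<^sub>M borel" "(\<lambda>a. rotation a x) \<in> borel \<rightarrow>\<^sub>M borel"
proof -
  show "rotation a \<in> borel \<rightarrow>\<^sub>M borel"
    by (rule borel_measurable_continuous_onI)
       (rule linear_continuous_on, rule linear_conv_bounded_linear[THEN iffD1, OF linear_rotation])
  have "continuous_on UNIV (\<lambda>a::real. (a, x))" by (intro continuous_intros)
  from continuous_on_compose2[OF continuous_rotation this]
  have "continuous_on UNIV (\<lambda>a. rotation a x)" by simp
  then show "(\<lambda>a. rotation a x) \<in> borel \<rightarrow>\<^sub>M borel" by (rule borel_measurable_continuous_onI)
qed

lemma AE_rotation:
  assumes N: "N \<in> null_sets (lborel :: (real^2) measure)"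
  shows "AE x in lborel. rotation a x \<notin> N"
proof -
  have "N \<in> null_sets lebesgue" using N by (rule null_sets_completionI)
  then have "negligible N" by (simp add: negligible_iff_null_sets)
  then have "negligible (rotation (- a) ` N)" by (rule negligible_differentiable_image_negligible[rotated])
       (rule linear_imp_differentiable_on[OF linear_rotation], simp)
  then have "AE x in lebesgue. x \<notin> rotation (- a) ` N" by (simp add: negligible_iff_null_sets AE_not_in)
  then have "AE x in lborel. x \<notin> rotation (- a) ` N" by (simp add: AE_completion_iff)
  then show ?thesis
  proof eventually_elim
    case (elim x)
    show ?case
    proof
      assume "rotation a x \<in> N"
      then have "rotation (- a) (rotation a x) \<in> rotation (- a) ` N" by (rule imageI)
      then show False using elim by (simp add: rotation_add rotation_0)
    qed
  qed
qed

lemma AE_lborel_shift: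
  fixes P :: "real \<Rightarrow> bool"
  assumes [measurable]: "Measurable.pred borel P" and "AE t in lborel. P (b + t)"
  shows "AE t in lborel. P t"
proof -
  have "AE t in distr lborel borel (\<lambda>t. b + t). P t"
    using assms(2) by (subst AE_distr_iff) auto
  then show ?thesis by (simp only: lborel_distr_plus)
qed

text \<open>The profile of a radial class need not be measurable, but the average of \<open>f\<close> over rotations is a Borel
function of the radius. For almost every \<open>x\<close> almost every rotation of \<open>x\<close> avoids the exceptional null
set, so that the average at \<open>x\<close> is \<open>f x\<close>.\<close>

lemma radial_borel_profile:
  assumes f: "f \<in> borel_measurable borel" and rad: "radial f"
  shows "\<exists>g\<in>borel_measurable borel. AE x in lborel. f x = g ((norm x)\<^sup>2)"
proof -
  note f [measurable]
  obtain g0 where "AE x in lborel. f x = g0 (norm x)" using rad by (auto simp: radial_def)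
  then obtain N where N: "N \<in> null_sets lborel" "{x \<in> space lborel. \<not> f x = g0 (norm x)} \<subseteq> N"
    by (auto simp: eventually_ae_filter)
  have eq: "f x = g0 (norm x)" if "x \<notin> N" for x using N(2) that by auto
  have Ns [measurable]: "N \<in> sets borel" using N(1) by auto
  have "AE a in lborel. AE x in (lborel :: (real^2) measure). rotation a x \<notin> N"
    by (rule AE_I2) (rule AE_rotation[OF N(1)])
  then have sw: "AE x in (lborel :: (real^2) measure). AE a in (lborel :: real measure). rotation a x \<notin> N"
  proof (subst lborel_pair.AE_commute)
    have [measurable]: "(\<lambda>p. (snd p, fst p)) \<in> (borel :: (real^2) measure) \<Otimes>\<^sub>M (borel :: real measure) \<rightarrow>\<^sub>M borel \<Otimes>\<^sub>M borel"
      by measurable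
    have [measurable]: "(\<lambda>p. rotation (snd p) (fst p)) \<in> borel \<Otimes>\<^sub>M borel \<rightarrow>\<^sub>M borel"
      using measurable_compose[OF \<open>(\<lambda>p. (snd p, fst p)) \<in> _\<close> borel_rotation] by simp
    show "{x \<in> space (lborel \<Otimes>\<^sub>M lborel). rotation (snd x) (fst x) \<notin> N} \<in> sets (lborel \<Otimes>\<^sub>M lborel)"
      by measurable
  qed
  (* Any interval of angles of length 1 will do, since f is almost everywhere constant along the circle. *)
  define g where "g r = (\<integral>a. indicator {0..1} a *\<^sub>R f (rotation a (sqrt r *\<^sub>R axis 1 1)) \<partial>lborel)" for r
  have pm: "(\<lambda>p::real \<times> real. (snd p, sqrt (fst p) *\<^sub>R axis 1 1 :: real^2)) \<in> borel \<Otimes>\<^sub>M borel \<rightarrow>\<^sub>M borel \<Otimes>\<^sub>M borel"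
    by measurable
  have [measurable]: "(\<lambda>p::real \<times> real. rotation (snd p) (sqrt (fst p) *\<^sub>R axis 1 1)) \<in> borel \<Otimes>\<^sub>M borel \<rightarrow>\<^sub>M borel"
    using measurable_compose[OF pm borel_rotation] by simp
  have "g \<in> borel_measurable borel"
    unfolding g_def[abs_def] by measurable
  moreover have "AE x in lborel. f x = g ((norm x)\<^sup>2)"
    using sw AE_not_in[OF N(1)]
  proof eventually_elim
    case (elim x)
    obtain b where b: "x = rotation b (norm x *\<^sub>R axis 1 1)" using polar_rotation by blast
    have "AE a in lborel. f (rotation (b + a) (norm x *\<^sub>R axis 1 1)) = f x"
      using elim(1)
    proof eventually_elim
      case (elim a)
      have "rotation (b + a) (norm x *\<^sub>R axis 1 1) = rotation a x"
        by (subst (2) b) (simp add: rotation_add add.commute)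
      moreover have "f (rotation a x) = g0 (norm x)" using eq[OF elim] by (simp add: norm_rotation)
      ultimately show ?case using eq[of x] \<open>x \<notin> N\<close> by simp
    qed
    then have ae: "AE a in lborel. f (rotation a (norm x *\<^sub>R axis 1 1)) = f x"
      by (rule AE_lborel_shift[rotated]) measurable
    have "g ((norm x)\<^sup>2) = (\<integral>a. indicator {0..1} a *\<^sub>R f x \<partial>(lborel :: real measure))"
      unfolding g_def
    proof (rule integral_cong_AE)
      show "AE a in lborel. indicator {0..1} a *\<^sub>R f (rotation a (sqrt ((norm x)\<^sup>2) *\<^sub>R axis 1 1)) = indicator {0..1} a *\<^sub>R f x"
        using ae by eventually_elim simp
    qed measurable
    then show ?case by simp
  qed
  ultimately show ?thesis by blast
qed

section \<open>Superpositions as weak solutions\<close>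

lemma wave_sum_L2_halfline:
  "(\<integral>\<^sup>+r. ennreal ((norm (wave_sum c K t r))\<^sup>2) \<partial>halfline) = ennreal (\<Sum>n<K. (norm (c n))\<^sup>2)"
proof -
  have "ennreal pi * (\<integral>\<^sup>+r. ennreal ((norm (wave_sum c K t r))\<^sup>2) \<partial>halfline)
     = (\<integral>\<^sup>+x. ennreal ((norm (wave_sum c K t ((norm (x::real^2))\<^sup>2)))\<^sup>2) \<partial>lborel)"
    by (rule nn_integral_radial[symmetric]) measurable
  also have "\<dots> = ennreal pi * ennreal (\<Sum>n<K. (norm (c n))\<^sup>2)"
    unfolding wave_sum_L2 by (rule ennreal_mult) (auto intro: sum_nonneg)
  finally have "ennreal pi = 0 \<or> (\<integral>\<^sup>+r. ennreal ((norm (wave_sum c K t r))\<^sup>2) \<partial>halfline) = ennreal (\<Sum>n<K. (norm (c n))\<^sup>2)"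
    by (simp only: ennreal_mult_cancel_left) auto
  moreover have "ennreal pi \<noteq> 0" using pi_gt_zero by (simp add: ennreal_eq_0_iff not_le)
  ultimately show ?thesis by blast
qed

lemma wave_sum_diff:
  assumes "m \<le> K"
  shows "wave_sum c K t r - wave_sum c m t r = wave_sum (\<lambda>n. if n < m then 0 else c n) K t r"
proof -
  have "wave_sum c K t r = (\<Sum>n<K. (if n < m then c n * wave n t r else 0)) + (\<Sum>n<K. (if n < m then 0 else c n) * wave n t r)"
    unfolding wave_sum_def sum.distrib[symmetric] by (intro sum.cong refl) simp
  also have "(\<Sum>n<K. (if n < m then c n * wave n t r else 0)) = wave_sum c m t r"
    unfolding wave_sum_def using assms by (intro sum.mono_neutral_cong_right) auto
  finally show ?thesis by (simp add: wave_sum_def)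
qed

text \<open>A wave decays like a Gaussian at a rate that is locally uniform in time; this dominates the passage to
the limit in time.\<close>

lemma wave_gaussian_bound: "\<exists>A\<ge>0. \<forall>t r. r \<ge> 0 \<longrightarrow> norm (wave n t r) \<le> A * exp (- (1 / (4 * (1 + 4 * t\<^sup>2))) * r)"
proof -
  define A where "A = (\<Sum>k\<le>degree (laguerre n). \<bar>coeff (laguerre n) k\<bar> * (fact k * (2 / (1/2)) ^ k))"
  have A: "A \<ge> 0" unfolding A_def by (intro sum_nonneg) auto
  have b: "\<bar>laguerre_fun n x\<bar> \<le> A * exp (- (1/4) * x)" if "x \<ge> 0" for x
  proof -
    have "\<bar>laguerre_fun n x\<bar> = \<bar>\<Sum>k\<le>degree (laguerre n). coeff (laguerre n) k * (x ^ k * exp (- (1/2) * x))\<bar>"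
      unfolding laguerre_fun_def poly_altdef by (simp add: sum_distrib_right mult.assoc)
    also have "\<dots> \<le> (\<Sum>k\<le>degree (laguerre n). \<bar>coeff (laguerre n) k * (x ^ k * exp (- (1/2) * x))\<bar>)" by (rule sum_abs)
    also have "\<dots> \<le> (\<Sum>k\<le>degree (laguerre n). \<bar>coeff (laguerre n) k\<bar> * (fact k * (2 / (1/2)) ^ k * exp (- (1/2/2) * x)))"
    proof (rule sum_mono)
      fix k
      have "\<bar>x ^ k * exp (- (1/2) * x)\<bar> \<le> fact k * (2 / (1/2)) ^ k * exp (- (1/2/2) * x)"
        using power_exp_bound[of "1/2" x k] that by (simp add: abs_mult)
      then show "\<bar>coeff (laguerre n) k * (x ^ k * exp (- (1/2) * x))\<bar> \<le> \<bar>coeff (laguerre n) k\<bar> * (fact k * (2 / (1/2)) ^ k * exp (- (1/2/2) * x))"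
        unfolding abs_mult[of "coeff (laguerre n) k"] by (rule mult_left_mono) simp
    qed
    also have "\<dots> = A * exp (- (1/4) * x)" by (simp add: A_def sum_distrib_right mult.assoc)
    finally show ?thesis .
  qed
  have "norm (wave n t r) \<le> A * exp (- (1 / (4 * (1 + 4 * t\<^sup>2))) * r)" if r: "r \<ge> 0" for t r
  proof -
    have s: "1 \<le> sqrt (1 + 4 * t\<^sup>2)" by (simp add: real_le_rsqrt)
    have "norm (wave n t r) = \<bar>laguerre_fun n (r / (1 + 4 * t\<^sup>2))\<bar> / sqrt (1 + 4 * t\<^sup>2)"
      unfolding wave_eq by (simp add: norm_mult norm_divide norm_power norm_phase norm_one_plus)
    also have "\<dots> \<le> \<bar>laguerre_fun n (r / (1 + 4 * t\<^sup>2))\<bar> / 1"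
    proof (rule divide_left_mono)
      show "0 < sqrt (1 + 4 * t\<^sup>2) * 1" using s by linarith
    qed (use s in auto)
    also have "\<dots> \<le> A * exp (- (1/4) * (r / (1 + 4 * t\<^sup>2)))"
      using b[of "r / (1 + 4 * t\<^sup>2)"] r one_plus_pos[of t] by simp
    also have "- (1/4) * (r / (1 + 4 * t\<^sup>2)) = - (1 / (4 * (1 + 4 * t\<^sup>2))) * r" by simp
    finally show ?thesis .
  qed
  then show ?thesis using A by blast
qed

lemma scaled_wave_L2_continuous:
  fixes \<alpha> \<beta> :: real
  assumes \<alpha>: "\<alpha> > 0"
  shows "in_Lp 2 lborel (\<lambda>x::real^2. wave n (\<alpha> * t + \<beta>) (\<alpha> * (norm x)\<^sup>2))"
    and "((\<lambda>t. \<integral>x. (norm (wave n (\<alpha> * t + \<beta>) (\<alpha> * (norm (x::real^2))\<^sup>2) - wave n (\<alpha> * t0 + \<beta>) (\<alpha> * (norm x)\<^sup>2)))\<^sup>2 \<partial>lborel) \<longlongrightarrow> 0) (at t0)"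
proof -
  obtain A where A: "A \<ge> 0" "\<And>t r. r \<ge> 0 \<Longrightarrow> norm (wave n t r) \<le> A * exp (- (1 / (4 * (1 + 4 * t\<^sup>2))) * r)"
    using wave_gaussian_bound[of n] by blast
  have bnd: "norm (wave n (\<alpha> * t + \<beta>) (\<alpha> * q)) \<le> A * exp (- (\<alpha> / (4 * (1 + 4 * M\<^sup>2))) * q)"
    if "\<bar>\<alpha> * t + \<beta>\<bar> \<le> M" "q \<ge> 0" for t q M
  proof -
    define s where "s = \<alpha> * t + \<beta>"
    have s2: "s\<^sup>2 \<le> M\<^sup>2" using that(1) unfolding s_def by (metis abs_ge_zero order.trans power2_abs power_mono)
    have "norm (wave n s (\<alpha> * q)) \<le> A * exp (- (1 / (4 * (1 + 4 * s\<^sup>2))) * (\<alpha> * q))"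
      using that \<alpha> by (intro A(2)) simp
    also have "\<dots> \<le> A * exp (- (1 / (4 * (1 + 4 * M\<^sup>2))) * (\<alpha> * q))"
    proof -
      have "1 / (4 * (1 + 4 * M\<^sup>2)) \<le> 1 / (4 * (1 + 4 * s\<^sup>2))"
        using s2 one_plus_pos[of s] one_plus_pos[of M] by (intro divide_left_mono mult_pos_pos) (simp_all add: one_plus_pos)
      then have "1 / (4 * (1 + 4 * M\<^sup>2)) * (\<alpha> * q) \<le> 1 / (4 * (1 + 4 * s\<^sup>2)) * (\<alpha> * q)"
        using that \<alpha> by (intro mult_right_mono) auto
      then show ?thesis using A(1) by (intro mult_left_mono) auto
    qed
    also have "- (1 / (4 * (1 + 4 * M\<^sup>2))) * (\<alpha> * q) = - (\<alpha> / (4 * (1 + 4 * M\<^sup>2))) * q" by simp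
    finally show ?thesis by (simp only: s_def)
  qed
  have wc: "continuous_on UNIV (\<lambda>r. wave n s (\<alpha> * r))" for s
  proof -
    have "continuous_on UNIV (\<lambda>r. (s, \<alpha> * r))" by (intro continuous_intros)
    from continuous_on_compose2[OF wave_continuous[of n] this] show ?thesis by simp
  qed
  have [measurable]: "(\<lambda>r. wave n s (\<alpha> * r)) \<in> borel_measurable borel" for s
    by (rule borel_measurable_continuous_onI[OF wc])
  have gi: "integrable lborel (\<lambda>x::real^2. C * exp (- (2 * (\<alpha> / (4 * (1 + 4 * M\<^sup>2)))) * (norm x)\<^sup>2))" for C M
    using \<alpha> one_plus_pos[of M] by (intro integrable_mult_right integrable_gaussian) simp
  have bnd2: "(norm (wave n (\<alpha> * t + \<beta>) (\<alpha> * q)))\<^sup>2 \<le> A\<^sup>2 * exp (- (2 * (\<alpha> / (4 * (1 + 4 * M\<^sup>2)))) * q)"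
    if "\<bar>\<alpha> * t + \<beta>\<bar> \<le> M" "q \<ge> 0" for t q M
  proof -
    have "(norm (wave n (\<alpha> * t + \<beta>) (\<alpha> * q)))\<^sup>2 \<le> (A * exp (- (\<alpha> / (4 * (1 + 4 * M\<^sup>2))) * q))\<^sup>2"
      by (rule power_mono[OF bnd[OF that]]) simp
    also have "\<dots> = A\<^sup>2 * exp (- (2 * (\<alpha> / (4 * (1 + 4 * M\<^sup>2)))) * q)"
      by (simp only: power_mult_distrib exp_double[symmetric]) (simp add: mult_ac)
    finally show ?thesis .
  qed
  show L: "in_Lp 2 lborel (\<lambda>x::real^2. wave n (\<alpha> * t + \<beta>) (\<alpha> * (norm x)\<^sup>2))" for t
    unfolding in_Lp_2_iff
  proof
    show m: "(\<lambda>x::real^2. wave n (\<alpha> * t + \<beta>) (\<alpha> * (norm x)\<^sup>2)) \<in> borel_measurable lborel"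
      using measurable_compose[of "\<lambda>x::real^2. (norm x)\<^sup>2" lborel borel "\<lambda>r. wave n (\<alpha> * t + \<beta>) (\<alpha> * r)" borel] by simp
    show "integrable lborel (\<lambda>x::real^2. (norm (wave n (\<alpha> * t + \<beta>) (\<alpha> * (norm x)\<^sup>2)))\<^sup>2)"
    proof (rule Bochner_Integration.integrable_bound[OF gi[of "A\<^sup>2" "\<bar>\<alpha> * t + \<beta>\<bar>"]])
      show "AE x in lborel. norm ((norm (wave n (\<alpha> * t + \<beta>) (\<alpha> * (norm (x::real^2))\<^sup>2)))\<^sup>2)
          \<le> norm (A\<^sup>2 * exp (- (2 * (\<alpha> / (4 * (1 + 4 * \<bar>\<alpha> * t + \<beta>\<bar>\<^sup>2)))) * (norm x)\<^sup>2))"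
      proof (rule AE_I2)
        fix x :: "real^2"
        have "(norm (wave n (\<alpha> * t + \<beta>) (\<alpha> * (norm x)\<^sup>2)))\<^sup>2 \<le> A\<^sup>2 * exp (- (2 * (\<alpha> / (4 * (1 + 4 * \<bar>\<alpha> * t + \<beta>\<bar>\<^sup>2)))) * (norm x)\<^sup>2)"
          by (rule bnd2) auto
        also have "\<dots> \<le> norm \<dots>" by simp
        finally show "norm ((norm (wave n (\<alpha> * t + \<beta>) (\<alpha> * (norm x)\<^sup>2)))\<^sup>2)
          \<le> norm (A\<^sup>2 * exp (- (2 * (\<alpha> / (4 * (1 + 4 * \<bar>\<alpha> * t + \<beta>\<bar>\<^sup>2)))) * (norm x)\<^sup>2))" by simp
      qed
    qed (use m in measurable)
  qed
  show "((\<lambda>t. \<integral>x. (norm (wave n (\<alpha> * t + \<beta>) (\<alpha> * (norm (x::real^2))\<^sup>2) - wave n (\<alpha> * t0 + \<beta>) (\<alpha> * (norm x)\<^sup>2)))\<^sup>2 \<partial>lborel) \<longlongrightarrow> 0) (at t0)"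
  proof -
    define M where "M = \<bar>\<alpha> * t0 + \<beta>\<bar> + \<alpha>"
    have M: "\<bar>\<alpha> * t + \<beta>\<bar> \<le> M" if "\<bar>t - t0\<bar> \<le> 1" for t
    proof -
      have "\<bar>\<alpha> * (t - t0)\<bar> \<le> \<alpha> * 1" unfolding abs_mult using \<alpha> that by (intro mult_mono) auto
      moreover have "\<alpha> * t + \<beta> = \<alpha> * (t - t0) + (\<alpha> * t0 + \<beta>)" by (simp add: algebra_simps)
      ultimately show ?thesis unfolding M_def by linarith
    qed
    show ?thesis unfolding tendsto_at_iff_sequentially
    proof (intro allI impI)
      fix X :: "nat \<Rightarrow> real" assume X: "\<forall>i. X i \<in> UNIV - {t0}" "X \<longlonglongrightarrow> t0"
      have "\<forall>\<^sub>F i in sequentially. dist (X i) t0 < 1" using tendstoD[OF X(2), of 1] by simp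
      then obtain n0 where n0: "\<And>i. \<bar>X (i + n0) - t0\<bar> < 1"
        unfolding eventually_sequentially dist_real_def by (meson le_add2)
      let ?d = "\<lambda>i x. (norm (wave n (\<alpha> * X (i + n0) + \<beta>) (\<alpha> * (norm (x::real^2))\<^sup>2) - wave n (\<alpha> * t0 + \<beta>) (\<alpha> * (norm x)\<^sup>2)))\<^sup>2"
      have "(\<lambda>i. \<integral>x. ?d i x \<partial>lborel) \<longlonglongrightarrow> (\<integral>x. 0 \<partial>(lborel :: (real^2) measure))"
      proof (rule integral_dominated_convergence[OF _ _ gi[of "4 * A\<^sup>2" M]])
        show "AE x in lborel. (\<lambda>i. ?d i x) \<longlonglongrightarrow> 0"
        proof (rule AE_I2)
          fix x :: "real^2"
          have "isCont (\<lambda>s. wave n s (\<alpha> * (norm x)\<^sup>2)) (\<alpha> * t0 + \<beta>)"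
            by (rule has_vector_derivative_continuous[OF wave_deriv_t])
          moreover have "(\<lambda>i. \<alpha> * X (i + n0) + \<beta>) \<longlonglongrightarrow> \<alpha> * t0 + \<beta>"
            by (intro tendsto_intros LIMSEQ_ignore_initial_segment X(2))
          ultimately have "(\<lambda>i. wave n (\<alpha> * X (i + n0) + \<beta>) (\<alpha> * (norm x)\<^sup>2)) \<longlonglongrightarrow> wave n (\<alpha> * t0 + \<beta>) (\<alpha> * (norm x)\<^sup>2)"
            by (rule isCont_tendsto_compose)
          then have "(\<lambda>i. ?d i x) \<longlonglongrightarrow> (norm (wave n (\<alpha> * t0 + \<beta>) (\<alpha> * (norm x)\<^sup>2) - wave n (\<alpha> * t0 + \<beta>) (\<alpha> * (norm x)\<^sup>2)))\<^sup>2"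
            by (intro tendsto_intros)
          then show "(\<lambda>i. ?d i x) \<longlonglongrightarrow> 0" by simp
        qed
        show "AE x in lborel. norm (?d i x) \<le> 4 * A\<^sup>2 * exp (- (2 * (\<alpha> / (4 * (1 + 4 * M\<^sup>2)))) * (norm x)\<^sup>2)" for i
        proof (rule AE_I2)
          fix x :: "real^2"
          have "?d i x \<le> 2 * (norm (wave n (\<alpha> * X (i + n0) + \<beta>) (\<alpha> * (norm x)\<^sup>2)))\<^sup>2 + 2 * (norm (wave n (\<alpha> * t0 + \<beta>) (\<alpha> * (norm x)\<^sup>2)))\<^sup>2"
            using norm_add_sq_le[of "wave n (\<alpha> * X (i + n0) + \<beta>) (\<alpha> * (norm x)\<^sup>2)" "- wave n (\<alpha> * t0 + \<beta>) (\<alpha> * (norm x)\<^sup>2)"] by simp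
          also have "\<dots> \<le> 2 * (A\<^sup>2 * exp (- (2 * (\<alpha> / (4 * (1 + 4 * M\<^sup>2)))) * (norm x)\<^sup>2)) + 2 * (A\<^sup>2 * exp (- (2 * (\<alpha> / (4 * (1 + 4 * M\<^sup>2)))) * (norm x)\<^sup>2))"
            using n0[of i] by (intro add_mono mult_left_mono bnd2 M) auto
          finally show "norm (?d i x) \<le> 4 * A\<^sup>2 * exp (- (2 * (\<alpha> / (4 * (1 + 4 * M\<^sup>2)))) * (norm x)\<^sup>2)" by simp
        qed
        show "?d i \<in> borel_measurable lborel" for i
          using in_Lp_2_borel[OF in_Lp_2_diff[OF L L]] by measurable
      qed simp
      then have "(\<lambda>i. \<integral>x. ?d i x \<partial>lborel) \<longlonglongrightarrow> 0" by simp
      then show "((\<lambda>t. \<integral>x. (norm (wave n (\<alpha> * t + \<beta>) (\<alpha> * (norm (x::real^2))\<^sup>2) - wave n (\<alpha> * t0 + \<beta>) (\<alpha> * (norm x)\<^sup>2)))\<^sup>2 \<partial>lborel) \<circ> X) \<longlonglongrightarrow> 0"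
        unfolding o_def by (rule LIMSEQ_offset[where k = n0])
    qed
  qed
qed

lemma weak_curve_scaled_wave:
  assumes "\<alpha> > 0" shows "weak_curve (\<lambda>t x. wave n (\<alpha> * t + \<beta>) (\<alpha> * (norm x)\<^sup>2))"
  unfolding weak_curve_def
  using scaled_wave_L2_continuous[OF assms] wave_weak_solution[where y = 0] by simp

lemma weak_curve_cmult:
  assumes w: "weak_curve w" shows "weak_curve (\<lambda>t x. c * w t x)"
  unfolding weak_curve_def
proof (intro conjI allI impI)
  show "in_Lp 2 lborel (\<lambda>x. c * w t x)" for t by (intro in_Lp_2_cmult weak_curve_L2 w)
  fix t0
  have "((\<lambda>t. (norm c)\<^sup>2 * (\<integral>x. (norm (w t x - w t0 x))\<^sup>2 \<partial>lborel)) \<longlongrightarrow> (norm c)\<^sup>2 * 0) (at t0)"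
    by (intro tendsto_intros weak_curve_continuous w)
  then show "((\<lambda>t. \<integral>x. (norm (c * w t x - c * w t0 x))\<^sup>2 \<partial>lborel) \<longlongrightarrow> 0) (at t0)"
    by (simp add: norm_mult power_mult_distrib flip: right_diff_distrib)
next
  fix \<psi> t assume "test_function \<psi>"
  from has_vector_derivative_mult_right[OF weak_curve_deriv[OF w this, of t], of c]
  show "((\<lambda>s. \<integral>x. c * w s x * \<psi> x \<partial>lborel) has_vector_derivative \<i> * (\<integral>x. c * w t x * laplacian \<psi> x \<partial>lborel)) (at t)"
    by (simp add: mult.assoc mult.left_commute)
qed

lemma weak_curve_0: "weak_curve (\<lambda>t x. 0)"
  by (simp add: weak_curve_def in_Lp_2_iff)

lemma weak_curve_add: "weak_curve u \<Longrightarrow> weak_curve v \<Longrightarrow> weak_curve (\<lambda>t x. u t x + v t x)"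
  using weak_curve_diff[of u "\<lambda>t x. - 1 * v t x"] weak_curve_cmult[of v "- 1"] by simp

lemma weak_curve_wave_sum: "weak_curve (\<lambda>t x. wave_sum c K t ((norm x)\<^sup>2))"
proof (induction K)
  case 0 then show ?case using weak_curve_0 by (simp add: wave_sum_def)
next
  case (Suc K)
  have "weak_curve (\<lambda>t x. c K * wave K t ((norm x)\<^sup>2))"
    using weak_curve_cmult[OF weak_curve_scaled_wave[of 1 K 0]] by simp
  from weak_curve_add[OF Suc this] show ?case by (simp add: wave_sum_def)
qed

text \<open>All three conditions pass to limits that are uniform in time: the derivatives of the pairings converge
uniformly too, by the inequality of Cauchy and Schwarz.\<close>

lemma weak_curve_uniform_limit:
  assumes u: "\<And>j::nat. weak_curve (u j)"
    and vm: "\<And>t. v t \<in> borel_measurable lborel"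
    and lim: "\<And>j t. (\<integral>\<^sup>+x. ennreal ((norm (v t x - u j t x))\<^sup>2) \<partial>lborel) \<le> ennreal (\<epsilon> j)"
    and \<epsilon>: "\<epsilon> \<longlonglongrightarrow> 0" "\<And>j. \<epsilon> j \<ge> 0"
  shows "weak_curve v"
proof -
  have [measurable]: "v t \<in> borel_measurable lborel" "u j t \<in> borel_measurable lborel" for t j
    using vm in_Lp_2_borel[OF weak_curve_L2[OF u]] by auto
  have dL: "in_Lp 2 lborel (\<lambda>x. v t x - u j t x)" for t j
    unfolding in_Lp_2_iff
  proof
    show "integrable lborel (\<lambda>x. (norm (v t x - u j t x))\<^sup>2)"
      by (rule integrableI_nonneg) (use le_less_trans[OF lim[of t j]] in auto)
  qed measurable
  have d: "(\<integral>x. (norm (v t x - u j t x))\<^sup>2 \<partial>lborel) \<le> \<epsilon> j" for t j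
  proof -
    have "ennreal (\<integral>x. (norm (v t x - u j t x))\<^sup>2 \<partial>lborel) = (\<integral>\<^sup>+x. ennreal ((norm (v t x - u j t x))\<^sup>2) \<partial>lborel)"
      by (rule nn_integral_eq_integral[symmetric]) (use in_Lp_2_integrable[OF dL] in auto)
    also have "\<dots> \<le> ennreal (\<epsilon> j)" by (rule lim)
    finally show ?thesis using \<epsilon>(2)[of j] by simp
  qed
  have vL: "in_Lp 2 lborel (v t)" for t
    using in_Lp_2_add[OF dL[of t 0] weak_curve_L2[OF u[of 0], of t]] by simp
  show ?thesis unfolding weak_curve_def
  proof (intro conjI allI impI)
    show "in_Lp 2 lborel (v t)" for t by (rule vL)
    fix t0
    show "((\<lambda>t. \<integral>x. (norm (v t x - v t0 x))\<^sup>2 \<partial>lborel) \<longlongrightarrow> 0) (at t0)"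
    proof (rule tendstoI)
      fix e :: real assume e: "e > 0"
      (* The splitting below bounds the square by 2 * (e / 4) + 8 * (e / 24) < e. *)
      have "\<forall>\<^sub>F j in sequentially. \<epsilon> j < e / 24" using order_tendstoD(2)[OF \<epsilon>(1), of "e/24"] e by simp
      then obtain j where j: "\<epsilon> j < e / 24" by (auto simp: eventually_sequentially)
      have "\<forall>\<^sub>F t in at t0. (\<integral>x. (norm (u j t x - u j t0 x))\<^sup>2 \<partial>lborel) < e / 4"
        using order_tendstoD(2)[OF weak_curve_continuous[OF u[of j], of t0], of "e/4"] e by simp
      then show "\<forall>\<^sub>F t in at t0. dist (\<integral>x. (norm (v t x - v t0 x))\<^sup>2 \<partial>lborel) 0 < e"
      proof eventually_elim
        case (elim t)
        have i: "integrable lborel (\<lambda>x. (norm (u j t x - u j t0 x))\<^sup>2)" "integrable lborel (\<lambda>x. (norm (v s x - u j s x))\<^sup>2)" for s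
          by (intro in_Lp_2_integrable in_Lp_2_diff weak_curve_L2 u vL)+
        have "(\<integral>x. (norm (v t x - v t0 x))\<^sup>2 \<partial>lborel) \<le> (\<integral>x. 2 * (norm (u j t x - u j t0 x))\<^sup>2
            + (4 * (norm (v t x - u j t x))\<^sup>2 + 4 * (norm (v t0 x - u j t0 x))\<^sup>2) \<partial>lborel)"
        proof (rule integral_mono)
          fix x
          have "(norm (v t x - v t0 x))\<^sup>2 \<le> 2 * (norm (u j t x - u j t0 x))\<^sup>2 + 2 * (norm ((v t x - u j t x) + - (v t0 x - u j t0 x)))\<^sup>2"
            using norm_add_sq_le[of "u j t x - u j t0 x" "(v t x - u j t x) + - (v t0 x - u j t0 x)"] by simp
          also have "(norm ((v t x - u j t x) + - (v t0 x - u j t0 x)))\<^sup>2 \<le> 2 * (norm (v t x - u j t x))\<^sup>2 + 2 * (norm (v t0 x - u j t0 x))\<^sup>2"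
            using norm_add_sq_le[of "v t x - u j t x" "- (v t0 x - u j t0 x)"] by (simp only: norm_minus_cancel)
          finally show "(norm (v t x - v t0 x))\<^sup>2 \<le> 2 * (norm (u j t x - u j t0 x))\<^sup>2
            + (4 * (norm (v t x - u j t x))\<^sup>2 + 4 * (norm (v t0 x - u j t0 x))\<^sup>2)" by simp
        qed (use i in_Lp_2_integrable[OF in_Lp_2_diff[OF vL vL]] in auto)
        also have "\<dots> = 2 * (\<integral>x. (norm (u j t x - u j t0 x))\<^sup>2 \<partial>lborel) + (4 * (\<integral>x. (norm (v t x - u j t x))\<^sup>2 \<partial>lborel) + 4 * (\<integral>x. (norm (v t0 x - u j t0 x))\<^sup>2 \<partial>lborel))"
          using i by simp
        also have "\<dots> < e" using elim d[of t j] d[of t0 j] j e by linarith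
        finally show ?case by simp
      qed
    qed
  next
    fix \<psi> t assume t: "test_function \<psi>"
    note \<psi>L = test_function_L2[OF t]
    have dist_bound: "norm ((\<integral>x. u j s x * \<eta> x \<partial>lborel) - (\<integral>x. v s x * \<eta> x \<partial>lborel)) \<le> sqrt (\<epsilon> j * (\<integral>x. (norm (\<eta> x))\<^sup>2 \<partial>lborel))"
      if \<eta>: "in_Lp 2 lborel \<eta>" for \<eta> j s
    proof -
      have "(\<integral>x. u j s x * \<eta> x \<partial>lborel) - (\<integral>x. v s x * \<eta> x \<partial>lborel) = - (\<integral>x. (v s x - u j s x) * \<eta> x \<partial>lborel)"
        using in_Lp_2_integrable_mult[OF weak_curve_L2[OF u[of j], of s] \<eta>] in_Lp_2_integrable_mult[OF vL[of s] \<eta>]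
        by (simp add: left_diff_distrib)
      moreover have "(norm (\<integral>x. (v s x - u j s x) * \<eta> x \<partial>lborel))\<^sup>2 \<le> (\<integral>x. (norm (v s x - u j s x))\<^sup>2 \<partial>lborel) * (\<integral>x. (norm (\<eta> x))\<^sup>2 \<partial>lborel)"
        by (rule Cauchy_Schwarz_integral(2)[OF dL \<eta>])
      moreover have "\<dots> \<le> \<epsilon> j * (\<integral>x. (norm (\<eta> x))\<^sup>2 \<partial>lborel)" using d by (intro mult_right_mono) auto
      ultimately show ?thesis by (intro real_le_rsqrt) (simp add: norm_minus_commute)
    qed
    have sq0: "(\<lambda>j. sqrt (\<epsilon> j * C)) \<longlonglongrightarrow> 0" for C
    proof -
      have "(\<lambda>j. sqrt (\<epsilon> j * C)) \<longlonglongrightarrow> sqrt (0 * C)" by (intro tendsto_intros \<epsilon>(1))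
      then show ?thesis by simp
    qed
    have conv: "(\<lambda>j. \<integral>x. u j s x * \<psi> x \<partial>lborel) \<longlonglongrightarrow> (\<integral>x. v s x * \<psi> x \<partial>lborel)" for s
      by (rule LIM_zero_cancel, rule Lim_null_comparison[OF _ sq0[of "\<integral>x. (norm (\<psi> x))\<^sup>2 \<partial>lborel"]])
         (intro always_eventually allI dist_bound \<psi>L)
    have "\<exists>g. \<forall>s\<in>UNIV. (\<lambda>j. \<integral>x. u j s x * \<psi> x \<partial>lborel) \<longlonglongrightarrow> g s \<and>
        (g has_derivative (\<lambda>h. h *\<^sub>R (\<i> * (\<integral>x. v s x * laplacian \<psi> x \<partial>lborel)))) (at s within UNIV)"
    proof (rule has_derivative_sequence[where ?x0.0 = 0])
      show "((\<lambda>s. \<integral>x. u j s x * \<psi> x \<partial>lborel) has_derivative (\<lambda>h. h *\<^sub>R (\<i> * (\<integral>x. u j s x * laplacian \<psi> x \<partial>lborel)))) (at s within UNIV)" for j s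
        using weak_curve_deriv[OF u t, of j s] unfolding has_vector_derivative_def .
      show "\<forall>\<^sub>F j in sequentially. \<forall>s\<in>UNIV. \<forall>h. norm (h *\<^sub>R (\<i> * (\<integral>x. u j s x * laplacian \<psi> x \<partial>lborel)) - h *\<^sub>R (\<i> * (\<integral>x. v s x * laplacian \<psi> x \<partial>lborel))) \<le> e * norm h"
        if "e > 0" for e
        using order_tendstoD(2)[OF sq0[of "\<integral>x. (norm (laplacian \<psi> x))\<^sup>2 \<partial>lborel"] that]
      proof eventually_elim
        case (elim j)
        show ?case
        proof (intro ballI allI)
          fix s h :: real
          have "norm ((\<integral>x. u j s x * laplacian \<psi> x \<partial>lborel) - (\<integral>x. v s x * laplacian \<psi> x \<partial>lborel)) \<le> e"
            using dist_bound[OF \<psi>L(2), of j s] elim by linarith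
          then have "\<bar>h\<bar> * norm ((\<integral>x. u j s x * laplacian \<psi> x \<partial>lborel) - (\<integral>x. v s x * laplacian \<psi> x \<partial>lborel)) \<le> \<bar>h\<bar> * e"
            by (rule mult_left_mono) simp
          then show "norm (h *\<^sub>R (\<i> * (\<integral>x. u j s x * laplacian \<psi> x \<partial>lborel)) - h *\<^sub>R (\<i> * (\<integral>x. v s x * laplacian \<psi> x \<partial>lborel))) \<le> e * norm h"
            by (simp add: norm_mult mult.commute flip: scaleR_diff_right right_diff_distrib)
        qed
      qed
      show "(\<lambda>j. \<integral>x. u j 0 x * \<psi> x \<partial>lborel) \<longlonglongrightarrow> (\<integral>x. v 0 x * \<psi> x \<partial>lborel)" by (rule conv)
    qed auto
    then obtain g where g: "\<And>s. (\<lambda>j. \<integral>x. u j s x * \<psi> x \<partial>lborel) \<longlonglongrightarrow> g s"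
      "(g has_derivative (\<lambda>h. h *\<^sub>R (\<i> * (\<integral>x. v t x * laplacian \<psi> x \<partial>lborel)))) (at t)" by auto
    have "g = (\<lambda>s. \<integral>x. v s x * \<psi> x \<partial>lborel)" using LIMSEQ_unique[OF g(1) conv] by auto
    then show "((\<lambda>s. \<integral>x. v s x * \<psi> x \<partial>lborel) has_vector_derivative \<i> * (\<integral>x. v t x * laplacian \<psi> x \<partial>lborel)) (at t)"
      using g(2) by (simp add: has_vector_derivative_def)
  qed
qed

section \<open>The solution with given radial data\<close>

lemma wave_0: "wave n 0 r = of_real (laguerre_fun n r)"
  by (simp add: wave_eq phase_def)

lemma wave_sum_L2_class: "in_Lp 2 halfline (wave_sum c K t)"
  and integral_wave_sum_sq: "(\<integral>r. (norm (wave_sum c K t r))\<^sup>2 \<partial>halfline) = (\<Sum>n<K. (norm (c n))\<^sup>2)"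
proof -
  show i: "in_Lp 2 halfline (wave_sum c K t)"
    unfolding in_Lp_2_iff
  proof
    show "integrable halfline (\<lambda>r. (norm (wave_sum c K t r))\<^sup>2)"
      by (rule integrableI_nonneg) (auto simp: wave_sum_L2_halfline)
  qed measurable
  have "ennreal (\<integral>r. (norm (wave_sum c K t r))\<^sup>2 \<partial>halfline) = ennreal (\<Sum>n<K. (norm (c n))\<^sup>2)"
    unfolding wave_sum_L2_halfline[of c K t, symmetric]
    by (rule nn_integral_eq_integral[symmetric]) (use in_Lp_2_integrable[OF i] in auto)
  then show "(\<integral>r. (norm (wave_sum c K t r))\<^sup>2 \<partial>halfline) = (\<Sum>n<K. (norm (c n))\<^sup>2)"
    by (subst (asm) ennreal_inj) (auto intro: sum_nonneg)
qed

text \<open>For \<open>h = \<Sum>n<K. cnj (c n) * wave n 0\<close> both the pairing of \<open>g\<close> with \<open>h\<close> and the squared norm of \<open>h\<close> are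
the sum on the left; the inequality of Cauchy and Schwarz does the rest.\<close>

lemma laguerre_bessel:
  assumes g: "in_Lp 2 halfline g"
  shows "(\<Sum>n<K. (norm (\<integral>r. g r * of_real (laguerre_fun n r) \<partial>halfline))\<^sup>2) \<le> (\<integral>r. (norm (g r))\<^sup>2 \<partial>halfline)"
proof -
  define c where "c n = (\<integral>r. g r * of_real (laguerre_fun n r) \<partial>halfline)" for n
  define S where "S = (\<Sum>n<K. (norm (c n))\<^sup>2)"
  have S: "S \<ge> 0" unfolding S_def by (intro sum_nonneg) auto
  have i: "integrable halfline (\<lambda>r. g r * of_real (laguerre_fun n r))" for n
    by (rule in_Lp_2_integrable_mult[OF g laguerre_fun_L2])
  have "(\<integral>r. g r * wave_sum (\<lambda>n. cnj (c n)) K 0 r \<partial>halfline)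
      = (\<integral>r. (\<Sum>n<K. cnj (c n) * (g r * of_real (laguerre_fun n r))) \<partial>halfline)"
    unfolding wave_sum_def wave_0 sum_distrib_left by (simp add: mult_ac)
  also have "\<dots> = (\<Sum>n<K. cnj (c n) * c n)"
    using i by (simp add: c_def)
  also have "\<dots> = of_real S"
    unfolding S_def of_real_sum by (rule sum.cong[OF refl]) (simp add: complex_norm_square mult.commute del: of_real_power)
  finally have "(norm (\<integral>r. g r * wave_sum (\<lambda>n. cnj (c n)) K 0 r \<partial>halfline))\<^sup>2 = S\<^sup>2" by simp
  then have "S\<^sup>2 \<le> (\<integral>r. (norm (g r))\<^sup>2 \<partial>halfline) * S"
    using Cauchy_Schwarz_integral(2)[OF g wave_sum_L2_class[of "\<lambda>n. cnj (c n)" K 0]]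
    unfolding integral_wave_sum_sq by (simp add: S_def)
  then have "S = 0 \<or> S \<le> (\<integral>r. (norm (g r))\<^sup>2 \<partial>halfline)"
    using S mult_right_le_imp_le[of S S "\<integral>r. (norm (g r))\<^sup>2 \<partial>halfline"] unfolding power2_eq_square[of S] by linarith
  then show ?thesis unfolding S_def c_def by (auto intro: integral_nonneg)
qed

lemma summable_fast_subsequence:
  fixes a :: "nat \<Rightarrow> real"
  assumes "summable a"
  shows "\<exists>N. strict_mono N \<and> (\<forall>j K. sum a {N j..<K} \<le> (1/4) ^ j)"
proof -
  have "\<forall>j. \<exists>M. \<forall>m\<ge>M. \<forall>K. norm (sum a {m..<K}) < (1/4) ^ j"
    using assms[unfolded summable_Cauchy] by simp
  then obtain M where M: "\<And>j m K. m \<ge> M j \<Longrightarrow> norm (sum a {m..<K}) < (1/4) ^ j" by metis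
  (* Accumulating the thresholds M, and adding 1, makes the sequence strictly increasing. *)
  define N where "N j = (\<Sum>i\<le>j. M i + 1)" for j
  have "strict_mono N" by (simp add: strict_mono_Suc_iff N_def)
  moreover have "N j \<ge> M j" for j
    unfolding N_def using member_le_sum[of j "{..j}" "\<lambda>i. M i + 1"] by simp
  then have "sum a {N j..<K} \<le> (1/4) ^ j" for j K
    using M[of j "N j" K] by simp
  ultimately show ?thesis by blast
qed

text \<open>Along a subsequence with geometrically decreasing tails the partial sums converge almost everywhere, at
every time. The limit is taken pointwise (and set to 0 where it does not exist), which makes it jointly
measurable in time and space.\<close>

lemma wave_series:
  assumes "summable (\<lambda>n. (norm (c n))\<^sup>2)"
  shows "\<exists>V N. strict_mono N \<and> (\<lambda>(t, r). V t r) \<in> borel_measurable borel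
     \<and> (\<forall>t r. V t r = 0 \<or> (\<lambda>j. wave_sum c (N j) t r) \<longlonglongrightarrow> V t r)
     \<and> (\<forall>t j. (\<integral>\<^sup>+r. ennreal ((norm (V t r - wave_sum c (N j) t r))\<^sup>2) \<partial>halfline) \<le> ennreal ((1/4) ^ j))"
proof -
  obtain N where N: "strict_mono N" "\<And>j K. (\<Sum>n\<in>{N j..<K}. (norm (c n))\<^sup>2) \<le> (1/4) ^ j"
    using summable_fast_subsequence[OF assms] by blast
  define s where "s j t r = wave_sum c (N j) t r" for j t r
  define V where "V t r = (if Cauchy (\<lambda>j. s j t r) then lim (\<lambda>j. s j t r) else 0)" for t r
  have sm[measurable]: "(\<lambda>p. s j (fst p) (snd p)) \<in> borel_measurable borel" for j
    unfolding s_def using borel_measurable_continuous_onI[OF continuous_wave_sum[of c "N j"]] by (simp add: split_beta')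
  have sm'[measurable]: "s j t \<in> borel_measurable borel" for j t
    unfolding s_def[abs_def] by measurable
  have Vm: "(\<lambda>(t, r). V t r) \<in> borel_measurable borel"
  proof -
    have "(\<lambda>p. if Cauchy (\<lambda>j. s j (fst p) (snd p)) then lim (\<lambda>j. s j (fst p) (snd p)) else 0) \<in> borel_measurable borel"
      by (intro measurable_If borel_measurable_lim_metric sets_Collect_Cauchy sm) auto
    then show ?thesis by (simp add: V_def split_beta')
  qed
  have Vm'[measurable]: "V t \<in> borel_measurable borel" for t
    using measurable_compose[of "\<lambda>r. (t, r)" borel borel "\<lambda>(t, r). V t r" borel] Vm by (simp add: borel_prod[symmetric])
  have diff: "(\<integral>\<^sup>+r. ennreal ((norm (s k t r - s j t r))\<^sup>2) \<partial>halfline) \<le> ennreal ((1/4) ^ j)" if "j \<le> k" for j k t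
  proof -
    have Nle: "N j \<le> N k" using strict_mono_less_eq[OF N(1)] that by simp
    have "(\<integral>\<^sup>+r. ennreal ((norm (s k t r - s j t r))\<^sup>2) \<partial>halfline) = ennreal (\<Sum>n<N k. (norm (if n < N j then 0 else c n))\<^sup>2)"
      unfolding s_def wave_sum_diff[OF Nle] wave_sum_L2_halfline ..
    also have "(\<Sum>n<N k. (norm (if n < N j then 0 else c n))\<^sup>2) = (\<Sum>n\<in>{N j..<N k}. (norm (c n))\<^sup>2)"
      by (rule sum.mono_neutral_cong_right) auto
    also have "ennreal \<dots> \<le> ennreal ((1/4) ^ j)" by (rule ennreal_leI[OF N(2)])
    finally show ?thesis .
  qed
  have lim: "AE r in halfline. (\<lambda>k. s k t r) \<longlonglongrightarrow> V t r" for t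
  proof -
    have "AE r in halfline. convergent (\<lambda>k. s k t r)"
    proof (rule L2_fast_Cauchy_convergent[where C = 1])
      show "(\<integral>\<^sup>+r. ennreal ((norm (s (Suc j) t r - s j t r))\<^sup>2) \<partial>halfline) \<le> ennreal (1 * (1/4) ^ j)" for j
        using diff[of j "Suc j" t] by simp
    qed (simp_all, measurable)
    then show ?thesis
      by eventually_elim (simp add: V_def convergent_LIMSEQ_iff Cauchy_convergent_iff)
  qed
  have "(\<integral>\<^sup>+r. ennreal ((norm (V t r - s j t r))\<^sup>2) \<partial>halfline) \<le> ennreal ((1/4) ^ j)" for t j
  proof -
    have "(\<integral>\<^sup>+r. ennreal ((norm (V t r - s j t r))\<^sup>2) \<partial>halfline)
        = (\<integral>\<^sup>+r. liminf (\<lambda>k. ennreal ((norm (s k t r - s j t r))\<^sup>2)) \<partial>halfline)"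
    proof (rule nn_integral_cong_AE, use lim[of t] in eventually_elim)
      case (elim r)
      have "(\<lambda>k. ennreal ((norm (s k t r - s j t r))\<^sup>2)) \<longlonglongrightarrow> ennreal ((norm (V t r - s j t r))\<^sup>2)"
        by (intro tendsto_intros tendsto_ennrealI elim)
      from lim_imp_Liminf[OF sequentially_bot this] show ?case by (rule sym)
    qed
    also have "\<dots> \<le> liminf (\<lambda>k. \<integral>\<^sup>+r. ennreal ((norm (s k t r - s j t r))\<^sup>2) \<partial>halfline)"
      by (rule nn_integral_liminf) measurable
    also have "\<dots> \<le> limsup (\<lambda>k. \<integral>\<^sup>+r. ennreal ((norm (s k t r - s j t r))\<^sup>2) \<partial>halfline)"
      by (rule Liminf_le_Limsup) simp
    also have "\<dots> \<le> ennreal ((1/4) ^ j)"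
      by (rule Limsup_bounded) (auto intro!: eventually_sequentiallyI[of j] diff)
    finally show ?thesis .
  qed
  moreover have "V t r = 0 \<or> (\<lambda>j. s j t r) \<longlonglongrightarrow> V t r" for t r
    by (simp add: V_def convergent_LIMSEQ_iff Cauchy_convergent_iff)
  ultimately show ?thesis using N(1) Vm unfolding s_def by blast
qed

text \<open>The series is a limit of weak solutions, uniformly in time. At time 0 it has the same Laguerre coefficients as \<open>g\<close>
and so equals \<open>g\<close> by completeness. The estimate passes to the limit by Fatou's lemma, once in space and
once in time.\<close>

lemma radial_solution_exists:
  fixes g :: "real \<Rightarrow> complex"
  assumes gb[measurable]: "g \<in> borel_measurable borel" and g: "in_Lp 2 halfline g"
  defines "c \<equiv> \<lambda>n. \<integral>r. g r * of_real (laguerre_fun n r) \<partial>halfline"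
  defines "G \<equiv> \<integral>r. (norm (g r))\<^sup>2 \<partial>halfline"
  shows "summable (\<lambda>n. (norm (c n))\<^sup>2)"
    and "\<exists>v. schroedinger_solution (\<lambda>x. g ((norm x)\<^sup>2)) v \<and>
      (\<forall>N. (\<integral>\<^sup>+t. \<integral>\<^sup>+x. ennreal ((norm (v t x)) ^ 4) \<partial>lborel \<partial>lborel) \<le> ennreal (pi\<^sup>2 / 4 * (G\<^sup>2 - deficit c N)))"
proof -
  have bessel: "(\<Sum>n<K. (norm (c n))\<^sup>2) \<le> G" for K
    unfolding c_def G_def by (rule laguerre_bessel[OF g])
  show summ: "summable (\<lambda>n. (norm (c n))\<^sup>2)"
    by (rule summableI_nonneg_bounded[OF _ bessel]) simp
  obtain V N where N: "strict_mono N" and Vm: "(\<lambda>(t, r). V t r) \<in> borel_measurable borel"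
    and V: "\<And>t r. V t r = 0 \<or> (\<lambda>j. wave_sum c (N j) t r) \<longlonglongrightarrow> V t r"
      "\<And>t j. (\<integral>\<^sup>+r. ennreal ((norm (V t r - wave_sum c (N j) t r))\<^sup>2) \<partial>halfline) \<le> ennreal ((1/4) ^ j)"
    using wave_series[OF summ] by blast
  have [measurable]: "V t \<in> borel_measurable borel" for t
    using measurable_compose[of "\<lambda>r. (t, r)" borel borel "\<lambda>(t, r). V t r" borel] Vm by (simp add: borel_prod[symmetric])
  define v where "v t x = V t ((norm (x::real^2))\<^sup>2)" for t x
  have jm: "(\<lambda>(x, t). v t x) \<in> borel_measurable (lborel :: ((real^2) \<times> real) measure)"
  proof -
    have "(\<lambda>p::(real^2) \<times> real. (snd p, (norm (fst p))\<^sup>2)) \<in> borel_measurable borel"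
      by (intro borel_measurable_continuous_onI continuous_intros)
    from measurable_compose[OF this Vm] show ?thesis by (simp add: v_def split_beta')
  qed
  have vd: "(\<integral>\<^sup>+x. ennreal ((norm (v t x - wave_sum c (N j) t ((norm x)\<^sup>2)))\<^sup>2) \<partial>lborel) \<le> ennreal (pi * (1/4) ^ j)" for t j
  proof -
    have "(\<integral>\<^sup>+x. ennreal ((norm (v t x - wave_sum c (N j) t ((norm x)\<^sup>2)))\<^sup>2) \<partial>lborel)
       = ennreal pi * (\<integral>\<^sup>+r. ennreal ((norm (V t r - wave_sum c (N j) t r))\<^sup>2) \<partial>halfline)"
      unfolding v_def by (rule nn_integral_radial) measurable
    also have "\<dots> \<le> ennreal pi * ennreal ((1/4) ^ j)" by (intro mult_left_mono V(2)) simp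
    finally show ?thesis by (simp add: ennreal_mult)
  qed
  have wc: "weak_curve v"
  proof (rule weak_curve_uniform_limit[where u = "\<lambda>j t x. wave_sum c (N j) t ((norm x)\<^sup>2)", OF weak_curve_wave_sum _ vd])
    show "v t \<in> borel_measurable lborel" for t unfolding v_def[abs_def] by measurable
    have "(\<lambda>j. pi * (1/4) ^ j) \<longlonglongrightarrow> pi * 0" by (intro tendsto_intros LIMSEQ_power_zero) simp
    then show "(\<lambda>j. pi * (1/4) ^ j) \<longlonglongrightarrow> 0" by simp
  qed simp
  have V0: "AE r in halfline. V 0 r - g r = 0"
  proof (rule laguerre_complete)
    have d: "in_Lp 2 halfline (\<lambda>r. V 0 r - wave_sum c (N j) 0 r)" for j
      unfolding in_Lp_2_iff
    proof
      show "integrable halfline (\<lambda>r. (norm (V 0 r - wave_sum c (N j) 0 r))\<^sup>2)"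
        by (rule integrableI_nonneg) (use le_less_trans[OF V(2)[of 0 j]] in auto)
    qed measurable
    have VL: "in_Lp 2 halfline (V 0)"
      using in_Lp_2_add[OF d[of 0] wave_sum_L2_class[of c "N 0" 0]] by simp
    show "in_Lp 2 halfline (\<lambda>r. V 0 r - g r)" by (rule in_Lp_2_diff[OF VL g])
    fix n
    let ?l = "\<lambda>r. complex_of_real (laguerre_fun n r)"
    have sq: "(norm (\<integral>r. (V 0 r - g r) * ?l r \<partial>halfline))\<^sup>2 \<le> (1/4) ^ j" if j: "j > n" for j
    proof -
      have nj: "n < N j" using j strict_mono_imp_increasing[OF N, of j] by simp
      have "(\<integral>r. wave_sum c (N j) 0 r * ?l r \<partial>halfline) = (\<integral>r. (\<Sum>m<N j. c m * of_real (laguerre_fun m r * laguerre_fun n r)) \<partial>halfline)"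
        unfolding wave_sum_def wave_0 sum_distrib_right by (simp add: mult.assoc)
      also have "\<dots> = (\<Sum>m<N j. c m * of_real (if m = n then 1 else 0))"
        using integrable_laguerre_fun_mult by (simp add: laguerre_fun_orthonormal del: of_real_mult)
      also have "\<dots> = c n" using nj by (simp add: if_distrib cong: if_cong)
      finally have "(\<integral>r. (V 0 r - g r) * ?l r \<partial>halfline) = (\<integral>r. (V 0 r - wave_sum c (N j) 0 r) * ?l r \<partial>halfline)"
        using in_Lp_2_integrable_mult[OF VL laguerre_fun_L2] in_Lp_2_integrable_mult[OF g laguerre_fun_L2]
          in_Lp_2_integrable_mult[OF wave_sum_L2_class laguerre_fun_L2]
        by (simp add: left_diff_distrib c_def)
      moreover have "(norm (\<integral>r. (V 0 r - wave_sum c (N j) 0 r) * ?l r \<partial>halfline))\<^sup>2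
         \<le> (\<integral>r. (norm (V 0 r - wave_sum c (N j) 0 r))\<^sup>2 \<partial>halfline) * (\<integral>r. (norm (?l r))\<^sup>2 \<partial>halfline)"
        by (rule Cauchy_Schwarz_integral(2)[OF d laguerre_fun_L2])
      moreover have "(\<integral>r. (norm (?l r))\<^sup>2 \<partial>halfline) = 1"
        using laguerre_fun_orthonormal[of n n] by (simp add: power2_eq_square)
      moreover have "(\<integral>r. (norm (V 0 r - wave_sum c (N j) 0 r))\<^sup>2 \<partial>halfline) \<le> (1/4) ^ j"
      proof -
        have "ennreal (\<integral>r. (norm (V 0 r - wave_sum c (N j) 0 r))\<^sup>2 \<partial>halfline) \<le> ennreal ((1/4) ^ j)"
          using V(2)[of 0 j] nn_integral_eq_integral[OF in_Lp_2_integrable[OF d[of j]]] by simp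
        then show ?thesis by (subst (asm) ennreal_le_iff) auto
      qed
      ultimately show ?thesis by simp
    qed
    have "(\<lambda>j. (1/4) ^ j) \<longlonglongrightarrow> (0::real)" by (rule LIMSEQ_power_zero) simp
    then have "(norm (\<integral>r. (V 0 r - g r) * ?l r \<partial>halfline))\<^sup>2 \<le> 0"
      by (rule LIMSEQ_le_const) (use sq in \<open>auto intro!: exI[of _ "Suc n"]\<close>)
    then show "(\<integral>r. (V 0 r - g r) * ?l r \<partial>halfline) = 0" by simp
  qed
  have "AE x in lborel. v 0 x = g ((norm x)\<^sup>2)"
    using AE_radial[of "\<lambda>r. V 0 r - g r = 0"] V0 by (simp add: v_def)
  then have sol: "schroedinger_solution (\<lambda>x. g ((norm x)\<^sup>2)) v"
    unfolding schroedinger_solution_iff_weak_curve using jm wc by blast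
  have bound: "(\<integral>\<^sup>+t. \<integral>\<^sup>+x. ennreal ((norm (v t x)) ^ 4) \<partial>lborel \<partial>lborel) \<le> ennreal (pi\<^sup>2 / 4 * (G\<^sup>2 - deficit c M))" for M
  proof -
    let ?w = "\<lambda>j t x. ennreal ((norm (wave_sum c (N j) t ((norm (x::real^2))\<^sup>2))) ^ 4)"
    have wm: "(\<lambda>(t, x). ?w j t x) \<in> borel_measurable (lborel \<Otimes>\<^sub>M lborel)" for j
    proof -
      have "(\<lambda>p::real \<times> (real^2). (fst p, (norm (snd p))\<^sup>2)) \<in> borel_measurable borel"
        by (intro borel_measurable_continuous_onI continuous_intros)
      from measurable_compose[OF this borel_measurable_continuous_onI[OF continuous_wave_sum[of c "N j"]]]
      have [measurable]: "(\<lambda>p::real \<times> (real^2). wave_sum c (N j) (fst p) ((norm (snd p))\<^sup>2)) \<in> borel_measurable borel" by simp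
      have "(\<lambda>p::real \<times> (real^2). ?w j (fst p) (snd p)) \<in> borel_measurable borel" by measurable
      then show ?thesis by (simp add: split_beta' lborel_prod)
    qed
    have "ennreal ((norm (v t x)) ^ 4) \<le> liminf (\<lambda>j. ?w j t x)" for t x
    proof (cases "V t ((norm x)\<^sup>2) = 0")
      case True then show ?thesis by (simp add: v_def)
    next
      case False
      then have "(\<lambda>j. ?w j t x) \<longlonglongrightarrow> ennreal ((norm (v t x)) ^ 4)"
        unfolding v_def using V(1)[of t "(norm x)\<^sup>2"] by (intro tendsto_intros tendsto_ennrealI) auto
      from lim_imp_Liminf[OF sequentially_bot this] show ?thesis by (simp only: order_refl)
    qed
    then have "(\<integral>\<^sup>+t. \<integral>\<^sup>+x. ennreal ((norm (v t x)) ^ 4) \<partial>lborel \<partial>lborel) \<le> (\<integral>\<^sup>+t. \<integral>\<^sup>+x. liminf (\<lambda>j. ?w j t x) \<partial>lborel \<partial>lborel)"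
      by (intro nn_integral_mono)
    also have "\<dots> \<le> (\<integral>\<^sup>+t. liminf (\<lambda>j. \<integral>\<^sup>+x. ?w j t x \<partial>lborel) \<partial>lborel)"
      by (intro nn_integral_mono nn_integral_liminf) measurable
    also have "\<dots> \<le> liminf (\<lambda>j. \<integral>\<^sup>+t. \<integral>\<^sup>+x. ?w j t x \<partial>lborel \<partial>lborel)"
      by (intro nn_integral_liminf lborel.borel_measurable_nn_integral wm)
    also have "\<dots> \<le> limsup (\<lambda>j. \<integral>\<^sup>+t. \<integral>\<^sup>+x. ?w j t x \<partial>lborel \<partial>lborel)"
      by (rule Liminf_le_Limsup) simp
    also have "\<dots> \<le> ennreal (pi\<^sup>2 / 4 * (G\<^sup>2 - deficit c M))"
    proof (rule Limsup_bounded, rule eventually_sequentiallyI[of "Suc M"])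
      fix j assume "Suc M \<le> j"
      then have "M < N j" using strict_mono_imp_increasing[OF N, of j] by simp
      from wave_sum_L4_bound[OF this, of c]
      have "(\<integral>\<^sup>+t. \<integral>\<^sup>+x. ?w j t x \<partial>lborel \<partial>lborel) \<le> ennreal (pi\<^sup>2 / 4 * ((\<Sum>n<N j. (norm (c n))\<^sup>2)\<^sup>2 - deficit c M))" .
      also have "\<dots> \<le> ennreal (pi\<^sup>2 / 4 * (G\<^sup>2 - deficit c M))"
        using power_mono[OF bessel[of "N j"] sum_nonneg, of 2] by (intro ennreal_leI mult_left_mono) auto
      finally show "(\<integral>\<^sup>+t. \<integral>\<^sup>+x. ?w j t x \<partial>lborel \<partial>lborel) \<le> ennreal (pi\<^sup>2 / 4 * (G\<^sup>2 - deficit c M))" .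
    qed
    finally show ?thesis .
  qed
  show "\<exists>v. schroedinger_solution (\<lambda>x. g ((norm x)\<^sup>2)) v \<and>
      (\<forall>N. (\<integral>\<^sup>+t. \<integral>\<^sup>+x. ennreal ((norm (v t x)) ^ 4) \<partial>lborel \<partial>lborel) \<le> ennreal (pi\<^sup>2 / 4 * (G\<^sup>2 - deficit c N)))"
    using sol bound by blast
qed

section \<open>Extremal data\<close>

lemma exp_halfline_L2:
  assumes "Re B > 0" shows "in_Lp 2 halfline (\<lambda>r. A * exp (- B * of_real r))"
  unfolding in_Lp_2_iff
proof
  have "(norm (A * exp (- B * of_real r)))\<^sup>2 = (norm A)\<^sup>2 * exp (- (2 * Re B) * r)" for r
    by (simp add: norm_mult power_mult_distrib power2_eq_square[of "exp _"] flip: exp_add)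
  then show "integrable halfline (\<lambda>r. (norm (A * exp (- B * of_real r)))\<^sup>2)"
    using integrable_exp_halfline[of "2 * Re B"] assms by simp
  have "(\<lambda>r. A * exp (- B * of_real r)) \<in> borel_measurable borel"
    by (intro borel_measurable_continuous_onI continuous_intros)
  then show "(\<lambda>r. A * exp (- B * of_real r)) \<in> borel_measurable halfline" by simp
qed

text \<open>Compare \<open>c 1 * c n\<close> with \<open>c 0 * c (Suc n)\<close> on the antidiagonal \<open>Suc n\<close>.\<close>

lemma deficit_zero_geometric:
  assumes d: "\<And>N. deficit c N = 0" and nz: "c 0 \<noteq> 0"
  shows "c n = c 0 * (c 1 / c 0) ^ n"
proof (induction n)
  case (Suc n)
  have "c 1 * c n = c 0 * c (Suc n)" using deficit_0_imp[OF d, of 1 "Suc n"] by simp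
  then have "c (Suc n) = c n * (c 1 / c 0)" using nz by (simp add: field_simps)
  with Suc show ?case by simp
qed simp

lemma Re_cayley_pos:
  assumes "norm q < 1" shows "Re ((1 + q) / (1 - q)) > 0"
proof -
  have q: "1 - q \<noteq> 0" using assms by auto
  have "(norm q)\<^sup>2 < 1" using assms by (simp add: abs_square_less_1)
  then have "(Re q)\<^sup>2 + (Im q)\<^sup>2 < 1" unfolding cmod_power2 .
  then have "Re ((1 + q) * cnj (1 - q)) > 0" by (simp add: power2_eq_square algebra_simps)
  moreover have "Re ((1 + q) / (1 - q)) = Re ((1 + q) * cnj (1 - q)) / (norm (1 - q))\<^sup>2"
    unfolding complex_div_cnj[of "1 + q"] by (simp flip: of_real_power)
  ultimately show ?thesis using q by simp
qed

text \<open>If \<open>c 0 = 0\<close> then all squares \<open>c n * c n\<close> vanish. Otherwise \<open>c n = c 0 * q^n\<close>, where \<open>|q| < 1\<close> by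
summability, and these are the coefficients of the Gaussian with
\<open>B = (1 + q) / (2 (1 - q))\<close>: then \<open>B - 1/2 = q / (1 - q)\<close> and \<open>B + 1/2 = 1 / (1 - q)\<close>.\<close>

lemma deficit_zero_gaussian:
  fixes g :: "real \<Rightarrow> complex"
  assumes g: "in_Lp 2 halfline g"
  defines "c \<equiv> \<lambda>n. \<integral>r. g r * of_real (laguerre_fun n r) \<partial>halfline"
  assumes summ: "summable (\<lambda>n. (norm (c n))\<^sup>2)" and d: "\<And>N. deficit c N = 0"
  shows "\<exists>A B. Re B > 0 \<and> (AE r in halfline. g r = A * exp (- B * of_real r))"
proof (cases "c 0 = 0")
  case True
  have "c n = 0" for n using deficit_0_imp[OF d, of n "n + n"] True by simp
  then have "AE r in halfline. g r = 0" using laguerre_complete[OF g] by (simp add: c_def)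
  then show ?thesis by (intro exI[where x = 0] exI[where x = 1]) simp
next
  case False
  define q where "q = c 1 / c 0"
  have c: "c n = c 0 * q ^ n" for n unfolding q_def by (rule deficit_zero_geometric[OF d False])
  have "(\<lambda>n. (norm (c n))\<^sup>2) = (\<lambda>n. (norm (c 0))\<^sup>2 * ((norm q)\<^sup>2) ^ n)"
  proof
    fix n
    have "norm (c n) = norm (c 0) * norm q ^ n" by (subst c) (simp only: norm_mult norm_power)
    then show "(norm (c n))\<^sup>2 = (norm (c 0))\<^sup>2 * ((norm q)\<^sup>2) ^ n" by (simp only: power_mult_distrib power_mult[symmetric] mult.commute[of n 2])
  qed
  then have "summable (\<lambda>n. (norm (c 0))\<^sup>2 * ((norm q)\<^sup>2) ^ n)" using summ by (rule subst[where P = summable])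
  then have "summable (\<lambda>n. ((norm q)\<^sup>2) ^ n)" unfolding summable_cmult_iff using False by simp
  then have "norm ((norm q)\<^sup>2) < 1" by (simp only: summable_geometric_iff)
  then have q: "norm q < 1" by (simp add: abs_square_less_1)
  then have q1: "1 - q \<noteq> 0" by auto
  define Q where "Q = (1 + q) / (1 - q)"
  define B where "B = Q / 2"
  define A where "A = c 0 / (1 - q)"
  have B: "Re B > 0" using Re_cayley_pos[OF q, folded Q_def] by (simp add: B_def)
  have b: "B - 1/2 = q / (1 - q)" "B + 1/2 = 1 / (1 - q)"
    using q1 by (simp_all add: B_def Q_def field_simps)
  have "AE r in halfline. g r - A * exp (- B * of_real r) = 0"
  proof (rule laguerre_complete)
    show "in_Lp 2 halfline (\<lambda>r. g r - A * exp (- B * of_real r))"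
      by (rule in_Lp_2_diff[OF g exp_halfline_L2[OF B]])
    fix n
    note l = laguerre_fun_L2[of n]
    have "(\<integral>r. A * exp (- B * of_real r) * of_real (laguerre_fun n r) \<partial>halfline)
       = A * (\<integral>r. of_real (laguerre_fun n r) * exp (- B * of_real r) \<partial>halfline)"
      by (subst integral_mult_right_zero[symmetric]) (simp add: mult_ac)
    also have "(\<integral>r. of_real (laguerre_fun n r) * exp (- B * of_real r) \<partial>halfline) = (B - 1/2) ^ n / (B + 1/2) ^ Suc n"
      using B by (intro laplace_laguerre_fun) simp
    also have "A * ((B - 1/2) ^ n / (B + 1/2) ^ Suc n) = c n"
      unfolding b c[of n] A_def using q1 by (simp add: power_divide)
    finally show "(\<integral>r. (g r - A * exp (- B * of_real r)) * of_real (laguerre_fun n r) \<partial>halfline) = 0"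
      using in_Lp_2_integrable_mult[OF g l] in_Lp_2_integrable_mult[OF exp_halfline_L2[OF B] l]
      by (simp add: left_diff_distrib c_def)
  qed
  then show ?thesis using B by auto
qed

lemma nn_integral_radial_scale:
  assumes [measurable]: "h \<in> borel_measurable borel" and a: "\<alpha> > 0"
  shows "(\<integral>\<^sup>+x. h (\<alpha> * (norm (x::real^2))\<^sup>2) \<partial>lborel) = ennreal (1 / \<alpha>) * (\<integral>\<^sup>+x. h ((norm (x::real^2))\<^sup>2) \<partial>lborel)"
proof -
  have "(\<integral>\<^sup>+x. h (\<alpha> * (norm (x::real^2))\<^sup>2) \<partial>lborel) = ennreal pi * (\<integral>\<^sup>+r. h (\<alpha> * r) \<partial>halfline)"
    by (rule nn_integral_radial[where g = "\<lambda>r. h (\<alpha> * r)"]) measurable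
  also have "(\<integral>\<^sup>+r. h (\<alpha> * r) \<partial>halfline) = ennreal (1 / \<alpha>) * (\<integral>\<^sup>+r. h r \<partial>halfline)"
    using nn_integral_halfline_scale[of h "1 / \<alpha>"] a by (simp add: mult.commute)
  finally show ?thesis by (simp add: nn_integral_radial mult.left_commute)
qed

lemma wave_0_gaussian: "wave 0 t r = exp (- of_real r / (2 * (1 + 2 * \<i> * of_real t))) / (1 + 2 * \<i> * of_real t)"
  by (simp add: wave_def wave_gen_def wave_amp_def claguerre_def)

text \<open>The Gaussian is \<open>wave 0\<close>, dilated by \<open>\<alpha>\<close> and started at the time \<open>\<beta>\<close>. Its norms are those of a wave
sum with one term, whose antidiagonal sums consist of a single product.\<close>

lemma gaussian_solution:
  fixes A B :: complex
  assumes B: "Re B > 0"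
  defines "f \<equiv> \<lambda>x::real^2. A * exp (- B * of_real ((norm x)\<^sup>2))"
  shows "\<exists>v. schroedinger_solution f v \<and>
    (\<integral>\<^sup>+t. \<integral>\<^sup>+x. ennreal ((norm (v t x)) ^ 4) \<partial>lborel \<partial>lborel) = ennreal ((\<integral>x. (norm (f x))\<^sup>2 \<partial>lborel)\<^sup>2 / 4)"
proof -
  have Bnz: "B \<noteq> 0" using B by auto
  have R: "Re (1 / B) > 0" using B Bnz by (simp add: Re_divide power2_eq_square sum_squares_gt_zero_iff complex_eq_iff)
  (* wave 0 at time \<beta> and radius \<alpha> r has the exponent - \<alpha> r / (2 D) with D = 1 + 2 \<i> \<beta>, so that 2 B D = \<alpha> is required; \<alpha> and \<beta> solve the real and imaginary parts. *)
  define E where "E = 1 / B"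
  define \<alpha> where "\<alpha> = 2 / Re E"
  define \<beta> where "\<beta> = \<alpha> * Im E / 4"
  define D where "D = 1 + 2 * \<i> * complex_of_real \<beta>"
  have \<alpha>: "\<alpha> > 0" using R by (simp add: \<alpha>_def E_def)
  have "D = of_real \<alpha> / 2 * E"
    unfolding D_def using R[folded E_def] by (intro complex_eqI) (simp_all add: \<beta>_def \<alpha>_def)
  then have DB: "D * (2 * B) = of_real \<alpha>" using Bnz by (simp add: E_def)
  have D: "D \<noteq> 0" unfolding D_def by (rule one_plus_i_nonzero)
  define c where "c n = (if n = 0 then A * D else 0)" for n :: nat
  define w where "w = wave_sum c 1"
  have w: "w t r = A * D * wave 0 t r" for t r by (simp add: w_def wave_sum_def c_def)
  define v where "v t x = w (\<alpha> * t + \<beta>) (\<alpha> * (norm (x::real^2))\<^sup>2)" for t x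
  have wm[measurable]: "w t \<in> borel_measurable borel" for t unfolding w_def by measurable
  have v0: "v 0 = f"
  proof
    fix x :: "real^2"
    have "of_real (\<alpha> * (norm x)\<^sup>2) / (2 * D) = B * of_real ((norm x)\<^sup>2)"
      unfolding of_real_mult DB[symmetric] using D by simp
    then show "v 0 x = f x" unfolding v_def w wave_0_gaussian f_def using D by (simp add: D_def[symmetric])
  qed
  have "weak_curve v"
    unfolding v_def[abs_def] w by (rule weak_curve_cmult[OF weak_curve_scaled_wave[OF \<alpha>]])
  moreover have "(\<lambda>(x, t). v t x) \<in> borel_measurable (lborel :: ((real^2) \<times> real) measure)"
  proof -
    have "continuous_on UNIV (\<lambda>p::(real^2) \<times> real. (\<alpha> * snd p + \<beta>, \<alpha> * (norm (fst p))\<^sup>2))"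
      by (intro continuous_intros)
    from continuous_on_compose2[OF continuous_wave_sum[of c 1] this]
    have "continuous_on UNIV (\<lambda>p::(real^2) \<times> real. v (snd p) (fst p))" by (simp add: v_def w_def)
    then show ?thesis using borel_measurable_continuous_onI by (simp add: split_beta')
  qed
  ultimately have sol: "schroedinger_solution f v"
    unfolding schroedinger_solution_iff_weak_curve by (simp add: v0)
  define a where "a = (norm (A * D))\<^sup>2"
  have a: "a \<ge> 0" by (simp add: a_def)
  have "(\<integral>\<^sup>+x. ennreal ((norm (f x))\<^sup>2) \<partial>lborel) = (\<integral>\<^sup>+x. ennreal ((norm (w \<beta> (\<alpha> * (norm (x::real^2))\<^sup>2)))\<^sup>2) \<partial>lborel)"
    unfolding v0[symmetric] v_def by simp
  also have "\<dots> = ennreal (1 / \<alpha>) * ennreal (pi * a)"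
    using nn_integral_radial_scale[OF _ \<alpha>, of "\<lambda>r. ennreal ((norm (w \<beta> r))\<^sup>2)"]
    by (simp add: w_def wave_sum_L2 a_def c_def)
  also have "\<dots> = ennreal (pi * a / \<alpha>)"
    using \<alpha> a by (simp add: mult.commute flip: ennreal_mult)
  finally have f2: "(\<integral>x. (norm (f x))\<^sup>2 \<partial>lborel) = pi * a / \<alpha>"
    using in_Lp_2_integrable[OF weak_curve_L2[OF \<open>weak_curve v\<close>, of 0]] a \<alpha> unfolding v0
    by (subst integral_eq_nn_integral) auto
  define F where "F s = (\<integral>\<^sup>+x. ennreal ((norm (w s ((norm (x::real^2))\<^sup>2))) ^ 4) \<partial>lborel)" for s
  have Fm: "(\<lambda>p. ennreal ((norm (w (fst p) ((norm (snd p::real^2))\<^sup>2))) ^ 4)) \<in> borel_measurable (borel \<Otimes>\<^sub>M lborel)"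
  proof -
    have "continuous_on UNIV (\<lambda>p::real \<times> (real^2). (fst p, (norm (snd p))\<^sup>2))"
      by (intro continuous_intros)
    from continuous_on_compose2[OF continuous_wave_sum[of c 1] this]
    have "continuous_on UNIV (\<lambda>p::real \<times> (real^2). w (fst p) ((norm (snd p))\<^sup>2))" by (simp add: w_def)
    from borel_measurable_continuous_onI[OF this]
    have b: "(\<lambda>p::real \<times> (real^2). w (fst p) ((norm (snd p))\<^sup>2)) \<in> borel_measurable (borel \<Otimes>\<^sub>M borel)"
      unfolding borel_prod .
    have "sets (borel \<Otimes>\<^sub>M (lborel :: (real^2) measure)) = sets ((borel :: real measure) \<Otimes>\<^sub>M borel)"
      by (rule sets_pair_measure_cong) simp_all
    from measurable_cong_sets[OF this refl] b
    have "(\<lambda>p::real \<times> (real^2). w (fst p) ((norm (snd p))\<^sup>2)) \<in> borel_measurable (borel \<Otimes>\<^sub>M lborel)"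
      by blast
    moreover have "(\<lambda>z::complex. ennreal (norm z ^ 4)) \<in> borel_measurable borel" by measurable
    ultimately show ?thesis by (rule measurable_compose)
  qed
  have [measurable]: "F \<in> borel_measurable borel"
    unfolding F_def by (rule lborel.borel_measurable_nn_integral) (use Fm in \<open>simp only: split_beta'\<close>)
  have "(\<integral>\<^sup>+t. \<integral>\<^sup>+x. ennreal ((norm (v t x)) ^ 4) \<partial>lborel \<partial>lborel) = (\<integral>\<^sup>+t. ennreal (1 / \<alpha>) * F (\<alpha> * t + \<beta>) \<partial>lborel)"
    unfolding v_def F_def
    using nn_integral_radial_scale[OF _ \<alpha>, of "\<lambda>r. ennreal ((norm (w (\<alpha> * t + \<beta>) r)) ^ 4)" for t] by simp
  also have "\<dots> = ennreal (1 / \<alpha>) * (ennreal (1 / \<alpha>) * (\<integral>\<^sup>+t. F t \<partial>lborel))"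
  proof -
    have "(\<integral>\<^sup>+t. F t \<partial>lborel) = ennreal \<alpha> * (\<integral>\<^sup>+t. F (\<alpha> * t + \<beta>) \<partial>lborel)"
      using nn_integral_real_affine[of F \<alpha> \<beta>] \<alpha> by (simp add: add.commute)
    then have "ennreal (1 / \<alpha>) * (\<integral>\<^sup>+t. F t \<partial>lborel) = (ennreal (1 / \<alpha>) * ennreal \<alpha>) * (\<integral>\<^sup>+t. F (\<alpha> * t + \<beta>) \<partial>lborel)"
      by (simp only: mult.assoc)
    also have "ennreal (1 / \<alpha>) * ennreal \<alpha> = 1" using \<alpha> by (simp flip: ennreal_mult)
    finally show ?thesis by (subst nn_integral_cmult) auto
  qed
  also have "(\<integral>\<^sup>+t. F t \<partial>lborel) = ennreal (pi\<^sup>2 / 4 * (\<Sum>N<2*1. \<Sum>k\<le>N. (norm (antidiagonal c N k))\<^sup>2))"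
    unfolding F_def w_def by (rule wave_sum_L4) (simp add: c_def)
  also have "(\<Sum>N<2*1. \<Sum>k\<le>N. (norm (antidiagonal c N k))\<^sup>2) = a\<^sup>2"
    by (simp add: numeral_2_eq_2 antidiagonal_def c_def linearization_def coeff_diag_poly_0 a_def norm_mult norm_power power2_eq_square)
  also have "ennreal (1 / \<alpha>) * (ennreal (1 / \<alpha>) * ennreal (pi\<^sup>2 / 4 * a\<^sup>2)) = ennreal ((pi * a / \<alpha>)\<^sup>2 / 4)"
    using \<alpha> by (simp add: power2_eq_square mult_ac flip: ennreal_mult)
  finally show ?thesis using sol unfolding f2 by blast
qed

section \<open>The sharp estimate\<close>

lemma schroedinger_solution_cong_AE:
  assumes "AE x in lborel. f x = g x"
  shows "schroedinger_solution f u \<longleftrightarrow> schroedinger_solution g u"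
proof -
  have "(AE x in lborel. u 0 x = f x) \<longleftrightarrow> (AE x in lborel. u 0 x = g x)"
    using assms by (auto elim: AE_mp)
  then show ?thesis by (simp add: schroedinger_solution_def)
qed

text \<open>Tonelli's theorem, in the direction from the iterated to the space-time integral.\<close>

lemma L4_norm_iterated:
  fixes u :: "real \<Rightarrow> real^2 \<Rightarrow> complex"
  assumes u: "(\<lambda>(x, t). u t x) \<in> borel_measurable (lborel :: ((real^2) \<times> real) measure)"
    and J: "(\<integral>\<^sup>+t. \<integral>\<^sup>+x. ennreal ((norm (u t x)) ^ 4) \<partial>lborel \<partial>lborel) = ennreal j" "j \<ge> 0"
  shows "in_Lp 4 lborel (\<lambda>(x, t). u t x)" and "Lp_norm 4 lborel (\<lambda>(x, t). u t x) = j powr (1/4)"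
proof -
  let ?U = "\<lambda>p::(real^2) \<times> real. norm (case p of (x, t) \<Rightarrow> u t x) powr 4"
  have pw: "?U p = (norm (case p of (x, t) \<Rightarrow> u t x)) ^ 4" for p
    using powr_numeral[of "norm (case p of (x, t) \<Rightarrow> u t x)" "num.Bit0 (num.Bit0 num.One)"] by simp
  note [measurable] = u
  have Um: "?U \<in> borel_measurable lborel" by measurable
  then have Um': "(\<lambda>p. ennreal (?U p)) \<in> borel_measurable (lborel \<Otimes>\<^sub>M lborel)"
    unfolding lborel_prod by measurable
  have "(\<integral>\<^sup>+p. ennreal (?U p) \<partial>lborel) = (\<integral>\<^sup>+t. \<integral>\<^sup>+x. ennreal ((norm (u t x)) ^ 4) \<partial>lborel \<partial>lborel)"
    using lborel_pair.nn_integral_snd[OF Um'] unfolding lborel_prod pw by simp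
  then have n: "(\<integral>\<^sup>+p. ennreal (?U p) \<partial>lborel) = ennreal j" by (simp only: J)
  have i: "integrable lborel ?U"
    by (rule integrableI_nonneg[OF Um]) (rule AE_I2[OF powr_ge_zero], simp only: n ennreal_less_top infinity_ennreal_def)
  then show "in_Lp 4 lborel (\<lambda>(x, t). u t x)" using u by (simp add: in_Lp_def)
  have "(\<integral>p. ?U p \<partial>lborel) = j"
    unfolding integral_eq_nn_integral[OF Um AE_I2[OF powr_ge_zero]] n by (rule enn2real_ennreal[OF J(2)])
  then show "Lp_norm 4 lborel (\<lambda>(x, t). u t x) = j powr (1/4)" by (simp add: Lp_norm_def)
qed

lemma schroedinger_solution_L4_unique:
  assumes "schroedinger_solution f u" "schroedinger_solution f v"
  shows "(\<integral>\<^sup>+t. \<integral>\<^sup>+x. ennreal ((norm (u t x)) ^ 4) \<partial>lborel \<partial>lborel) = (\<integral>\<^sup>+t. \<integral>\<^sup>+x. ennreal ((norm (v t x)) ^ 4) \<partial>lborel \<partial>lborel)"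
proof (rule nn_integral_cong, rule nn_integral_cong_AE)
  fix t :: real
  show "AE x in lborel. ennreal ((norm (u t x)) ^ 4) = ennreal ((norm (v t x)) ^ 4)"
    using schroedinger_solution_unique[OF assms, of t] by eventually_elim simp
qed

theorem corollary7:
  fixes f :: "real^2 \<Rightarrow> complex"
  assumes "in_Lp 2 lborel f" and "radial f"
  shows "in_Lp 4 lborel (\<lambda>(x :: real^2, t :: real). exp_it_laplacian t f x) \<and>
    Lp_norm 4 lborel (\<lambda>(x :: real^2, t :: real). exp_it_laplacian t f x)
      \<le> 2 powr (-1/2) * Lp_norm 2 lborel f \<and>
    (Lp_norm 4 lborel (\<lambda>(x :: real^2, t :: real). exp_it_laplacian t f x)
        = 2 powr (-1/2) * Lp_norm 2 lborel f \<longleftrightarrow>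
      (\<exists>A B :: complex. Re B > 0 \<and>
        (AE x in lborel. f x = A * exp (- B * of_real ((norm x)\<^sup>2)))))"
proof -
  have [measurable]: "f \<in> borel_measurable borel" using in_Lp_2_borel[OF assms(1)] by simp
  obtain g where gb[measurable]: "g \<in> borel_measurable borel" and fg: "AE x in lborel. f x = g ((norm x)\<^sup>2)"
    using radial_borel_profile[OF \<open>f \<in> borel_measurable borel\<close> assms(2)] by blast
  define c where "c n = (\<integral>r. g r * of_real (laguerre_fun n r) \<partial>halfline)" for n
  define G where "G = (\<integral>r. (norm (g r))\<^sup>2 \<partial>halfline)"
  define I where "I = (\<integral>x. (norm (f x))\<^sup>2 \<partial>lborel)"
  have "integrable lborel (\<lambda>x::real^2. (norm (g ((norm x)\<^sup>2)))\<^sup>2)"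
    by (rule Bochner_Integration.integrable_cong_AE_imp[OF in_Lp_2_integrable[OF assms(1)]]) (use fg in auto)
  then have "integrable halfline (\<lambda>r. (norm (g r))\<^sup>2)"
    using integral_radial(2)[of "\<lambda>r. (norm (g r))\<^sup>2"] by simp
  then have g: "in_Lp 2 halfline g" by (simp add: in_Lp_2_iff)
  have "I = (\<integral>x. (norm (g ((norm (x::real^2))\<^sup>2)))\<^sup>2 \<partial>lborel)"
    unfolding I_def by (rule integral_cong_AE) (use fg in auto)
  then have I: "I = pi * G"
    using integral_radial(1)[of "\<lambda>r. (norm (g r))\<^sup>2"] by (simp add: G_def)
  have I0: "I \<ge> 0" by (simp add: I_def)
  obtain v where v: "schroedinger_solution f v"
    and vb: "\<And>N. (\<integral>\<^sup>+t. \<integral>\<^sup>+x. ennreal ((norm (v t x)) ^ 4) \<partial>lborel \<partial>lborel) \<le> ennreal (pi\<^sup>2 / 4 * (G\<^sup>2 - deficit c N))"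
    using radial_solution_exists(2)[OF gb g] schroedinger_solution_cong_AE[OF fg] unfolding G_def c_def by blast
  define u where "u = (SOME u. schroedinger_solution f u)"
  have u: "schroedinger_solution f u" unfolding u_def using v by (rule someI[where P = "schroedinger_solution f"])
  have eu: "(\<lambda>(x :: real^2, t :: real). exp_it_laplacian t f x) = (\<lambda>(x, t). u t x)"
    by (simp add: exp_it_laplacian_def u_def)
  define j where "j = enn2real (\<integral>\<^sup>+t. \<integral>\<^sup>+x. ennreal ((norm (u t x)) ^ 4) \<partial>lborel \<partial>lborel)"
  have j0: "j \<ge> 0" by (simp add: j_def)
  have ub: "(\<integral>\<^sup>+t. \<integral>\<^sup>+x. ennreal ((norm (u t x)) ^ 4) \<partial>lborel \<partial>lborel) \<le> ennreal (pi\<^sup>2 / 4 * (G\<^sup>2 - deficit c N))" for N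
    using vb unfolding schroedinger_solution_L4_unique[OF u v] .
  have J: "(\<integral>\<^sup>+t. \<integral>\<^sup>+x. ennreal ((norm (u t x)) ^ 4) \<partial>lborel \<partial>lborel) = ennreal j"
    unfolding j_def using le_less_trans[OF ub[of 0] ennreal_less_top] by simp
  note L4 = L4_norm_iterated[OF _ J j0]
  have um: "(\<lambda>(x, t). u t x) \<in> borel_measurable (lborel :: ((real^2) \<times> real) measure)"
    using u by (simp add: schroedinger_solution_def)
  have jle: "j \<le> I\<^sup>2 / 4"
  proof -
    have "ennreal j \<le> ennreal (pi\<^sup>2 / 4 * (G\<^sup>2 - deficit c 0))" using ub[of 0] unfolding J .
    also have "\<dots> \<le> ennreal (I\<^sup>2 / 4)"
      using deficit_nonneg[of c 0] by (intro ennreal_leI) (simp add: I power_mult_distrib right_diff_distrib)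
    finally show ?thesis by (subst (asm) ennreal_le_iff) auto
  qed
  (* Both norms become fourth roots, and the claim is j \<le> I\<^sup>2 / 4 with its case of equality. *)
  have rhs: "2 powr (-1/2) * Lp_norm 2 lborel f = (I\<^sup>2 / 4) powr (1/4)"
  proof -
    have "(I\<^sup>2 / 4) powr (1/4) = ((I / 2) powr 2) powr (1/4)"
      using I0 by (simp add: power_divide)
    also have "\<dots> = (I / 2) powr (1/2)" unfolding powr_powr by simp
    also have "\<dots> = sqrt I * 2 powr (-1/2)"
      using I0 by (simp add: powr_half_sqrt real_sqrt_divide powr_minus_divide)
    finally show ?thesis unfolding Lp_norm_2 I_def by (simp only: mult.commute)
  qed
  have iff: "j powr (1/4) = (I\<^sup>2 / 4) powr (1/4) \<longleftrightarrow> j = I\<^sup>2 / 4"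
  proof
    assume "j powr (1/4) = (I\<^sup>2 / 4) powr (1/4)"
    then have "(j powr (1/4)) powr 4 = ((I\<^sup>2 / 4) powr (1/4)) powr 4" by simp
    then show "j = I\<^sup>2 / 4" unfolding powr_powr using j0 by simp
  qed (rule arg_cong)
  have "j = I\<^sup>2 / 4 \<longleftrightarrow> (\<exists>A B :: complex. Re B > 0 \<and> (AE x in lborel. f x = A * exp (- B * of_real ((norm x)\<^sup>2))))"
  proof
    assume eq: "j = I\<^sup>2 / 4"
    have "\<exists>A B. Re B > 0 \<and> (AE r in halfline. g r = A * exp (- B * of_real r))"
    (* The bound is truncated to nonnegative reals, so that it can reveal a deficit only if j > 0. *)
    proof (cases "G = 0")
      case True
      then have "AE r in halfline. (norm (g r))\<^sup>2 = 0"
        using integral_nonneg_eq_0_iff_AE[OF in_Lp_2_integrable[OF g]] by (simp add: G_def)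
      then show ?thesis by (intro exI[where x = 0] exI[where x = 1]) simp
    next
      case False
      have jp: "j > 0" using False by (simp add: eq I)
      have "deficit c N = 0" for N
      proof (rule ccontr)
        assume "deficit c N \<noteq> 0"
        then have "deficit c N > 0" using deficit_nonneg[of c N] by simp
        then have "pi\<^sup>2 / 4 * (G\<^sup>2 - deficit c N) < j"
          by (simp add: eq I power_mult_distrib right_diff_distrib)
        then have "ennreal (pi\<^sup>2 / 4 * (G\<^sup>2 - deficit c N)) < ennreal j" by (rule ennreal_lessI[OF jp])
        then show False using ub[of N] unfolding J by simp
      qed
      then show ?thesis
        using deficit_zero_gaussian[OF g] radial_solution_exists(1)[OF gb g] unfolding c_def by blast
    qed
    then obtain A B where B: "Re B > 0" and A: "AE r in halfline. g r = A * exp (- B * of_real r)" by blast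
    have "(\<lambda>r. A * exp (- B * of_real r)) \<in> borel_measurable borel"
      by (intro borel_measurable_continuous_onI continuous_intros)
    then have "AE x in lborel. g ((norm (x::real^2))\<^sup>2) = A * exp (- B * of_real ((norm x)\<^sup>2))"
      using AE_radial[of "\<lambda>r. g r = A * exp (- B * of_real r)"] A by simp
    with fg have "AE x in lborel. f x = A * exp (- B * of_real ((norm x)\<^sup>2))"
      by eventually_elim (rule trans)
    with B show "\<exists>A B. Re B > 0 \<and> (AE x in lborel. f x = A * exp (- B * of_real ((norm x)\<^sup>2)))" by blast
  next
    assume "\<exists>A B. Re B > 0 \<and> (AE x in lborel. f x = A * exp (- B * of_real ((norm x)\<^sup>2)))"
    then obtain A B where B: "Re B > 0" and A: "AE x in lborel. f x = A * exp (- B * of_real ((norm x)\<^sup>2))" by blast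
    let ?h = "\<lambda>x::real^2. A * exp (- B * of_real ((norm x)\<^sup>2))"
    have [measurable]: "?h \<in> borel_measurable borel"
      by (intro borel_measurable_continuous_onI continuous_intros)
    obtain w where w: "schroedinger_solution ?h w"
      "(\<integral>\<^sup>+t. \<integral>\<^sup>+x. ennreal ((norm (w t x)) ^ 4) \<partial>lborel \<partial>lborel) = ennreal ((\<integral>x. (norm (?h x))\<^sup>2 \<partial>lborel)\<^sup>2 / 4)"
      using gaussian_solution[OF B, of A] by blast
    have "I = (\<integral>x. (norm (?h x))\<^sup>2 \<partial>lborel)"
      unfolding I_def by (rule integral_cong_AE) (use A in auto)
    then have "ennreal j = ennreal (I\<^sup>2 / 4)"
      using w(2) schroedinger_solution_L4_unique[OF u, of w] w(1) schroedinger_solution_cong_AE[OF A] unfolding J by metis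
    then show "j = I\<^sup>2 / 4" using j0 by (subst (asm) ennreal_inj) auto
  qed
  moreover have "j powr (1/4) \<le> (I\<^sup>2 / 4) powr (1/4)"
    using jle j0 by (intro powr_mono2) auto
  ultimately show ?thesis
    unfolding eu rhs L4(2)[OF um] iff using L4(1)[OF um] by blast
qed

end
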